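(* Let $p,e,s$ satisfy Gibbs' equation $\vartheta\, Ds = De + p\,D(1/\varrho)$ and the thermodynamic stability condition $\frac{\partial p(\varrho,\vartheta)}{\partial\varrho}>0$, $\frac{\partial e(\varrho,\vartheta)}{\partial\vartheta}>0$ for all $\varrho,\vartheta>0$. Let the transport coefficients $\kappa(\varrho,\vartheta)$, $\mu(\varrho,\vartheta)$, $\lambda(\varrho,\vartheta)$ be continuously differentiable and positive for $\varrho>0,\ \vartheta>0$. Let $(\tilde\varrho,\tilde{\mathbf u},\tilde\vartheta)$ be a strong solution of the Navier--Stokes--Fourier system in $[0,T]\times\Omega$ (with the Dirichlet boundary conditions $\tilde{\mathbf u}|_{\partial\Omega}=0$, $\tilde\vartheta|_{\partial\Omega}=\vartheta_B$) emanating from initial data $(\varrho_0,\mathbf u_0,\vartheta_0)$ with $\varrho_0>0$, $\vartheta_0>0$. Let $\mathcal V=\{\mathcal V_{t,x}\}$ be a measure-valued solution of the same problem (in the sense of the definition given in the context), with initial measure $$\mathcal V_{0,x}=\delta_{[\varrho_0(x),\mathbf u_0(x),\vartheta_0(x)]}\quad\text{for a.e. }x\in\Omega,$$ and suppose there are constants $\underline\varrho,\overline\varrho,\underline\vartheta,\overline\vartheta>0$ such that $$\mathcal V_{t,x}\left\{0<\underline\varrho<\varrho<\overline\varrho,\ 0<\underline\vartheta<\vartheta<\overline\vartheta\right\}=1\quad\text{for a.e. }(t,x)\in Q_T.$$ Then $$\mathcal V_{t,x}=\delta_{[\tilde\varrho(t,x),\,\tilde{\mathbf u}(t,x),\,\tilde\vartheta(t,x),\,\mathbb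 D_x\tilde{\mathbf u}(t,x),\,\nabla_x\tilde\vartheta(t,x)]}\quad\text{for a.e. }(t,x)\in Q_T.$$
   Context: **Setting.** $T>0$, $\Omega\subset\mathbb R^d$ is a bounded domain, $d\in\{2,3\}$, $Q_T=(0,T)\times\Omega$. The Navier--Stokes--Fourier system (without external force) for density $\varrho$, velocity $\mathbf u$, absolute temperature $\vartheta$ is $$\partial_t\varrho+\mathrm{div}_x(\varrho\mathbf u)=0,$$ $$\partial_t(\varrho\mathbf u)+\mathrm{div}_x(\varrho\mathbf u\otimes\mathbf u)+\nabla_xp(\varrho,\vartheta)=\mathrm{div}_x\mathbb S,$$ $$\partial_t(\varrho e(\varrho,\vartheta))+\mathrm{div}_x(\varrho e(\varrho,\vartheta)\mathbf u)+\mathrm{div}_x\mathbf q=\mathbb S:\mathbb D_x\mathbf u-p(\varrho,\vartheta)\,\mathrm{div}_x\mathbf u,$$ with boundary conditions $\mathbf u|_{\partial\Omega}=0$, $\vartheta|_{\partial\Omega}=\vartheta_B$, where $\vartheta_B\in C^1((0,T)\times\partial\Omega)$, $\vartheta_B>0$, is given. Here $p,e,s$ (pressure, internal energy, entropy) are given sufficiently smooth functions of $(\varrho,\vartheta)$, $D=(\partial_\varrho,\partial_\vartheta)$, $\mathbb D_x\mathbf u=\frac12(\nabla_x\mathbf u+\nabla_x^T\mathbf u)$, $\mathbf q=-\kappa(\varrho,\vartheta)\nabla_x\vartheta$. For $\mathbb A\in\mathbb R^{d\times d}$ put $\mathbb D(\mathbb A)=\frac12(\mathbb A+\mathbb A^T)$,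 $\mathbb D_0(\mathbb A)=\mathbb D(\mathbb A)-\frac1d\mathrm{Tr}(\mathbb A)\mathbb I$. The viscous stress is $\mathbb S(\varrho,\vartheta,\mathbb A)=\mu(\varrho,\vartheta)\mathbb D_0(\mathbb A)+\lambda(\varrho,\vartheta)\mathrm{Tr}(\mathbb A)\mathbb I$, evaluated at $\mathbb A=\nabla_x\mathbf u$ in the system. **Strong solution.** A classical solution $(\tilde\varrho,\tilde{\mathbf u},\tilde\vartheta)$ of the Navier--Stokes--Fourier initial-boundary value problem, i.e. of $$\partial_t\tilde\varrho+\mathrm{div}_x(\tilde\varrho\tilde{\mathbf u})=0,$$ $$\partial_t(\tilde\varrho\tilde{\mathbf u})+\mathrm{div}_x(\tilde\varrho\tilde{\mathbf u}\otimes\tilde{\mathbf u})+\nabla_xp(\tilde\varrho,\tilde\vartheta)=\mathrm{div}_x\mathbb S(\tilde\varrho,\tilde\vartheta,\nabla_x\tilde{\mathbf u}),$$ $$\partial_t(\tilde\varrho e(\tilde\varrho,\tilde\vartheta))+\mathrm{div}_x(\tilde\varrho e(\tilde\varrho,\tilde\vartheta)\tilde{\mathbf u})-\mathrm{div}_x(\kappa(\tilde\varrho,\tilde\vartheta)\nabla_x\tilde\vartheta)=\mathbb S(\tilde\varrho,\tilde\vartheta,\nabla_x\tilde{\mathbf u}):\mathbb D_x\tilde{\mathbf u}-p(\tilde\varrho,\tilde\vartheta)\,\mathrm{div}_x\tilde{\mathbf u}$$ in $(0,T)\times\Omega$ with $\tilde{\mathbf u}|_{\partial\Omega}=0$, $\tilde\vartheta|_{\partial\Omega}=\vartheta_B$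 and $(\tilde\varrho,\tilde{\mathbf u},\tilde\vartheta)(0,\cdot)=(\varrho_0,\mathbf u_0,\vartheta_0)$: $\tilde\varrho,\tilde{\mathbf u},\tilde\vartheta\in C^1([0,T]\times\overline\Omega)$, second spatial derivatives of $\tilde{\mathbf u},\tilde\vartheta$ continuous on $[0,T]\times\overline\Omega$, $\tilde\varrho,\tilde\vartheta>0$ on $[0,T]\times\overline\Omega$. **Measure-valued solution.** Phase spaces: $\mathcal F=\{[\varrho,\mathbf u,\vartheta,\mathbb D_{\mathbf u},\mathbf D_\vartheta]:\varrho\in[0,\infty),\mathbf u\in\mathbb R^d,\vartheta\in[0,\infty),\mathbb D_{\mathbf u}\in\mathbb R^{d\times d}_{sym},\mathbf D_\vartheta\in\mathbb R^d\}$ and $\mathcal F_0=\{[\varrho,\mathbf u,\vartheta]\in[0,\infty)\times\mathbb R^d\times[0,\infty)\}$. $\langle\mathcal V_{t,x};G\rangle$ is the integral of $G$ against $\mathcal V_{t,x}$; all integrands below are understood to be well defined and integrable. Call $\widetilde\Theta$ *admissible* if $\widetilde\Theta\in C^1([0,T]\times\overline\Omega)$, $\widetilde\Theta>0$, $\widetilde\Theta|_{\partial\Omega}=\vartheta_B$. Let $\mathcal V_0\in L^\infty_{weak-( * )}(\Omega;\mathcal P(\mathcal F_0))$ have finite energy, i.e. $\int_\Omega\langle\mathcal V_{0,x};\frac12\varrho|\mathbf u|^2+\varrho e-\widetilde\Theta(0,x)\varrho s\rangle\,dx<\infty$ for each admissible $\widetilde\Theta$. A measure-valued solution with initial measure $\mathcal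 V_0$ consists of a Young measure $\mathcal V\in L^\infty_{weak-( * )}((0,T)\times\Omega;\mathcal P(\mathcal F))$ and, for each admissible $\widetilde\Theta$, a dissipation defect $\mathcal D_{\widetilde\Theta}\in L^\infty(0,T)$, $\mathcal D_{\widetilde\Theta}\ge0$, such that: 1. Velocity compatibility: $-\int_0^T\!\int_\Omega\langle\mathcal V_{t,x};\mathbf u\rangle\cdot\mathrm{div}_x\mathbb T\,dx\,dt=\int_0^T\!\int_\Omega\langle\mathcal V_{t,x};\mathbb D_{\mathbf u}\rangle:\mathbb T\,dx\,dt$ for all $\mathbb T\in C^1(\overline{Q_T};\mathbb R^{d\times d}_{sym})$. 2. Temperature compatibility: $-\int_0^T\!\int_\Omega\langle\mathcal V_{t,x};\vartheta-\widetilde\Theta\rangle\,\mathrm{div}_x\psi\,dx\,dt=\int_0^T\!\int_\Omega\langle\mathcal V_{t,x};\mathbf D_\vartheta-\nabla_x\widetilde\Theta\rangle\cdot\psi\,dx\,dt$ for all $\psi\in C^1([0,T]\times\overline\Omega;\mathbb R^d)$ and all $\widetilde\Theta\in C^1([0,T]\times\overline\Omega)$ with $\widetilde\Theta=\vartheta_B$ on $\partial\Omega$. 3. Continuity equation: for a.e. $\tau\in(0,T)$ and all $\psi\in C^1([0,T]\times\overline\Omega)$, $\int_\Omega\langle\mathcal V_{\tau,x};\varrho\rangle\psi(\tau,\cdot)dx-\int_\Omega\langle\mathcal V_{0,x};\varrho\rangle\psi(0,\cdot)dx=\int_0^\tau\!\int_\Omega[\langle\mathcal V_{t,x};\varrho\rangle\partial_t\psi+\langle\mathcal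 V_{t,x};\varrho\mathbf u\rangle\cdot\nabla_x\psi]dx\,dt$. 4. Momentum equation: there is $r^M\in L^\infty_{weak-( * )}(0,T;\mathcal M(\overline\Omega;\mathbb R^{d\times d}))$ such that for a.e. $\tau\in(0,T)$ and all $\boldsymbol\varphi\in C^1([0,T]\times\overline\Omega;\mathbb R^d)$ with $\boldsymbol\varphi|_{\partial\Omega}=0$, $\int_\Omega\langle\mathcal V_{\tau,x};\varrho\mathbf u\rangle\cdot\boldsymbol\varphi(\tau,\cdot)dx-\int_\Omega\langle\mathcal V_{0,x};\varrho\mathbf u\rangle\cdot\boldsymbol\varphi(0,\cdot)dx=\int_0^\tau\!\int_\Omega[\langle\mathcal V_{t,x};\varrho\mathbf u\rangle\cdot\partial_t\boldsymbol\varphi+\langle\mathcal V_{t,x};\varrho\mathbf u\otimes\mathbf u\rangle:\nabla_x\boldsymbol\varphi+\langle\mathcal V_{t,x};p(\varrho,\vartheta)\rangle\mathrm{div}_x\boldsymbol\varphi]dx\,dt-\int_0^\tau\!\int_\Omega\langle\mathcal V_{t,x};\mathbb S(\varrho,\vartheta,\mathbb D_{\mathbf u})\rangle:\nabla_x\boldsymbol\varphi\,dx\,dt+\int_0^\tau\langle r^M;\nabla_x\boldsymbol\varphi\rangle dt$, the last bracket being the duality between $\mathcal M(\overline\Omega;\mathbb R^{d\times d})$ and $C(\overline\Omega;\mathbb R^{d\times d})$. 5. Entropy inequality: for a.e. $\tau\in(0,T)$ and all $0\le\phi\in C^1_c([0,T]\times\Omega)$, $\int_\Omega\langle\mathcal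 V_{\tau,x};\varrho s\rangle\phi(\tau,x)dx-\int_\Omega\langle\mathcal V_{0,x};\varrho s\rangle\phi(0,x)dx\ge\int_0^\tau\!\int_\Omega\langle\mathcal V_{t,x};\varrho s\rangle\partial_t\phi\,dx\,dt+\int_0^\tau\!\int_\Omega\langle\mathcal V_{t,x};\varrho s\mathbf u-\frac{\kappa}{\vartheta}\mathbf D_\vartheta\rangle\cdot\nabla_x\phi\,dx\,dt+\int_0^\tau\!\int_\Omega\langle\mathcal V_{t,x};\frac1\vartheta(\mathbb S(\varrho,\vartheta,\mathbb D_{\mathbf u}):\mathbb D_{\mathbf u}+\frac\kappa\vartheta|\mathbf D_\vartheta|^2)\rangle\phi\,dx\,dt$. 6. Ballistic energy inequality: for every admissible $\widetilde\Theta$ and a.e. $\tau\in(0,T)$, $\int_\Omega\langle\mathcal V_{\tau,x};\frac12\varrho|\mathbf u|^2+\varrho e-\widetilde\Theta\varrho s\rangle dx+\int_0^\tau\!\int_\Omega\langle\mathcal V_{t,x};\frac1\vartheta(\mathbb S(\varrho,\vartheta,\mathbb D_{\mathbf u}):\mathbb D_{\mathbf u}+\frac\kappa\vartheta|\mathbf D_\vartheta|^2)\rangle\widetilde\Theta\,dx\,dt+\mathcal D_{\widetilde\Theta}(\tau)\le\int_\Omega\langle\mathcal V_{0,x};\frac12\varrho|\mathbf u|^2+\varrho e-\widetilde\Theta\varrho s\rangle dx-\int_0^\tau\!\int_\Omega\langle\mathcal V_{t,x};\varrho s\rangle\partial_t\widetilde\Theta\,dx\,dt-\int_0^\tau\!\int_\Omega\langle\mathcal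 V_{t,x};\varrho s\mathbf u\rangle\cdot\nabla_x\widetilde\Theta\,dx\,dt+\int_0^\tau\!\int_\Omega\langle\mathcal V_{t,x};\frac\kappa\vartheta\mathbf D_\vartheta\rangle\cdot\nabla_x\widetilde\Theta\,dx\,dt$ (with $\widetilde\Theta$ evaluated at time $\tau$, resp. $0$, in the first integral on each side). 7. Compatibility of defects: for every admissible $\widetilde\Theta$, $|\langle r^M(\tau);\nabla_x\boldsymbol\varphi\rangle|\le\xi(\tau)\mathcal D_{\widetilde\Theta}(\tau)\|\boldsymbol\varphi\|_{C^1(\overline\Omega)}$ for a.e. $\tau\in(0,T)$ and all $\boldsymbol\varphi\in C^1(\overline\Omega;\mathbb R^d)$ with $\boldsymbol\varphi|_{\partial\Omega}=0$, where $\xi\in L^1(0,T)$. 8. Generalized Korn--Poincaré inequality: there is a constant $C_p$ such that for a.e. $\tau\in(0,T)$ and every $\widetilde{\mathbf U}\in L^2(0,T;W^{1,2}_0(\Omega;\mathbb R^d))$, $\int_0^\tau\!\int_\Omega\langle\mathcal V_{t,x};|\mathbf u-\widetilde{\mathbf U}|^2\rangle dx\,dt\le C_p\int_0^\tau\!\int_\Omega\langle\mathcal V_{t,x};|\mathbb D_0(\mathbb D_{\mathbf u})-\mathbb D_0(\nabla_x\widetilde{\mathbf U})|^2\rangle dx\,dt$. *)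

theory Defs
  imports "HOL-Probability.Probability"
begin

text \<open>
  Space-time fields are curried functions of \<open>t\<close> and \<open>x\<close>. Matrices are elements of
  \<^typ>\<open>real^'d^'d\<close>: the double contraction is the inner product, and the norm is the
  Frobenius norm.
\<close>

abbreviation QT :: "real \<Rightarrow> (real^'d) set \<Rightarrow> (real \<times> (real^'d)) set"
  where "QT T \<Omega> \<equiv> {0<..<T} \<times> \<Omega>"

definition bounded_domain :: "(real^'d) set \<Rightarrow> bool"
  where "bounded_domain \<Omega> \<longleftrightarrow> open \<Omega> \<and> connected \<Omega> \<and> bounded \<Omega> \<and> \<Omega> \<noteq> {}"


section \<open>Differential operators and regularity classes\<close>

definition dt :: "(real \<Rightarrow> real^'d \<Rightarrow> 'b::real_normed_vector) \<Rightarrow> real \<Rightarrow> real^'d \<Rightarrow> 'b"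
  where "dt f t x = vector_derivative (\<lambda>\<tau>. f \<tau> x) (at t)"

definition grad :: "(real^'d \<Rightarrow> real) \<Rightarrow> real^'d \<Rightarrow> real^'d"
  where "grad f x = (\<chi> i. frechet_derivative f (at x) (axis i 1))"

text \<open>Entry \<open>i, j\<close> is the \<open>j\<close>-th partial derivative of the \<open>i\<close>-th component.\<close>

definition Grad :: "(real^'d \<Rightarrow> real^'d) \<Rightarrow> real^'d \<Rightarrow> real^'d^'d"
  where "Grad u x = jacobian u (at x)"

definition dvg :: "(real^'d \<Rightarrow> real^'d) \<Rightarrow> real^'d \<Rightarrow> real"
  where "dvg u x = trace (Grad u x)"

definition Dvg :: "(real^'d \<Rightarrow> real^'d^'d) \<Rightarrow> real^'d \<Rightarrow> real^'d"
  where "Dvg A x = (\<chi> i. dvg (\<lambda>y. A y $ i) x)"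

primrec Ck_on :: "nat \<Rightarrow> 'a::euclidean_space set \<Rightarrow> ('a \<Rightarrow> 'b::real_normed_vector) \<Rightarrow> bool"
  where
    "Ck_on 0 U f \<longleftrightarrow> continuous_on U f"
  | "Ck_on (Suc k) U f \<longleftrightarrow> (\<forall>x\<in>U. f differentiable (at x)) \<and>
       (\<forall>v. Ck_on k U (\<lambda>x. frechet_derivative f (at x) v))"

text \<open>
  \<open>C\<^sup>1\<close> up to the boundary: for open \<open>U\<close>, the function is continuously differentiable
  in \<open>U\<close>, and it and its derivative extend continuously to the closure. No regularity of
  the boundary is needed.
\<close>

definition C1_closure :: "'a::euclidean_space set \<Rightarrow> ('a \<Rightarrow> 'b::real_normed_vector) \<Rightarrow> bool"
  where "C1_closure U f \<longleftrightarrow> continuous_on (closure U) f \<and>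
    (\<exists>f' :: 'a \<Rightarrow> ('a \<Rightarrow>\<^sub>L 'b). continuous_on (closure U) f' \<and>
       (\<forall>z\<in>U. (f has_derivative blinfun_apply (f' z)) (at z)))"

abbreviation C1_QT :: "real \<Rightarrow> (real^'d) set \<Rightarrow> (real \<Rightarrow> real^'d \<Rightarrow> 'b::real_normed_vector) \<Rightarrow> bool"
  where "C1_QT T \<Omega> f \<equiv> C1_closure (QT T \<Omega>) (\<lambda>(t, x). f t x)"

text \<open>
  The spatial derivative exists in the cylinder and extends continuously to its closure.
  This is applied to gradients.
\<close>

definition C1x_QT :: "real \<Rightarrow> (real^'d) set \<Rightarrow> (real \<Rightarrow> real^'d \<Rightarrow> 'b::real_normed_vector) \<Rightarrow> bool"
  where "C1x_QT T \<Omega> g \<longleftrightarrow>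
    (\<exists>g' :: real \<times> (real^'d) \<Rightarrow> ((real^'d) \<Rightarrow>\<^sub>L 'b). continuous_on (closure (QT T \<Omega>)) g' \<and>
       (\<forall>t\<in>{0<..<T}. \<forall>x\<in>\<Omega>. (g t has_derivative blinfun_apply (g' (t, x))) (at x)))"

text \<open>
  \<open>C\<^sup>1\<close> on an arbitrary set: locally the restriction of a \<open>C\<^sup>1\<close> function on an open set.
  On a smooth hypersurface this is the usual notion.
\<close>

definition C1_on_subset :: "'a::euclidean_space set \<Rightarrow> ('a \<Rightarrow> 'b::real_normed_vector) \<Rightarrow> bool"
  where "C1_on_subset A f \<longleftrightarrow>
    (\<forall>a\<in>A. \<exists>U g. open U \<and> a \<in> U \<and> Ck_on 1 U g \<and> (\<forall>z\<in>A \<inter> U. g z = f z))"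

text \<open>The gradient at boundary points is the continuous extension from the interior.\<close>

definition Grad_cl :: "(real^'d) set \<Rightarrow> (real^'d \<Rightarrow> real^'d) \<Rightarrow> real^'d \<Rightarrow> real^'d^'d"
  where "Grad_cl \<Omega> \<phi> x = Lim (at x within \<Omega>) (Grad \<phi>)"

definition C1_norm :: "(real^'d) set \<Rightarrow> (real^'d \<Rightarrow> real^'d) \<Rightarrow> real"
  where "C1_norm \<Omega> \<phi> = (SUP x\<in>\<Omega>. norm (\<phi> x)) + (SUP x\<in>\<Omega>. norm (Grad \<phi> x))"


section \<open>Sobolev functions with zero trace\<close>

definition L2_on :: "'a::euclidean_space set \<Rightarrow> ('a \<Rightarrow> 'b::euclidean_space) \<Rightarrow> bool"
  where "L2_on S f \<longleftrightarrow> f \<in> borel_measurable (lebesgue_on S) \<and>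
    integrable (lebesgue_on S) (\<lambda>x. (norm (f x))\<^sup>2)"

definition test_field :: "(real^'d) set \<Rightarrow> (real^'d \<Rightarrow> real^'d) \<Rightarrow> bool"
  where "test_field \<Omega> \<phi> \<longleftrightarrow> (\<forall>k. Ck_on k UNIV \<phi>) \<and>
    (\<exists>K. compact K \<and> K \<subseteq> \<Omega> \<and> (\<forall>x. x \<notin> K \<longrightarrow> \<phi> x = 0))"

text \<open>
  \<open>v\<close> lies in \<open>W\<^sub>0\<^sup>1\<^sup>,\<^sup>2\<close>, the closure of the test fields in the Sobolev norm, and \<open>A\<close> is its
  weak gradient.
\<close>

definition W012 :: "(real^'d) set \<Rightarrow> (real^'d \<Rightarrow> real^'d) \<Rightarrow> (real^'d \<Rightarrow> real^'d^'d) \<Rightarrow> bool"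
  where "W012 \<Omega> v A \<longleftrightarrow> L2_on \<Omega> v \<and> L2_on \<Omega> A \<and>
    (\<exists>\<phi>. (\<forall>n::nat. test_field \<Omega> (\<phi> n)) \<and>
       (\<lambda>n. LINT x|lebesgue_on \<Omega>. (norm (\<phi> n x - v x))\<^sup>2) \<longlonglongrightarrow> 0 \<and>
       (\<lambda>n. LINT x|lebesgue_on \<Omega>. (norm (Grad (\<phi> n) x - A x))\<^sup>2) \<longlonglongrightarrow> 0)"

text \<open>
  Elements of \<open>L\<^sup>2(0,T; W\<^sub>0\<^sup>1\<^sup>,\<^sup>2)\<close> as jointly measurable functions; the space of
  values is separable, so this agrees with strong (Bochner) measurability.
\<close>

definition L2_W012 :: "real \<Rightarrow> (real^'d) set \<Rightarrow> (real \<Rightarrow> real^'d \<Rightarrow> real^'d)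
    \<Rightarrow> (real \<Rightarrow> real^'d \<Rightarrow> real^'d^'d) \<Rightarrow> bool"
  where "L2_W012 T \<Omega> U A \<longleftrightarrow>
    L2_on (QT T \<Omega>) (\<lambda>(t, x). U t x) \<and> L2_on (QT T \<Omega>) (\<lambda>(t, x). A t x) \<and>
    (AE t in lebesgue_on {0<..<T}. W012 \<Omega> (U t) (A t))"


section \<open>Constitutive relations\<close>

definition symm :: "real^'d^'d \<Rightarrow> real^'d^'d"
  where "symm A = (1/2) *\<^sub>R (A + transpose A)"

definition dev :: "real^'d^'d \<Rightarrow> real^'d^'d"
  where "dev A = symm A - (trace A / real CARD('d)) *\<^sub>R mat 1"

definition outer :: "real^'d \<Rightarrow> real^'d \<Rightarrow> real^'d^'d"
  where "outer u v = (\<chi> i j. u $ i * v $ j)"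

definition stress :: "(real \<Rightarrow> real \<Rightarrow> real) \<Rightarrow> (real \<Rightarrow> real \<Rightarrow> real)
    \<Rightarrow> real \<Rightarrow> real \<Rightarrow> real^'d^'d \<Rightarrow> real^'d^'d"
  where "stress \<mu> lam \<rho> \<theta> A = \<mu> \<rho> \<theta> *\<^sub>R dev A + (lam \<rho> \<theta> * trace A) *\<^sub>R mat 1"

definition d_rho :: "(real \<Rightarrow> real \<Rightarrow> real) \<Rightarrow> real \<Rightarrow> real \<Rightarrow> real"
  where "d_rho f \<rho> \<theta> = deriv (\<lambda>r. f r \<theta>) \<rho>"

definition d_theta :: "(real \<Rightarrow> real \<Rightarrow> real) \<Rightarrow> real \<Rightarrow> real \<Rightarrow> real"
  where "d_theta f \<rho> \<theta> = deriv (\<lambda>h. f \<rho> h) \<theta>"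

definition Ck_quadrant :: "nat \<Rightarrow> (real \<Rightarrow> real \<Rightarrow> real) \<Rightarrow> bool"
  where "Ck_quadrant k f \<longleftrightarrow> Ck_on k ({0<..} \<times> {0<..}) (\<lambda>(\<rho>, \<theta>). f \<rho> \<theta>)"

definition gibbs :: "(real \<Rightarrow> real \<Rightarrow> real) \<Rightarrow> (real \<Rightarrow> real \<Rightarrow> real) \<Rightarrow> (real \<Rightarrow> real \<Rightarrow> real) \<Rightarrow> bool"
  where "gibbs p e s \<longleftrightarrow> (\<forall>\<rho>>0. \<forall>\<theta>>0.
    \<theta> * d_rho s \<rho> \<theta> = d_rho e \<rho> \<theta> + p \<rho> \<theta> * d_rho (\<lambda>r h. 1 / r) \<rho> \<theta> \<and>
    \<theta> * d_theta s \<rho> \<theta> = d_theta e \<rho> \<theta> + p \<rho> \<theta> * d_theta (\<lambda>r h. 1 / r) \<rho> \<theta>)"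

definition thermodynamically_stable ::
    "(real \<Rightarrow> real \<Rightarrow> real) \<Rightarrow> (real \<Rightarrow> real \<Rightarrow> real) \<Rightarrow> bool"
  where "thermodynamically_stable p e \<longleftrightarrow>
    (\<forall>\<rho>>0. \<forall>\<theta>>0. d_rho p \<rho> \<theta> > 0 \<and> d_theta e \<rho> \<theta> > 0)"

definition transport_coefficient :: "(real \<Rightarrow> real \<Rightarrow> real) \<Rightarrow> bool"
  where "transport_coefficient f \<longleftrightarrow> Ck_quadrant 1 f \<and> (\<forall>\<rho>>0. \<forall>\<theta>>0. f \<rho> \<theta> > 0)"


section \<open>Strong solutions\<close>

definition matches_boundary :: "real \<Rightarrow> (real^'d) set \<Rightarrow> (real \<Rightarrow> real^'d \<Rightarrow> real)
    \<Rightarrow> (real \<Rightarrow> real^'d \<Rightarrow> real) \<Rightarrow> bool"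
  where "matches_boundary T \<Omega> \<theta>B \<Theta> \<longleftrightarrow> (\<forall>t\<in>{0<..<T}. \<forall>x\<in>frontier \<Omega>. \<Theta> t x = \<theta>B t x)"

definition boundary_temperature :: "real \<Rightarrow> (real^'d) set \<Rightarrow> (real \<Rightarrow> real^'d \<Rightarrow> real) \<Rightarrow> bool"
  where "boundary_temperature T \<Omega> \<theta>B \<longleftrightarrow>
    C1_on_subset ({0<..<T} \<times> frontier \<Omega>) (\<lambda>(t, x). \<theta>B t x) \<and>
    (\<forall>t\<in>{0<..<T}. \<forall>x\<in>frontier \<Omega>. \<theta>B t x > 0)"

definition strong_solution ::
    "real \<Rightarrow> (real^'d) set \<Rightarrow> (real \<Rightarrow> real^'d \<Rightarrow> real)
      \<Rightarrow> (real \<Rightarrow> real \<Rightarrow> real) \<Rightarrow> (real \<Rightarrow> real \<Rightarrow> real)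
      \<Rightarrow> (real \<Rightarrow> real \<Rightarrow> real) \<Rightarrow> (real \<Rightarrow> real \<Rightarrow> real) \<Rightarrow> (real \<Rightarrow> real \<Rightarrow> real)
      \<Rightarrow> (real^'d \<Rightarrow> real) \<Rightarrow> (real^'d \<Rightarrow> real^'d) \<Rightarrow> (real^'d \<Rightarrow> real)
      \<Rightarrow> (real \<Rightarrow> real^'d \<Rightarrow> real) \<Rightarrow> (real \<Rightarrow> real^'d \<Rightarrow> real^'d) \<Rightarrow> (real \<Rightarrow> real^'d \<Rightarrow> real) \<Rightarrow> bool"
  where "strong_solution T \<Omega> \<theta>B p e \<kappa> \<mu> lam \<rho>0 u0 \<theta>0 \<rho> u \<theta> \<longleftrightarrow>
    C1_QT T \<Omega> \<rho> \<and> C1_QT T \<Omega> u \<and> C1_QT T \<Omega> \<theta> \<and>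
    C1x_QT T \<Omega> (\<lambda>t. Grad (u t)) \<and> C1x_QT T \<Omega> (\<lambda>t. grad (\<theta> t)) \<and>
    (\<forall>t\<in>{0..T}. \<forall>x\<in>closure \<Omega>. \<rho> t x > 0 \<and> \<theta> t x > 0) \<and>
    (\<forall>t\<in>{0..T}. \<forall>x\<in>frontier \<Omega>. u t x = 0) \<and>
    matches_boundary T \<Omega> \<theta>B \<theta> \<and>
    (\<forall>x\<in>\<Omega>. \<rho> 0 x = \<rho>0 x \<and> u 0 x = u0 x \<and> \<theta> 0 x = \<theta>0 x) \<and>
    (\<forall>t\<in>{0<..<T}. \<forall>x\<in>\<Omega>.
       dt \<rho> t x + dvg (\<lambda>y. \<rho> t y *\<^sub>R u t y) x = 0 \<and>
       dt (\<lambda>\<tau> y. \<rho> \<tau> y *\<^sub>R u \<tau> y) t x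
         + Dvg (\<lambda>y. \<rho> t y *\<^sub>R outer (u t y) (u t y)) x
         + grad (\<lambda>y. p (\<rho> t y) (\<theta> t y)) x
         = Dvg (\<lambda>y. stress \<mu> lam (\<rho> t y) (\<theta> t y) (Grad (u t) y)) x \<and>
       dt (\<lambda>\<tau> y. \<rho> \<tau> y * e (\<rho> \<tau> y) (\<theta> \<tau> y)) t x
         + dvg (\<lambda>y. (\<rho> t y * e (\<rho> t y) (\<theta> t y)) *\<^sub>R u t y) x
         - dvg (\<lambda>y. \<kappa> (\<rho> t y) (\<theta> t y) *\<^sub>R grad (\<theta> t) y) x
         = stress \<mu> lam (\<rho> t x) (\<theta> t x) (Grad (u t) x) \<bullet> symm (Grad (u t) x)
           - p (\<rho> t x) (\<theta> t x) * dvg (u t) x)"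


section \<open>Young measures and measure-valued fields\<close>

text \<open>
  The phase spaces are closed subsets of Euclidean spaces. Measures on them are
  represented as Borel measures on the ambient space that are concentrated on the subset.
\<close>

type_synonym 'd phase = "real \<times> (real^'d) \<times> real \<times> (real^'d^'d) \<times> (real^'d)"
type_synonym 'd phase0 = "real \<times> (real^'d) \<times> real"

definition phase_space :: "('d::finite) phase set"
  where "phase_space = {(\<rho>, u, \<theta>, A, g). \<rho> \<ge> 0 \<and> \<theta> \<ge> 0 \<and> transpose A = A}"

definition phase_space0 :: "('d::finite) phase0 set"
  where "phase_space0 = {(\<rho>, u, \<theta>). \<rho> \<ge> 0 \<and> \<theta> \<ge> 0}"

abbreviation bracket :: "'w measure \<Rightarrow> ('w \<Rightarrow> 'b::{banach, second_countable_topology}) \<Rightarrow> 'b"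
    ("\<langle>_; _\<rangle>")
  where "\<langle>V; G\<rangle> \<equiv> integral\<^sup>L V G"

text \<open>
  Weak-star measurable maps into the probability measures on \<open>F\<close>, tested with continuous
  functions vanishing at infinity; for closed \<open>F\<close> these all extend to the ambient space.
\<close>

definition young_measure :: "'z::euclidean_space set \<Rightarrow> 'w::euclidean_space set
    \<Rightarrow> ('z \<Rightarrow> 'w measure) \<Rightarrow> bool"
  where "young_measure S F V \<longleftrightarrow>
    (AE z in lebesgue_on S. sets (V z) = sets borel \<and> prob_space (V z) \<and> emeasure (V z) F = 1) \<and>
    (\<forall>G :: 'w \<Rightarrow> real. continuous_on UNIV G \<and> (G \<longlongrightarrow> 0) at_infinity \<longrightarrow>
       (\<lambda>z. \<langle>V z; G\<rangle>) \<in> borel_measurable (lebesgue_on S))"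

definition bracket_integrable :: "'z::euclidean_space set \<Rightarrow> ('z \<Rightarrow> 'w measure)
    \<Rightarrow> ('z \<Rightarrow> 'w \<Rightarrow> 'b::euclidean_space) \<Rightarrow> bool"
  where "bracket_integrable S V G \<longleftrightarrow>
    (AE z in lebesgue_on S. integrable (V z) (G z)) \<and>
    integrable (lebesgue_on S) (\<lambda>z. \<langle>V z; G z\<rangle>)"

abbreviation integrable_QT :: "real \<Rightarrow> (real^'d::finite) set \<Rightarrow> (real \<Rightarrow> real^'d \<Rightarrow> 'd phase measure)
    \<Rightarrow> (real \<Rightarrow> real^'d \<Rightarrow> 'd phase \<Rightarrow> 'b::euclidean_space) \<Rightarrow> bool"
  where "integrable_QT T \<Omega> V G \<equiv>
    bracket_integrable (QT T \<Omega>) (\<lambda>(t, x). V t x) (\<lambda>(t, x). G t x)"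

text \<open>
  A matrix-valued Radon measure on the compact set \<open>K\<close> is encoded as a density
  \<open>\<Psi>\<close> with respect to a finite positive measure \<open>\<nu>\<close>. By the polar decomposition, every such
  measure has this form. Its total variation is the \<open>\<nu>\<close>-integral of the norm of \<open>\<Psi>\<close>.
\<close>

type_synonym 'd matrix_measure = "(real^'d) measure \<times> (real^'d \<Rightarrow> real^'d^'d)"

definition is_matrix_measure :: "(real^'d) set \<Rightarrow> ('d::finite) matrix_measure \<Rightarrow> bool"
  where "is_matrix_measure K r \<longleftrightarrow> (case r of (\<nu>, \<Psi>) \<Rightarrow>
    sets \<nu> = sets borel \<and> finite_measure \<nu> \<and> emeasure \<nu> (- K) = 0 \<and> integrable \<nu> \<Psi>)"

definition total_variation :: "('d::finite) matrix_measure \<Rightarrow> real"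
  where "total_variation r = (case r of (\<nu>, \<Psi>) \<Rightarrow> LINT x|\<nu>. norm (\<Psi> x))"

definition pairing :: "(real^'d) set \<Rightarrow> ('d::finite) matrix_measure \<Rightarrow> (real^'d \<Rightarrow> real^'d^'d) \<Rightarrow> real"
  where "pairing K r \<Phi> = (case r of (\<nu>, \<Psi>) \<Rightarrow> LINT x:K|\<nu>. \<Phi> x \<bullet> \<Psi> x)"

definition Linf_weakstar :: "real \<Rightarrow> (real^'d) set \<Rightarrow> (real \<Rightarrow> ('d::finite) matrix_measure) \<Rightarrow> bool"
  where "Linf_weakstar T K r \<longleftrightarrow>
    (\<exists>C. AE t in lebesgue_on {0<..<T}. is_matrix_measure K (r t) \<and> total_variation (r t) \<le> C) \<and>
    (\<forall>\<Phi>. continuous_on K \<Phi> \<longrightarrow>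
       (\<lambda>t. pairing K (r t) \<Phi>) \<in> borel_measurable (lebesgue_on {0<..<T}))"


section \<open>Measure-valued solutions\<close>

definition admissible :: "real \<Rightarrow> (real^'d) set \<Rightarrow> (real \<Rightarrow> real^'d \<Rightarrow> real)
    \<Rightarrow> (real \<Rightarrow> real^'d \<Rightarrow> real) \<Rightarrow> bool"
  where "admissible T \<Omega> \<theta>B \<Theta> \<longleftrightarrow> C1_QT T \<Omega> \<Theta> \<and>
    (\<forall>t\<in>{0..T}. \<forall>x\<in>closure \<Omega>. \<Theta> t x > 0) \<and> matches_boundary T \<Omega> \<theta>B \<Theta>"

definition ballistic :: "(real \<Rightarrow> real \<Rightarrow> real) \<Rightarrow> (real \<Rightarrow> real \<Rightarrow> real)
    \<Rightarrow> real \<Rightarrow> real \<Rightarrow> real^'d \<Rightarrow> real \<Rightarrow> real"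
  where "ballistic e s \<Theta> \<rho> u \<theta> = 1/2 * \<rho> * (norm u)\<^sup>2 + \<rho> * e \<rho> \<theta> - \<Theta> * (\<rho> * s \<rho> \<theta>)"

definition entropy_production ::
    "(real \<Rightarrow> real \<Rightarrow> real) \<Rightarrow> (real \<Rightarrow> real \<Rightarrow> real) \<Rightarrow> (real \<Rightarrow> real \<Rightarrow> real)
      \<Rightarrow> real \<Rightarrow> real \<Rightarrow> real^'d^'d \<Rightarrow> real^'d \<Rightarrow> real"
  where "entropy_production \<kappa> \<mu> lam \<rho> \<theta> A g =
    1 / \<theta> * (stress \<mu> lam \<rho> \<theta> A \<bullet> A + \<kappa> \<rho> \<theta> / \<theta> * (norm g)\<^sup>2)"

definition finite_initial_energy ::
    "real \<Rightarrow> (real^'d) set \<Rightarrow> (real \<Rightarrow> real^'d \<Rightarrow> real)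
      \<Rightarrow> (real \<Rightarrow> real \<Rightarrow> real) \<Rightarrow> (real \<Rightarrow> real \<Rightarrow> real)
      \<Rightarrow> (real^'d \<Rightarrow> ('d::finite) phase0 measure) \<Rightarrow> bool"
  where "finite_initial_energy T \<Omega> \<theta>B e s V0 \<longleftrightarrow> (\<forall>\<Theta>. admissible T \<Omega> \<theta>B \<Theta> \<longrightarrow>
    bracket_integrable \<Omega> V0 (\<lambda>x (\<rho>, u, \<theta>). ballistic e s (\<Theta> 0 x) \<rho> u \<theta>))"

definition mv_velocity_compat ::
    "real \<Rightarrow> (real^'d) set \<Rightarrow> (real \<Rightarrow> real^'d \<Rightarrow> ('d::finite) phase measure) \<Rightarrow> bool"
  where "mv_velocity_compat T \<Omega> V \<longleftrightarrow>
    integrable_QT T \<Omega> V (\<lambda>t x (\<rho>, u, \<theta>, A, g). u) \<and>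
    integrable_QT T \<Omega> V (\<lambda>t x (\<rho>, u, \<theta>, A, g). A) \<and>
    (\<forall>\<T>. C1_QT T \<Omega> \<T> \<and> (\<forall>t\<in>{0..T}. \<forall>x\<in>closure \<Omega>. transpose (\<T> t x) = \<T> t x) \<longrightarrow>
       - (LINT (t, x)|lebesgue_on (QT T \<Omega>). \<langle>V t x; \<lambda>(\<rho>, u, \<theta>, A, g). u\<rangle> \<bullet> Dvg (\<T> t) x)
       = (LINT (t, x)|lebesgue_on (QT T \<Omega>). \<langle>V t x; \<lambda>(\<rho>, u, \<theta>, A, g). A\<rangle> \<bullet> \<T> t x))"

definition mv_temperature_compat ::
    "real \<Rightarrow> (real^'d) set \<Rightarrow> (real \<Rightarrow> real^'d \<Rightarrow> real)
      \<Rightarrow> (real \<Rightarrow> real^'d \<Rightarrow> ('d::finite) phase measure) \<Rightarrow> bool"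
  where "mv_temperature_compat T \<Omega> \<theta>B V \<longleftrightarrow>
    integrable_QT T \<Omega> V (\<lambda>t x (\<rho>, u, \<theta>, A, g). \<theta>) \<and>
    integrable_QT T \<Omega> V (\<lambda>t x (\<rho>, u, \<theta>, A, g). g) \<and>
    (\<forall>\<psi> \<Theta>. C1_QT T \<Omega> \<psi> \<and> C1_QT T \<Omega> \<Theta> \<and> matches_boundary T \<Omega> \<theta>B \<Theta> \<longrightarrow>
       - (LINT (t, x)|lebesgue_on (QT T \<Omega>).
            \<langle>V t x; \<lambda>(\<rho>, u, \<theta>, A, g). \<theta> - \<Theta> t x\<rangle> * dvg (\<psi> t) x)
       = (LINT (t, x)|lebesgue_on (QT T \<Omega>).
            \<langle>V t x; \<lambda>(\<rho>, u, \<theta>, A, g). g - grad (\<Theta> t) x\<rangle> \<bullet> \<psi> t x))"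

definition mv_continuity_eq ::
    "real \<Rightarrow> (real^'d) set \<Rightarrow> (real^'d \<Rightarrow> ('d::finite) phase0 measure)
      \<Rightarrow> (real \<Rightarrow> real^'d \<Rightarrow> 'd phase measure) \<Rightarrow> bool"
  where "mv_continuity_eq T \<Omega> V0 V \<longleftrightarrow>
    bracket_integrable \<Omega> V0 (\<lambda>x (\<rho>, u, \<theta>). \<rho>) \<and>
    integrable_QT T \<Omega> V (\<lambda>t x (\<rho>, u, \<theta>, A, g). \<rho>) \<and>
    integrable_QT T \<Omega> V (\<lambda>t x (\<rho>, u, \<theta>, A, g). \<rho> *\<^sub>R u) \<and>
    (AE \<tau> in lebesgue_on {0<..<T}. \<forall>\<psi>. C1_QT T \<Omega> \<psi> \<longrightarrow>
       (LINT x|lebesgue_on \<Omega>. \<langle>V \<tau> x; \<lambda>(\<rho>, u, \<theta>, A, g). \<rho>\<rangle> * \<psi> \<tau> x)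
       - (LINT x|lebesgue_on \<Omega>. \<langle>V0 x; \<lambda>(\<rho>, u, \<theta>). \<rho>\<rangle> * \<psi> 0 x)
       = (LINT (t, x)|lebesgue_on (QT \<tau> \<Omega>).
            \<langle>V t x; \<lambda>(\<rho>, u, \<theta>, A, g). \<rho>\<rangle> * dt \<psi> t x
            + \<langle>V t x; \<lambda>(\<rho>, u, \<theta>, A, g). \<rho> *\<^sub>R u\<rangle> \<bullet> grad (\<psi> t) x))"

definition mv_momentum_eq ::
    "real \<Rightarrow> (real^'d) set \<Rightarrow> (real \<Rightarrow> real \<Rightarrow> real) \<Rightarrow> (real \<Rightarrow> real \<Rightarrow> real) \<Rightarrow> (real \<Rightarrow> real \<Rightarrow> real)
      \<Rightarrow> (real^'d \<Rightarrow> ('d::finite) phase0 measure) \<Rightarrow> (real \<Rightarrow> real^'d \<Rightarrow> 'd phase measure)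
      \<Rightarrow> (real \<Rightarrow> 'd matrix_measure) \<Rightarrow> bool"
  where "mv_momentum_eq T \<Omega> p \<mu> lam V0 V r \<longleftrightarrow>
    bracket_integrable \<Omega> V0 (\<lambda>x (\<rho>, u, \<theta>). \<rho> *\<^sub>R u) \<and>
    integrable_QT T \<Omega> V (\<lambda>t x (\<rho>, u, \<theta>, A, g). \<rho> *\<^sub>R u) \<and>
    integrable_QT T \<Omega> V (\<lambda>t x (\<rho>, u, \<theta>, A, g). \<rho> *\<^sub>R outer u u) \<and>
    integrable_QT T \<Omega> V (\<lambda>t x (\<rho>, u, \<theta>, A, g). p \<rho> \<theta>) \<and>
    integrable_QT T \<Omega> V (\<lambda>t x (\<rho>, u, \<theta>, A, g). stress \<mu> lam \<rho> \<theta> A) \<and>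
    (AE \<tau> in lebesgue_on {0<..<T}. \<forall>\<phi>. C1_QT T \<Omega> \<phi> \<and> (\<forall>t\<in>{0..T}. \<forall>x\<in>frontier \<Omega>. \<phi> t x = 0) \<longrightarrow>
       (LINT x|lebesgue_on \<Omega>. \<langle>V \<tau> x; \<lambda>(\<rho>, u, \<theta>, A, g). \<rho> *\<^sub>R u\<rangle> \<bullet> \<phi> \<tau> x)
       - (LINT x|lebesgue_on \<Omega>. \<langle>V0 x; \<lambda>(\<rho>, u, \<theta>). \<rho> *\<^sub>R u\<rangle> \<bullet> \<phi> 0 x)
       = (LINT (t, x)|lebesgue_on (QT \<tau> \<Omega>).
            \<langle>V t x; \<lambda>(\<rho>, u, \<theta>, A, g). \<rho> *\<^sub>R u\<rangle> \<bullet> dt \<phi> t x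
            + \<langle>V t x; \<lambda>(\<rho>, u, \<theta>, A, g). \<rho> *\<^sub>R outer u u\<rangle> \<bullet> Grad (\<phi> t) x
            + \<langle>V t x; \<lambda>(\<rho>, u, \<theta>, A, g). p \<rho> \<theta>\<rangle> * dvg (\<phi> t) x)
         - (LINT (t, x)|lebesgue_on (QT \<tau> \<Omega>).
              \<langle>V t x; \<lambda>(\<rho>, u, \<theta>, A, g). stress \<mu> lam \<rho> \<theta> A\<rangle> \<bullet> Grad (\<phi> t) x)
         + (LINT t|lebesgue_on {0<..<\<tau>}. pairing (closure \<Omega>) (r t) (Grad_cl \<Omega> (\<phi> t))))"

definition mv_entropy_ineq ::
    "real \<Rightarrow> (real^'d) set \<Rightarrow> (real \<Rightarrow> real \<Rightarrow> real)
      \<Rightarrow> (real \<Rightarrow> real \<Rightarrow> real) \<Rightarrow> (real \<Rightarrow> real \<Rightarrow> real) \<Rightarrow> (real \<Rightarrow> real \<Rightarrow> real)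
      \<Rightarrow> (real^'d \<Rightarrow> ('d::finite) phase0 measure) \<Rightarrow> (real \<Rightarrow> real^'d \<Rightarrow> 'd phase measure) \<Rightarrow> bool"
  where "mv_entropy_ineq T \<Omega> s \<kappa> \<mu> lam V0 V \<longleftrightarrow>
    bracket_integrable \<Omega> V0 (\<lambda>x (\<rho>, u, \<theta>). \<rho> * s \<rho> \<theta>) \<and>
    integrable_QT T \<Omega> V (\<lambda>t x (\<rho>, u, \<theta>, A, g). \<rho> * s \<rho> \<theta>) \<and>
    integrable_QT T \<Omega> V (\<lambda>t x (\<rho>, u, \<theta>, A, g). (\<rho> * s \<rho> \<theta>) *\<^sub>R u - (\<kappa> \<rho> \<theta> / \<theta>) *\<^sub>R g) \<and>
    integrable_QT T \<Omega> V (\<lambda>t x (\<rho>, u, \<theta>, A, g). entropy_production \<kappa> \<mu> lam \<rho> \<theta> A g) \<and>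
    (AE \<tau> in lebesgue_on {0<..<T}. \<forall>\<phi>. C1_QT T \<Omega> \<phi> \<and>
         (\<forall>t\<in>{0..T}. \<forall>x\<in>\<Omega>. \<phi> t x \<ge> 0) \<and>
         (\<exists>K. compact K \<and> K \<subseteq> \<Omega> \<and> (\<forall>t\<in>{0..T}. \<forall>x\<in>closure \<Omega> - K. \<phi> t x = 0)) \<longrightarrow>
       (LINT x|lebesgue_on \<Omega>. \<langle>V \<tau> x; \<lambda>(\<rho>, u, \<theta>, A, g). \<rho> * s \<rho> \<theta>\<rangle> * \<phi> \<tau> x)
       - (LINT x|lebesgue_on \<Omega>. \<langle>V0 x; \<lambda>(\<rho>, u, \<theta>). \<rho> * s \<rho> \<theta>\<rangle> * \<phi> 0 x)
       \<ge> (LINT (t, x)|lebesgue_on (QT \<tau> \<Omega>). \<langle>V t x; \<lambda>(\<rho>, u, \<theta>, A, g). \<rho> * s \<rho> \<theta>\<rangle> * dt \<phi> t x)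
         + (LINT (t, x)|lebesgue_on (QT \<tau> \<Omega>).
              \<langle>V t x; \<lambda>(\<rho>, u, \<theta>, A, g). (\<rho> * s \<rho> \<theta>) *\<^sub>R u - (\<kappa> \<rho> \<theta> / \<theta>) *\<^sub>R g\<rangle> \<bullet> grad (\<phi> t) x)
         + (LINT (t, x)|lebesgue_on (QT \<tau> \<Omega>).
              \<langle>V t x; \<lambda>(\<rho>, u, \<theta>, A, g). entropy_production \<kappa> \<mu> lam \<rho> \<theta> A g\<rangle> * \<phi> t x))"

definition mv_ballistic_energy_ineq ::
    "real \<Rightarrow> (real^'d) set \<Rightarrow> (real \<Rightarrow> real^'d \<Rightarrow> real)
      \<Rightarrow> (real \<Rightarrow> real \<Rightarrow> real) \<Rightarrow> (real \<Rightarrow> real \<Rightarrow> real)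
      \<Rightarrow> (real \<Rightarrow> real \<Rightarrow> real) \<Rightarrow> (real \<Rightarrow> real \<Rightarrow> real) \<Rightarrow> (real \<Rightarrow> real \<Rightarrow> real)
      \<Rightarrow> (real^'d \<Rightarrow> ('d::finite) phase0 measure) \<Rightarrow> (real \<Rightarrow> real^'d \<Rightarrow> 'd phase measure)
      \<Rightarrow> ((real \<Rightarrow> real^'d \<Rightarrow> real) \<Rightarrow> real \<Rightarrow> real) \<Rightarrow> bool"
  where "mv_ballistic_energy_ineq T \<Omega> \<theta>B e s \<kappa> \<mu> lam V0 V D \<longleftrightarrow>
    (\<forall>\<Theta>. admissible T \<Omega> \<theta>B \<Theta> \<longrightarrow>
       bracket_integrable \<Omega> V0 (\<lambda>x (\<rho>, u, \<theta>). ballistic e s (\<Theta> 0 x) \<rho> u \<theta>) \<and>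
       integrable_QT T \<Omega> V (\<lambda>t x (\<rho>, u, \<theta>, A, g). ballistic e s (\<Theta> t x) \<rho> u \<theta>) \<and>
       integrable_QT T \<Omega> V (\<lambda>t x (\<rho>, u, \<theta>, A, g). entropy_production \<kappa> \<mu> lam \<rho> \<theta> A g) \<and>
       integrable_QT T \<Omega> V (\<lambda>t x (\<rho>, u, \<theta>, A, g). \<rho> * s \<rho> \<theta>) \<and>
       integrable_QT T \<Omega> V (\<lambda>t x (\<rho>, u, \<theta>, A, g). (\<rho> * s \<rho> \<theta>) *\<^sub>R u) \<and>
       integrable_QT T \<Omega> V (\<lambda>t x (\<rho>, u, \<theta>, A, g). (\<kappa> \<rho> \<theta> / \<theta>) *\<^sub>R g) \<and>
       (AE \<tau> in lebesgue_on {0<..<T}.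
         (LINT x|lebesgue_on \<Omega>. \<langle>V \<tau> x; \<lambda>(\<rho>, u, \<theta>, A, g). ballistic e s (\<Theta> \<tau> x) \<rho> u \<theta>\<rangle>)
         + (LINT (t, x)|lebesgue_on (QT \<tau> \<Omega>).
              \<langle>V t x; \<lambda>(\<rho>, u, \<theta>, A, g). entropy_production \<kappa> \<mu> lam \<rho> \<theta> A g\<rangle> * \<Theta> t x)
         + D \<Theta> \<tau>
         \<le> (LINT x|lebesgue_on \<Omega>. \<langle>V0 x; \<lambda>(\<rho>, u, \<theta>). ballistic e s (\<Theta> 0 x) \<rho> u \<theta>\<rangle>)
           - (LINT (t, x)|lebesgue_on (QT \<tau> \<Omega>).
                \<langle>V t x; \<lambda>(\<rho>, u, \<theta>, A, g). \<rho> * s \<rho> \<theta>\<rangle> * dt \<Theta> t x)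
           - (LINT (t, x)|lebesgue_on (QT \<tau> \<Omega>).
                \<langle>V t x; \<lambda>(\<rho>, u, \<theta>, A, g). (\<rho> * s \<rho> \<theta>) *\<^sub>R u\<rangle> \<bullet> grad (\<Theta> t) x)
           + (LINT (t, x)|lebesgue_on (QT \<tau> \<Omega>).
                \<langle>V t x; \<lambda>(\<rho>, u, \<theta>, A, g). (\<kappa> \<rho> \<theta> / \<theta>) *\<^sub>R g\<rangle> \<bullet> grad (\<Theta> t) x)))"

definition mv_defect_compat ::
    "real \<Rightarrow> (real^'d) set \<Rightarrow> (real \<Rightarrow> real^'d \<Rightarrow> real)
      \<Rightarrow> ((real \<Rightarrow> real^'d \<Rightarrow> real) \<Rightarrow> real \<Rightarrow> real) \<Rightarrow> (real \<Rightarrow> ('d::finite) matrix_measure) \<Rightarrow> bool"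
  where "mv_defect_compat T \<Omega> \<theta>B D r \<longleftrightarrow>
    (\<forall>\<Theta>. admissible T \<Omega> \<theta>B \<Theta> \<longrightarrow>
      (\<exists>\<xi>. integrable (lebesgue_on {0<..<T}) \<xi> \<and>
        (AE \<tau> in lebesgue_on {0<..<T}. \<forall>\<phi>. C1_closure \<Omega> \<phi> \<and> (\<forall>x\<in>frontier \<Omega>. \<phi> x = 0) \<longrightarrow>
           \<bar>pairing (closure \<Omega>) (r \<tau>) (Grad_cl \<Omega> \<phi>)\<bar> \<le> \<xi> \<tau> * D \<Theta> \<tau> * C1_norm \<Omega> \<phi>)))"

definition mv_korn_poincare ::
    "real \<Rightarrow> (real^'d) set \<Rightarrow> (real \<Rightarrow> real^'d \<Rightarrow> ('d::finite) phase measure) \<Rightarrow> bool"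
  where "mv_korn_poincare T \<Omega> V \<longleftrightarrow>
    (\<forall>U DU. L2_W012 T \<Omega> U DU \<longrightarrow>
       integrable_QT T \<Omega> V (\<lambda>t x (\<rho>, u, \<theta>, A, g). (norm (u - U t x))\<^sup>2) \<and>
       integrable_QT T \<Omega> V (\<lambda>t x (\<rho>, u, \<theta>, A, g). (norm (dev A - dev (DU t x)))\<^sup>2)) \<and>
    (\<exists>Cp. AE \<tau> in lebesgue_on {0<..<T}. \<forall>U DU. L2_W012 T \<Omega> U DU \<longrightarrow>
       (LINT (t, x)|lebesgue_on (QT \<tau> \<Omega>). \<langle>V t x; \<lambda>(\<rho>, u, \<theta>, A, g). (norm (u - U t x))\<^sup>2\<rangle>)
       \<le> Cp * (LINT (t, x)|lebesgue_on (QT \<tau> \<Omega>).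
                 \<langle>V t x; \<lambda>(\<rho>, u, \<theta>, A, g). (norm (dev A - dev (DU t x)))\<^sup>2\<rangle>))"

definition measure_valued_solution ::
    "real \<Rightarrow> (real^'d) set \<Rightarrow> (real \<Rightarrow> real^'d \<Rightarrow> real)
      \<Rightarrow> (real \<Rightarrow> real \<Rightarrow> real) \<Rightarrow> (real \<Rightarrow> real \<Rightarrow> real) \<Rightarrow> (real \<Rightarrow> real \<Rightarrow> real)
      \<Rightarrow> (real \<Rightarrow> real \<Rightarrow> real) \<Rightarrow> (real \<Rightarrow> real \<Rightarrow> real) \<Rightarrow> (real \<Rightarrow> real \<Rightarrow> real)
      \<Rightarrow> (real^'d \<Rightarrow> ('d::finite) phase0 measure) \<Rightarrow> (real \<Rightarrow> real^'d \<Rightarrow> 'd phase measure)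
      \<Rightarrow> ((real \<Rightarrow> real^'d \<Rightarrow> real) \<Rightarrow> real \<Rightarrow> real) \<Rightarrow> bool"
  where "measure_valued_solution T \<Omega> \<theta>B p e s \<kappa> \<mu> lam V0 V D \<longleftrightarrow>
    young_measure \<Omega> phase_space0 V0 \<and>
    finite_initial_energy T \<Omega> \<theta>B e s V0 \<and>
    young_measure (QT T \<Omega>) phase_space (\<lambda>(t, x). V t x) \<and>
    (\<forall>\<Theta>. admissible T \<Omega> \<theta>B \<Theta> \<longrightarrow>
       D \<Theta> \<in> borel_measurable (lebesgue_on {0<..<T}) \<and>
       (\<exists>C. AE \<tau> in lebesgue_on {0<..<T}. 0 \<le> D \<Theta> \<tau> \<and> D \<Theta> \<tau> \<le> C)) \<and>
    mv_velocity_compat T \<Omega> V \<and>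
    mv_temperature_compat T \<Omega> \<theta>B V \<and>
    mv_continuity_eq T \<Omega> V0 V \<and>
    (\<exists>r. Linf_weakstar T (closure \<Omega>) r \<and>
       mv_momentum_eq T \<Omega> p \<mu> lam V0 V r \<and>
       mv_defect_compat T \<Omega> \<theta>B D r) \<and>
    mv_entropy_ineq T \<Omega> s \<kappa> \<mu> lam V0 V \<and>
    mv_ballistic_energy_ineq T \<Omega> \<theta>B e s \<kappa> \<mu> lam V0 V D \<and>
    mv_korn_poincare T \<Omega> V"

end

theory Submission
  imports Defs
begin

text \<open>
  Relative energy method. Testing the continuity and momentum equations with quantities built from
  the strong solution and taking \<open>\<Theta> = \<theta>'\<close> in the ballistic energy inequality, the mean relative
  energy plus the dissipation defect at time \<open>\<tau>\<close> is bounded by the space-time integral of a rate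
  and the defect of the momentum equation. By thermodynamic stability the relative energy controls
  the squared distance of \<open>(\<rho>, u, \<theta>)\<close> from the strong solution on the support of the Young
  measure; the rate, a quadratic remainder once the strong equations are used, is at most a multiple
  of the relative energy minus a coercive form in the deviations of the two gradient variables. The
  defect compatibility and Gronwall's inequality make the relative energy and the defect vanish, and
  then the coercive form vanishes too.

  The terms linear in the gradient variables are integrated by parts with the compatibility
  conditions; these hold on the whole of \<open>(0, T)\<close> only, so they are localized to \<open>(0, \<tau>)\<close> by
  Bernstein polynomials in time. No regularity of the boundary is available: fields vanishing on
  the boundary are truncated near zero so as to have compact support.
\<close>

section \<open>Integrals of derivatives of functions vanishing on the boundary\<close>

text \<open>Two obstacles shape the argument. The fields \<open>S\<close> (stress) and
  \<open>\<eta>\<close> (heat flux over temperature) that test the compatibility conditions contain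
  first spatial derivatives of the strong solution. They have continuous spatial derivatives, but
  nothing is known of their time derivatives, so they are not C1 test fields. A polynomial in time
  whose coefficients are such fields frozen at fixed times is one; Bernstein polynomials with nodes
  in time recover the field itself in the limit. Secondly, the gradient variables are independent
  coordinates of the phase space. Terms linear in them can be absorbed only after they have become
  products of deviations, and integrals known to vanish are added for that purpose. The relative
  energy is the ballistic energy minus its tangent at the strong state. The tangent is affine in the
  density and the momentum, its temperature derivative being zero by Gibbs' relation. Hence its
  evolution is given by the continuity and momentum equations, and its coefficients dictate the
  functions with which these are tested.\<close>

lemma integral_deriv_compact_support:
  fixes g :: "'a::euclidean_space \<Rightarrow> real"
  assumes der: "\<And>x. (g has_derivative g' x) (at x)"
    and bd: "\<And>x v. \<bar>g' x v\<bar> \<le> L * norm v"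
    and supp: "\<And>x. norm x > R \<Longrightarrow> g x = 0"
  shows "integrable lborel (\<lambda>x. g' x e)" and "(LINT x|lborel. g' x e) = 0"
proof -
  \<comment> \<open>Difference quotients have integral zero by translation invariance. The Lipschitz
    bound that follows from the bounded derivative dominates them, and a shift by at most
    \<open>norm e\<close> enlarges the support ball from radius \<open>R\<close> to
    \<open>R + norm e\<close>, uniformly in \<open>n\<close>.\<close>
  define q where "q n x = real (Suc n) * (g (x + (1 / real (Suc n)) *\<^sub>R e) - g x)" for n x
  define w where "w x = (L * norm e) * indicator (cball 0 (R + norm e)) x" for x :: 'a
  have cont: "continuous_on UNIV g"
    using der by (meson continuous_at_imp_continuous_on has_derivative_continuous)
  have gi: "integrable lborel g"
  proof -
    have "integrable lborel (\<lambda>x. indicator (cball 0 R) x *\<^sub>R g x)"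
      by (intro borel_integrable_compact continuous_on_subset[OF cont]) auto
    also have "(\<lambda>x. indicator (cball 0 R) x *\<^sub>R g x) = g"
      using supp by (auto simp: indicator_def fun_eq_iff not_le)
    finally show ?thesis .
  qed
  have [measurable]: "g \<in> borel_measurable borel" using cont by (rule borel_measurable_continuous_onI)
  have tr: "integrable lborel (\<lambda>x. g (x + a))" "(LINT x|lborel. g (x + a)) = (LINT x|lborel. g x)" for a
    using lborel_distr_plus[of a] integrable_distr_eq[of "(+) a" lborel borel g] integral_distr[of "(+) a" lborel borel g] gi
    by (simp_all add: add.commute)
  have q0: "(LINT x|lborel. q n x) = 0" for n
    unfolding q_def using tr gi by simp
  have conv: "(\<lambda>n. q n x) \<longlonglongrightarrow> g' x e" for x
  proof -
    have "((\<lambda>t. g (x + t *\<^sub>R e)) has_derivative (\<lambda>t. g' x (t *\<^sub>R e))) (at 0)"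
      by (rule has_derivative_compose[of "\<lambda>t. x + t *\<^sub>R e" "\<lambda>t. t *\<^sub>R e" 0 UNIV g "g' x", simplified])
        (use der in \<open>auto intro!: derivative_eq_intros\<close>)
    moreover have "linear (g' x)" using der has_derivative_linear by blast
    ultimately have "((\<lambda>t. g (x + t *\<^sub>R e)) has_real_derivative (g' x e)) (at 0)"
      by (simp add: has_field_derivative_def linear_cmul mult_commute_abs)
    then have "((\<lambda>h. (g (x + h *\<^sub>R e) - g x) / h) \<longlongrightarrow> g' x e) (at 0)"
      by (simp add: DERIV_def)
    moreover have "filterlim (\<lambda>n. 1 / real (Suc n)) (at 0) sequentially"
      by (intro filterlim_atI LIMSEQ_Suc[OF lim_1_over_n]) auto
    ultimately have "((\<lambda>n. (g (x + (1 / real (Suc n)) *\<^sub>R e) - g x) / (1 / real (Suc n))) \<longlonglongrightarrow> g' x e)"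
      by (rule filterlim_compose)
    then show ?thesis by (simp add: q_def mult.commute)
  qed
  have lip: "\<bar>g y - g x\<bar> \<le> L * norm (y - x)" for x y
    using differentiable_bound[of UNIV g g' L y x] der bd
    by (simp add: onorm_le real_norm_def)
  have qb: "norm (q n x) \<le> w x" for n x
  proof (cases "norm x \<le> R + norm e")
    case True
    have "\<bar>q n x\<bar> \<le> real (Suc n) * (L * norm ((1 / real (Suc n)) *\<^sub>R e))"
      unfolding q_def abs_mult using lip[of "x + (1 / real (Suc n)) *\<^sub>R e" x]
      by (intro mult_mono) auto
    also have "\<dots> = L * norm e" by (simp add: field_simps del: of_nat_Suc)
    finally show ?thesis using True by (simp add: w_def)
  next
    case False
    have "norm ((1 / real (Suc n)) *\<^sub>R e) \<le> norm e"
      by (simp add: field_simps mult_left_le_one_le)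
    then have "norm (x + (1 / real (Suc n)) *\<^sub>R e) > R"
      using False norm_triangle_ineq4[of "x + (1 / real (Suc n)) *\<^sub>R e" "(1 / real (Suc n)) *\<^sub>R e"] by simp
    moreover have "norm x > R" using False norm_ge_zero[of e] by linarith
    ultimately show ?thesis using False by (simp add: q_def w_def supp)
  qed
  have [measurable]: "q n \<in> borel_measurable lborel" for n
    unfolding q_def by measurable
  have gm: "(\<lambda>x. g' x e) \<in> borel_measurable lborel"
    by (rule borel_measurable_LIMSEQ_real[of _ q]) (use conv in auto)
  have wi: "integrable lborel w"
    unfolding w_def by (intro integrable_mult_right integrable_real_indicator) (use emeasure_lborel_cball_finite in \<open>auto simp: less_top\<close>)
  have "(\<lambda>n. LINT x|lborel. q n x) \<longlonglongrightarrow> (LINT x|lborel. g' x e)"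
    by (rule integral_dominated_convergence[of _ _ _ w]) (use gm wi conv qb in auto)
  then show "(LINT x|lborel. g' x e) = 0" by (simp add: q0 LIMSEQ_const_iff)
  show "integrable lborel (\<lambda>x. g' x e)"
    by (rule integrable_dominated_convergence[where s = q and w = w]) (use gm wi conv qb in auto)
qed

text \<open>Above \<epsilon> this is \<open>s - 2 * \<epsilon> + \<epsilon>\<^sup>2 / s\<close>. The
  double zero at \<epsilon> makes the truncation continuously differentiable; its slope
  \<open>trunc'\<close> lies in [0, 1] and tends to 1 at every positive \<open>s\<close> as
  \<epsilon> tends to 0.\<close>

definition trunc :: "real \<Rightarrow> real \<Rightarrow> real"
  where "trunc \<epsilon> s = (if s > \<epsilon> then (s - \<epsilon>)\<^sup>2 / s else 0)"

definition trunc' :: "real \<Rightarrow> real \<Rightarrow> real"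
  where "trunc' \<epsilon> s = (if s > \<epsilon> then 1 - (\<epsilon> / s)\<^sup>2 else 0)"

lemma trunc_deriv:
  assumes "\<epsilon> > 0"
  shows "(trunc \<epsilon> has_real_derivative trunc' \<epsilon> s) (at s)"
proof -
  consider "s > \<epsilon>" | "s < \<epsilon>" | "s = \<epsilon>" by linarith
  then show ?thesis
  proof cases
    case 1
    have "((\<lambda>s. (s - \<epsilon>)\<^sup>2 / s) has_real_derivative trunc' \<epsilon> s) (at s)"
      using 1 assms by (auto intro!: derivative_eq_intros simp: trunc'_def field_simps power2_eq_square)
    then show ?thesis
      by (rule has_field_derivative_transform_within[where d = "s - \<epsilon>"]) (use 1 in \<open>auto simp: trunc_def dist_real_def\<close>)
  next
    case 2
    have "((\<lambda>s. 0) has_real_derivative trunc' \<epsilon> s) (at s)"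
      using 2 by (simp add: trunc'_def)
    then show ?thesis
      by (rule has_field_derivative_transform_within[where d = "\<epsilon> - s"]) (use 2 in \<open>auto simp: trunc_def dist_real_def\<close>)
  next
    case 3
    have b: "\<bar>trunc \<epsilon> (s + h) / h\<bar> \<le> \<bar>h\<bar> / \<epsilon>" if "h \<noteq> 0" for h
    proof (cases "h > 0")
      case True
      have "trunc \<epsilon> (s + h) / h = h / (\<epsilon> + h)"
        using True 3 assms by (simp add: trunc_def power2_eq_square)
      also have "\<dots> \<le> h / \<epsilon>" using True assms by (simp add: frac_le)
      finally show ?thesis using True assms 3 by (simp add: trunc_def)
    next
      case False
      then show ?thesis using that 3 assms by (simp add: trunc_def divide_nonpos_nonneg)
    qed
    have "((\<lambda>h. trunc \<epsilon> (s + h) / h) \<longlongrightarrow> 0) (at 0)"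
    proof (rule Lim_null_comparison)
      show "\<forall>\<^sub>F h in at 0. norm (trunc \<epsilon> (s + h) / h) \<le> \<bar>h\<bar> / \<epsilon>"
        using b by (auto simp: eventually_at intro!: exI[of _ 1])
      show "((\<lambda>h. \<bar>h\<bar> / \<epsilon>) \<longlongrightarrow> 0) (at 0)"
        using assms by (auto intro!: tendsto_eq_intros)
    qed
    then show ?thesis using 3 assms by (simp add: DERIV_def trunc_def trunc'_def)
  qed
qed

lemma trunc'_bounds: "\<epsilon> > 0 \<Longrightarrow> 0 \<le> trunc' \<epsilon> s \<and> trunc' \<epsilon> s \<le> 1"
  by (auto simp: trunc'_def divide_le_eq power_le_one)

text \<open>Truncating \<open>f\<close> at the level 1/(n+1) produces a function supported in a
  compact subset of \<Omega>, so its extension by zero is differentiable everywhere, whatever the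
  boundary looks like. Its derivatives have integral zero and a common majorant; in the limit they
  become the derivative of \<open>f\<close> on the set where \<open>f\<close> is positive.\<close>

lemma integral_deriv_pos_part:
  fixes f :: "'a::euclidean_space \<Rightarrow> real"
  assumes "open \<Omega>" "bounded \<Omega>" and cf: "continuous_on (closure \<Omega>) f"
    and z: "\<And>x. x \<in> frontier \<Omega> \<Longrightarrow> f x = 0"
    and der: "\<And>x. x \<in> \<Omega> \<Longrightarrow> (f has_derivative f' x) (at x)"
    and bd: "\<And>x v. x \<in> \<Omega> \<Longrightarrow> \<bar>f' x v\<bar> \<le> L * norm v"
    and "L \<ge> 0"
  shows "integrable lborel (\<lambda>x. if x \<in> \<Omega> \<and> f x > 0 then f' x e else 0)"
    and "(LINT x|lborel. (if x \<in> \<Omega> \<and> f x > 0 then f' x e else 0)) = 0"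
proof -
  define ep where "ep n = 1 / real (Suc n)" for n
  have ep: "ep n > 0" for n by (simp add: ep_def)
  define g where "g n x = (if x \<in> \<Omega> then trunc (ep n) (f x) else 0)" for n x
  define g' where "g' n x v = (if x \<in> \<Omega> then trunc' (ep n) (f x) * f' x v else 0)" for n x v
  obtain R where R: "R > 0" "\<Omega> \<subseteq> ball 0 R" using \<open>bounded \<Omega>\<close> bounded_subset_ballD by blast
  have gder: "(g n has_derivative g' n x) (at x)" for n x
  proof (cases "x \<in> \<Omega>")
    case True
    have "((\<lambda>x. trunc (ep n) (f x)) has_derivative (\<lambda>v. trunc' (ep n) (f x) * f' x v)) (at x)"
      using has_derivative_compose[OF der[OF True], of "trunc (ep n)"] trunc_deriv[OF ep]
      by (simp add: has_field_derivative_def)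
    then have "(g n has_derivative (\<lambda>v. trunc' (ep n) (f x) * f' x v)) (at x)"
      by (rule has_derivative_transform_within_open[where s = \<Omega>]) (use True \<open>open \<Omega>\<close> in \<open>auto simp: g_def\<close>)
    moreover have "g' n x = (\<lambda>v. trunc' (ep n) (f x) * f' x v)"
      using True by (simp add: g'_def fun_eq_iff)
    ultimately show ?thesis by simp
  next
    case False
    \<comment> \<open>\<open>K\<close> contains every point where the truncation is nonzero. It is
      closed in the whole space, and a point outside \<Omega> that belonged to it would be a
      boundary point with a positive value. Hence the truncation vanishes near every point outside
      \<Omega>.\<close>
    define K where "K = {y \<in> closure \<Omega>. f y \<ge> ep n}"
    have "closed K" unfolding K_def
      using continuous_on_closed_Collect_le[of "closure \<Omega>" "\<lambda>_. ep n" f] cf by auto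
    have "x \<notin> K"
    proof
      assume "x \<in> K"
      then have "x \<in> frontier \<Omega>" using False \<open>open \<Omega>\<close> by (auto simp: K_def frontier_def interior_open)
      then show False using z \<open>x \<in> K\<close> ep[of n] by (auto simp: K_def)
    qed
    have gz: "g n y = 0" if "y \<in> - K" for y
      using that closure_subset[of \<Omega>] by (auto simp: g_def trunc_def K_def)
    have "((\<lambda>_. 0) has_derivative (\<lambda>v. 0)) (at x)" by simp
    then have "(g n has_derivative (\<lambda>v. 0)) (at x)"
      by (rule has_derivative_transform_within_open[where s = "-K"])
        (use \<open>closed K\<close> \<open>x \<notin> K\<close> gz in auto)
    moreover have "g' n x = (\<lambda>v. 0)" using False by (simp add: g'_def fun_eq_iff)
    ultimately show ?thesis by simp
  qed
  have gb: "\<bar>g' n x v\<bar> \<le> L * norm v" for n x v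
  proof (cases "x \<in> \<Omega>")
    case True
    have "\<bar>g' n x v\<bar> \<le> \<bar>f' x v\<bar>"
      using True trunc'_bounds[OF ep, of n "f x"]
      by (auto simp: g'_def abs_mult mult_left_le_one_le)
    then show ?thesis using bd[OF True, of v] by simp
  qed (use \<open>L \<ge> 0\<close> in \<open>auto simp: g'_def\<close>)
  have gs: "g n x = 0" if "norm x > R" for n x
    using that R by (auto simp: g_def)
  have i: "integrable lborel (\<lambda>x. g' n x e)" and i0: "(LINT x|lborel. g' n x e) = 0" for n
    using integral_deriv_compact_support[of "g n" "g' n" L R e, OF gder gb gs] by auto
  define w where "w x = (L * norm e) * indicator (cball 0 R) x" for x :: 'a
  have wi: "integrable lborel w"
    unfolding w_def by (intro integrable_mult_right integrable_real_indicator) (use emeasure_lborel_cball_finite in \<open>auto simp: less_top\<close>)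
  have wb: "norm (g' n x e) \<le> w x" for n x
    using gb[of n x e] R \<open>L \<ge> 0\<close> by (auto simp: w_def g'_def indicator_def)
  have conv: "(\<lambda>n. g' n x e) \<longlonglongrightarrow> (if x \<in> \<Omega> \<and> f x > 0 then f' x e else 0)" for x
  proof (cases "x \<in> \<Omega> \<and> f x > 0")
    case True
    have e0: "ep \<longlonglongrightarrow> 0" unfolding ep_def by (rule LIMSEQ_Suc[OF lim_1_over_n])
    have "(\<lambda>n. (1 - (ep n / f x)\<^sup>2) * f' x e) \<longlonglongrightarrow> (1 - (0 / f x)\<^sup>2) * f' x e"
      using True by (intro tendsto_intros e0) auto
    moreover have "\<forall>\<^sub>F n in sequentially. (1 - (ep n / f x)\<^sup>2) * f' x e = g' n x e"
      using order_tendstoD(2)[OF e0 conjunct2[OF True]]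
      by eventually_elim (use True in \<open>auto simp: g'_def trunc'_def\<close>)
    ultimately show ?thesis using True by (simp add: tendsto_cong)
  next
    case False
    then have "g' n x e = 0" for n using ep[of n] by (auto simp: g'_def trunc'_def)
    then show ?thesis using False by auto
  qed
  have m: "(\<lambda>x. if x \<in> \<Omega> \<and> f x > 0 then f' x e else 0) \<in> borel_measurable lborel"
    by (rule borel_measurable_LIMSEQ_real[of _ "\<lambda>n x. g' n x e"])
      (use conv i in \<open>auto dest: borel_measurable_integrable\<close>)
  have "(\<lambda>n. LINT x|lborel. g' n x e) \<longlonglongrightarrow> (LINT x|lborel. (if x \<in> \<Omega> \<and> f x > 0 then f' x e else 0))"
    by (rule integral_dominated_convergence[of _ _ _ w]) (use m wi conv wb i in \<open>auto dest: borel_measurable_integrable\<close>)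
  then show "(LINT x|lborel. (if x \<in> \<Omega> \<and> f x > 0 then f' x e else 0)) = 0" by (simp add: i0 LIMSEQ_const_iff)
  show "integrable lborel (\<lambda>x. if x \<in> \<Omega> \<and> f x > 0 then f' x e else 0)"
    by (rule integrable_dominated_convergence[where s = "\<lambda>n x. g' n x e" and w = w]) (use m wi conv wb i in \<open>auto dest: borel_measurable_integrable\<close>)
qed

text \<open>Near a zero with nonzero derivative, a ray from a point behind it meets the level set at most once.\<close>

lemma negligible_zero_set_deriv_nonzero:
  fixes f :: "'a::euclidean_space \<Rightarrow> real" and f' :: "'a \<Rightarrow> 'a \<Rightarrow>\<^sub>L real"
  assumes "open \<Omega>" and der: "\<And>x. x \<in> \<Omega> \<Longrightarrow> (f has_derivative f' x) (at x)"
    and cf': "continuous_on \<Omega> f'"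
  shows "negligible {x \<in> \<Omega>. f x = 0 \<and> f' x e \<noteq> 0}"
proof (subst locally_negligible_alt, clarify)
  fix x0 assume x0: "x0 \<in> \<Omega>" "f x0 = 0" "f' x0 e \<noteq> 0"
  let ?S = "{x \<in> \<Omega>. f x = 0 \<and> f' x e \<noteq> 0}"
  \<comment> \<open>The rays start at \<open>a\<close>, so that the ray through \<open>x0\<close>
    has direction \<open>e\<close>. Then \<open>P x0\<close> is the square of
    \<open>f' x0 e\<close>, and by continuity the derivative of \<open>f\<close> along the rays
    keeps one sign near \<open>x0\<close>.\<close>
  define a where "a = x0 - e"
  define P where "P x = f' x (x - a) * f' x0 e" for x
  have "continuous_on \<Omega> P" unfolding P_def by (intro continuous_intros cf')
  moreover have "P x0 > 0" using x0 by (simp add: P_def a_def) (meson not_real_square_gt_zero)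
  ultimately have "open (\<Omega> \<inter> P -` {0<..})"
    using continuous_open_preimage[OF _ \<open>open \<Omega>\<close>, of P "{0<..}"] by simp
  then obtain r where r: "r > 0" "cball x0 r \<subseteq> \<Omega> \<inter> P -` {0<..}"
    using x0 \<open>P x0 > 0\<close> open_contains_cball[THEN iffD1, rule_format, of "\<Omega> \<inter> P -` {0<..}" x0]
    by (metis Int_iff greaterThan_iff vimage_eq)
  define S where "S = {x \<in> cball x0 r. f x = 0}"
  have "closed S"
  proof -
    have "continuous_on (cball x0 r) f"
      using r der by (intro continuous_at_imp_continuous_on) (auto intro: has_derivative_continuous)
    then show ?thesis unfolding S_def by (intro continuous_closed_preimage_constant) auto
  qed
  have "negligible S"
  proof (rule starlike_negligible[OF \<open>closed S\<close>, of a])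
    \<comment> \<open>Rolle's argument: between two zeros on one ray the derivative along the ray
      vanishes somewhere, against \<open>P > 0\<close>. The segment stays in the ball by
      convexity.\<close>
    have key: False if y: "a + y \<in> S" "a + c *\<^sub>R y \<in> S" "0 \<le> c" "c < 1" for c y
    proof -
      define h where "h t = f (a + t *\<^sub>R y)" for t
      have seg: "a + t *\<^sub>R y \<in> cball x0 r" if "c \<le> t" "t \<le> 1" for t
      proof -
        define s where "s = (t - c) / (1 - c)"
        have s: "0 \<le> s" "s \<le> 1" using that y by (auto simp: s_def divide_simps)
        have "s * (1 - c) = t - c" using y by (simp add: s_def)
        then have "t = (1 - s) * c + s" by (simp add: algebra_simps)
        then have "a + t *\<^sub>R y = (1 - s) *\<^sub>R (a + c *\<^sub>R y) + s *\<^sub>R (a + y)"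
          by (subst \<open>t = _\<close>) (simp add: algebra_simps)
        also have "\<dots> \<in> cball x0 r"
          using y s by (intro convexD[OF convex_cball]) (auto simp: S_def)
        finally show ?thesis .
      qed
      have hd: "(h has_real_derivative f' (a + t *\<^sub>R y) y) (at t)" if "c \<le> t" "t \<le> 1" for t
      proof -
        have "a + t *\<^sub>R y \<in> \<Omega>" using seg[OF that] r by auto
        moreover have "((\<lambda>t. a + t *\<^sub>R y) has_derivative (\<lambda>t. t *\<^sub>R y)) (at t)"
          by (auto intro!: derivative_eq_intros)
        ultimately have "(h has_derivative (\<lambda>s. f' (a + t *\<^sub>R y) (s *\<^sub>R y))) (at t)"
          unfolding h_def using has_derivative_compose[OF _ der] by blast
        then show ?thesis
          by (simp add: has_field_derivative_def blinfun.scaleR_right mult_commute_abs)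
      qed
      have "\<exists>z>c. z < 1 \<and> h 1 - h c = (1 - c) * f' (a + z *\<^sub>R y) y"
        using MVT2[of c 1 h "\<lambda>t. f' (a + t *\<^sub>R y) y"] hd y by auto
      then obtain t where t: "c < t" "t < 1" "h 1 - h c = (1 - c) * f' (a + t *\<^sub>R y) y" by auto
      have "h 1 = 0" "h c = 0" using y by (auto simp: h_def S_def)
      then have "f' (a + t *\<^sub>R y) y = 0" using t y by auto
      moreover have "P (a + t *\<^sub>R y) > 0" using seg[of t] t r by auto
      ultimately show False by (simp add: P_def blinfun.scaleR_right)
    qed
    fix c x assume h: "a + c *\<^sub>R x \<in> S" "0 \<le> c" "a + x \<in> S"
    show "c = 1"
    proof (rule ccontr)
      assume "c \<noteq> 1"
      then consider "c < 1" | "c > 1" by linarith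
      then show False
      proof cases
        case 1 then show False using key[of x c] h by simp
      next
        \<comment> \<open>Rescaling the ray exchanges the roles of the two points.\<close>
        case 2 then show False using key[of "c *\<^sub>R x" "1 / c"] h by (simp add: field_simps)
      qed
    qed
  qed
  then have "negligible (?S \<inter> ball x0 r)"
    by (rule negligible_subset) (auto simp: S_def)
  moreover have "openin (top_of_set ?S) (?S \<inter> ball x0 r)" by (simp add: openin_open_Int)
  ultimately show "\<exists>U. openin (top_of_set ?S) U \<and> x0 \<in> U \<and> negligible U"
    using x0 r by (intro exI[of _ "?S \<inter> ball x0 r"]) auto
qed

text \<open>The positive-part statement for \<open>f\<close> and for \<open>- f\<close> accounts for
  the derivative on \<open>{f > 0}\<close> and on \<open>{f < 0}\<close>; on \<open>{f = 0}\<close>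
  it is nonzero only on a negligible set. This takes the place of the divergence theorem on a domain
  with arbitrary boundary.\<close>

lemma integral_deriv_zero_boundary:
  fixes f :: "'a::euclidean_space \<Rightarrow> real" and f' :: "'a \<Rightarrow> 'a \<Rightarrow>\<^sub>L real"
  assumes "open \<Omega>" "bounded \<Omega>" and cf: "continuous_on (closure \<Omega>) f"
    and z: "\<And>x. x \<in> frontier \<Omega> \<Longrightarrow> f x = 0"
    and der: "\<And>x. x \<in> \<Omega> \<Longrightarrow> (f has_derivative f' x) (at x)"
    and cf': "continuous_on \<Omega> f'" and bd: "\<And>x. x \<in> \<Omega> \<Longrightarrow> norm (f' x) \<le> L"
  shows "integrable (lebesgue_on \<Omega>) (\<lambda>x. f' x e)" and "(LINT x|lebesgue_on \<Omega>. f' x e) = 0"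
proof -
  define Q where "Q x = (if x \<in> \<Omega> \<and> f x > 0 then f' x e else 0)" for x
  define N where "N x = (if x \<in> \<Omega> \<and> - f x > 0 then (- f' x) e else 0)" for x
  have b: "\<bar>f' x v\<bar> \<le> max L 0 * norm v" if "x \<in> \<Omega>" for x v
  proof -
    have "norm (f' x) * norm v \<le> max L 0 * norm v"
      using bd[OF that] by (intro mult_right_mono) auto
    then show ?thesis using norm_blinfun[of "f' x" v] by simp
  qed
  have b': "\<bar>(- f' x) v\<bar> \<le> max L 0 * norm v" if "x \<in> \<Omega>" for x v
    using b[OF that] by (simp add: blinfun.minus_left)
  have Q: "integrable lborel Q" "(LINT x|lborel. Q x) = 0"
    unfolding Q_def
    using integral_deriv_pos_part[of \<Omega> f "\<lambda>x. f' x" "max L 0" e] assms b by auto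
  have dm: "((\<lambda>x. - f x) has_derivative (- f' x)) (at x)" if "x \<in> \<Omega>" for x
    using has_derivative_minus[OF der[OF that]] by (simp add: blinfun.minus_left fun_eq_iff uminus_blinfun.rep_eq)
  have N: "integrable lborel N" "(LINT x|lborel. N x) = 0"
    unfolding N_def
    using integral_deriv_pos_part[of \<Omega> "\<lambda>x. - f x" "\<lambda>x. - f' x" "max L 0" e] dm b' assms
    by (auto intro!: continuous_intros)
  have i: "has_bochner_integral lebesgue (\<lambda>x. Q x - N x) 0"
    using Q N by (auto simp: has_bochner_integral_iff integrable_completion integral_completion)
  have ae: "AE x in lebesgue. Q x - N x = indicator \<Omega> x *\<^sub>R f' x e"
  proof -
    have "negligible {x \<in> \<Omega>. f x = 0 \<and> f' x e \<noteq> 0}"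
      by (rule negligible_zero_set_deriv_nonzero) (use assms in auto)
    then have "AE x in lebesgue. x \<notin> {x \<in> \<Omega>. f x = 0 \<and> f' x e \<noteq> 0}"
      unfolding negligible_iff_null_sets by (rule AE_not_in)
    then show ?thesis
      by eventually_elim (auto simp: Q_def N_def indicator_def blinfun.minus_left)
  qed
  have O: "\<Omega> \<in> sets lebesgue" using \<open>open \<Omega>\<close> by auto
  have m0: "(\<lambda>x. f' x e) \<in> borel_measurable (lebesgue_on \<Omega>)"
    using O by (intro continuous_imp_measurable_on_sets_lebesgue continuous_intros cf')
  have m: "(\<lambda>x. indicator \<Omega> x *\<^sub>R f' x e) \<in> borel_measurable lebesgue"
    using m0 O by (simp add: borel_measurable_restrict_space_iff)
  have "has_bochner_integral lebesgue (\<lambda>x. indicator \<Omega> x *\<^sub>R f' x e) 0"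
    using has_bochner_integral_cong_AE[THEN iffD1, OF _ m ae i] i
    by (auto dest: has_bochner_integral_integrable)
  then show "integrable (lebesgue_on \<Omega>) (\<lambda>x. f' x e)" and "(LINT x|lebesgue_on \<Omega>. f' x e) = 0"
    using O by (auto simp: has_bochner_integral_iff integrable_restrict_space integral_restrict_space)
qed

section \<open>Integration on Lebesgue subspaces, Gronwall, and localization in time\<close>

lemma open_sets_lebesgue: "open S \<Longrightarrow> S \<in> sets lebesgue"
  by simp

lemma AE_lebesgue_on_iff:
  "S \<in> sets lebesgue \<Longrightarrow> (AE x in lebesgue_on S. P x) \<longleftrightarrow> (AE x in lborel. x \<in> S \<longrightarrow> P x)"
  by (simp add: AE_restrict_space_iff AE_completion_iff)

lemma integrable_lebesgue_on_iff:
  fixes f :: "'a::euclidean_space \<Rightarrow> 'b::euclidean_space"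
  shows "S \<in> sets lebesgue \<Longrightarrow> integrable (lebesgue_on S) f \<longleftrightarrow> integrable lebesgue (\<lambda>x. indicator S x *\<^sub>R f x)"
  by (simp add: integrable_restrict_space)

lemma integral_lebesgue_on_eq:
  fixes f :: "'a::euclidean_space \<Rightarrow> 'b::euclidean_space"
  shows "S \<in> sets lebesgue \<Longrightarrow> integral\<^sup>L (lebesgue_on S) f = (LINT x|lebesgue. indicator S x *\<^sub>R f x)"
  by (simp add: integral_restrict_space)

lemma integrable_lebesgue_on_mono:
  fixes f :: "'a::euclidean_space \<Rightarrow> 'b::euclidean_space"
  assumes f: "integrable (lebesgue_on S) f" and "S' \<subseteq> S" "S \<in> sets lebesgue" "S' \<in> sets lebesgue"
  shows "integrable (lebesgue_on S') f"
proof -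
  have "integrable lebesgue (\<lambda>x. indicator S' x *\<^sub>R (indicator S x *\<^sub>R f x))"
    by (rule integrable_mult_indicator) (use f assms in \<open>simp_all add: integrable_lebesgue_on_iff\<close>)
  also have "(\<lambda>x. indicator S' x *\<^sub>R (indicator S x *\<^sub>R f x)) = (\<lambda>x. indicator S' x *\<^sub>R f x)"
    using \<open>S' \<subseteq> S\<close> by (auto simp: indicator_def fun_eq_iff)
  finally show ?thesis using assms by (simp add: integrable_lebesgue_on_iff)
qed

lemma AE_lebesgue_on_mono_set:
  "(AE x in lebesgue_on S. P x) \<Longrightarrow> S' \<subseteq> S \<Longrightarrow> S \<in> sets lebesgue \<Longrightarrow> S' \<in> sets lebesgue \<Longrightarrow> AE x in lebesgue_on S'. P x"
  by (auto simp: AE_lebesgue_on_iff elim: eventually_mono)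

lemma integrable_inner_bounded:
  fixes f c :: "'a \<Rightarrow> 'b::euclidean_space"
  assumes f: "integrable M f" and c: "c \<in> borel_measurable M" and b: "\<And>x. x \<in> space M \<Longrightarrow> norm (c x) \<le> B"
  shows "integrable M (\<lambda>x. f x \<bullet> c x)"
proof (rule Bochner_Integration.integrable_bound)
  show "integrable M (\<lambda>x. B *\<^sub>R norm (f x))" using f by simp
  show "(\<lambda>x. f x \<bullet> c x) \<in> borel_measurable M" using f c by auto
  have "norm (f x \<bullet> c x) \<le> norm (B *\<^sub>R norm (f x))" if "x \<in> space M" for x
  proof -
    have "norm (f x \<bullet> c x) \<le> norm (f x) * norm (c x)" by (simp add: Cauchy_Schwarz_ineq2)
    also have "\<dots> \<le> norm (f x) * B" using b[OF that] by (intro mult_left_mono) auto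
    also have "\<dots> \<le> norm (B *\<^sub>R norm (f x))" by (simp add: mult.commute abs_mult mult_right_mono)
    finally show ?thesis .
  qed
  then show "AE x in M. norm (f x \<bullet> c x) \<le> norm (B *\<^sub>R norm (f x))" by simp
qed

lemma prod_sets_lebesgue:
  fixes A :: "'a::euclidean_space set" and B :: "'b::euclidean_space set"
  shows "open A \<Longrightarrow> open B \<Longrightarrow> A \<times> B \<in> sets lebesgue"
  by (simp add: open_Times)

lemma AE_lebesgue_on_Times:
  fixes A :: "'a::euclidean_space set" and B :: "'b::euclidean_space set"
  assumes "open A" "open B" "AE z in lebesgue_on (A \<times> B). P z"
  shows "AE t in lebesgue_on A. AE x in lebesgue_on B. P (t, x)"
proof -
  have "AE z in lborel \<Otimes>\<^sub>M lborel. z \<in> A \<times> B \<longrightarrow> P z"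
    using assms unfolding lborel_prod by (simp add: AE_lebesgue_on_iff prod_sets_lebesgue)
  from lborel_pair.AE_pair[OF this]
  have "AE t in lborel. t \<in> A \<longrightarrow> (AE x in lborel. x \<in> B \<longrightarrow> P (t, x))"
    by (auto elim!: eventually_mono)
  then show ?thesis using assms by (simp add: AE_lebesgue_on_iff)
qed

lemma integrable_lebesgue_AE_borel:
  fixes f g :: "'a::euclidean_space \<Rightarrow> real"
  assumes "AE x in lborel. f x = g x" "integrable lborel g"
  shows "integrable lebesgue f" "integral\<^sup>L lebesgue f = integral\<^sup>L lborel g"
proof -
  have g: "g \<in> borel_measurable lborel" using assms(2) by simp
  have g': "g \<in> borel_measurable lebesgue" using g by (rule measurable_completion)
  have ae: "AE x in lebesgue. g x = f x"
    using assms(1) by (auto simp: AE_completion_iff elim: eventually_mono)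
  then have f: "f \<in> borel_measurable lebesgue" using g' borel_measurable_AE by blast
  have "integrable lebesgue g" using assms(2) g integrable_completion by blast
  then show "integrable lebesgue f" using integrable_cong_AE[OF g' f ae] by simp
  show "integral\<^sup>L lebesgue f = integral\<^sup>L lborel g"
    using integral_cong_AE[OF g' f ae] integral_completion[OF g] by simp
qed

text \<open>Lebesgue measure on a product is the completion of the product measure, not the product
  of the completions. Fubini's theorem is therefore applied to a Borel function that agrees almost
  everywhere with the extension of \<open>f\<close> by zero, and almost every slice inherits
  integrability and the value of the integral.\<close>

lemma Fubini_lebesgue_on:
  fixes f :: "'a::euclidean_space \<times> 'b::euclidean_space \<Rightarrow> real"
  assumes "open A" "open B" and f: "integrable (lebesgue_on (A \<times> B)) f"
  shows "AE t in lebesgue_on A. integrable (lebesgue_on B) (\<lambda>x. f (t, x))"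
    and "integrable (lebesgue_on A) (\<lambda>t. LINT x|lebesgue_on B. f (t, x))"
    and "(LINT t|lebesgue_on A. LINT x|lebesgue_on B. f (t, x)) = integral\<^sup>L (lebesgue_on (A \<times> B)) f"
    and "(LINT x|lebesgue_on B. LINT t|lebesgue_on A. f (t, x)) = integral\<^sup>L (lebesgue_on (A \<times> B)) f"
proof -
  note AB = prod_sets_lebesgue[OF assms(1,2)] open_sets_lebesgue[OF assms(1)] open_sets_lebesgue[OF assms(2)]
  define F where "F z = indicator (A \<times> B) z *\<^sub>R f z" for z
  have F: "integrable lebesgue F"
    using f AB unfolding F_def by (simp add: integrable_lebesgue_on_iff)
  then obtain g where g: "g \<in> borel_measurable lborel" and ae: "AE z in lborel. F z = g z"
    using completion_ex_borel_measurable_real[of F lborel] by auto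
  have gi: "integrable lborel g" and Ig: "integral\<^sup>L lebesgue F = integral\<^sup>L lborel g"
  proof -
    have g': "g \<in> borel_measurable lebesgue" using g by (rule measurable_completion)
    have ae': "AE z in lebesgue. F z = g z" using ae by (simp add: AE_completion_iff)
    have "integrable lebesgue g"
      using integrable_cong_AE[OF _ g' ae'] F by auto
    then show "integrable lborel g" using g integrable_completion by blast
    show "integral\<^sup>L lebesgue F = integral\<^sup>L lborel g"
      using integral_cong_AE[OF _ g' ae'] F integral_completion[OF g] by auto
  qed
  have gi': "integrable (lborel \<Otimes>\<^sub>M lborel) (\<lambda>(t, x). g (t, x))" using gi unfolding lborel_prod by simp
  have Fe: "F (t, x) = indicator A t *\<^sub>R (indicator B x *\<^sub>R f (t, x))" for t x
    by (simp add: F_def indicator_times)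
  have 1: "AE t in lborel. AE x in lborel. F (t, x) = g (t, x)"
    using lborel_pair.AE_pair[of "\<lambda>z. F z = g z"] ae unfolding lborel_prod by simp
  \<comment> \<open>Exchanging the two almost-everywhere quantifiers needs a Borel set, which the
    set where \<open>F\<close> and \<open>g\<close> differ need not be. It is replaced by a Borel
    null set that contains it.\<close>
  have 2: "AE x in lborel. AE t in lborel. F (t, x) = g (t, x)"
  proof -
    have "AE z in lborel \<Otimes>\<^sub>M lborel. F z = g z" using ae unfolding lborel_prod by simp
    then obtain N where N: "N \<in> null_sets (lborel \<Otimes>\<^sub>M lborel)" "{z \<in> space (lborel \<Otimes>\<^sub>M lborel). F z \<noteq> g z} \<subseteq> N"
      unfolding eventually_ae_filter by blast
    have "AE t in lborel. AE x in lborel. (t, x) \<notin> N"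
      using lborel_pair.AE_pair[OF AE_not_in[OF N(1)]] .
    moreover have "{z \<in> space (lborel \<Otimes>\<^sub>M lborel). (fst z, snd z) \<notin> N} \<in> sets (lborel \<Otimes>\<^sub>M lborel)"
    proof -
      have "{z \<in> space (lborel \<Otimes>\<^sub>M lborel). (fst z, snd z) \<notin> N} = space (lborel \<Otimes>\<^sub>M lborel) - N" by auto
      then show ?thesis using N(1) by (metis null_setsD2 sets.compl_sets)
    qed
    ultimately have "AE x in lborel. AE t in lborel. (t, x) \<notin> N"
      using lborel_pair.AE_commute[of "\<lambda>t x. (t, x) \<notin> N"] by blast
    then show ?thesis
      by (rule eventually_mono) (use N(2) in \<open>auto simp: space_pair_measure elim!: eventually_mono\<close>)
  qed
  have s1: "AE t in lborel. integrable lebesgue (\<lambda>x. F (t, x)) \<and> (LINT x|lebesgue. F (t, x)) = (LINT x|lborel. g (t, x))"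
    using 1 lborel_pair.AE_integrable_fst[OF gi']
    by eventually_elim (simp add: integrable_lebesgue_AE_borel)
  show "AE t in lebesgue_on A. integrable (lebesgue_on B) (\<lambda>x. f (t, x))"
    using s1 unfolding AE_lebesgue_on_iff[OF AB(2)]
    by eventually_elim (use AB in \<open>auto simp: Fe integrable_lebesgue_on_iff\<close>)
  have e1: "indicator A t *\<^sub>R (LINT x|lebesgue_on B. f (t, x)) = (LINT x|lebesgue. F (t, x))" for t
    using AB by (simp add: integral_lebesgue_on_eq Fe)
  have e2: "indicator B x *\<^sub>R (LINT t|lebesgue_on A. f (t, x)) = (LINT t|lebesgue. F (t, x))" for x
    using AB by (simp add: integral_lebesgue_on_eq Fe indicator_def)
  have i1: "integrable lebesgue (\<lambda>t. LINT x|lebesgue. F (t, x))"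
    "(LINT t|lebesgue. LINT x|lebesgue. F (t, x)) = integral\<^sup>L (lborel \<Otimes>\<^sub>M lborel) (\<lambda>(t, x). g (t, x))"
    using integrable_lebesgue_AE_borel[of "\<lambda>t. LINT x|lebesgue. F (t, x)" "\<lambda>t. LINT x|lborel. g (t, x)"]
      s1 lborel_pair.integrable_fst[OF gi'] lborel_pair.integral_fst[OF gi'] by (auto elim: eventually_mono)
  show "integrable (lebesgue_on A) (\<lambda>t. LINT x|lebesgue_on B. f (t, x))"
    using i1(1) AB by (simp add: integrable_lebesgue_on_iff e1 del: real_scaleR_def)
  have J: "integral\<^sup>L (lborel \<Otimes>\<^sub>M lborel) (\<lambda>(t, x). g (t, x)) = integral\<^sup>L (lebesgue_on (A \<times> B)) f"
    using Ig AB unfolding lborel_prod by (simp add: integral_lebesgue_on_eq F_def[abs_def])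
  show "(LINT t|lebesgue_on A. LINT x|lebesgue_on B. f (t, x)) = integral\<^sup>L (lebesgue_on (A \<times> B)) f"
    using i1(2) J AB by (simp add: integral_lebesgue_on_eq[OF AB(2)] e1 del: real_scaleR_def)
  have s2: "AE x in lborel. (LINT t|lebesgue. F (t, x)) = (LINT t|lborel. g (t, x))"
    using 2 lborel_pair.AE_integrable_snd[OF gi']
    by eventually_elim (simp add: integrable_lebesgue_AE_borel)
  have i2: "(LINT x|lebesgue. LINT t|lebesgue. F (t, x)) = integral\<^sup>L (lborel \<Otimes>\<^sub>M lborel) (\<lambda>(t, x). g (t, x))"
    using integrable_lebesgue_AE_borel[of "\<lambda>x. LINT t|lebesgue. F (t, x)" "\<lambda>x. LINT t|lborel. g (t, x)"]
      s2 lborel_pair.integrable_snd[OF gi'] lborel_pair.integral_snd[OF gi'] by auto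
  show "(LINT x|lebesgue_on B. LINT t|lebesgue_on A. f (t, x)) = integral\<^sup>L (lebesgue_on (A \<times> B)) f"
    using i2 J AB by (simp add: integral_lebesgue_on_eq[OF AB(3)] e2 del: real_scaleR_def)
qed

lemma prob_space_AE_eq_imp_return:
  fixes M :: "'a::t2_space measure"
  assumes "prob_space M" "sets M = sets borel" "AE w in M. w = z"
  shows "M = return borel z"
proof (rule measure_eqI)
  fix X assume X: "X \<in> sets M"
  have "emeasure M X = (if z \<in> X then 1 else 0)"
  proof (cases "z \<in> X")
    case True
    then have "AE w in M. w \<in> X" using assms(3) by (auto elim: eventually_mono)
    then show ?thesis using True prob_space.emeasure_eq_1_AE[OF assms(1) X] by simp
  next
    case False
    then have "AE w in M. w \<notin> X" using assms(3) by (auto elim: eventually_mono)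
    then have "X \<in> null_sets M"
      using AE_iff_null_sets[OF X] by simp
    then show ?thesis using False by auto
  qed
  then show "emeasure M X = emeasure (return borel z) X"
    using X assms(2) by (simp add: indicator_def)
qed (use assms in simp)

text \<open>\<open>f\<close> carries no measurability assumption: if it is not integrable, its
  integral is 0 by convention, and \<open>g\<close> is nonnegative almost everywhere. This covers
  the pairing of a time-dependent measure with a time-dependent field, since weak-star measurability
  speaks of fixed fields only.\<close>

lemma integral_norm_bound_le:
  assumes "integrable M g" "AE x in M. \<bar>f x\<bar> \<le> g x"
  shows "\<bar>LINT x|M. f x\<bar> \<le> (LINT x|M. (g x :: real))"
proof (cases "integrable M f")
  case True
  have "\<bar>LINT x|M. f x\<bar> \<le> (LINT x|M. \<bar>f x\<bar>)" by (rule integral_abs_bound)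
  also have "\<dots> \<le> (LINT x|M. g x)" using True assms by (intro integral_mono_AE) auto
  finally show ?thesis .
next
  case False
  have "AE x in M. 0 \<le> g x" using assms(2) by (auto elim!: eventually_mono)
  then show ?thesis using False by (simp add: not_integrable_integral_eq integral_nonneg_AE)
qed

text \<open>The times up to which the integral of \<open>g\<close> vanishes form a compact set; let
  \<sigma> be its largest element. If \<sigma> were below \<open>T\<close>, then the integral of
  \<open>k\<close> over a short interval after \<sigma> would be less than 1. Integrating the
  hypothesis over that interval bounds the integral of \<open>g\<close> by a proper fraction of
  itself, so it still vanishes at the end of the interval, against the choice of \<sigma>. No
  boundedness of \<open>k\<close> enters, only continuity of its indefinite integral.\<close>

lemma Gronwall_L1:
  fixes g k :: "real \<Rightarrow> real"
  assumes "T > 0" and g: "integrable (lebesgue_on {0<..<T}) g" and k: "integrable (lebesgue_on {0<..<T}) k"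
    and g0: "AE t in lebesgue_on {0<..<T}. g t \<ge> 0" and k0: "AE t in lebesgue_on {0<..<T}. k t \<ge> 0"
    and le: "AE \<tau> in lebesgue_on {0<..<T}. g \<tau> \<le> k \<tau> * (LINT t|lebesgue_on {0<..<\<tau>}. g t)"
  shows "AE t in lebesgue_on {0<..<T}. g t = 0"
proof -
  have S: "{x<..<y::real} \<in> sets lebesgue" for x y by simp
  have sub: "integrable (lebesgue_on {x<..<y}) f" if "integrable (lebesgue_on {0<..<T}) f" "0 \<le> x" "y \<le> T"
    for f :: "real \<Rightarrow> real" and x y
    by (rule integrable_lebesgue_on_mono[OF that(1)]) (use that in auto)
  define I where "I f x y = (LINT t|lebesgue_on {x<..<y}. f t)" for f :: "real \<Rightarrow> real" and x y
  have hk: "I f x y = integral {x..y} f" "f integrable_on {x..y}" if "integrable (lebesgue_on {0<..<T}) f" "0 \<le> x" "y \<le> T"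
    for f x y
  proof -
    have "(f has_integral I f x y) {x<..<y}"
      unfolding I_def by (rule has_integral_integral_lebesgue_on) (use sub that in auto)
    then have "(f has_integral I f x y) {x..y}"
      using has_integral_Icc_iff_Ioo by blast
    then show "I f x y = integral {x..y} f" "f integrable_on {x..y}"
      by (auto simp: integral_unique)
  qed
  have split: "I f x z = I f x y + I f y z" if "integrable (lebesgue_on {0<..<T}) f" "0 \<le> x" "x \<le> y" "y \<le> z" "z \<le> T"
    for f x y z
    using that hk[OF that(1)] Henstock_Kurzweil_Integration.integral_combine[of x y z f] by simp
  have cont: "continuous_on {0..T} (I f 0)" if "integrable (lebesgue_on {0<..<T}) f" for f
  proof -
    have "continuous_on {0..T} (\<lambda>x. integral {0..x} f)"
      by (rule indefinite_integral_continuous_1) (use hk[OF that, of 0 T] in auto)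
    then show ?thesis by (rule continuous_on_eq) (use hk[OF that] in auto)
  qed
  have nonneg: "I f x y \<ge> 0" if "AE t in lebesgue_on {0<..<T}. f t \<ge> 0" "0 \<le> x" "y \<le> T" for f x y
    unfolding I_def by (intro integral_nonneg_AE AE_lebesgue_on_mono_set[OF that(1)]) (use that in auto)
  define Z where "Z = {t \<in> {0..T}. I g 0 t = 0}"
  have "closed Z" unfolding Z_def by (intro continuous_closed_preimage_constant cont g) auto
  moreover have "bounded Z"
    by (rule bounded_subset[of "{0..T}"]) (auto simp: Z_def)
  ultimately have "compact Z" by (simp add: compact_eq_bounded_closed)
  moreover have "0 \<in> Z" using \<open>T > 0\<close> by (simp add: Z_def I_def)
  ultimately obtain \<sigma> where \<sigma>: "\<sigma> \<in> Z" "\<And>t. t \<in> Z \<Longrightarrow> t \<le> \<sigma>"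
    using compact_attains_sup[of Z] by auto
  have "\<sigma> = T"
  proof (rule ccontr)
    assume "\<sigma> \<noteq> T"
    then have s: "0 \<le> \<sigma>" "\<sigma> < T" using \<sigma>(1) by (auto simp: Z_def)
    have "isCont (I k 0) \<sigma> \<or> \<sigma> = 0"
      using cont[OF k] s by (auto intro: continuous_on_interior)
    obtain d where d: "d > 0" "\<And>y. y \<in> {0..T} \<Longrightarrow> dist y \<sigma> < d \<Longrightarrow> dist (I k 0 y) (I k 0 \<sigma>) < 1"
      using cont[OF k] s unfolding continuous_on_iff by (metis atLeastAtMost_iff less_eq_real_def zero_less_one)
    define b where "b = min T (\<sigma> + d / 2)"
    have b: "\<sigma> < b" "b \<le> T" "dist b \<sigma> < d" using s d(1) by (auto simp: b_def dist_real_def)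
    have k1: "I k \<sigma> b < 1"
      using d(2)[of b] b s split[OF k, of 0 \<sigma> b] by (auto simp: dist_real_def)
    have "I g 0 b = I g \<sigma> b" using split[OF g, of 0 \<sigma> b] s b \<sigma>(1) by (simp add: Z_def)
    also have "\<dots> \<le> (LINT t|lebesgue_on {\<sigma><..<b}. k t * I g 0 b)"
      unfolding I_def[of g \<sigma>]
    proof (rule integral_mono_AE)
      show "integrable (lebesgue_on {\<sigma><..<b}) g" using sub[OF g] s b by auto
      show "integrable (lebesgue_on {\<sigma><..<b}) (\<lambda>t. k t * I g 0 b)" using sub[OF k] s b by auto
      have "AE t in lebesgue_on {\<sigma><..<b}. g t \<le> k t * I g 0 t \<and> k t \<ge> 0"
        by (rule AE_lebesgue_on_mono_set[where S = "{0<..<T}"]) (use le k0 s b in \<open>auto simp: I_def\<close>)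
      moreover have "AE t in lebesgue_on {\<sigma><..<b}. t \<in> {\<sigma><..<b}"
        by (rule AE_I2) simp
      ultimately show "AE t in lebesgue_on {\<sigma><..<b}. g t \<le> k t * I g 0 b"
      proof eventually_elim
        case (elim t)
        have "I g 0 t \<le> I g 0 b" using split[OF g, of 0 t b] nonneg[OF g0, of t b] elim s b by auto
        then have "k t * I g 0 t \<le> k t * I g 0 b" using elim by (intro mult_left_mono) auto
        then show ?case using elim by linarith
      qed
    qed
    also have "\<dots> = I k \<sigma> b * I g 0 b" by (simp add: I_def)
    finally have "I g 0 b * (1 - I k \<sigma> b) \<le> 0" by (simp add: algebra_simps)
    moreover have "I g 0 b \<ge> 0" using nonneg[OF g0] b s by auto
    ultimately have "I g 0 b = 0" using k1 by (simp add: mult_le_0_iff)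
    then have "b \<in> Z" using b s by (simp add: Z_def)
    then show False using \<sigma>(2) b by fastforce
  qed
  then have "I g 0 T = 0" using \<sigma> by (simp add: Z_def)
  then show ?thesis unfolding I_def using integral_nonneg_eq_0_iff_AE[OF g g0] by simp
qed

section \<open>Bernstein approximation in time\<close>

lemma Bernstein_tendsto:
  fixes f :: "real \<Rightarrow> real"
  assumes "continuous_on {0..1} f" "x \<in> {0..1}"
  shows "(\<lambda>n. \<Sum>k\<le>n. f (k / n) * Bernstein n k x) \<longlonglongrightarrow> f x"
proof (rule LIMSEQ_I)
  fix r :: real assume "r > 0"
  from Bernstein_Weierstrass[OF assms(1) this] assms(2)
  show "\<exists>no. \<forall>n\<ge>no. norm ((\<Sum>k\<le>n. f (k / n) * Bernstein n k x) - f x) < r"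
    by (metis abs_minus_commute real_norm_def)
qed

text \<open>Localizes an identity tested with functions polynomial in time to the diagonal and to
  \<open>(0, \<tau>)\<close>. The nodes stay inside \<open>(0, T)\<close>.\<close>

lemma time_localization:
  fixes H :: "real \<Rightarrow> real \<times> 'a::euclidean_space \<Rightarrow> real"
  assumes "T > 0" "open \<Omega>"
    and w: "integrable (lebesgue_on ({0<..<T} \<times> \<Omega>)) w"
    and meas: "\<And>s. s \<in> {0<..<T} \<Longrightarrow> H s \<in> borel_measurable (lebesgue_on ({0<..<T} \<times> \<Omega>))"
    and bd: "\<And>s z. z \<in> {0<..<T} \<times> \<Omega> \<Longrightarrow> s \<in> {0<..<T} \<Longrightarrow> \<bar>H s z\<bar> \<le> w z"
    and cont: "\<And>z. z \<in> {0<..<T} \<times> \<Omega> \<Longrightarrow> continuous_on {0..T} (\<lambda>s. H s z)"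
    and zero: "\<And>n (c :: nat \<Rightarrow> real). (LINT z|lebesgue_on ({0<..<T} \<times> \<Omega>).
        (\<Sum>k\<in>{1..<n}. Bernstein n k (fst z / T) * c k * H (k / n * T) z)) = 0"
    and \<tau>: "\<tau> \<in> {0<..<T}"
  shows "integrable (lebesgue_on ({0<..<\<tau>} \<times> \<Omega>)) (\<lambda>z. H (fst z) z)"
    and "(LINT z|lebesgue_on ({0<..<\<tau>} \<times> \<Omega>). H (fst z) z) = 0"
proof -
  let ?Q = "{0<..<T} \<times> \<Omega>"
  let ?M = "lebesgue_on ?Q"
  have Qs: "?Q \<in> sets lebesgue" "{0<..<\<tau>} \<times> \<Omega> \<in> sets lebesgue"
    using assms by (auto intro!: prod_sets_lebesgue)
  have fstm[measurable]: "fst \<in> borel_measurable ?M"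
    using Qs(1) by (intro continuous_imp_measurable_on_sets_lebesgue continuous_intros)
  have w0: "w z \<ge> 0" if "z \<in> ?Q" for z using bd[OF that \<tau>] by linarith
  \<comment> \<open>In \<open>H s z\<close> the test coefficient is frozen at the time
    \<open>s\<close>, everything else is taken at \<open>z\<close>. Bernstein approximation of the
    dependence on \<open>s\<close>, after multiplication by a cutoff \<open>ch\<close>, recovers the
    diagonal where \<open>s\<close> is the time of \<open>z\<close>.\<close>
  have step1: "(LINT z|?M. ch (fst z) * H (fst z) z) = 0 \<and> (\<lambda>z. ch (fst z) * H (fst z) z) \<in> borel_measurable ?M"
    if ch: "continuous_on {0..T} ch" "ch 0 = 0" "ch T = 0" "\<And>t. \<bar>ch t\<bar> \<le> 1" for ch
  proof -
    define S where "S n z = (\<Sum>k\<in>{1..<n}. Bernstein n k (fst z / T) * ch (k / n * T) * H (k / n * T) z)" for n z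
    have node: "real k / real n * T \<in> {0<..<T}" if "k \<in> {1..<n}" for k n
      using that \<open>T > 0\<close> by (auto simp: field_simps)
    have Sm: "S n \<in> borel_measurable ?M" for n
      unfolding S_def Bernstein_def
      by (intro borel_measurable_sum borel_measurable_times borel_measurable_power borel_measurable_diff
          borel_measurable_divide borel_measurable_const fstm meas node) auto
    have conv: "(\<lambda>n. S n z) \<longlonglongrightarrow> ch (fst z) * H (fst z) z" if z: "z \<in> ?Q" for z
    proof -
      define f where "f y = ch (y * T) * H (y * T) z" for y
      have "continuous_on {0..1} f"
        unfolding f_def using \<open>T > 0\<close>
        by (intro continuous_intros continuous_on_compose2[OF ch(1)] continuous_on_compose2[OF cont[OF z]])
          (auto simp: mult_le_one mult_left_le_one_le)
      moreover have "fst z / T \<in> {0..1}" using z \<open>T > 0\<close> by auto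
      ultimately have "(\<lambda>n. \<Sum>k\<le>n. f (k / n) * Bernstein n k (fst z / T)) \<longlonglongrightarrow> f (fst z / T)"
        by (rule Bernstein_tendsto)
      also have "f (fst z / T) = ch (fst z) * H (fst z) z" using \<open>T > 0\<close> by (simp add: f_def)
      finally have "(\<lambda>n. \<Sum>k\<le>n. f (k / n) * Bernstein n k (fst z / T)) \<longlonglongrightarrow> ch (fst z) * H (fst z) z" .
      moreover have "\<forall>\<^sub>F n in sequentially. (\<Sum>k\<le>n. f (k / n) * Bernstein n k (fst z / T)) = S n z"
        unfolding eventually_sequentially
      proof (intro exI[of _ 1] allI impI)
        fix n :: nat assume n: "1 \<le> n"
        \<comment> \<open>The cutoff vanishes at both ends, so the terms with \<open>k = 0\<close>
          and \<open>k = n\<close> drop out and no slice at the times 0 and \<open>T\<close> is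
          used.\<close>
        have f01: "f 0 = 0" "f 1 = 0" using ch by (auto simp: f_def)
        have "(\<Sum>k\<le>n. f (k / n) * Bernstein n k (fst z / T)) = (\<Sum>k\<in>{1..<n}. f (k / n) * Bernstein n k (fst z / T))"
          by (rule sum.mono_neutral_right) (use n f01 in \<open>auto simp: not_le not_less Suc_le_eq dest!: le_antisym\<close>)
        then show "(\<Sum>k\<le>n. f (k / n) * Bernstein n k (fst z / T)) = S n z"
          by (simp add: S_def f_def mult_ac)
      qed
      ultimately show ?thesis by (rule Lim_transform_eventually)
    qed
    \<comment> \<open>Bernstein polynomials are nonnegative on [0, 1] and sum to one, so the
      majorant does not depend on \<open>n\<close>.\<close>
    have bound: "norm (S n z) \<le> w z" if z: "z \<in> ?Q" for n z
    proof -
      have y: "0 \<le> fst z / T" "fst z / T \<le> 1" using z \<open>T > 0\<close> by auto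
      have "norm (S n z) \<le> (\<Sum>k\<in>{1..<n}. \<bar>Bernstein n k (fst z / T) * ch (k / n * T) * H (k / n * T) z\<bar>)"
        unfolding S_def real_norm_def by (rule sum_abs)
      also have "\<dots> \<le> (\<Sum>k\<in>{1..<n}. Bernstein n k (fst z / T) * w z)"
      proof (rule sum_mono)
        fix k assume k: "k \<in> {1..<n}"
        have "\<bar>ch (k / n * T) * H (k / n * T) z\<bar> \<le> 1 * w z"
          unfolding abs_mult by (intro mult_mono ch bd z node k) auto
        then show "\<bar>Bernstein n k (fst z / T) * ch (k / n * T) * H (k / n * T) z\<bar> \<le> Bernstein n k (fst z / T) * w z"
          using Bernstein_nonneg[OF y, of n k] by (simp add: abs_mult mult.assoc mult_left_mono)
      qed
      also have "\<dots> \<le> (\<Sum>k\<le>n. Bernstein n k (fst z / T) * w z)"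
        by (rule sum_mono2) (use y w0[OF z] in \<open>auto intro!: mult_nonneg_nonneg Bernstein_nonneg\<close>)
      also have "\<dots> = w z" by (simp flip: sum_distrib_right)
      finally show ?thesis .
    qed
    have lm: "(\<lambda>z. ch (fst z) * H (fst z) z) \<in> borel_measurable ?M"
      by (rule borel_measurable_LIMSEQ_real[of _ S]) (use conv Sm in auto)
    have "(\<lambda>n. integral\<^sup>L ?M (S n)) \<longlonglongrightarrow> (LINT z|?M. ch (fst z) * H (fst z) z)"
      by (rule integral_dominated_convergence[where w = w]) (use lm Sm w conv bound in auto)
    moreover have "integral\<^sup>L ?M (S n) = 0" for n unfolding S_def by (rule zero)
    ultimately show ?thesis using lm by (simp add: LIMSEQ_const_iff)
  qed
  \<comment> \<open>Trapezoids with slopes \<open>m\<close> and \<open>- m\<close>. They vanish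
    outside (0, \<tau>) and equal one at any given point of that interval once \<open>m\<close> is
    large.\<close>
  define ch where "ch m t = max 0 (min 1 (min (real m * t) (real m * (\<tau> - t))))" for m t
  have ch: "continuous_on {0..T} (ch m)" "ch m 0 = 0" "ch m T = 0" "\<bar>ch m t\<bar> \<le> 1" for m t
    unfolding ch_def using \<tau> by (auto intro!: continuous_intros simp: mult_le_0_iff min_le_iff_disj)
  have conv: "(\<lambda>m. ch m (fst z) * H (fst z) z) \<longlonglongrightarrow> indicator ({0<..<\<tau>} \<times> \<Omega>) z *\<^sub>R H (fst z) z" if z: "z \<in> ?Q" for z
  proof (cases "fst z < \<tau>")
    case True
    define \<delta> where "\<delta> = min (fst z) (\<tau> - fst z)"
    have "\<delta> > 0" using True z by (auto simp: \<delta>_def)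
    have "ch m (fst z) = 1" if "m \<ge> nat \<lceil>1 / \<delta>\<rceil>" for m
    proof -
      have "1 / \<delta> \<le> real m" using that by linarith
      then have "1 \<le> real m * \<delta>" using \<open>\<delta> > 0\<close> by (simp add: field_simps)
      moreover have "real m * \<delta> \<le> real m * fst z" "real m * \<delta> \<le> real m * (\<tau> - fst z)"
        by (intro mult_left_mono; simp add: \<delta>_def)+
      ultimately show ?thesis by (simp add: ch_def)
    qed
    then have "\<forall>\<^sub>F m in sequentially. H (fst z) z = ch m (fst z) * H (fst z) z"
      unfolding eventually_sequentially by (intro exI[of _ "nat \<lceil>1 / \<delta>\<rceil>"]) auto
    then have "(\<lambda>m. ch m (fst z) * H (fst z) z) \<longlonglongrightarrow> H (fst z) z"
      by (rule Lim_transform_eventually[OF tendsto_const])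
    then show ?thesis using True z by (auto simp: indicator_def)
  next
    case False
    then have "ch m (fst z) = 0" for m by (auto simp: ch_def min_le_iff_disj mult_le_0_iff)
    then show ?thesis using False by (auto simp: indicator_def)
  qed
  have bound: "norm (ch m (fst z) * H (fst z) z) \<le> w z" if z: "z \<in> ?Q" for m z
  proof -
    have "\<bar>ch m (fst z)\<bar> * \<bar>H (fst z) z\<bar> \<le> 1 * w z"
      using z by (intro mult_mono ch bd) auto
    then show ?thesis by (simp add: abs_mult)
  qed
  have m: "(\<lambda>z. ch m (fst z) * H (fst z) z) \<in> borel_measurable ?M" "(LINT z|?M. ch m (fst z) * H (fst z) z) = 0" for m
    using step1[of "ch m", OF ch] by auto
  have lm: "(\<lambda>z. indicator ({0<..<\<tau>} \<times> \<Omega>) z *\<^sub>R H (fst z) z) \<in> borel_measurable ?M"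
    by (rule borel_measurable_LIMSEQ_real[of _ "\<lambda>m z. ch m (fst z) * H (fst z) z"]) (use conv m in auto)
  have lim: "(\<lambda>i. LINT z|?M. ch i (fst z) * H (fst z) z) \<longlonglongrightarrow> (LINT z|?M. indicator ({0<..<\<tau>} \<times> \<Omega>) z *\<^sub>R H (fst z) z)"
    by (rule integral_dominated_convergence[where w = w]) (use lm m w conv bound in auto)
  have int: "integrable ?M (\<lambda>z. indicator ({0<..<\<tau>} \<times> \<Omega>) z *\<^sub>R H (fst z) z)"
    by (rule integrable_dominated_convergence[where w = w and s = "\<lambda>m z. ch m (fst z) * H (fst z) z"])
      (use lm m w conv bound in auto)
  have ind: "indicator ?Q z *\<^sub>R (indicator ({0<..<\<tau>} \<times> \<Omega>) z *\<^sub>R H (fst z) z) = indicator ({0<..<\<tau>} \<times> \<Omega>) z *\<^sub>R H (fst z) z" for z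
    using \<tau> by (auto simp: indicator_def)
  show "integrable (lebesgue_on ({0<..<\<tau>} \<times> \<Omega>)) (\<lambda>z. H (fst z) z)"
    using int Qs unfolding integrable_lebesgue_on_iff[OF Qs(1)] integrable_lebesgue_on_iff[OF Qs(2)] ind by simp
  have "(LINT z|?M. indicator ({0<..<\<tau>} \<times> \<Omega>) z *\<^sub>R H (fst z) z) = 0"
    using lim m by (simp add: LIMSEQ_const_iff)
  then show "(LINT z|lebesgue_on ({0<..<\<tau>} \<times> \<Omega>). H (fst z) z) = 0"
    unfolding integral_lebesgue_on_eq[OF Qs(1)] integral_lebesgue_on_eq[OF Qs(2)] ind .
qed

section \<open>Smooth functions on the quadrant and thermodynamics\<close>

lemma Ck_on_cong:
  assumes "open U" "\<And>x. x \<in> U \<Longrightarrow> f x = g x" "Ck_on k U f"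
  shows "Ck_on k U g"
  using assms(2,3)
proof (induction k arbitrary: f g)
  case 0
  then show ?case by (simp cong: continuous_on_cong)
next
  case (Suc k)
  have d: "(g has_derivative frechet_derivative f (at x)) (at x)" if "x \<in> U" for x
  proof (rule has_derivative_transform_within_open[OF _ \<open>open U\<close> that])
    show "(f has_derivative frechet_derivative f (at x)) (at x)"
      using Suc.prems that by (simp flip: frechet_derivative_works)
  qed (use Suc.prems in auto)
  then have "frechet_derivative g (at x) = frechet_derivative f (at x)" if "x \<in> U" for x
    using that frechet_derivative_at by metis
  moreover have "Ck_on k U (\<lambda>x. frechet_derivative f (at x) v)" for v
    using Suc.prems by simp
  ultimately have "Ck_on k U (\<lambda>x. frechet_derivative g (at x) v)" for v
    using Suc.IH[of "\<lambda>x. frechet_derivative f (at x) v" "\<lambda>x. frechet_derivative g (at x) v"] by auto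
  then show ?case using d by (auto simp: differentiable_def)
qed

lemma Ck_on_Suc_D: "Ck_on (Suc k) U f \<Longrightarrow> Ck_on k U f"
proof (induction k arbitrary: f)
  case 0
  then show ?case
    by (auto intro!: continuous_at_imp_continuous_on differentiable_imp_continuous_within)
next
  case (Suc k)
  then show ?case by (metis Ck_on.simps(2))
qed

context
  fixes f :: "real \<Rightarrow> real \<Rightarrow> real" and k :: nat
  assumes f: "Ck_quadrant (Suc k) f"
begin

lemma Ck_quadrant_has_derivative:
  assumes "\<rho> > 0" "\<theta> > 0"
  shows "((\<lambda>(\<rho>, \<theta>). f \<rho> \<theta>) has_derivative (\<lambda>(a, b). d_rho f \<rho> \<theta> * a + d_theta f \<rho> \<theta> * b)) (at (\<rho>, \<theta>))"
proof -
  let ?F = "\<lambda>(\<rho>, \<theta>). f \<rho> \<theta>"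
  define D where "D = frechet_derivative ?F (at (\<rho>, \<theta>))"
  have D: "(?F has_derivative D) (at (\<rho>, \<theta>))"
    using f assms unfolding D_def Ck_quadrant_def by (simp flip: frechet_derivative_works)
  have lin: "linear D" using D has_derivative_linear by blast
  have "((\<lambda>r. ?F (r, \<theta>)) has_derivative (\<lambda>a. D (a, 0))) (at \<rho>)"
    by (rule has_derivative_compose[of "\<lambda>r. (r, \<theta>)" "\<lambda>a. (a, 0)"])
      (use D in \<open>auto intro!: derivative_eq_intros\<close>)
  moreover have "(\<lambda>a. D (a, 0)) = (\<lambda>a. D (1, 0) * a)"
  proof
    fix a show "D (a, 0) = D (1, 0) * a" using linear_cmul[OF lin, of a "(1, 0)"] by simp
  qed
  ultimately have 1: "((\<lambda>r. f r \<theta>) has_real_derivative D (1, 0)) (at \<rho>)"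
    by (simp add: has_field_derivative_def)
  have "((\<lambda>h. ?F (\<rho>, h)) has_derivative (\<lambda>b. D (0, b))) (at \<theta>)"
    by (rule has_derivative_compose[of "\<lambda>h. (\<rho>, h)" "\<lambda>b. (0, b)"])
      (use D in \<open>auto intro!: derivative_eq_intros\<close>)
  moreover have "(\<lambda>b. D (0, b)) = (\<lambda>b. D (0, 1) * b)"
  proof
    fix b show "D (0, b) = D (0, 1) * b" using linear_cmul[OF lin, of b "(0, 1)"] by simp
  qed
  ultimately have 2: "((\<lambda>h. f \<rho> h) has_real_derivative D (0, 1)) (at \<theta>)"
    by (simp add: has_field_derivative_def)
  have "D (a, b) = d_rho f \<rho> \<theta> * a + d_theta f \<rho> \<theta> * b" for a b
  proof -
    have "D (a, b) = D (a *\<^sub>R (1, 0) + b *\<^sub>R (0, 1))" by simp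
    also have "\<dots> = a * D (1, 0) + b * D (0, 1)"
      using lin by (simp only: linear_add linear_cmul real_scaleR_def)
    finally show ?thesis
      unfolding d_rho_def d_theta_def using DERIV_imp_deriv[OF 1] DERIV_imp_deriv[OF 2] by simp
  qed
  then have "D = (\<lambda>(a, b). d_rho f \<rho> \<theta> * a + d_theta f \<rho> \<theta> * b)" by auto
  with D show ?thesis by simp
qed

lemma Ck_quadrant_partials: "Ck_quadrant k (d_rho f)" "Ck_quadrant k (d_theta f)"
proof -
  let ?F = "\<lambda>(\<rho>, \<theta>). f \<rho> \<theta>" and ?U = "{0::real<..} \<times> {0::real<..}"
  have o: "open ?U" by (intro open_Times) auto
  have fr: "frechet_derivative ?F (at z) = (\<lambda>(a, b). d_rho f (fst z) (snd z) * a + d_theta f (fst z) (snd z) * b)"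
    if "z \<in> ?U" for z
    using Ck_quadrant_has_derivative[of "fst z" "snd z"] that
    by (metis frechet_derivative_at greaterThan_iff mem_Times_iff prod.collapse)
  have "Ck_on k ?U (\<lambda>z. frechet_derivative ?F (at z) v)" for v
    using f unfolding Ck_quadrant_def Ck_on.simps by blast
  from Ck_on_cong[OF o _ this[of "(1, 0)"], of "\<lambda>(\<rho>, \<theta>). d_rho f \<rho> \<theta>"]
    Ck_on_cong[OF o _ this[of "(0, 1)"], of "\<lambda>(\<rho>, \<theta>). d_theta f \<rho> \<theta>"]
  show "Ck_quadrant k (d_rho f)" "Ck_quadrant k (d_theta f)"
    unfolding Ck_quadrant_def by (auto simp: fr split: prod.splits)
qed

lemma d_rho_DERIV:
  assumes "\<rho> > 0" "\<theta> > 0"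
  shows "((\<lambda>r. f r \<theta>) has_real_derivative d_rho f \<rho> \<theta>) (at \<rho>)"
proof -
  have "((\<lambda>r. (r, \<theta>)) has_derivative (\<lambda>a. (a, 0))) (at \<rho>)"
    by (auto intro!: derivative_eq_intros)
  from has_derivative_compose[OF this Ck_quadrant_has_derivative[OF assms]]
  show ?thesis by (simp add: has_field_derivative_def)
qed

lemma d_theta_DERIV:
  assumes "\<rho> > 0" "\<theta> > 0"
  shows "((\<lambda>h. f \<rho> h) has_real_derivative d_theta f \<rho> \<theta>) (at \<theta>)"
proof -
  have "((\<lambda>h. (\<rho>, h)) has_derivative (\<lambda>b. (0, b))) (at \<theta>)"
    by (auto intro!: derivative_eq_intros)
  from has_derivative_compose[OF this Ck_quadrant_has_derivative[OF assms]]
  show ?thesis by (simp add: has_field_derivative_def)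
qed

end

lemma Ck_quadrant_0D: "Ck_quadrant 0 f \<Longrightarrow> continuous_on ({0<..} \<times> {0<..}) (\<lambda>(\<rho>, \<theta>). f \<rho> \<theta>)"
  by (simp add: Ck_quadrant_def)

lemma Ck_quadrant_Suc_D: "Ck_quadrant (Suc k) f \<Longrightarrow> Ck_quadrant k f"
  using Ck_on_Suc_D by (auto simp: Ck_quadrant_def simp del: Ck_on.simps)

lemma Ck_quadrant_2D:
  assumes "Ck_quadrant 2 f"
  shows "Ck_quadrant (Suc (Suc 0)) f" "Ck_quadrant (Suc 0) f" "Ck_quadrant (Suc 0) (d_rho f)" "Ck_quadrant (Suc 0) (d_theta f)"
proof -
  show *: "Ck_quadrant (Suc (Suc 0)) f" using assms by (simp add: numeral_2_eq_2)
  then show "Ck_quadrant (Suc 0) f" by (rule Ck_quadrant_Suc_D)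
  from * show "Ck_quadrant (Suc 0) (d_rho f)" "Ck_quadrant (Suc 0) (d_theta f)"
    by (rule Ck_quadrant_partials)+
qed

text \<open>The mean value theorem on the segment between the two states, which stays in the square
  by convexity. The two distance bounds on the intermediate point are what later makes the Taylor
  remainder quadratic.\<close>

lemma MVT_quadrant:
  assumes f: "Ck_quadrant (Suc k) f" and "a > 0"
    and in_ab: "{\<rho>, \<theta>, r, h} \<subseteq> {a..b}"
  obtains \<rho>1 \<theta>1 where "\<rho>1 \<in> {a..b}" "\<theta>1 \<in> {a..b}" "\<bar>\<rho>1 - r\<bar> \<le> \<bar>\<rho> - r\<bar>" "\<bar>\<theta>1 - h\<bar> \<le> \<bar>\<theta> - h\<bar>"
    "f \<rho> \<theta> - f r h = d_rho f \<rho>1 \<theta>1 * (\<rho> - r) + d_theta f \<rho>1 \<theta>1 * (\<theta> - h)"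
proof -
  define P where "P t = r + t * (\<rho> - r)" for t
  define Q where "Q t = h + t * (\<theta> - h)" for t
  have inn: "x + t * (y - x) \<in> {a..b}" if "x \<in> {a..b}" "y \<in> {a..b}" "0 \<le> t" "t \<le> 1" for x y t
    using convexD_alt[of "{a..b}" x y t] that by (simp add: algebra_simps)
  have PQ: "P t \<in> {a..b}" "Q t \<in> {a..b}" if "0 \<le> t" "t \<le> 1" for t
    using inn that in_ab by (auto simp: P_def Q_def)
  have d: "((\<lambda>t. f (P t) (Q t)) has_real_derivative
      d_rho f (P t) (Q t) * (\<rho> - r) + d_theta f (P t) (Q t) * (\<theta> - h)) (at t)" if "0 \<le> t" "t \<le> 1" for t
  proof -
    have "((\<lambda>t. (P t, Q t)) has_derivative (\<lambda>s. (s * (\<rho> - r), s * (\<theta> - h)))) (at t)"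
      unfolding P_def Q_def by (auto intro!: derivative_eq_intros)
    moreover have pos: "P t > 0" "Q t > 0" using PQ[OF that] \<open>a > 0\<close> by auto
    ultimately have "((\<lambda>t. f (P t) (Q t)) has_derivative (\<lambda>s. d_rho f (P t) (Q t) * (s * (\<rho> - r))
        + d_theta f (P t) (Q t) * (s * (\<theta> - h)))) (at t)"
      using has_derivative_compose[where f = "\<lambda>t. (P t, Q t)" and x = t, OF _ Ck_quadrant_has_derivative[OF f pos]]
      by fastforce
    then show ?thesis
      by (rule has_derivative_imp_has_field_derivative) (simp add: algebra_simps)
  qed
  have "\<exists>t>0. t < 1 \<and> f (P 1) (Q 1) - f (P 0) (Q 0) =
      (1 - 0) * (d_rho f (P t) (Q t) * (\<rho> - r) + d_theta f (P t) (Q t) * (\<theta> - h))"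
    using MVT2[of 0 1 "\<lambda>t. f (P t) (Q t)"] d by auto
  then obtain t where t: "0 < t" "t < 1" "f (P 1) (Q 1) - f (P 0) (Q 0) =
      d_rho f (P t) (Q t) * (\<rho> - r) + d_theta f (P t) (Q t) * (\<theta> - h)" by auto
  show ?thesis
  proof (rule that[of "P t" "Q t"])
    show "\<bar>P t - r\<bar> \<le> \<bar>\<rho> - r\<bar>" "\<bar>Q t - h\<bar> \<le> \<bar>\<theta> - h\<bar>"
      using t by (auto simp: P_def Q_def abs_mult intro!: mult_left_le_one_le)
    show "f \<rho> \<theta> - f r h = d_rho f (P t) (Q t) * (\<rho> - r) + d_theta f (P t) (Q t) * (\<theta> - h)"
      using t(3) by (simp add: P_def Q_def)
  qed (use PQ t in auto)
qed

lemma square_subset_quadrant: "(a::real) > 0 \<Longrightarrow> {a..b} \<times> {a..b} \<subseteq> {0<..} \<times> {0<..}"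
  by auto

lemma quadrant_bounded:
  assumes "Ck_quadrant 0 f" and "a > 0"
  obtains B where "B > 0" "\<And>\<rho> \<theta>. {\<rho>, \<theta>} \<subseteq> {a..b} \<Longrightarrow> \<bar>f \<rho> \<theta>\<bar> \<le> B"
proof -
  have "compact ((\<lambda>(\<rho>, \<theta>). f \<rho> \<theta>) ` ({a..b} \<times> {a..b}))"
    by (intro compact_continuous_image compact_Times compact_Icc
        continuous_on_subset[OF Ck_quadrant_0D[OF assms(1)] square_subset_quadrant[OF assms(2)]])
  from compact_imp_bounded[OF this] obtain B where "B > 0" "\<forall>y\<in>(\<lambda>(\<rho>, \<theta>). f \<rho> \<theta>) ` ({a..b} \<times> {a..b}). norm y \<le> B"
    by (auto simp: bounded_pos)
  then show ?thesis by (intro that[of B]) force+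
qed

lemma quadrant_pos_lower_bound:
  fixes f :: "real \<Rightarrow> real \<Rightarrow> real" and a b :: real
  assumes f: "continuous_on ({0<..} \<times> {0<..}) (\<lambda>(\<rho>, \<theta>). f \<rho> \<theta>)" and "a > 0"
    and pos: "\<And>\<rho> \<theta>. \<rho> > 0 \<Longrightarrow> \<theta> > 0 \<Longrightarrow> f \<rho> \<theta> > 0"
  obtains c where "c > 0" "\<And>\<rho> \<theta>. {\<rho>, \<theta>} \<subseteq> {a..b} \<Longrightarrow> c \<le> f \<rho> \<theta>"
proof (cases "a \<le> b")
  case True
  have "\<exists>x\<in>{a..b} \<times> {a..b}. \<forall>y\<in>{a..b} \<times> {a..b}. (\<lambda>(\<rho>, \<theta>). f \<rho> \<theta>) x \<le> (\<lambda>(\<rho>, \<theta>). f \<rho> \<theta>) y"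
    by (rule continuous_attains_inf)
      (use True assms in \<open>auto intro!: compact_Times continuous_on_subset[OF f square_subset_quadrant[OF \<open>a > 0\<close>]]\<close>)
  then obtain \<rho> \<theta> where x: "\<rho> \<in> {a..b}" "\<theta> \<in> {a..b}" and m: "\<forall>y\<in>{a..b} \<times> {a..b}. f \<rho> \<theta> \<le> (\<lambda>(\<rho>, \<theta>). f \<rho> \<theta>) y"
    by auto
  show ?thesis by (rule that[of "f \<rho> \<theta>"]) (use x m pos \<open>a > 0\<close> in auto)
next
  case False
  then show ?thesis by (intro that[of 1]) auto
qed

lemma quadrant_Lipschitz:
  assumes "Ck_quadrant (Suc 0) f" and "a > 0"
  obtains L where "L > 0" "\<And>\<rho> \<theta> r h. {\<rho>, \<theta>, r, h} \<subseteq> {a..b} \<Longrightarrow> \<bar>f \<rho> \<theta> - f r h\<bar> \<le> L * (\<bar>\<rho> - r\<bar> + \<bar>\<theta> - h\<bar>)"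
proof -
  obtain B1 where B1: "B1 > 0" "\<And>\<rho> \<theta>. {\<rho>, \<theta>} \<subseteq> {a..b} \<Longrightarrow> \<bar>d_rho f \<rho> \<theta>\<bar> \<le> B1"
    using quadrant_bounded[OF Ck_quadrant_partials(1)[OF assms(1)] assms(2)] by metis
  obtain B2 where B2: "B2 > 0" "\<And>\<rho> \<theta>. {\<rho>, \<theta>} \<subseteq> {a..b} \<Longrightarrow> \<bar>d_theta f \<rho> \<theta>\<bar> \<le> B2"
    using quadrant_bounded[OF Ck_quadrant_partials(2)[OF assms(1)] assms(2)] by metis
  show ?thesis
  proof (rule that[of "B1 + B2"])
    fix \<rho> \<theta> r h assume *: "{\<rho>, \<theta>, r, h} \<subseteq> {a..b}"
    obtain \<rho>1 \<theta>1 where m: "\<rho>1 \<in> {a..b}" "\<theta>1 \<in> {a..b}"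
      "f \<rho> \<theta> - f r h = d_rho f \<rho>1 \<theta>1 * (\<rho> - r) + d_theta f \<rho>1 \<theta>1 * (\<theta> - h)"
      using MVT_quadrant[OF assms *] by metis
    have "\<bar>f \<rho> \<theta> - f r h\<bar> \<le> \<bar>d_rho f \<rho>1 \<theta>1\<bar> * \<bar>\<rho> - r\<bar> + \<bar>d_theta f \<rho>1 \<theta>1\<bar> * \<bar>\<theta> - h\<bar>"
      unfolding m(3) by (metis abs_mult abs_triangle_ineq)
    also have "\<dots> \<le> (B1 + B2) * \<bar>\<rho> - r\<bar> + (B1 + B2) * \<bar>\<theta> - h\<bar>"
      using B1(2)[of \<rho>1 \<theta>1] B2(2)[of \<rho>1 \<theta>1] m B1(1) B2(1) by (intro add_mono mult_right_mono) auto
    finally show "\<bar>f \<rho> \<theta> - f r h\<bar> \<le> (B1 + B2) * (\<bar>\<rho> - r\<bar> + \<bar>\<theta> - h\<bar>)" by (simp add: algebra_simps)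
  qed (use B1 B2 in auto)
qed

lemma sum_abs_squared_le: "(\<bar>x\<bar> + \<bar>y\<bar>)\<^sup>2 \<le> 2 * (x\<^sup>2 + y\<^sup>2)" for x y :: real
  using sum_squares_bound[of "\<bar>x\<bar>" "\<bar>y\<bar>"] by (simp add: power2_sum)

text \<open>By the mean value theorem the remainder pairs the increment with the change of the
  partial derivatives between \<open>(r, h)\<close> and an intermediate point. The partial
  derivatives are Lipschitz on the square, so the remainder is quadratic with a constant uniform in
  both states.\<close>

lemma quadrant_Taylor:
  assumes "Ck_quadrant 2 f" and "a > 0"
  obtains L where "L > 0" "\<And>\<rho> \<theta> r h. {\<rho>, \<theta>, r, h} \<subseteq> {a..b} \<Longrightarrow>
    \<bar>f \<rho> \<theta> - f r h - d_rho f r h * (\<rho> - r) - d_theta f r h * (\<theta> - h)\<bar> \<le> L * ((\<rho> - r)\<^sup>2 + (\<theta> - h)\<^sup>2)"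
proof -
  note C = Ck_quadrant_2D[OF assms(1)]
  obtain L1 where L1: "L1 > 0" "\<And>\<rho> \<theta> r h. {\<rho>, \<theta>, r, h} \<subseteq> {a..b} \<Longrightarrow> \<bar>d_rho f \<rho> \<theta> - d_rho f r h\<bar> \<le> L1 * (\<bar>\<rho> - r\<bar> + \<bar>\<theta> - h\<bar>)"
    using quadrant_Lipschitz[OF C(3) assms(2)] by metis
  obtain L2 where L2: "L2 > 0" "\<And>\<rho> \<theta> r h. {\<rho>, \<theta>, r, h} \<subseteq> {a..b} \<Longrightarrow> \<bar>d_theta f \<rho> \<theta> - d_theta f r h\<bar> \<le> L2 * (\<bar>\<rho> - r\<bar> + \<bar>\<theta> - h\<bar>)"
    using quadrant_Lipschitz[OF C(4) assms(2)] by metis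
  show ?thesis
  proof (rule that[of "2 * (L1 + L2)"])
    fix \<rho> \<theta> r h assume *: "{\<rho>, \<theta>, r, h} \<subseteq> {a..b}"
    define d where "d = \<bar>\<rho> - r\<bar> + \<bar>\<theta> - h\<bar>"
    obtain \<rho>1 \<theta>1 where m: "\<rho>1 \<in> {a..b}" "\<theta>1 \<in> {a..b}" "\<bar>\<rho>1 - r\<bar> \<le> \<bar>\<rho> - r\<bar>" "\<bar>\<theta>1 - h\<bar> \<le> \<bar>\<theta> - h\<bar>"
      "f \<rho> \<theta> - f r h = d_rho f \<rho>1 \<theta>1 * (\<rho> - r) + d_theta f \<rho>1 \<theta>1 * (\<theta> - h)"
      using MVT_quadrant[OF C(2) assms(2) *] by metis
    have d1: "\<bar>\<rho>1 - r\<bar> + \<bar>\<theta>1 - h\<bar> \<le> d" using m by (simp add: d_def)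
    have s: "{\<rho>1, \<theta>1, r, h} \<subseteq> {a..b}" using m * by auto
    have l1: "\<bar>d_rho f \<rho>1 \<theta>1 - d_rho f r h\<bar> \<le> L1 * d"
      using L1(2)[OF s] mult_left_mono[OF d1, of L1] L1(1) by linarith
    have l2: "\<bar>d_theta f \<rho>1 \<theta>1 - d_theta f r h\<bar> \<le> L2 * d"
      using L2(2)[OF s] mult_left_mono[OF d1, of L2] L2(1) by linarith
    have "f \<rho> \<theta> - f r h - d_rho f r h * (\<rho> - r) - d_theta f r h * (\<theta> - h)
       = (d_rho f \<rho>1 \<theta>1 - d_rho f r h) * (\<rho> - r) + (d_theta f \<rho>1 \<theta>1 - d_theta f r h) * (\<theta> - h)"
      using m(5) by (simp add: algebra_simps)
    also have "\<bar>\<dots>\<bar> \<le> \<bar>d_rho f \<rho>1 \<theta>1 - d_rho f r h\<bar> * \<bar>\<rho> - r\<bar> + \<bar>d_theta f \<rho>1 \<theta>1 - d_theta f r h\<bar> * \<bar>\<theta> - h\<bar>"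
      by (metis abs_mult abs_triangle_ineq)
    also have "\<dots> \<le> (L1 * d) * d + (L2 * d) * d"
      using l1 l2 L1(1) L2(1) by (intro add_mono mult_mono) (auto simp: d_def)
    also have "\<dots> = (L1 + L2) * d\<^sup>2" by (simp add: power2_eq_square algebra_simps)
    also have "\<dots> \<le> (L1 + L2) * (2 * ((\<rho> - r)\<^sup>2 + (\<theta> - h)\<^sup>2))"
      using L1(1) L2(1) sum_abs_squared_le[of "\<rho> - r" "\<theta> - h"] by (intro mult_left_mono) (simp_all add: d_def)
    finally show "\<bar>f \<rho> \<theta> - f r h - d_rho f r h * (\<rho> - r) - d_theta f r h * (\<theta> - h)\<bar>
        \<le> 2 * (L1 + L2) * ((\<rho> - r)\<^sup>2 + (\<theta> - h)\<^sup>2)" by (simp add: algebra_simps)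
  qed (use L1 L2 in auto)
qed

text \<open>Schwarz's theorem by second differences over a square of side \<open>k n\<close>: the
  mean value theorem, used in either order of the variables, produces equal values of
  \<open>P'\<close> and \<open>Q'\<close> at two points of the square, and both points converge to
  (\<rho>, \<theta>). The partial derivatives are separate functions because those of the free
  energy are known in closed form.\<close>

lemma mixed_partials_eq:
  fixes F P Q :: "real \<Rightarrow> real \<Rightarrow> real"
  assumes P: "\<And>\<rho> \<theta>. \<rho> > 0 \<Longrightarrow> \<theta> > 0 \<Longrightarrow> ((\<lambda>r. F r \<theta>) has_real_derivative P \<rho> \<theta>) (at \<rho>)"
    and Q: "\<And>\<rho> \<theta>. \<rho> > 0 \<Longrightarrow> \<theta> > 0 \<Longrightarrow> ((\<lambda>h. F \<rho> h) has_real_derivative Q \<rho> \<theta>) (at \<theta>)"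
    and P': "\<And>\<rho> \<theta>. \<rho> > 0 \<Longrightarrow> \<theta> > 0 \<Longrightarrow> ((\<lambda>h. P \<rho> h) has_real_derivative P' \<rho> \<theta>) (at \<theta>)"
    and Q': "\<And>\<rho> \<theta>. \<rho> > 0 \<Longrightarrow> \<theta> > 0 \<Longrightarrow> ((\<lambda>r. Q r \<theta>) has_real_derivative Q' \<rho> \<theta>) (at \<rho>)"
    and c: "continuous_on ({0<..} \<times> {0<..}) (\<lambda>(\<rho>, \<theta>). P' \<rho> \<theta>)" "continuous_on ({0<..} \<times> {0<..}) (\<lambda>(\<rho>, \<theta>). Q' \<rho> \<theta>)"
    and pos: "\<rho> > 0" "\<theta> > 0"
  shows "P' \<rho> \<theta> = Q' \<rho> \<theta>"
proof -
  define k where "k n = 1 / real (Suc n)" for n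
  have k: "k n > 0" for n by (simp add: k_def)
  have k0: "k \<longlonglongrightarrow> 0" unfolding k_def by (rule LIMSEQ_Suc[OF lim_1_over_n])
  have ex: "\<exists>x1 y1 x2 y2. \<rho> < x1 \<and> x1 < \<rho> + k n \<and> \<theta> < y1 \<and> y1 < \<theta> + k n \<and>
      \<rho> < x2 \<and> x2 < \<rho> + k n \<and> \<theta> < y2 \<and> y2 < \<theta> + k n \<and> P' x1 y1 = Q' x2 y2" for n
  proof -
    let ?k = "k n"
    have "\<exists>x>\<rho>. x < \<rho> + ?k \<and> (F (\<rho> + ?k) (\<theta> + ?k) - F (\<rho> + ?k) \<theta>) - (F \<rho> (\<theta> + ?k) - F \<rho> \<theta>)
        = (\<rho> + ?k - \<rho>) * (P x (\<theta> + ?k) - P x \<theta>)"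
      by (rule MVT2[where f = "\<lambda>r. F r (\<theta> + ?k) - F r \<theta>"])
        (use k[of n] pos in \<open>auto intro!: derivative_intros P\<close>)
    then obtain x1 where x1: "x1 > \<rho>" "x1 < \<rho> + ?k" "(F (\<rho> + ?k) (\<theta> + ?k) - F (\<rho> + ?k) \<theta>) - (F \<rho> (\<theta> + ?k) - F \<rho> \<theta>)
        = ?k * (P x1 (\<theta> + ?k) - P x1 \<theta>)" by auto
    have "\<exists>y>\<theta>. y < \<theta> + ?k \<and> P x1 (\<theta> + ?k) - P x1 \<theta> = (\<theta> + ?k - \<theta>) * P' x1 y"
      by (rule MVT2) (use k[of n] pos x1 in \<open>auto intro!: P'\<close>)
    then obtain y1 where y1: "y1 > \<theta>" "y1 < \<theta> + ?k" "P x1 (\<theta> + ?k) - P x1 \<theta> = ?k * P' x1 y1" by auto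
    have "\<exists>y>\<theta>. y < \<theta> + ?k \<and> (F (\<rho> + ?k) (\<theta> + ?k) - F \<rho> (\<theta> + ?k)) - (F (\<rho> + ?k) \<theta> - F \<rho> \<theta>)
        = (\<theta> + ?k - \<theta>) * (Q (\<rho> + ?k) y - Q \<rho> y)"
      by (rule MVT2[where f = "\<lambda>h. F (\<rho> + ?k) h - F \<rho> h"])
        (use k[of n] pos in \<open>auto intro!: derivative_intros Q\<close>)
    then obtain y2 where y2: "y2 > \<theta>" "y2 < \<theta> + ?k" "(F (\<rho> + ?k) (\<theta> + ?k) - F \<rho> (\<theta> + ?k)) - (F (\<rho> + ?k) \<theta> - F \<rho> \<theta>)
        = ?k * (Q (\<rho> + ?k) y2 - Q \<rho> y2)" by auto
    have "\<exists>x>\<rho>. x < \<rho> + ?k \<and> Q (\<rho> + ?k) y2 - Q \<rho> y2 = (\<rho> + ?k - \<rho>) * Q' x y2"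
      by (rule MVT2[where f = "\<lambda>r. Q r y2"]) (use k[of n] pos y2 in \<open>auto intro!: Q'\<close>)
    then obtain x2 where x2: "x2 > \<rho>" "x2 < \<rho> + ?k" "Q (\<rho> + ?k) y2 - Q \<rho> y2 = ?k * Q' x2 y2" by auto
    have "?k * (?k * P' x1 y1) = ?k * (?k * Q' x2 y2)"
      using x1(3) y1(3) x2(3) y2(3) by (simp add: algebra_simps)
    then have "P' x1 y1 = Q' x2 y2" using k[of n] by simp
    then show ?thesis using x1 y1 x2 y2 by blast
  qed
  obtain x1 y1 x2 y2 where
    b: "\<And>n. \<rho> < x1 n \<and> x1 n < \<rho> + k n \<and> \<theta> < y1 n \<and> y1 n < \<theta> + k n \<and>
      \<rho> < x2 n \<and> x2 n < \<rho> + k n \<and> \<theta> < y2 n \<and> y2 n < \<theta> + k n \<and> P' (x1 n) (y1 n) = Q' (x2 n) (y2 n)"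
    using ex by metis
  have sq: "x \<longlonglongrightarrow> z" if "\<And>n. z < x n \<and> x n < z + k n" for x z
  proof (rule tendsto_sandwich[where f = "\<lambda>_. z" and h = "\<lambda>n. z + k n"])
    show "(\<lambda>n. z + k n) \<longlonglongrightarrow> z" using tendsto_add[OF tendsto_const k0, of z] by simp
  qed (use that less_imp_le in \<open>auto intro!: always_eventually\<close>)
  have at: "isCont (\<lambda>(\<rho>, \<theta>). P' \<rho> \<theta>) (\<rho>, \<theta>)" "isCont (\<lambda>(\<rho>, \<theta>). Q' \<rho> \<theta>) (\<rho>, \<theta>)"
    using c pos by (auto simp: continuous_on_eq_continuous_at open_Times)
  have "(\<lambda>n. (\<lambda>(\<rho>, \<theta>). P' \<rho> \<theta>) (x1 n, y1 n)) \<longlonglongrightarrow> (\<lambda>(\<rho>, \<theta>). P' \<rho> \<theta>) (\<rho>, \<theta>)"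
    by (intro isCont_tendsto_compose[OF at(1)] tendsto_Pair sq) (use b in auto)
  moreover have "(\<lambda>n. (\<lambda>(\<rho>, \<theta>). Q' \<rho> \<theta>) (x2 n, y2 n)) \<longlonglongrightarrow> (\<lambda>(\<rho>, \<theta>). Q' \<rho> \<theta>) (\<rho>, \<theta>)"
    by (intro isCont_tendsto_compose[OF at(2)] tendsto_Pair sq) (use b in auto)
  ultimately show ?thesis using b LIMSEQ_unique by auto
qed

text \<open>With \<open>M = e r h - h * s r h + p r h / r\<close> one has
  \<open>r * (e r h - h * s r h) - M * r = - p r h\<close>. So this is
  \<open>\<rho> * (e - h * s)\<close> at the state (\<rho>, \<theta>), minus its value at
  \<open>(r, h)\<close>, minus \<open>M * (\<rho> - r)\<close>: the distance from the tangent at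
  \<open>(r, h)\<close>. The tangent has no temperature term, because by Gibbs' relation the
  temperature derivative vanishes when the temperature equals \<open>h\<close>.\<close>

definition thermo_rel :: "(real \<Rightarrow> real \<Rightarrow> real) \<Rightarrow> (real \<Rightarrow> real \<Rightarrow> real) \<Rightarrow> (real \<Rightarrow> real \<Rightarrow> real)
    \<Rightarrow> real \<Rightarrow> real \<Rightarrow> real \<Rightarrow> real \<Rightarrow> real"
  where "thermo_rel p e s \<rho> \<theta> r h =
    \<rho> * e \<rho> \<theta> - h * (\<rho> * s \<rho> \<theta>) - (e r h - h * s r h + p r h / r) * \<rho> + p r h"

text \<open>The factor \<open>z - x\<close> makes \<open>g\<close> decrease up to \<open>x\<close>
  and increase after it. Applied to a function with a quadratic already subtracted, it gives
  quadratic lower bounds without second derivatives.\<close>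

lemma deriv_sign_imp_ge:
  fixes g m :: "real \<Rightarrow> real"
  assumes d: "\<And>z. z \<in> {a..b} \<Longrightarrow> (g has_real_derivative (z - x) * m z) (at z)"
    and m: "\<And>z. z \<in> {a..b} \<Longrightarrow> m z \<ge> 0" and "x \<in> {a..b}" "y \<in> {a..b}"
  shows "g x \<le> g y"
proof -
  consider "x = y" | "x < y" | "y < x" by linarith
  then show ?thesis
  proof cases
    case 2
    have "\<exists>z>x. z < y \<and> g y - g x = (y - x) * ((z - x) * m z)"
      by (rule MVT2) (use 2 d assms(3,4) in auto)
    then obtain z where z: "z > x" "z < y" "g y - g x = (y - x) * ((z - x) * m z)" by auto
    have "m z \<ge> 0" using m z assms(3,4) by auto
    then have "0 \<le> (y - x) * ((z - x) * m z)" using z by (intro mult_nonneg_nonneg) auto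
    then show ?thesis using z by linarith
  next
    case 3
    have "\<exists>z>y. z < x \<and> g x - g y = (x - y) * ((z - x) * m z)"
      by (rule MVT2) (use 3 d assms(3,4) in auto)
    then obtain z where z: "z > y" "z < x" "g x - g y = (x - y) * ((z - x) * m z)" by auto
    have "m z \<ge> 0" using m z assms(3,4) by auto
    then have "(x - y) * ((z - x) * m z) \<le> 0" using z
      by (intro mult_nonneg_nonpos mult_nonpos_nonneg) auto
    then show ?thesis using z by linarith
  qed auto
qed

section \<open>Consequences of Gibbs' relation and of thermodynamic stability\<close>

locale thermodynamics =
  fixes p e s :: "real \<Rightarrow> real \<Rightarrow> real"
  assumes p2: "Ck_quadrant 2 p" and e2: "Ck_quadrant 2 e" and s2: "Ck_quadrant 2 s"
    and gibbs: "gibbs p e s" and stable: "thermodynamically_stable p e"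
begin

lemmas p1 = Ck_quadrant_2D[OF p2] and e1 = Ck_quadrant_2D[OF e2] and s1 = Ck_quadrant_2D[OF s2]

lemma gibbs_rho:
  assumes "\<rho> > 0" "\<theta> > 0"
  shows "d_rho e \<rho> \<theta> - \<theta> * d_rho s \<rho> \<theta> = p \<rho> \<theta> / \<rho>\<^sup>2"
proof -
  have "d_rho (\<lambda>r h. 1 / r) \<rho> \<theta> = - 1 / \<rho>\<^sup>2"
    unfolding d_rho_def using assms
    by (intro DERIV_imp_deriv) (auto intro!: derivative_eq_intros simp: power2_eq_square)
  then show ?thesis using gibbs assms by (simp add: gibbs_def)
qed

lemma gibbs_theta:
  assumes "\<rho> > 0" "\<theta> > 0"
  shows "d_theta e \<rho> \<theta> = \<theta> * d_theta s \<rho> \<theta>"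
proof -
  have "d_theta (\<lambda>r h. 1 / r) \<rho> \<theta> = 0"
    unfolding d_theta_def by simp
  then show ?thesis using gibbs assms by (simp add: gibbs_def)
qed

text \<open>Equality of the mixed derivatives of the Helmholtz free energy \<open>e - \<theta> s\<close>, whose
  partial derivatives are \<open>p / \<rho>\<^sup>2\<close> and \<open>- s\<close>.\<close>

lemma maxwell_relation:
  assumes "\<rho> > 0" "\<theta> > 0"
  shows "d_rho s \<rho> \<theta> = - d_theta p \<rho> \<theta> / \<rho>\<^sup>2"
proof -
  have "(\<lambda>\<rho> \<theta>. d_theta p \<rho> \<theta> / \<rho>\<^sup>2) \<rho> \<theta> = (\<lambda>\<rho> \<theta>. - d_rho s \<rho> \<theta>) \<rho> \<theta>"
  proof (rule mixed_partials_eq[where F = "\<lambda>\<rho> \<theta>. e \<rho> \<theta> - \<theta> * s \<rho> \<theta>" and P = "\<lambda>\<rho> \<theta>. p \<rho> \<theta> / \<rho>\<^sup>2" and Q = "\<lambda>\<rho> \<theta>. - s \<rho> \<theta>"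
        and P' = "\<lambda>\<rho> \<theta>. d_theta p \<rho> \<theta> / \<rho>\<^sup>2" and Q' = "\<lambda>\<rho> \<theta>. - d_rho s \<rho> \<theta>"])
    fix \<rho> \<theta> :: real assume pos: "\<rho> > 0" "\<theta> > 0"
    show "((\<lambda>r. e r \<theta> - \<theta> * s r \<theta>) has_real_derivative p \<rho> \<theta> / \<rho>\<^sup>2) (at \<rho>)"
      using gibbs_rho[OF pos] pos
      by (auto intro!: derivative_eq_intros d_rho_DERIV[OF e1(2)] d_rho_DERIV[OF s1(2)] simp: mult.commute)
    show "((\<lambda>h. e \<rho> h - h * s \<rho> h) has_real_derivative - s \<rho> \<theta>) (at \<theta>)"
      using gibbs_theta[OF pos] pos
      by (auto intro!: derivative_eq_intros d_theta_DERIV[OF e1(2)] d_theta_DERIV[OF s1(2)] simp: algebra_simps)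
    show "((\<lambda>h. p \<rho> h / \<rho>\<^sup>2) has_real_derivative d_theta p \<rho> \<theta> / \<rho>\<^sup>2) (at \<theta>)"
      using pos by (intro DERIV_cdivide d_theta_DERIV[OF p1(2)])
    show "((\<lambda>r. - s r \<theta>) has_real_derivative - d_rho s \<rho> \<theta>) (at \<rho>)"
      using pos by (intro DERIV_minus d_rho_DERIV[OF s1(2)])
  next
    have "continuous_on ({0<..} \<times> {0<..}) (\<lambda>z. (\<lambda>(\<rho>, \<theta>). d_theta p \<rho> \<theta>) z / (fst z)\<^sup>2)"
      using Ck_quadrant_0D[OF Ck_quadrant_Suc_D[OF p1(4)]] by (intro continuous_intros) auto
    then show "continuous_on ({0<..} \<times> {0<..}) (\<lambda>(\<rho>, \<theta>). d_theta p \<rho> \<theta> / \<rho>\<^sup>2)"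
      by (simp add: case_prod_unfold)
    have "continuous_on ({0<..} \<times> {0<..}) (\<lambda>z. - (\<lambda>(\<rho>, \<theta>). d_rho s \<rho> \<theta>) z)"
      using Ck_quadrant_0D[OF Ck_quadrant_Suc_D[OF s1(3)]] by (intro continuous_intros) auto
    then show "continuous_on ({0<..} \<times> {0<..}) (\<lambda>(\<rho>, \<theta>). - d_rho s \<rho> \<theta>)"
      by (simp add: case_prod_unfold)
  qed (use assms in auto)
  then show ?thesis by simp
qed

text \<open>Gibbs' relation in the density cancels all derivatives of \<open>e\<close> and
  \<open>s\<close>. The sign is that of \<open>d_rho p\<close>, so by stability the chemical
  potential increases with the density at fixed temperature.\<close>

lemma chemical_potential_DERIV:
  assumes "\<rho> > 0" "h > 0"
  shows "((\<lambda>\<rho>. e \<rho> h - h * s \<rho> h + p \<rho> h / \<rho>) has_real_derivative d_rho p \<rho> h / \<rho>) (at \<rho>)"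
proof -
  have "((\<lambda>\<rho>. e \<rho> h - h * s \<rho> h + p \<rho> h / \<rho>) has_real_derivative
      d_rho e \<rho> h - h * d_rho s \<rho> h + (d_rho p \<rho> h * \<rho> - p \<rho> h) / (\<rho> * \<rho>)) (at \<rho>)"
    using assms
    by (auto intro!: derivative_eq_intros d_rho_DERIV[OF e1(2)] d_rho_DERIV[OF s1(2)] d_rho_DERIV[OF p1(2)])
  also have "d_rho e \<rho> h - h * d_rho s \<rho> h + (d_rho p \<rho> h * \<rho> - p \<rho> h) / (\<rho> * \<rho>) = d_rho p \<rho> h / \<rho>"
    using gibbs_rho[OF assms] assms by (simp add: field_simps power2_eq_square)
  finally show ?thesis .
qed

text \<open>The state moves to \<open>(r, h)\<close> in two legs, each controlled by one stability
  condition. At fixed density the temperature derivative of \<open>\<rho> * (e - h * s)\<close> is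
  \<open>\<theta> - h\<close> times \<open>\<rho> * d_theta e / \<theta>\<close>. At fixed
  temperature \<open>h\<close> the density derivative, after subtraction of the tangent, is the
  increment of the chemical potential. The constants \<open>c1\<close> and \<open>c2\<close> are
  positive lower bounds of the two factors on the square.\<close>

lemma thermo_rel_coercive:
  assumes "a > 0"
  obtains c where "c > 0" "\<And>\<rho> \<theta> r h. {\<rho>, \<theta>, r, h} \<subseteq> {a..b} \<Longrightarrow>
    c * ((\<rho> - r)\<^sup>2 + (\<theta> - h)\<^sup>2) \<le> thermo_rel p e s \<rho> \<theta> r h"
proof -
  have "continuous_on ({0<..} \<times> {0<..}) (\<lambda>z. (\<lambda>(\<rho>, \<theta>). d_rho p \<rho> \<theta>) z / fst z)"
    using Ck_quadrant_0D[OF Ck_quadrant_Suc_D[OF p1(3)]] by (intro continuous_intros) auto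
  then have "continuous_on ({0<..} \<times> {0<..}) (\<lambda>(\<rho>, \<theta>). d_rho p \<rho> \<theta> / \<rho>)"
    by (simp add: case_prod_unfold)
  then obtain c1 where c1: "c1 > 0" "\<And>\<rho> \<theta>. {\<rho>, \<theta>} \<subseteq> {a..b} \<Longrightarrow> c1 \<le> d_rho p \<rho> \<theta> / \<rho>"
    using quadrant_pos_lower_bound[of "\<lambda>\<rho> \<theta>. d_rho p \<rho> \<theta> / \<rho>" a b] assms stable
    by (auto simp: thermodynamically_stable_def)
  have "continuous_on ({0<..} \<times> {0<..}) (\<lambda>z. fst z * (\<lambda>(\<rho>, \<theta>). d_theta e \<rho> \<theta>) z / snd z)"
    using Ck_quadrant_0D[OF Ck_quadrant_Suc_D[OF e1(4)]] by (intro continuous_intros) auto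
  then have "continuous_on ({0<..} \<times> {0<..}) (\<lambda>(\<rho>, \<theta>). \<rho> * d_theta e \<rho> \<theta> / \<theta>)"
    by (simp add: case_prod_unfold)
  then obtain c2 where c2: "c2 > 0" "\<And>\<rho> \<theta>. {\<rho>, \<theta>} \<subseteq> {a..b} \<Longrightarrow> c2 \<le> \<rho> * d_theta e \<rho> \<theta> / \<theta>"
    using quadrant_pos_lower_bound[of "\<lambda>\<rho> \<theta>. \<rho> * d_theta e \<rho> \<theta> / \<theta>" a b] assms stable
    by (auto simp: thermodynamically_stable_def)
  show ?thesis
  proof (rule that[of "min c1 c2 / 2"])
    fix \<rho> \<theta> r h assume *: "{\<rho>, \<theta>, r, h} \<subseteq> {a..b}"
    then have pos: "\<rho> > 0" "\<theta> > 0" "r > 0" "h > 0" using assms by auto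
    have 1: "\<rho> * (e \<rho> h - h * s \<rho> h) - c2 / 2 * (h - h)\<^sup>2 \<le> \<rho> * (e \<rho> \<theta> - h * s \<rho> \<theta>) - c2 / 2 * (\<theta> - h)\<^sup>2"
    proof (rule deriv_sign_imp_ge[where g = "\<lambda>\<theta>. \<rho> * (e \<rho> \<theta> - h * s \<rho> \<theta>) - c2 / 2 * (\<theta> - h)\<^sup>2" and x = h and y = \<theta>
          and m = "\<lambda>z. \<rho> * d_theta e \<rho> z / z - c2" and a = a and b = b])
      fix z assume z: "z \<in> {a..b}"
      then have "z > 0" using assms by auto
      then show "((\<lambda>\<theta>. \<rho> * (e \<rho> \<theta> - h * s \<rho> \<theta>) - c2 / 2 * (\<theta> - h)\<^sup>2) has_real_derivative
          (z - h) * (\<rho> * d_theta e \<rho> z / z - c2)) (at z)"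
        using pos gibbs_theta[of \<rho> z]
        by (auto intro!: derivative_eq_intros d_theta_DERIV[OF e1(2)] d_theta_DERIV[OF s1(2)]
            simp: field_simps)
      show "0 \<le> \<rho> * d_theta e \<rho> z / z - c2" using c2(2)[of \<rho> z] * z by auto
    qed (use * in auto)
    define M where "M = e r h - h * s r h + p r h / r"
    \<comment> \<open>Writing the increment as a factor times \<open>z - r\<close> gives the
      derivative the shape that \<open>deriv_sign_imp_ge\<close> expects. The intermediate point may
      depend on \<open>z\<close> in an arbitrary way.\<close>
    have mon: "\<exists>\<xi>\<in>{a..b}. (e z h - h * s z h + p z h / z) - M = d_rho p \<xi> h / \<xi> * (z - r)" if z: "z \<in> {a..b}" for z
    proof -
      let ?g = "\<lambda>\<rho>. e \<rho> h - h * s \<rho> h + p \<rho> h / \<rho>"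
      have d: "(?g has_real_derivative d_rho p y h / y) (at y)" if "y \<in> {a..b}" for y
        using chemical_potential_DERIV that assms pos by auto
      have flip: "H - G = X * (z - r)" if "G - H = (r - z) * X" for G H X :: real
        using that by (simp add: algebra_simps)
      consider "z = r" | "r < z" | "z < r" by linarith
      then show ?thesis
      proof cases
        case 1 then show ?thesis using z by (auto simp: M_def)
      next
        case 2
        have "\<exists>y>r. y < z \<and> ?g z - ?g r = (z - r) * (d_rho p y h / y)"
          by (rule MVT2) (use 2 d z * in auto)
        then obtain y where y: "r < y" "y < z" "?g z - ?g r = (z - r) * (d_rho p y h / y)" by blast
        show ?thesis
          by (rule bexI[of _ y]) (use y z * in \<open>auto simp: M_def\<close>)
      next
        case 3
        have "\<exists>y>z. y < r \<and> ?g r - ?g z = (r - z) * (d_rho p y h / y)"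
          by (rule MVT2) (use 3 d z * in auto)
        then obtain y where y: "z < y" "y < r" "?g r - ?g z = (r - z) * (d_rho p y h / y)" by blast
        have "?g z - ?g r = d_rho p y h / y * (z - r)"
          using flip[OF y(3)] .
        then show ?thesis
          by (intro bexI[of _ y]) (use y z * in \<open>auto simp: M_def\<close>)
      qed
    qed
    then obtain \<xi> where \<xi>: "\<And>z. z \<in> {a..b} \<Longrightarrow> \<xi> z \<in> {a..b} \<and>
        (e z h - h * s z h + p z h / z) - M = d_rho p (\<xi> z) h / \<xi> z * (z - r)" by metis
    have 2: "(r * (e r h - h * s r h) - M * r) - c1 / 2 * (r - r)\<^sup>2 \<le> (\<rho> * (e \<rho> h - h * s \<rho> h) - M * \<rho>) - c1 / 2 * (\<rho> - r)\<^sup>2"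
    proof (rule deriv_sign_imp_ge[where g = "\<lambda>\<rho>. (\<rho> * (e \<rho> h - h * s \<rho> h) - M * \<rho>) - c1 / 2 * (\<rho> - r)\<^sup>2" and x = r and y = \<rho>
          and m = "\<lambda>z. d_rho p (\<xi> z) h / \<xi> z - c1" and a = a and b = b])
      fix z assume z: "z \<in> {a..b}"
      then have "z > 0" using assms by auto
      have "((\<lambda>\<rho>. (\<rho> * (e \<rho> h - h * s \<rho> h) - M * \<rho>) - c1 / 2 * (\<rho> - r)\<^sup>2) has_real_derivative
          (e z h - h * s z h + z * (d_rho e z h - h * d_rho s z h) - M) - c1 * (z - r)) (at z)"
        using pos \<open>z > 0\<close>
        by (auto intro!: derivative_eq_intros d_rho_DERIV[OF e1(2)] d_rho_DERIV[OF s1(2)] simp: field_simps)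
      also have "z * (d_rho e z h - h * d_rho s z h) = p z h / z"
        using gibbs_rho[of z h] pos \<open>z > 0\<close> by (simp add: power2_eq_square)
      also have "(e z h - h * s z h + p z h / z - M) - c1 * (z - r) = (z - r) * (d_rho p (\<xi> z) h / \<xi> z - c1)"
        using \<xi>[OF z] by (simp add: algebra_simps)
      finally show "((\<lambda>\<rho>. (\<rho> * (e \<rho> h - h * s \<rho> h) - M * \<rho>) - c1 / 2 * (\<rho> - r)\<^sup>2) has_real_derivative
          (z - r) * (d_rho p (\<xi> z) h / \<xi> z - c1)) (at z)" .
      show "0 \<le> d_rho p (\<xi> z) h / \<xi> z - c1" using c1(2)[of "\<xi> z" h] \<xi>[OF z] * by auto
    qed (use * in auto)
    have Mr: "r * (e r h - h * s r h) - M * r = - p r h"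
      using pos by (simp add: M_def field_simps)
    have "min c1 c2 / 2 * ((\<rho> - r)\<^sup>2 + (\<theta> - h)\<^sup>2) \<le> c1 / 2 * (\<rho> - r)\<^sup>2 + c2 / 2 * (\<theta> - h)\<^sup>2"
      unfolding distrib_left by (intro add_mono mult_right_mono) auto
    also have "\<dots> \<le> thermo_rel p e s \<rho> \<theta> r h"
      using 1 2 Mr by (simp add: thermo_rel_def M_def algebra_simps)
    finally show "min c1 c2 / 2 * ((\<rho> - r)\<^sup>2 + (\<theta> - h)\<^sup>2) \<le> thermo_rel p e s \<rho> \<theta> r h" .
  qed (use c1 c2 in auto)
qed

end

section \<open>Relative energy and its rate\<close>

lemma mat_1_inner: "mat 1 \<bullet> (Y :: real^'d^'d) = trace Y"
proof -
  have "(\<Sum>j\<in>UNIV. (if i = j then 1 else 0) * Y $ i $ j) = Y $ i $ i" for i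
  proof -
    have "(\<Sum>j\<in>UNIV. (if i = j then 1 else 0) * Y $ i $ j) = (\<Sum>j\<in>UNIV. if i = j then Y $ i $ j else 0)"
      by (rule sum.cong) auto
    then show ?thesis by simp
  qed
  then show ?thesis by (simp add: inner_vec_def trace_def mat_def)
qed

lemma trace_scaleR: "trace (c *\<^sub>R A) = c * trace (A :: real^'d^'d)"
  by (simp add: trace_def sum_distrib_left)

lemma transpose_inner_transpose: "transpose A \<bullet> transpose B = A \<bullet> (B :: real^'d^'d)"
proof -
  have "transpose A \<bullet> transpose B = (\<Sum>i\<in>UNIV. \<Sum>j\<in>UNIV. A $ j $ i * B $ j $ i)"
    by (simp add: inner_vec_def transpose_def)
  also have "\<dots> = (\<Sum>j\<in>UNIV. \<Sum>i\<in>UNIV. A $ j $ i * B $ j $ i)" by (rule sum.swap)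
  finally show ?thesis by (simp add: inner_vec_def)
qed

lemma transpose_inner: "transpose A \<bullet> B = A \<bullet> transpose (B :: real^'d^'d)"
  using transpose_inner_transpose[of A "transpose B"] by simp

lemma transpose_add: "transpose (A + B) = transpose A + transpose (B :: real^'d^'d)"
  and transpose_diff: "transpose (A - B) = transpose A - transpose (B :: real^'d^'d)"
  and transpose_scaleR: "transpose (c *\<^sub>R A) = c *\<^sub>R transpose A"
  by (simp_all add: transpose_def vec_eq_iff)

lemma symm_inner_symmetric: "transpose X = X \<Longrightarrow> X \<bullet> symm Y = X \<bullet> Y"
  using transpose_inner[of X Y] by (simp add: symm_def inner_simps)

lemma transpose_symm: "transpose (symm A) = symm A"
  by (simp add: symm_def transpose_scaleR transpose_add add.commute)

lemma trace_transpose: "trace (transpose A) = trace (A :: real^'d^'d)"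
  by (simp add: trace_def transpose_def)

lemma trace_symm: "trace (symm A) = trace A"
  by (simp add: symm_def trace_scaleR trace_add trace_transpose)

lemma transpose_dev: "transpose (dev A) = dev A"
  by (simp add: dev_def transpose_diff transpose_scaleR transpose_symm transpose_mat)

lemma trace_dev: "trace (dev (A :: real^'d::finite^'d)) = 0"
  by (simp add: dev_def trace_sub trace_scaleR trace_symm trace_I)

text \<open>\<open>dev\<close> is the orthogonal projection onto the symmetric trace-free matrices:
  multiples of the identity and skew matrices are orthogonal to its range.\<close>

lemma dev_inner: "dev A \<bullet> Y = dev A \<bullet> dev (Y :: real^'d::finite^'d)"
proof -
  have "dev A \<bullet> mat 1 = 0" using mat_1_inner[of "dev A"] by (simp add: inner_commute trace_dev)
  then have "dev A \<bullet> dev Y = dev A \<bullet> symm Y" by (simp add: dev_def[of Y] inner_simps)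
  then show ?thesis by (simp add: symm_inner_symmetric transpose_dev)
qed

lemma stress_inner:
  "stress \<mu> lam \<rho> \<theta> A \<bullet> (Y :: real^'d::finite^'d) = \<mu> \<rho> \<theta> * (dev A \<bullet> dev Y) + lam \<rho> \<theta> * (trace A * trace Y)"
  unfolding stress_def by (simp add: inner_simps mat_1_inner dev_inner[of A Y])

lemma stress_symm: "transpose (stress \<mu> lam \<rho> \<theta> A) = stress \<mu> lam \<rho> \<theta> A"
  by (simp add: stress_def transpose_add transpose_scaleR transpose_dev transpose_mat)

lemma symm_symmetric: "transpose A = A \<Longrightarrow> symm A = (A :: real^'d^'d)"
  by (simp add: symm_def vec_eq_iff)

lemma dev_diff: "dev (A - B) = dev A - dev (B :: real^'d::finite^'d)"
  by (simp add: dev_def symm_def transpose_diff trace_sub algebra_simps diff_divide_distrib)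

text \<open>Shear and bulk viscosity control the deviatoric part and the trace separately. These are
  orthogonal components of the symmetric part; the squared norm of the second is the squared trace
  divided by the dimension, which is at least 1. Together they control the whole symmetric
  deviation.\<close>

lemma norm_symm_diff_le:
  fixes A G :: "real^'d::finite^'d"
  assumes "transpose A = A"
  shows "(norm (A - symm G))\<^sup>2 \<le> (norm (dev A - dev G))\<^sup>2 + (trace A - trace G)\<^sup>2"
proof -
  let ?d = "real CARD('d)"
  define X where "X = A - G"
  have sX: "symm X = A - symm G"
    using symm_symmetric[OF assms] by (simp add: X_def symm_def transpose_diff algebra_simps)
  have "symm X = dev X + (trace X / ?d) *\<^sub>R mat 1" by (simp add: dev_def)
  moreover have "dev X \<bullet> mat 1 = 0" "mat 1 \<bullet> dev X = 0"
    using mat_1_inner[of "dev X"] by (simp_all add: inner_commute trace_dev)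
  ultimately have "(norm (symm X))\<^sup>2 = (norm (dev X))\<^sup>2 + (trace X / ?d)\<^sup>2 * ?d"
    unfolding power2_norm_eq_inner
    by (simp add: inner_simps mat_1_inner trace_I power2_eq_square)
  also have "(trace X / ?d)\<^sup>2 * ?d = (trace X)\<^sup>2 / ?d" by (simp add: power2_eq_square)
  also have "\<dots> \<le> (trace X)\<^sup>2"
    by (simp add: divide_le_eq mult_le_cancel_left1 Suc_leI)
  finally have "(norm (symm X))\<^sup>2 \<le> (norm (dev X))\<^sup>2 + (trace X)\<^sup>2" by simp
  then show ?thesis unfolding sX by (simp add: X_def dev_diff trace_sub)
qed

lemma outer_inner: "outer u v \<bullet> G = u \<bullet> (G *v v)"
  by (simp add: outer_def inner_vec_def matrix_vector_mult_def sum_distrib_left mult_ac)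

lemma norm_dev_le: "norm (dev A) \<le> norm (A :: real^'d::finite^'d)"
proof -
  have "norm (dev A) * norm (dev A) = dev A \<bullet> A"
    by (simp add: dev_inner[of A A] power2_norm_eq_inner flip: power2_eq_square)
  also have "\<dots> \<le> norm (dev A) * norm A" by (rule norm_cauchy_schwarz)
  finally show ?thesis by (cases "dev A = 0") (auto simp: mult_le_cancel_left_pos)
qed

lemma abs_trace_le: "\<bar>trace A\<bar> \<le> real CARD('d) * norm (A :: real^'d::finite^'d)"
proof -
  have "\<bar>trace A\<bar> \<le> (\<Sum>i\<in>UNIV. \<bar>A $ i $ i\<bar>)" unfolding trace_def by (rule sum_abs)
  also have "\<dots> \<le> (\<Sum>i\<in>(UNIV::'d set). norm A)"
  proof (rule sum_mono)
    fix i show "\<bar>A $ i $ i\<bar> \<le> norm A"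
      using component_le_norm_cart[of "A $ i" i] Finite_Cartesian_Product.norm_nth_le[of A i] by linarith
  qed
  finally show ?thesis by simp
qed

lemma norm_matrix_vector_le: "norm (A *v x) \<le> norm (A :: real^'d::finite^'d) * norm x"
proof -
  have "(norm (A *v x))\<^sup>2 = (\<Sum>i\<in>UNIV. (A $ i \<bullet> x)\<^sup>2)"
    unfolding power2_norm_eq_inner inner_vec_def[of "A *v x"] matrix_vector_mul_component
    by (simp add: power2_eq_square)
  also have "\<dots> \<le> (\<Sum>i\<in>UNIV. (A $ i \<bullet> A $ i) * (x \<bullet> x))"
    by (intro sum_mono Cauchy_Schwarz_ineq)
  also have "\<dots> = (A \<bullet> A) * (x \<bullet> x)"
    unfolding inner_vec_def[of A A] by (rule sum_distrib_right[symmetric])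
  also have "\<dots> = (norm A * norm x)\<^sup>2"
    by (simp add: power_mult_distrib dot_square_norm)
  finally show ?thesis by (rule power2_le_imp_le) simp
qed

text \<open>The strong solution enters pointwise through parameters: the values \<open>r\<close>,
  \<open>h\<close>, \<open>v\<close>, the time derivatives \<open>rt\<close>, \<open>ht\<close>,
  \<open>vt\<close>, the gradients \<open>gr\<close>, \<open>a\<close>, \<open>Gv\<close>, and the
  divergences \<open>dS\<close> of the stress and \<open>dK\<close> of \<kappa> times the
  temperature gradient. In the order of the summands: the ballistic energy inequality; minus the
  momentum equation tested with \<open>v\<close>; the continuity equation tested with kinetic energy
  minus chemical potential; the completing terms.\<close>

definition rel_rate :: "(real \<Rightarrow> real \<Rightarrow> real) \<Rightarrow> (real \<Rightarrow> real \<Rightarrow> real) \<Rightarrow> (real \<Rightarrow> real \<Rightarrow> real)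
    \<Rightarrow> (real \<Rightarrow> real \<Rightarrow> real) \<Rightarrow> (real \<Rightarrow> real \<Rightarrow> real)
    \<Rightarrow> real \<Rightarrow> real \<Rightarrow> real^'d::finite \<Rightarrow> real \<Rightarrow> real \<Rightarrow> real^'d \<Rightarrow> real^'d \<Rightarrow> real^'d \<Rightarrow> real^'d^'d \<Rightarrow> real^'d \<Rightarrow> real
    \<Rightarrow> 'd phase \<Rightarrow> real"
  where "rel_rate p s \<kappa> \<mu> lam r h v rt ht vt gr a Gv dS dK = (\<lambda>(\<rho>, u, \<theta>, A, g).
    let Pt = d_rho p r h * rt + d_theta p r h * ht;
        Px = d_rho p r h *\<^sub>R gr + d_theta p r h *\<^sub>R a;
        S = stress \<mu> lam r h Gv
    in - entropy_production \<kappa> \<mu> lam \<rho> \<theta> A g * h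
      - \<rho> * s \<rho> \<theta> * ht - ((\<rho> * s \<rho> \<theta>) *\<^sub>R u) \<bullet> a + ((\<kappa> \<rho> \<theta> / \<theta>) *\<^sub>R g) \<bullet> a
      - ((\<rho> *\<^sub>R u) \<bullet> vt + (\<rho> *\<^sub>R outer u u) \<bullet> Gv + p \<rho> \<theta> * trace Gv) + stress \<mu> lam \<rho> \<theta> A \<bullet> Gv
      + (\<rho> * (v \<bullet> vt - (Pt / r - s r h * ht)) + (\<rho> *\<^sub>R u) \<bullet> (transpose Gv *v v - ((1 / r) *\<^sub>R Px - s r h *\<^sub>R a)))
      + Pt + (u \<bullet> dS + A \<bullet> S) + (v \<bullet> Px + p r h * trace Gv - (v \<bullet> dS + Gv \<bullet> S))
      + ((\<theta> - h) * (dK / h - \<kappa> r h * (norm a)\<^sup>2 / h\<^sup>2) + (g - a) \<bullet> ((\<kappa> r h / h) *\<^sub>R a)))"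

text \<open>The viscous (deviatoric and volumetric) and the heat-conducting contributions to
  \<^const>\<open>rel_rate\<close> all have this shape, with \<open>m\<close> and \<open>m'\<close> the transport coefficient at the
  two states.\<close>

definition diss :: "real \<Rightarrow> real \<Rightarrow> real \<Rightarrow> real \<Rightarrow> 'a::real_inner \<Rightarrow> 'a \<Rightarrow> real"
  where "diss \<theta> h m m' X Y = - (h / \<theta>) * m * (X \<bullet> X) + m * (X \<bullet> Y) + m' * ((X - Y) \<bullet> Y)
    - (\<theta> - h) / h * m' * (Y \<bullet> Y)"

text \<open>All contributions of first order in the deviations cancel, through the three strong
  equations, Gibbs' relation and the Maxwell relation. Three dissipation forms remain, together with
  products of two deviations and second-order Taylor remainders of \<open>s\<close> and
  \<open>p\<close>.\<close>

lemma (in thermodynamics) rel_rate_eq: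
  fixes v :: "real^'d::finite"
  assumes pos: "r > 0" "h > 0" "\<theta> > 0"
    and cont: "rt + v \<bullet> gr + r * trace Gv = 0"
    and mom: "r *\<^sub>R (vt + Gv *v v) + (d_rho p r h *\<^sub>R gr + d_theta p r h *\<^sub>R a) = dS"
    and en: "r * (d_rho e r h * (rt + v \<bullet> gr) + d_theta e r h * (ht + v \<bullet> a))
      = dK + stress \<mu> lam r h Gv \<bullet> symm Gv - p r h * trace Gv"
  shows "rel_rate p s \<kappa> \<mu> lam r h v rt ht vt gr a Gv dS dK (\<rho>, u, \<theta>, A, g) =
      diss \<theta> h (\<mu> \<rho> \<theta>) (\<mu> r h) (dev A) (dev Gv) + diss \<theta> h (lam \<rho> \<theta>) (lam r h) (trace A) (trace Gv)
      + diss \<theta> h (\<kappa> \<rho> \<theta> / \<theta>) (\<kappa> r h / h) g a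
      - \<rho> * (s \<rho> \<theta> - s r h) * ((u - v) \<bullet> a) - \<rho> * ((u - v) \<bullet> (Gv *v (u - v))) + (1 - \<rho> / r) * ((u - v) \<bullet> dS)
      - (ht + v \<bullet> a) * ((\<rho> - r) * (s \<rho> \<theta> - s r h)
          + r * (s \<rho> \<theta> - s r h - d_rho s r h * (\<rho> - r) - d_theta s r h * (\<theta> - h)))
      - trace Gv * (p \<rho> \<theta> - p r h - d_rho p r h * (\<rho> - r) - d_theta p r h * (\<theta> - h))"
proof -
  define w where "w = u - v"
  have u: "u = v + w" by (simp add: w_def)
  define SB where "SB = stress \<mu> lam r h Gv \<bullet> symm Gv"
  define pr ph sr sh where "pr = d_rho p r h" and "ph = d_theta p r h" and "sr = d_rho s r h" and "sh = d_theta s r h"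
  define X where "X = ht + v \<bullet> a"
  define T where "T = trace Gv"
  have rt: "rt = - (v \<bullet> gr) - r * T" using cont by (simp add: T_def)
  have mx: "sr = - ph / r\<^sup>2" using maxwell_relation[OF pos(1,2)] by (simp add: sr_def ph_def)
  have er: "d_rho e r h = p r h / r\<^sup>2 + h * sr" using gibbs_rho[OF pos(1,2)] by (simp add: sr_def)
  have eh: "d_theta e r h = h * sh" using gibbs_theta[OF pos(1,2)] by (simp add: sh_def)
  \<comment> \<open>The internal energy equation divided by the temperature, that is, the entropy
    balance: Gibbs' relation replaces the derivatives of \<open>e\<close>, the Maxwell relation
    replaces \<open>d_rho s\<close>.\<close>
  have dK: "dK / h = r * sh * X + ph * T - SB / h"
  proof -
    have "dK = r * ((p r h / r\<^sup>2 + h * sr) * (- r * T) + h * sh * X) - SB + p r h * T"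
      using en rt unfolding er eh by (simp add: SB_def T_def X_def)
    also have "\<dots> = h * (r * sh * X + ph * T) - SB"
      unfolding mx using pos by (simp add: field_simps power2_eq_square)
    finally show ?thesis using pos by (simp add: field_simps)
  qed
  have wdS: "w \<bullet> dS = r * (w \<bullet> vt + w \<bullet> (Gv *v v)) + (pr * (w \<bullet> gr) + ph * (w \<bullet> a))"
    unfolding mom[symmetric] by (simp add: inner_simps pr_def ph_def algebra_simps)
  have tr: "y \<bullet> (transpose Gv *v v) = v \<bullet> (Gv *v y)" for y
    unfolding transpose_matrix_vector dot_lmul_matrix[symmetric] by (rule inner_commute)
  define Q where "Q = stress \<mu> lam r h Gv \<bullet> Gv"
  have SBQ: "SB = Q" unfolding SB_def Q_def by (simp add: symm_inner_symmetric stress_symm)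
  \<comment> \<open>All summands with the gradient variables \<open>A\<close> and \<open>g\<close>,
    with their counterparts at the strong state. The missing piece
    \<open>- (\<theta> - h) * SB / h\<close> of the dissipation forms is supplied by
    \<open>dK / h\<close>.\<close>
  define N where "N = - entropy_production \<kappa> \<mu> lam \<rho> \<theta> A g * h + ((\<kappa> \<rho> \<theta> / \<theta>) *\<^sub>R g) \<bullet> a
      + stress \<mu> lam \<rho> \<theta> A \<bullet> Gv + A \<bullet> stress \<mu> lam r h Gv - Gv \<bullet> stress \<mu> lam r h Gv
      - (\<theta> - h) * (\<kappa> r h * (norm a)\<^sup>2 / h\<^sup>2) + (g - a) \<bullet> ((\<kappa> r h / h) *\<^sub>R a)"
  have N: "N - (\<theta> - h) * SB / h = diss \<theta> h (\<mu> \<rho> \<theta>) (\<mu> r h) (dev A) (dev Gv) + diss \<theta> h (lam \<rho> \<theta>) (lam r h) (trace A) (trace Gv)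
      + diss \<theta> h (\<kappa> \<rho> \<theta> / \<theta>) (\<kappa> r h / h) g a"
  proof -
    have 1: "A \<bullet> stress \<mu> lam r h Gv = \<mu> r h * (dev A \<bullet> dev Gv) + lam r h * (trace A * trace Gv)"
      "Gv \<bullet> stress \<mu> lam r h Gv = \<mu> r h * (dev Gv \<bullet> dev Gv) + lam r h * (trace Gv * trace Gv)"
      using stress_inner[of \<mu> lam r h Gv A] stress_inner[of \<mu> lam r h Gv Gv]
        inner_commute[of A "stress \<mu> lam r h Gv"] inner_commute[of Gv "stress \<mu> lam r h Gv"]
        inner_commute[of "dev A" "dev Gv"] mult.commute[of "trace A" "trace Gv"] by metis+
    show ?thesis
      using pos 
      unfolding N_def SBQ Q_def entropy_production_def stress_inner 1 diss_def power2_norm_eq_inner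
      by (simp add: inner_simps inner_commute[of a g] divide_simps) (simp add: algebra_simps power2_eq_square)
  qed
  \<comment> \<open>Once these scalar products are named, what is left is an identity between
    rational expressions in real variables, with powers of \<open>r\<close> and \<open>h\<close> as
    the only denominators.\<close>
  define va wa vvt wvt vgr wgr vGv wGv vGw wGw
    where "va = v \<bullet> a" and "wa = w \<bullet> a" and "vvt = v \<bullet> vt" and "wvt = w \<bullet> vt" and "vgr = v \<bullet> gr" and "wgr = w \<bullet> gr"
      and "vGv = v \<bullet> (Gv *v v)" and "wGv = w \<bullet> (Gv *v v)" and "vGw = v \<bullet> (Gv *v w)" and "wGw = w \<bullet> (Gv *v w)"
  note defs = va_def wa_def vvt_def wvt_def vgr_def wgr_def vGv_def wGv_def vGw_def wGw_def
  have e1: "((\<rho> * s \<rho> \<theta>) *\<^sub>R u) \<bullet> a = \<rho> * s \<rho> \<theta> * (va + wa)"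
    by (simp add: u defs inner_simps)
  have e2: "(\<rho> *\<^sub>R u) \<bullet> vt = \<rho> * (vvt + wvt)"
    by (simp add: u defs inner_simps)
  have e3: "(\<rho> *\<^sub>R outer u u) \<bullet> Gv = \<rho> * (vGv + wGv + vGw + wGw)"
    by (simp add: u defs inner_simps outer_inner matrix_vector_right_distrib)
  have e4: "(\<rho> *\<^sub>R u) \<bullet> (transpose Gv *v v - ((1 / r) *\<^sub>R (pr *\<^sub>R gr + ph *\<^sub>R a) - s r h *\<^sub>R a))
      = \<rho> * (vGv + vGw - ((pr * (vgr + wgr) + ph * (va + wa)) / r - s r h * (va + wa)))"
    unfolding inner_diff_right inner_scaleR_left tr
    by (simp add: u defs inner_simps matrix_vector_right_distrib algebra_simps add_divide_distrib)
  have e5: "u \<bullet> dS = v \<bullet> dS + w \<bullet> dS"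
    by (simp add: u inner_simps)
  have e6: "v \<bullet> (pr *\<^sub>R gr + ph *\<^sub>R a) = pr * vgr + ph * va"
    by (simp add: defs inner_simps)
  have "rel_rate p s \<kappa> \<mu> lam r h v rt ht vt gr a Gv dS dK (\<rho>, u, \<theta>, A, g) = N
      - \<rho> * s \<rho> \<theta> * ht - \<rho> * s \<rho> \<theta> * (va + wa)
      - (\<rho> * (vvt + wvt) + \<rho> * (vGv + wGv + vGw + wGw) + p \<rho> \<theta> * T)
      + (\<rho> * (vvt - ((pr * rt + ph * ht) / r - s r h * ht))
        + \<rho> * (vGv + vGw - ((pr * (vgr + wgr) + ph * (va + wa)) / r - s r h * (va + wa))))
      + (pr * rt + ph * ht) + w \<bullet> dS + (pr * vgr + ph * va + p r h * T) + (\<theta> - h) * (dK / h)"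
    unfolding rel_rate_def Let_def prod.case pr_def[symmetric] ph_def[symmetric] T_def[symmetric] e1 e2 e3 e4 e5 e6
    unfolding N_def vvt_def by (simp add: right_diff_distrib)
  also have "\<dots> = (N - (\<theta> - h) * SB / h)
      - \<rho> * (s \<rho> \<theta> - s r h) * wa - \<rho> * wGw + (1 - \<rho> / r) * (w \<bullet> dS)
      - X * ((\<rho> - r) * (s \<rho> \<theta> - s r h) + r * (s \<rho> \<theta> - s r h - sr * (\<rho> - r) - sh * (\<theta> - h)))
      - T * (p \<rho> \<theta> - p r h - pr * (\<rho> - r) - ph * (\<theta> - h))"
    unfolding dK wdS rt mx X_def defs[symmetric]
    using pos by (simp add: divide_simps) (simp add: algebra_simps power2_eq_square)
  finally show ?thesis
    unfolding N by (simp add: w_def wa_def wGw_def X_def T_def pr_def ph_def sr_def sh_def)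
qed

text \<open>Two-sided and Lipschitz bounds on a square are all that the estimate of
  \<open>diss\<close> uses. The class is stable under division by the temperature, so one estimate
  serves both viscosities and \<kappa> / \<theta>.\<close>

definition good_coefficient :: "real \<Rightarrow> real \<Rightarrow> (real \<Rightarrow> real \<Rightarrow> real) \<Rightarrow> bool"
  where "good_coefficient a b m \<longleftrightarrow> (\<exists>m0>0. \<exists>m1>0. \<exists>L>0. \<forall>\<rho> \<theta> r h. {\<rho>, \<theta>, r, h} \<subseteq> {a..b} \<longrightarrow>
    m0 \<le> m \<rho> \<theta> \<and> m \<rho> \<theta> \<le> m1 \<and> \<bar>m \<rho> \<theta> - m r h\<bar> \<le> L * (\<bar>\<rho> - r\<bar> + \<bar>\<theta> - h\<bar>))"

lemma good_coefficient_transport: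
  assumes "transport_coefficient m" "a > 0"
  shows "good_coefficient a b m"
proof -
  have m: "Ck_quadrant (Suc 0) m" and pos: "\<And>\<rho> \<theta>. \<rho> > 0 \<Longrightarrow> \<theta> > 0 \<Longrightarrow> m \<rho> \<theta> > 0"
    using assms by (auto simp: transport_coefficient_def)
  note m' = Ck_quadrant_Suc_D[OF m]
  obtain m0 where "m0 > 0" "\<And>\<rho> \<theta>. {\<rho>, \<theta>} \<subseteq> {a..b} \<Longrightarrow> m0 \<le> m \<rho> \<theta>"
    using quadrant_pos_lower_bound[OF Ck_quadrant_0D[OF m'] assms(2) pos] by blast
  moreover obtain m1 where "m1 > 0" "\<And>\<rho> \<theta>. {\<rho>, \<theta>} \<subseteq> {a..b} \<Longrightarrow> \<bar>m \<rho> \<theta>\<bar> \<le> m1"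
    using quadrant_bounded[OF m' assms(2)] by blast
  moreover obtain L where "L > 0" "\<And>\<rho> \<theta> r h. {\<rho>, \<theta>, r, h} \<subseteq> {a..b} \<Longrightarrow> \<bar>m \<rho> \<theta> - m r h\<bar> \<le> L * (\<bar>\<rho> - r\<bar> + \<bar>\<theta> - h\<bar>)"
    using quadrant_Lipschitz[OF m assms(2)] by blast
  ultimately have "\<forall>\<rho> \<theta> r h. {\<rho>, \<theta>, r, h} \<subseteq> {a..b} \<longrightarrow>
    m0 \<le> m \<rho> \<theta> \<and> m \<rho> \<theta> \<le> m1 \<and> \<bar>m \<rho> \<theta> - m r h\<bar> \<le> L * (\<bar>\<rho> - r\<bar> + \<bar>\<theta> - h\<bar>)"
    by (auto intro: order_trans[OF abs_ge_self])
  then show ?thesis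
    unfolding good_coefficient_def using \<open>m0 > 0\<close> \<open>m1 > 0\<close> \<open>L > 0\<close> by blast
qed

lemma divided_difference_bound:
  fixes a \<theta> h m m' m1 L d :: real
  assumes "a > 0" "\<theta> \<ge> a" "h \<ge> a" and m': "0 \<le> m'" "m' \<le> m1" and d: "\<bar>m - m'\<bar> \<le> L * d" "\<bar>\<theta> - h\<bar> \<le> d"
  shows "\<bar>m / \<theta> - m' / h\<bar> \<le> (L / a + m1 / a\<^sup>2) * d"
proof -
  have pos: "\<theta> > 0" "h > 0" using assms by auto
  have "m / \<theta> - m' / h = (m - m') / \<theta> + m' * (h - \<theta>) / (\<theta> * h)"
    using pos by (simp add: field_simps)
  also have "\<bar>\<dots>\<bar> \<le> \<bar>m - m'\<bar> / \<theta> + m' * \<bar>\<theta> - h\<bar> / (\<theta> * h)"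
    using pos m' by (auto intro!: order_trans[OF abs_triangle_ineq] simp: abs_mult abs_minus_commute)
  also have "\<dots> \<le> (L * d) / a + m1 * d / (a * a)"
  proof (intro add_mono frac_le)
    show "0 \<le> L * d" using d(1) abs_ge_zero order_trans by blast
    show "m' * \<bar>\<theta> - h\<bar> \<le> m1 * d" using m' d by (intro mult_mono) auto
    show "0 \<le> m1 * d" using m' d by (intro mult_nonneg_nonneg) auto
    show "a * a \<le> \<theta> * h" using assms(1-3) by (intro mult_mono) auto
  qed (use assms in auto)
  finally show ?thesis by (simp add: algebra_simps power2_eq_square)
qed

lemma good_coefficient_divide:
  assumes "good_coefficient a b m" "a > 0"
  shows "good_coefficient a b (\<lambda>\<rho> \<theta>. m \<rho> \<theta> / \<theta>)"
proof (cases "a \<le> b")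
  case True
  obtain m0 m1 L where m: "m0 > 0" "m1 > 0" "L > 0" and
    H: "\<And>\<rho> \<theta> r h. {\<rho>, \<theta>, r, h} \<subseteq> {a..b} \<Longrightarrow>
    m0 \<le> m \<rho> \<theta> \<and> m \<rho> \<theta> \<le> m1 \<and> \<bar>m \<rho> \<theta> - m r h\<bar> \<le> L * (\<bar>\<rho> - r\<bar> + \<bar>\<theta> - h\<bar>)"
    using assms unfolding good_coefficient_def by auto
  show ?thesis
    unfolding good_coefficient_def
  proof (intro exI conjI allI impI)
    fix \<rho> \<theta> r h assume *: "{\<rho>, \<theta>, r, h} \<subseteq> {a..b}"
    have **: "{r, h, \<rho>, \<theta>} \<subseteq> {a..b}" using * by auto
    show "m0 / b \<le> m \<rho> \<theta> / \<theta>" "m \<rho> \<theta> / \<theta> \<le> m1 / a"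
      using H[OF *] * m \<open>a > 0\<close> by (auto intro!: frac_le)
    show "\<bar>m \<rho> \<theta> / \<theta> - m r h / h\<bar> \<le> (L / a + m1 / a\<^sup>2) * (\<bar>\<rho> - r\<bar> + \<bar>\<theta> - h\<bar>)"
      by (rule divided_difference_bound) (use H[OF *] H[OF **] * m \<open>a > 0\<close> in auto)
  qed (use m \<open>a > 0\<close> True in \<open>auto intro!: add_pos_pos divide_pos_pos\<close>)
next
  case False
  then show ?thesis unfolding good_coefficient_def by (auto intro!: exI[of _ "1::real"])
qed

text \<open>With \<open>X = w + Y\<close> the form splits into a negative multiple of the square of
  \<open>w\<close>, a cross term whose coefficient is bounded by the deviation of the state, and a
  multiple of the square of \<open>Y\<close> with a coefficient quadratic in that deviation. Young's
  inequality spends half of the first part on the second. \<open>Y\<close> will come from the strong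
  solution, hence its bound \<open>B\<close>.\<close>

lemma diss_bound:
  assumes "good_coefficient a b m" "a > 0" "a \<le> b" "B \<ge> 0"
  obtains c C where "c > 0" "C \<ge> 0" "\<And>\<rho> \<theta> r h (X :: 'a::real_inner) Y. {\<rho>, \<theta>, r, h} \<subseteq> {a..b} \<Longrightarrow> norm Y \<le> B \<Longrightarrow>
    diss \<theta> h (m \<rho> \<theta>) (m r h) X Y \<le> C * ((\<rho> - r)\<^sup>2 + (\<theta> - h)\<^sup>2) - c * (norm (X - Y))\<^sup>2"
proof -
  obtain m0 m1 L where m: "m0 > 0" "m1 > 0" "L > 0" and
    H: "\<And>\<rho> \<theta> r h. {\<rho>, \<theta>, r, h} \<subseteq> {a..b} \<Longrightarrow>
    m0 \<le> m \<rho> \<theta> \<and> m \<rho> \<theta> \<le> m1 \<and> \<bar>m \<rho> \<theta> - m r h\<bar> \<le> L * (\<bar>\<rho> - r\<bar> + \<bar>\<theta> - h\<bar>)"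
    using assms(1) unfolding good_coefficient_def by auto
  \<comment> \<open>\<open>c\<close> bounds \<open>h / \<theta> * m\<close> from below.
    \<open>K1\<close> and \<open>K2\<close> bound the coefficient of the cross term and the
    difference of the quotients \<open>m / \<theta>\<close>, per unit of
    \<open>\<bar>\<rho> - r\<bar> + \<bar>\<theta> - h\<bar>\<close>.\<close>
  define c where "c = a / b * m0"
  define K1 where "K1 = L + 2 * m1 / a"
  define K2 where "K2 = L / a + m1 / a\<^sup>2"
  have c: "c > 0" using assms m by (simp add: c_def)
  have K: "K1 \<ge> 0" "K2 \<ge> 0" using assms m by (auto simp: K1_def K2_def)
  define C where "C = 2 * (K1\<^sup>2 * B\<^sup>2 / (2 * c) + K2 * B\<^sup>2)"
  show ?thesis
  proof (rule that[of "c / 2" C])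
    fix \<rho> \<theta> r h and X Y :: 'a assume *: "{\<rho>, \<theta>, r, h} \<subseteq> {a..b}" and Y: "norm Y \<le> B"
    have **: "{r, h, \<rho>, \<theta>} \<subseteq> {a..b}" using * by auto
    have pos: "\<theta> > 0" "h > 0" using * assms by auto
    define M M' where "M = m \<rho> \<theta>" and "M' = m r h"
    define d where "d = \<bar>\<rho> - r\<bar> + \<bar>\<theta> - h\<bar>"
    define w where "w = X - Y"
    have X: "X = w + Y" by (simp add: w_def)
    have d: "d \<ge> 0" "\<bar>\<theta> - h\<bar> \<le> d" by (auto simp: d_def)
    have MM: "m0 \<le> M" "M \<le> m1" "m0 \<le> M'" "M' \<le> m1" "\<bar>M - M'\<bar> \<le> L * d"
      using H[OF *] H[OF **] by (auto simp: M_def M'_def d_def)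
    have eq: "diss \<theta> h M M' X Y = - (h / \<theta> * M * (norm w)\<^sup>2) + (M' - M + 2 * M * (\<theta> - h) / \<theta>) * (w \<bullet> Y)
        + (\<theta> - h) * (M / \<theta> - M' / h) * (norm Y)\<^sup>2"
      unfolding diss_def X power2_norm_eq_inner using pos
      by (simp add: inner_simps inner_commute[of Y w] divide_simps) (simp add: algebra_simps)
    have 1: "c * (norm w)\<^sup>2 \<le> (h / \<theta> * M) * (norm w)\<^sup>2"
      unfolding c_def using * MM m assms by (intro mult_right_mono mult_mono frac_le) auto
    have "\<bar>M' - M + 2 * M * (\<theta> - h) / \<theta>\<bar> \<le> \<bar>M - M'\<bar> + 2 * M * \<bar>\<theta> - h\<bar> / \<theta>"
      using pos MM m by (auto intro!: order_trans[OF abs_triangle_ineq] simp: abs_mult abs_minus_commute)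
    also have "\<dots> \<le> L * d + 2 * m1 * d / a"
      using pos MM m * d assms by (intro add_mono frac_le mult_mono mult_nonneg_nonneg) auto
    finally have k1: "\<bar>M' - M + 2 * M * (\<theta> - h) / \<theta>\<bar> \<le> K1 * d" by (simp add: K1_def algebra_simps)
    have "(M' - M + 2 * M * (\<theta> - h) / \<theta>) * (w \<bullet> Y) \<le> \<bar>M' - M + 2 * M * (\<theta> - h) / \<theta>\<bar> * \<bar>w \<bullet> Y\<bar>"
      by (metis abs_ge_self abs_mult)
    also have "\<dots> \<le> (K1 * d) * (norm w * B)"
      using k1 K d Y Cauchy_Schwarz_ineq2[of w Y] mult_left_mono[OF Y, of "norm w"] by (intro mult_mono) auto
    also have "\<dots> \<le> c / 2 * (norm w)\<^sup>2 + K1\<^sup>2 * B\<^sup>2 / (2 * c) * d\<^sup>2"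
    proof -
      have "0 \<le> (c * norm w - K1 * d * B)\<^sup>2 / (2 * c)" using c by simp
      also have "\<dots> = c / 2 * (norm w)\<^sup>2 + K1\<^sup>2 * B\<^sup>2 / (2 * c) * d\<^sup>2 - (K1 * d) * (norm w * B)"
        using c by (simp add: power2_diff power_mult_distrib field_simps power2_eq_square)
      finally show ?thesis by linarith
    qed
    finally have 2: "(M' - M + 2 * M * (\<theta> - h) / \<theta>) * (w \<bullet> Y) \<le> c / 2 * (norm w)\<^sup>2 + K1\<^sup>2 * B\<^sup>2 / (2 * c) * d\<^sup>2" .
    have k2: "\<bar>M / \<theta> - M' / h\<bar> \<le> K2 * d"
      unfolding K2_def by (rule divided_difference_bound) (use MM m * d assms in auto)
    have "(\<theta> - h) * (M / \<theta> - M' / h) \<le> \<bar>\<theta> - h\<bar> * \<bar>M / \<theta> - M' / h\<bar>"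
      by (metis abs_ge_self abs_mult)
    also have "\<dots> \<le> d * (K2 * d)" using k2 d by (intro mult_mono) auto
    finally have "(\<theta> - h) * (M / \<theta> - M' / h) * (norm Y)\<^sup>2 \<le> (d * (K2 * d)) * (norm Y)\<^sup>2"
      by (rule mult_right_mono) simp
    also have "\<dots> \<le> (d * (K2 * d)) * B\<^sup>2"
      using Y d K by (intro mult_left_mono power_mono) auto
    finally have "(\<theta> - h) * (M / \<theta> - M' / h) * (norm Y)\<^sup>2 \<le> (d * (K2 * d)) * B\<^sup>2" .
    then have 3: "(\<theta> - h) * (M / \<theta> - M' / h) * (norm Y)\<^sup>2 \<le> K2 * B\<^sup>2 * d\<^sup>2"
      by (simp add: power2_eq_square mult_ac)
    have "diss \<theta> h M M' X Y \<le> (K1\<^sup>2 * B\<^sup>2 / (2 * c) + K2 * B\<^sup>2) * d\<^sup>2 - c / 2 * (norm w)\<^sup>2"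
      unfolding eq distrib_right[of _ _ "d\<^sup>2"] using 1 2 3 by linarith
    also have "\<dots> \<le> (K1\<^sup>2 * B\<^sup>2 / (2 * c) + K2 * B\<^sup>2) * (2 * ((\<rho> - r)\<^sup>2 + (\<theta> - h)\<^sup>2)) - c / 2 * (norm w)\<^sup>2"
      using K c sum_abs_squared_le[of "\<rho> - r" "\<theta> - h"]
      by (intro diff_mono mult_left_mono order_refl add_nonneg_nonneg divide_nonneg_pos mult_nonneg_nonneg)
        (auto simp: d_def)
    also have "(K1\<^sup>2 * B\<^sup>2 / (2 * c) + K2 * B\<^sup>2) * (2 * ((\<rho> - r)\<^sup>2 + (\<theta> - h)\<^sup>2)) = C * ((\<rho> - r)\<^sup>2 + (\<theta> - h)\<^sup>2)"
      by (simp only: C_def mult_ac)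
    finally show "diss \<theta> h (m \<rho> \<theta>) (m r h) X Y \<le> C * ((\<rho> - r)\<^sup>2 + (\<theta> - h)\<^sup>2) - c / 2 * (norm (X - Y))\<^sup>2"
      by (simp add: M_def M'_def w_def)
  qed (use c K in \<open>auto simp: C_def\<close>)
qed

text \<open>Written in the form that the balance laws deliver: ballistic energy, momentum tested
  with \<open>v\<close>, density tested with kinetic energy minus chemical potential, pressure of
  the strong state. Completing the square in \<open>rel_energy_eq\<close> exhibits its sign.\<close>

definition rel_energy :: "(real \<Rightarrow> real \<Rightarrow> real) \<Rightarrow> (real \<Rightarrow> real \<Rightarrow> real) \<Rightarrow> (real \<Rightarrow> real \<Rightarrow> real)
    \<Rightarrow> real \<Rightarrow> real^'d::finite \<Rightarrow> real \<Rightarrow> 'd phase \<Rightarrow> real"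
  where "rel_energy p e s r v h = (\<lambda>(\<rho>, u, \<theta>, A, g). ballistic e s h \<rho> u \<theta> - (\<rho> *\<^sub>R u) \<bullet> v
    + \<rho> * ((norm v)\<^sup>2 / 2 - (e r h - h * s r h + p r h / r)) + p r h)"

lemma rel_energy_eq:
  "rel_energy p e s r v h (\<rho>, u, \<theta>, A, g) = \<rho> / 2 * (norm (u - v))\<^sup>2 + thermo_rel p e s \<rho> \<theta> r h"
  unfolding rel_energy_def thermo_rel_def ballistic_def power2_norm_eq_inner
  by (simp add: inner_simps inner_commute[of v u] algebra_simps)

text \<open>Since the density is at least \<open>a\<close>, the kinetic part controls the square of
  the velocity deviation, although the velocity itself is not confined to a bounded set.\<close>

lemma (in thermodynamics) rel_energy_coercive:
  assumes "a > 0"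
  obtains c where "c > 0" "\<And>\<rho> \<theta> r h u (v :: real^'d::finite) A g. {\<rho>, \<theta>, r, h} \<subseteq> {a..b} \<Longrightarrow>
    c * ((\<rho> - r)\<^sup>2 + (\<theta> - h)\<^sup>2 + (norm (u - v))\<^sup>2) \<le> rel_energy p e s r v h (\<rho>, u, \<theta>, A, g)"
proof -
  obtain c where c: "c > 0" "\<And>\<rho> \<theta> r h. {\<rho>, \<theta>, r, h} \<subseteq> {a..b} \<Longrightarrow>
    c * ((\<rho> - r)\<^sup>2 + (\<theta> - h)\<^sup>2) \<le> thermo_rel p e s \<rho> \<theta> r h"
    using thermo_rel_coercive[OF assms] by blast
  show ?thesis
  proof (rule that[of "min c (a / 2)"])
    fix \<rho> \<theta> r h A g and u v :: "real^'d" assume *: "{\<rho>, \<theta>, r, h} \<subseteq> {a..b}"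
    have "min c (a / 2) * ((\<rho> - r)\<^sup>2 + (\<theta> - h)\<^sup>2) \<le> c * ((\<rho> - r)\<^sup>2 + (\<theta> - h)\<^sup>2)"
      by (intro mult_right_mono) auto
    moreover have "min c (a / 2) * (norm (u - v))\<^sup>2 \<le> \<rho> / 2 * (norm (u - v))\<^sup>2"
      using * by (intro mult_right_mono) auto
    ultimately show "min c (a / 2) * ((\<rho> - r)\<^sup>2 + (\<theta> - h)\<^sup>2 + (norm (u - v))\<^sup>2) \<le> rel_energy p e s r v h (\<rho>, u, \<theta>, A, g)"
      unfolding rel_energy_eq using c(2)[OF *] by (simp add: algebra_simps)
  qed (use c assms in auto)
qed

text \<open>The velocity may be unbounded, but \<open>rel_rate_eq\<close> contains it only through
  \<open>u - v\<close> and at most quadratically; mixed products with the deviations of density and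
  temperature are split by Young's inequality. The gradient variables occur in the dissipation forms
  alone, which supply the negative terms.\<close>

lemma (in thermodynamics) rel_rate_bound:
  assumes \<kappa>: "transport_coefficient \<kappa>" and \<mu>: "transport_coefficient \<mu>" and lam: "transport_coefficient lam"
    and ab: "a > 0" "a \<le> b" and B: "B \<ge> 0"
  obtains c C where "c > 0" "C \<ge> 0"
    "\<And>r h (v :: real^'d::finite) rt ht vt gr q Gv dS dK \<rho> u \<theta> A g.
      {\<rho>, \<theta>, r, h} \<subseteq> {a..b} \<Longrightarrow> transpose A = A \<Longrightarrow>
      norm v \<le> B \<Longrightarrow> \<bar>ht\<bar> \<le> B \<Longrightarrow> norm q \<le> B \<Longrightarrow> norm Gv \<le> B \<Longrightarrow> norm dS \<le> B \<Longrightarrow>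
      rt + v \<bullet> gr + r * trace Gv = 0 \<Longrightarrow>
      r *\<^sub>R (vt + Gv *v v) + (d_rho p r h *\<^sub>R gr + d_theta p r h *\<^sub>R q) = dS \<Longrightarrow>
      r * (d_rho e r h * (rt + v \<bullet> gr) + d_theta e r h * (ht + v \<bullet> q))
        = dK + stress \<mu> lam r h Gv \<bullet> symm Gv - p r h * trace Gv \<Longrightarrow>
      rel_rate p s \<kappa> \<mu> lam r h v rt ht vt gr q Gv dS dK (\<rho>, u, \<theta>, A, g)
        \<le> C * ((\<rho> - r)\<^sup>2 + (\<theta> - h)\<^sup>2 + (norm (u - v))\<^sup>2) - c * ((norm (A - symm Gv))\<^sup>2 + (norm (g - q))\<^sup>2)"
proof -
  let ?n = "real CARD('d)"
  have n: "?n \<ge> 0" by simp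
  obtain c1 C1 where 1: "c1 > 0" "C1 \<ge> 0" "\<And>\<rho> \<theta> r h (X :: real^'d^'d) Y. {\<rho>, \<theta>, r, h} \<subseteq> {a..b} \<Longrightarrow> norm Y \<le> B \<Longrightarrow>
    diss \<theta> h (\<mu> \<rho> \<theta>) (\<mu> r h) X Y \<le> C1 * ((\<rho> - r)\<^sup>2 + (\<theta> - h)\<^sup>2) - c1 * (norm (X - Y))\<^sup>2"
    using diss_bound[OF good_coefficient_transport[OF \<mu> ab(1)] ab B] by blast
  obtain c2 C2 where 2: "c2 > 0" "C2 \<ge> 0" "\<And>\<rho> \<theta> r h (X :: real) Y. {\<rho>, \<theta>, r, h} \<subseteq> {a..b} \<Longrightarrow> norm Y \<le> ?n * B \<Longrightarrow>
    diss \<theta> h (lam \<rho> \<theta>) (lam r h) X Y \<le> C2 * ((\<rho> - r)\<^sup>2 + (\<theta> - h)\<^sup>2) - c2 * (norm (X - Y))\<^sup>2"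
    using diss_bound[OF good_coefficient_transport[OF lam ab(1)] ab mult_nonneg_nonneg[OF n B]] by blast
  obtain c3 C3 where 3: "c3 > 0" "C3 \<ge> 0" "\<And>\<rho> \<theta> r h (X :: real^'d) Y. {\<rho>, \<theta>, r, h} \<subseteq> {a..b} \<Longrightarrow> norm Y \<le> B \<Longrightarrow>
    diss \<theta> h (\<kappa> \<rho> \<theta> / \<theta>) (\<kappa> r h / h) X Y \<le> C3 * ((\<rho> - r)\<^sup>2 + (\<theta> - h)\<^sup>2) - c3 * (norm (X - Y))\<^sup>2"
    using diss_bound[OF good_coefficient_divide[OF good_coefficient_transport[OF \<kappa> ab(1)] ab(1)] ab B] by blast
  obtain Ls where Ls: "Ls > 0" "\<And>\<rho> \<theta> r h. {\<rho>, \<theta>, r, h} \<subseteq> {a..b} \<Longrightarrow> \<bar>s \<rho> \<theta> - s r h\<bar> \<le> Ls * (\<bar>\<rho> - r\<bar> + \<bar>\<theta> - h\<bar>)"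
    using quadrant_Lipschitz[OF s1(2) ab(1)] by blast
  obtain Ts where Ts: "Ts > 0" "\<And>\<rho> \<theta> r h. {\<rho>, \<theta>, r, h} \<subseteq> {a..b} \<Longrightarrow>
    \<bar>s \<rho> \<theta> - s r h - d_rho s r h * (\<rho> - r) - d_theta s r h * (\<theta> - h)\<bar> \<le> Ts * ((\<rho> - r)\<^sup>2 + (\<theta> - h)\<^sup>2)"
    using quadrant_Taylor[OF s2 ab(1)] by blast
  obtain Tp where Tp: "Tp > 0" "\<And>\<rho> \<theta> r h. {\<rho>, \<theta>, r, h} \<subseteq> {a..b} \<Longrightarrow>
    \<bar>p \<rho> \<theta> - p r h - d_rho p r h * (\<rho> - r) - d_theta p r h * (\<theta> - h)\<bar> \<le> Tp * ((\<rho> - r)\<^sup>2 + (\<theta> - h)\<^sup>2)"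
    using quadrant_Taylor[OF p2 ab(1)] by blast
  \<comment> \<open>The summands follow the terms of \<open>rel_rate_eq\<close>: the three
    dissipation forms, entropy against temperature gradient, convection, stress divergence, entropy
    remainders, pressure remainder. The factors 2 come from \<open>dw\<close> and from
    \<open>d * d \<le> 2 * D\<close>.\<close>
  define C where "C = C1 + C2 + C3 + b * Ls * B * 2 + b * B + B / a * 2 + (B + B * B) * (2 * Ls + b * Ts) + (?n * B) * Tp"
  define c where "c = min (min c1 c2) c3"
  show ?thesis
  proof (rule that[of c C])
    show "c > 0" using 1 2 3 by (simp add: c_def)
    show "C \<ge> 0" unfolding C_def using 1 2 3 Ls Ts Tp ab B by (intro add_nonneg_nonneg mult_nonneg_nonneg) auto
    fix r h rt ht dK \<rho> \<theta> and v vt gr q dS u g :: "real^'d" and Gv A :: "real^'d^'d"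
    assume *: "{\<rho>, \<theta>, r, h} \<subseteq> {a..b}" and A: "transpose A = A"
      and bds: "norm v \<le> B" "\<bar>ht\<bar> \<le> B" "norm q \<le> B" "norm Gv \<le> B" "norm dS \<le> B"
      and eqs: "rt + v \<bullet> gr + r * trace Gv = 0"
        "r *\<^sub>R (vt + Gv *v v) + (d_rho p r h *\<^sub>R gr + d_theta p r h *\<^sub>R q) = dS"
        "r * (d_rho e r h * (rt + v \<bullet> gr) + d_theta e r h * (ht + v \<bullet> q))
          = dK + stress \<mu> lam r h Gv \<bullet> symm Gv - p r h * trace Gv"
    have pos: "r > 0" "h > 0" "\<theta> > 0" and \<rho>: "0 \<le> \<rho>" "\<rho> \<le> b" and r: "a \<le> r" "0 \<le> r" "r \<le> b" using * ab by auto
    define D where "D = (\<rho> - r)\<^sup>2 + (\<theta> - h)\<^sup>2"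
    define w where "w = u - v"
    define d where "d = \<bar>\<rho> - r\<bar> + \<bar>\<theta> - h\<bar>"
    have D0: "D \<ge> 0" and d: "d \<ge> 0" "\<bar>\<rho> - r\<bar> \<le> d" "d\<^sup>2 \<le> 2 * D" "d * d \<le> 2 * D"
      using sum_abs_squared_le[of "\<rho> - r" "\<theta> - h"] by (auto simp: D_def d_def power2_eq_square)
    define E where "E = D + (norm w)\<^sup>2"
    have E: "D \<le> E" "(norm w)\<^sup>2 \<le> E" "E \<ge> 0" using D0 by (auto simp: E_def)
    have dw: "d * norm w \<le> 2 * E"
    proof -
      have "2 * (d * norm w) \<le> d\<^sup>2 + (norm w)\<^sup>2" using sum_squares_bound[of d "norm w"] by simp
      then have "2 * (d * norm w) \<le> 2 * D + (norm w)\<^sup>2" using d(3) by linarith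
      also have "\<dots> \<le> 2 * (2 * E)" using D0 zero_le_power2[of "norm w"] by (simp add: E_def)
      finally show ?thesis by simp
    qed
    have T: "norm (trace Gv) \<le> ?n * B"
      unfolding real_norm_def by (rule order_trans[OF abs_trace_le mult_left_mono[OF bds(4) n]])
    have i1: "diss \<theta> h (\<mu> \<rho> \<theta>) (\<mu> r h) (dev A) (dev Gv) \<le> C1 * E - c1 * (norm (dev A - dev Gv))\<^sup>2"
      using 1(3)[OF *, of "dev Gv" "dev A"] norm_dev_le[of Gv] bds mult_left_mono[OF E(1) 1(2)] by (simp add: D_def)
    have i2: "diss \<theta> h (lam \<rho> \<theta>) (lam r h) (trace A) (trace Gv) \<le> C2 * E - c2 * (trace A - trace Gv)\<^sup>2"
      using 2(3)[OF * T, of "trace A"] mult_left_mono[OF E(1) 2(2)] by (simp add: D_def)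
    have i3: "diss \<theta> h (\<kappa> \<rho> \<theta> / \<theta>) (\<kappa> r h / h) g q \<le> C3 * E - c3 * (norm (g - q))\<^sup>2"
      using 3(3)[OF * bds(3), of g] mult_left_mono[OF E(1) 3(2)] by (simp add: D_def)
    have ab': "x * y \<le> \<bar>x\<bar> * \<bar>y\<bar>" for x y :: real by (metis abs_ge_self abs_mult)
    have sl: "\<bar>s \<rho> \<theta> - s r h\<bar> \<le> Ls * d" using Ls(2)[OF *] by (simp add: d_def)
    have i4: "- \<rho> * (s \<rho> \<theta> - s r h) * (w \<bullet> q) \<le> (b * Ls * B * 2) * E"
    proof -
      have "- \<rho> * (s \<rho> \<theta> - s r h) * (w \<bullet> q) \<le> (\<rho> * \<bar>s \<rho> \<theta> - s r h\<bar>) * \<bar>w \<bullet> q\<bar>"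
        using ab'[of "- \<rho> * (s \<rho> \<theta> - s r h)" "w \<bullet> q"] \<rho> by (simp add: abs_mult)
      also have "\<dots> \<le> (b * (Ls * d)) * (norm w * B)"
        using \<rho> sl d Ls Cauchy_Schwarz_ineq2[of w q] mult_left_mono[OF bds(3), of "norm w"] by (intro mult_mono) auto
      also have "\<dots> = (b * Ls * B) * (d * norm w)" by simp
      also have "\<dots> \<le> (b * Ls * B) * (2 * E)" using dw ab Ls B by (intro mult_left_mono) auto
      finally show ?thesis by simp
    qed
    have i5: "- \<rho> * (w \<bullet> (Gv *v w)) \<le> (b * B) * E"
    proof -
      have "- \<rho> * (w \<bullet> (Gv *v w)) \<le> \<rho> * \<bar>w \<bullet> (Gv *v w)\<bar>" using ab'[of "-\<rho>" "w \<bullet> (Gv *v w)"] \<rho> by simp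
      also have "\<dots> \<le> b * (norm w * (B * norm w))"
        using \<rho> Cauchy_Schwarz_ineq2[of w "Gv *v w"] norm_matrix_vector_le[of Gv w] mult_right_mono[OF bds(4), of "norm w"]
        by (intro mult_mono order_trans[OF Cauchy_Schwarz_ineq2] mult_left_mono) auto
      also have "\<dots> = (b * B) * (norm w)\<^sup>2" by (simp add: power2_eq_square)
      also have "\<dots> \<le> (b * B) * E" using E ab B by (intro mult_left_mono) auto
      finally show ?thesis .
    qed
    have i6: "(1 - \<rho> / r) * (w \<bullet> dS) \<le> (B / a * 2) * E"
    proof -
      have "1 - \<rho> / r = (r - \<rho>) / r" using pos by (simp add: diff_divide_distrib)
      then have "\<bar>1 - \<rho> / r\<bar> = \<bar>\<rho> - r\<bar> / r" using pos by (simp add: abs_divide abs_minus_commute)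
      also have "\<dots> \<le> d / a" using r ab d by (intro frac_le) auto
      finally have 0: "\<bar>1 - \<rho> / r\<bar> \<le> d / a" .
      have "(1 - \<rho> / r) * (w \<bullet> dS) \<le> \<bar>1 - \<rho> / r\<bar> * \<bar>w \<bullet> dS\<bar>" by (rule ab')
      also have "\<dots> \<le> (d / a) * (norm w * B)"
        using 0 d ab Cauchy_Schwarz_ineq2[of w dS] mult_left_mono[OF bds(5), of "norm w"] by (intro mult_mono) auto
      also have "\<dots> = B / a * (d * norm w)" by simp
      also have "\<dots> \<le> B / a * (2 * E)" using dw ab B by (intro mult_left_mono) auto
      finally show ?thesis by simp
    qed
    let ?Rs = "s \<rho> \<theta> - s r h - d_rho s r h * (\<rho> - r) - d_theta s r h * (\<theta> - h)"
    let ?Rp = "p \<rho> \<theta> - p r h - d_rho p r h * (\<rho> - r) - d_theta p r h * (\<theta> - h)"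
    have i7: "- (ht + v \<bullet> q) * ((\<rho> - r) * (s \<rho> \<theta> - s r h) + r * ?Rs) \<le> ((B + B * B) * (2 * Ls + b * Ts)) * E"
    proof -
      have "\<bar>v \<bullet> q\<bar> \<le> B * B"
        using Cauchy_Schwarz_ineq2[of v q] mult_mono[OF bds(1,3) B norm_ge_zero] by linarith
      then have x: "\<bar>- (ht + v \<bullet> q)\<bar> \<le> B + B * B" using bds(2) by linarith
      have "\<bar>(\<rho> - r) * (s \<rho> \<theta> - s r h) + r * ?Rs\<bar> \<le> \<bar>\<rho> - r\<bar> * \<bar>s \<rho> \<theta> - s r h\<bar> + r * \<bar>?Rs\<bar>"
        using abs_triangle_ineq[of "(\<rho> - r) * (s \<rho> \<theta> - s r h)" "r * ?Rs"] pos by (simp add: abs_mult)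
      also have "\<dots> \<le> d * (Ls * d) + b * (Ts * D)"
        using sl d r Ts(2)[OF *] ab D0 Ts(1) Ls(1) by (intro add_mono mult_mono) (simp_all add: D_def)
      also have "\<dots> \<le> (2 * Ls + b * Ts) * E"
      proof -
        have "d * (Ls * d) \<le> Ls * (2 * E)" using mult_left_mono[of "d * d" "2 * E" Ls] d(4) E(1) Ls(1) by (simp add: mult_ac)
        moreover have "b * (Ts * D) \<le> b * (Ts * E)" using E ab Ts by (intro mult_left_mono) auto
        ultimately show ?thesis by (simp add: algebra_simps)
      qed
      finally have y: "\<bar>(\<rho> - r) * (s \<rho> \<theta> - s r h) + r * ?Rs\<bar> \<le> (2 * Ls + b * Ts) * E" .
      have "- (ht + v \<bullet> q) * ((\<rho> - r) * (s \<rho> \<theta> - s r h) + r * ?Rs) \<le> (B + B * B) * ((2 * Ls + b * Ts) * E)"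
        by (rule order_trans[OF ab' mult_mono[OF x y]]) (use B in auto)
      then show ?thesis by (simp add: mult_ac)
    qed
    have i8: "- trace Gv * ?Rp \<le> ((?n * B) * Tp) * E"
    proof -
      have "- trace Gv * ?Rp \<le> (?n * B) * (Tp * D)"
      proof (rule order_trans[OF ab' mult_mono])
        show "\<bar>- trace Gv\<bar> \<le> ?n * B" using T by simp
        show "\<bar>?Rp\<bar> \<le> Tp * D" using Tp(2)[OF *] by (simp add: D_def)
      qed (use B in auto)
      also have "\<dots> \<le> (?n * B) * (Tp * E)" using E B Tp by (intro mult_left_mono) auto
      finally show ?thesis by (simp add: mult_ac)
    qed
    \<comment> \<open>The deviatoric part and the trace are merged into one norm, which uses the
      symmetry of \<open>A\<close>; \<open>c\<close> is the smallest of the three dissipation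
      constants.\<close>
    have j: "c * ((norm (A - symm Gv))\<^sup>2 + (norm (g - q))\<^sup>2)
        \<le> c1 * (norm (dev A - dev Gv))\<^sup>2 + c2 * (trace A - trace Gv)\<^sup>2 + c3 * (norm (g - q))\<^sup>2"
    proof -
      have "c * ((norm (A - symm Gv))\<^sup>2 + (norm (g - q))\<^sup>2)
          \<le> c * ((norm (dev A - dev Gv))\<^sup>2 + (trace A - trace Gv)\<^sup>2 + (norm (g - q))\<^sup>2)"
        using norm_symm_diff_le[OF A, of Gv] \<open>c > 0\<close> by (intro mult_left_mono) auto
      also have "\<dots> \<le> c1 * (norm (dev A - dev Gv))\<^sup>2 + c2 * (trace A - trace Gv)\<^sup>2 + c3 * (norm (g - q))\<^sup>2"
        unfolding distrib_left by (intro add_mono mult_right_mono) (auto simp: c_def)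
      finally show ?thesis .
    qed
    \<comment> \<open>Stated for arbitrary reals, so that the long terms of the rate are atoms for
      linear arithmetic.\<close>
    have comb: "d1 + d2 + d3 - y4 - y5 + y6 - y7 - y8 \<le> (k1 + k2 + k3 + k4 + k5 + k6 + k7 + k8) * E - z"
      if "d1 \<le> k1 * E - z1" "d2 \<le> k2 * E - z2" "d3 \<le> k3 * E - z3" "- y4 \<le> k4 * E" "- y5 \<le> k5 * E"
        "y6 \<le> k6 * E" "- y7 \<le> k7 * E" "- y8 \<le> k8 * E" "z \<le> z1 + z2 + z3"
      for d1 d2 d3 y4 y5 y6 y7 y8 k1 k2 k3 k4 k5 k6 k7 k8 z z1 z2 z3
      using that unfolding distrib_right by linarith
    have "rel_rate p s \<kappa> \<mu> lam r h v rt ht vt gr q Gv dS dK (\<rho>, u, \<theta>, A, g) \<le> C * E - c * ((norm (A - symm Gv))\<^sup>2 + (norm (g - q))\<^sup>2)"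
      unfolding rel_rate_eq[OF pos eqs] C_def w_def[symmetric]
      by (rule comb[OF i1 i2 i3 i4[unfolded mult_minus_left] i5[unfolded mult_minus_left] i6
            i7[unfolded mult_minus_left] i8[unfolded mult_minus_left] j])
    then show "rel_rate p s \<kappa> \<mu> lam r h v rt ht vt gr q Gv dS dK (\<rho>, u, \<theta>, A, g)
        \<le> C * ((\<rho> - r)\<^sup>2 + (\<theta> - h)\<^sup>2 + (norm (u - v))\<^sup>2) - c * ((norm (A - symm Gv))\<^sup>2 + (norm (g - q))\<^sup>2)"
      by (simp add: E_def D_def w_def)
  qed
qed

section \<open>Calculus of the strong solution\<close>

text \<open>Derivative along the directions in the range of \<open>\<iota>\<close>, extending continuously to the closure.
  With \<open>\<iota> = id\<close> this is \<open>C\<^sup>1\<close> regularity up to the boundary; with \<open>\<iota> = Pair 0\<close> only the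
  spatial derivative is involved.\<close>

definition Cder :: "('h::euclidean_space \<Rightarrow> 'a::euclidean_space) \<Rightarrow> 'a set
    \<Rightarrow> ('a \<Rightarrow> 'b::real_normed_vector) \<Rightarrow> ('a \<Rightarrow> 'h \<Rightarrow> 'b) \<Rightarrow> bool"
  where "Cder \<iota> U f f' \<longleftrightarrow> continuous_on (closure U) f \<and> (\<forall>z\<in>closure U. linear (f' z)) \<and>
    (\<forall>h. continuous_on (closure U) (\<lambda>z. f' z h)) \<and>
    (\<forall>z\<in>U. ((\<lambda>h. f (z + \<iota> h)) has_derivative f' z) (at 0))"

section \<open>Rules for derivatives that extend to the closure\<close>

lemma CderD:
  assumes "Cder \<iota> U f f'"
  shows "continuous_on (closure U) f" "\<And>z. z \<in> closure U \<Longrightarrow> linear (f' z)"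
    "continuous_on (closure U) (\<lambda>z. f' z h)"
    "\<And>z. z \<in> U \<Longrightarrow> ((\<lambda>h. f (z + \<iota> h)) has_derivative f' z) (at 0)"
  using assms by (auto simp: Cder_def)

lemma Cder_bilinear:
  fixes f :: "'a::euclidean_space \<Rightarrow> 'b::real_normed_vector" and g :: "'a \<Rightarrow> 'c::real_normed_vector"
    and B :: "'b \<Rightarrow> 'c \<Rightarrow> 'd::real_normed_vector"
  assumes f: "Cder \<iota> U f f'" and g: "Cder \<iota> U g g'" and B: "bounded_bilinear B" and "\<iota> 0 = 0"
  shows "Cder \<iota> U (\<lambda>z. B (f z) (g z)) (\<lambda>z h. B (f z) (g' z h) + B (f' z h) (g z))"
  unfolding Cder_def
proof (intro conjI ballI allI)
  interpret bounded_bilinear B by fact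
  show "continuous_on (closure U) (\<lambda>z. B (f z) (g z))"
    using CderD(1)[OF f] CderD(1)[OF g] by (rule continuous_on)
  show "continuous_on (closure U) (\<lambda>z. B (f z) (g' z h) + B (f' z h) (g z))" for h
    by (intro continuous_on_add continuous_on CderD(1)[OF f] CderD(1)[OF g] CderD(3)[OF f] CderD(3)[OF g])
  show "linear (\<lambda>h. B (f z) (g' z h) + B (f' z h) (g z))" if "z \<in> closure U" for z
    by (rule linearI)
      (simp_all add: linear_add[OF CderD(2)[OF f that]] linear_cmul[OF CderD(2)[OF f that]]
        linear_add[OF CderD(2)[OF g that]] linear_cmul[OF CderD(2)[OF g that]]
        add_left add_right scaleR_left scaleR_right scaleR_add_right)
  show "((\<lambda>h. B (f (z + \<iota> h)) (g (z + \<iota> h))) has_derivative (\<lambda>h. B (f z) (g' z h) + B (f' z h) (g z))) (at 0)"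
    if "z \<in> U" for z
    using FDERIV[OF CderD(4)[OF f that] CderD(4)[OF g that]] \<open>\<iota> 0 = 0\<close> by simp
qed

lemma Cder_linear:
  assumes f: "Cder \<iota> U f f'" and L: "bounded_linear L"
  shows "Cder \<iota> U (\<lambda>z. L (f z)) (\<lambda>z h. L (f' z h))"
  unfolding Cder_def
proof (intro conjI ballI allI)
  interpret bounded_linear L by fact
  show "continuous_on (closure U) (\<lambda>z. L (f z))" "continuous_on (closure U) (\<lambda>z. L (f' z h))" for h
    by (rule continuous_on[OF CderD(1)[OF f]], rule continuous_on[OF CderD(3)[OF f]])
  show "linear (\<lambda>h. L (f' z h))" if "z \<in> closure U" for z
    by (rule linearI)
      (simp_all add: linear_add[OF CderD(2)[OF f that]] linear_cmul[OF CderD(2)[OF f that]] add scale)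
  show "((\<lambda>h. L (f (z + \<iota> h))) has_derivative (\<lambda>h. L (f' z h))) (at 0)" if "z \<in> U" for z
    by (rule has_derivative[OF CderD(4)[OF f that]])
qed

lemma Cder_add:
  assumes f: "Cder \<iota> U f f'" and g: "Cder \<iota> U g g'"
  shows "Cder \<iota> U (\<lambda>z. f z + g z) (\<lambda>z h. f' z h + g' z h)"
  unfolding Cder_def
proof (intro conjI ballI allI)
  show "continuous_on (closure U) (\<lambda>z. f z + g z)" "continuous_on (closure U) (\<lambda>z. f' z h + g' z h)" for h
    by (rule continuous_on_add[OF CderD(1)[OF f] CderD(1)[OF g]], rule continuous_on_add[OF CderD(3)[OF f] CderD(3)[OF g]])
  show "linear (\<lambda>h. f' z h + g' z h)" if "z \<in> closure U" for z
    by (rule linear_compose_add[OF CderD(2)[OF f that] CderD(2)[OF g that]])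
  show "((\<lambda>h. f (z + \<iota> h) + g (z + \<iota> h)) has_derivative (\<lambda>h. f' z h + g' z h)) (at 0)" if "z \<in> U" for z
    by (rule has_derivative_add[OF CderD(4)[OF f that] CderD(4)[OF g that]])
qed

lemma Cder_diff:
  assumes f: "Cder \<iota> U f f'" and g: "Cder \<iota> U g g'"
  shows "Cder \<iota> U (\<lambda>z. f z - g z) (\<lambda>z h. f' z h - g' z h)"
  using Cder_add[OF f Cder_linear[OF g bounded_linear_minus[OF bounded_linear_ident]]] by simp

lemma Cder_const: "Cder \<iota> U (\<lambda>z. c) (\<lambda>z h. 0)"
  by (simp add: Cder_def linear_zero)

lemma Cder_sum:
  assumes "\<And>i. i \<in> I \<Longrightarrow> Cder \<iota> U (f i) (f' i)"
  shows "Cder \<iota> U (\<lambda>z. \<Sum>i\<in>I. f i z) (\<lambda>z h. \<Sum>i\<in>I. f' i z h)"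
  using assms by (induction I rule: infinite_finite_induct) (simp_all add: Cder_const Cder_add)

text \<open>The partial derivatives are arguments, instead of \<open>d_rho f\<close> and
  \<open>d_theta f\<close>, so that they can be given in a form in which thermodynamic identities
  have already been used.\<close>

definition quad_deriv :: "(real \<Rightarrow> real \<Rightarrow> real) \<Rightarrow> (real \<Rightarrow> real \<Rightarrow> real) \<Rightarrow> (real \<Rightarrow> real \<Rightarrow> real) \<Rightarrow> bool"
  where "quad_deriv f fr fh \<longleftrightarrow>
    continuous_on ({0<..} \<times> {0<..}) (\<lambda>(\<rho>, \<theta>). fr \<rho> \<theta>) \<and> continuous_on ({0<..} \<times> {0<..}) (\<lambda>(\<rho>, \<theta>). fh \<rho> \<theta>) \<and>
    (\<forall>\<rho>>0. \<forall>\<theta>>0. ((\<lambda>(\<rho>, \<theta>). f \<rho> \<theta>) has_derivative (\<lambda>(a, b). fr \<rho> \<theta> * a + fh \<rho> \<theta> * b)) (at (\<rho>, \<theta>)))"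

lemma quad_deriv_Ck: "Ck_quadrant (Suc 0) f \<Longrightarrow> quad_deriv f (d_rho f) (d_theta f)"
  unfolding quad_deriv_def
  using Ck_quadrant_has_derivative Ck_quadrant_0D[OF Ck_quadrant_partials(1)] Ck_quadrant_0D[OF Ck_quadrant_partials(2)]
  by blast

lemma quad_deriv_inverse_theta: "quad_deriv (\<lambda>\<rho> \<theta>. 1 / \<theta>) (\<lambda>\<rho> \<theta>. 0) (\<lambda>\<rho> \<theta>. - 1 / \<theta>\<^sup>2)"
  unfolding quad_deriv_def
proof (intro conjI allI impI)
  show "continuous_on ({0<..} \<times> {0<..}) (\<lambda>(\<rho>::real, \<theta>::real). - 1 / \<theta>\<^sup>2)"
    unfolding case_prod_unfold by (intro continuous_intros) auto
  fix \<rho> \<theta> :: real assume pos: "\<rho> > 0" "\<theta> > 0"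
  show "((\<lambda>(\<rho>, \<theta>). 1 / \<theta>) has_derivative (\<lambda>(a, b). 0 * a + - 1 / \<theta>\<^sup>2 * b)) (at (\<rho>, \<theta>))"
    unfolding case_prod_unfold using pos
    by (auto intro!: derivative_eq_intros simp: fun_eq_iff field_simps power2_eq_square)
qed (simp add: case_prod_unfold)

text \<open>The Gibbs-Duhem relation: the differential of the chemical potential is that of
  \<open>p\<close> divided by \<rho>, minus \<open>s\<close> times that of \<theta>. Hence no
  derivative of \<open>e\<close> or \<open>s\<close> appears in the derivatives of the test function
  \<psi>.\<close>

lemma (in thermodynamics) quad_deriv_chemical_potential:
  "quad_deriv (\<lambda>\<rho> \<theta>. e \<rho> \<theta> - \<theta> * s \<rho> \<theta> + p \<rho> \<theta> / \<rho>) (\<lambda>\<rho> \<theta>. d_rho p \<rho> \<theta> / \<rho>) (\<lambda>\<rho> \<theta>. d_theta p \<rho> \<theta> / \<rho> - s \<rho> \<theta>)"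
  unfolding quad_deriv_def
proof (intro conjI allI impI)
  have c: "continuous_on ({0<..} \<times> {0<..}) (\<lambda>(\<rho>, \<theta>). d_rho p \<rho> \<theta>)"
    "continuous_on ({0<..} \<times> {0<..}) (\<lambda>(\<rho>, \<theta>). d_theta p \<rho> \<theta>)" "continuous_on ({0<..} \<times> {0<..}) (\<lambda>(\<rho>, \<theta>). s \<rho> \<theta>)"
    using Ck_quadrant_0D[OF Ck_quadrant_partials(1)[OF p1(2)]] Ck_quadrant_0D[OF Ck_quadrant_partials(2)[OF p1(2)]]
      Ck_quadrant_0D[OF Ck_quadrant_Suc_D[OF s1(2)]] by auto
  have "continuous_on ({0<..} \<times> {0<..}) (\<lambda>z. (\<lambda>(\<rho>, \<theta>). d_rho p \<rho> \<theta>) z / fst z)"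
    by (intro continuous_intros c) auto
  then show "continuous_on ({0<..} \<times> {0<..}) (\<lambda>(\<rho>, \<theta>). d_rho p \<rho> \<theta> / \<rho>)" by (simp add: case_prod_unfold)
  have "continuous_on ({0<..} \<times> {0<..}) (\<lambda>z. (\<lambda>(\<rho>, \<theta>). d_theta p \<rho> \<theta>) z / fst z - (\<lambda>(\<rho>, \<theta>). s \<rho> \<theta>) z)"
    by (intro continuous_intros c) auto
  then show "continuous_on ({0<..} \<times> {0<..}) (\<lambda>(\<rho>, \<theta>). d_theta p \<rho> \<theta> / \<rho> - s \<rho> \<theta>)" by (simp add: case_prod_unfold)
  fix \<rho> \<theta> :: real assume pos: "\<rho> > 0" "\<theta> > 0"
  let ?D = "\<lambda>f h. (\<lambda>(a, b). d_rho f \<rho> \<theta> * a + d_theta f \<rho> \<theta> * b) h :: real"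
  have "((\<lambda>z. (\<lambda>(\<rho>, \<theta>). e \<rho> \<theta>) z - snd z * (\<lambda>(\<rho>, \<theta>). s \<rho> \<theta>) z + (\<lambda>(\<rho>, \<theta>). p \<rho> \<theta>) z / fst z) has_derivative
      (\<lambda>h. ?D e h - (\<theta> * ?D s h + snd h * s \<rho> \<theta>) + (- p \<rho> \<theta> * (inverse \<rho> * fst h * inverse \<rho>) + ?D p h / \<rho>))) (at (\<rho>, \<theta>))"
    using pos has_derivative_add[OF has_derivative_diff[OF Ck_quadrant_has_derivative[OF e1(2) pos]
        has_derivative_mult[OF has_derivative_snd[OF has_derivative_ident] Ck_quadrant_has_derivative[OF s1(2) pos]]]
        has_derivative_divide[OF Ck_quadrant_has_derivative[OF p1(2) pos] has_derivative_fst[OF has_derivative_ident]]]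
    by simp
  moreover have "(\<lambda>h. ?D e h - (\<theta> * ?D s h + snd h * s \<rho> \<theta>) + (- p \<rho> \<theta> * (inverse \<rho> * fst h * inverse \<rho>) + ?D p h / \<rho>))
     = (\<lambda>(a, b). d_rho p \<rho> \<theta> / \<rho> * a + (d_theta p \<rho> \<theta> / \<rho> - s \<rho> \<theta>) * b)"
  proof -
    have er: "d_rho e \<rho> \<theta> = \<theta> * d_rho s \<rho> \<theta> + p \<rho> \<theta> / \<rho>\<^sup>2" using gibbs_rho[OF pos] by simp
    show ?thesis unfolding er gibbs_theta[OF pos] using pos
      by (auto simp: fun_eq_iff field_simps power2_eq_square)
  qed
  ultimately show "((\<lambda>(\<rho>, \<theta>). e \<rho> \<theta> - \<theta> * s \<rho> \<theta> + p \<rho> \<theta> / \<rho>) has_derivative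
      (\<lambda>(a, b). d_rho p \<rho> \<theta> / \<rho> * a + (d_theta p \<rho> \<theta> / \<rho> - s \<rho> \<theta>) * b)) (at (\<rho>, \<theta>))"
    by (simp add: case_prod_unfold)
qed

lemma quad_deriv_continuous_on:
  assumes "quad_deriv f fr fh"
  shows "continuous_on ({0<..} \<times> {0<..}) (\<lambda>(\<rho>, \<theta>). f \<rho> \<theta>)"
proof (rule continuous_at_imp_continuous_on, rule ballI)
  fix z :: "real \<times> real" assume "z \<in> {0<..} \<times> {0<..}"
  then have "fst z > 0" "snd z > 0" by auto
  then show "isCont (\<lambda>(\<rho>, \<theta>). f \<rho> \<theta>) z"
    using assms has_derivative_continuous unfolding quad_deriv_def by (metis prod.collapse)
qed

lemma Cder_quadrant:
  assumes f: "quad_deriv f fr fh" and R: "Cder \<iota> U R R'" and \<Theta>: "Cder \<iota> U \<Theta> \<Theta>'"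
    and pos: "\<And>z. z \<in> closure U \<Longrightarrow> R z > 0 \<and> \<Theta> z > 0" and "\<iota> 0 = 0"
  shows "Cder \<iota> U (\<lambda>z. f (R z) (\<Theta> z)) (\<lambda>z h. fr (R z) (\<Theta> z) * R' z h + fh (R z) (\<Theta> z) * \<Theta>' z h)"
  unfolding Cder_def
proof (intro conjI ballI allI)
  have cc: "continuous_on (closure U) (\<lambda>z. g (R z) (\<Theta> z))"
    if "continuous_on ({0<..} \<times> {0<..}) (\<lambda>(\<rho>, \<theta>). g \<rho> \<theta> :: real)" for g
    using continuous_on_compose2[OF that continuous_on_Pair[OF CderD(1)[OF R] CderD(1)[OF \<Theta>]]] pos by auto
  show "continuous_on (closure U) (\<lambda>z. f (R z) (\<Theta> z))"
    by (rule cc[OF quad_deriv_continuous_on[OF f]])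
  have "continuous_on (closure U) (\<lambda>z. fr (R z) (\<Theta> z))" "continuous_on (closure U) (\<lambda>z. fh (R z) (\<Theta> z))"
    using f cc unfolding quad_deriv_def by auto
  then show "continuous_on (closure U) (\<lambda>z. fr (R z) (\<Theta> z) * R' z h + fh (R z) (\<Theta> z) * \<Theta>' z h)" for h
    by (intro continuous_on_add continuous_on_mult CderD(3)[OF R] CderD(3)[OF \<Theta>])
  show "linear (\<lambda>h. fr (R z) (\<Theta> z) * R' z h + fh (R z) (\<Theta> z) * \<Theta>' z h)" if "z \<in> closure U" for z
    by (rule linearI)
      (simp_all add: linear_add[OF CderD(2)[OF R that]] linear_cmul[OF CderD(2)[OF R that]]
        linear_add[OF CderD(2)[OF \<Theta> that]] linear_cmul[OF CderD(2)[OF \<Theta> that]] algebra_simps)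
  fix z assume z: "z \<in> U"
  have p: "R z > 0" "\<Theta> z > 0" using pos[of z] closure_subset z by auto
  have 1: "((\<lambda>(\<rho>, \<theta>). f \<rho> \<theta>) has_derivative (\<lambda>(a, b). fr (R z) (\<Theta> z) * a + fh (R z) (\<Theta> z) * b)) (at (R z, \<Theta> z))"
    using f p unfolding quad_deriv_def by blast
  have 2: "((\<lambda>h. (R (z + \<iota> h), \<Theta> (z + \<iota> h))) has_derivative (\<lambda>h. (R' z h, \<Theta>' z h))) (at 0)"
    by (rule has_derivative_Pair[OF CderD(4)[OF R z] CderD(4)[OF \<Theta> z]])
  have 3: "((\<lambda>(\<rho>, \<theta>). f \<rho> \<theta>) has_derivative (\<lambda>(a, b). fr (R z) (\<Theta> z) * a + fh (R z) (\<Theta> z) * b)) (at (R (z + \<iota> 0), \<Theta> (z + \<iota> 0)))"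
    using 1 \<open>\<iota> 0 = 0\<close> by simp
  show "((\<lambda>h. f (R (z + \<iota> h)) (\<Theta> (z + \<iota> h))) has_derivative
      (\<lambda>h. fr (R z) (\<Theta> z) * R' z h + fh (R z) (\<Theta> z) * \<Theta>' z h)) (at 0)"
    using has_derivative_compose[OF 2 3] by simp
qed

lemma has_derivative_shift:
  assumes "(f has_derivative D) (at z)"
  shows "((\<lambda>h. f (z + h)) has_derivative D) (at 0)"
proof -
  have "((\<lambda>h. z + h) has_derivative (\<lambda>h. h)) (at 0)" by (auto intro!: derivative_eq_intros)
  from has_derivative_compose[OF this, of f D] assms show ?thesis by simp
qed

lemma has_derivative_unshift:
  assumes "((\<lambda>h. f (z + h)) has_derivative D) (at 0)"
  shows "(f has_derivative D) (at z)"
proof -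
  have "((\<lambda>y. y - z) has_derivative (\<lambda>h. h)) (at z)" by (auto intro!: derivative_eq_intros)
  from has_derivative_compose[OF this, of "\<lambda>h. f (z + h)" D] assms show ?thesis by simp
qed

lemma Cder_has_derivative:
  assumes "Cder id U f f'" "z \<in> U"
  shows "(f has_derivative f' z) (at z)"
  by (rule has_derivative_unshift) (use CderD(4)[OF assms] in simp)

text \<open>In finite dimension a family of linear maps is continuous in operator norm as soon as
  its value in every direction is continuous.\<close>

lemma Cder_imp_C1_closure:
  assumes f: "Cder id U f f'"
  shows "C1_closure U f"
proof -
  define F where "F z = Blinfun (f' z)" for z
  have F: "blinfun_apply (F z) = f' z" if "z \<in> closure U" for z
    unfolding F_def using CderD(2)[OF f that]
    by (intro bounded_linear_Blinfun_apply) (simp add: linear_conv_bounded_linear)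
  have "continuous_on (closure U) F"
  proof (rule continuous_on_blinfun_componentwise)
    show "continuous_on (closure U) (\<lambda>z. F z i)" for i
      using CderD(3)[OF f, of i] by (rule continuous_on_eq) (simp add: F)
  qed
  moreover have "(f has_derivative blinfun_apply (F z)) (at z)" if "z \<in> U" for z
    unfolding F[OF subsetD[OF closure_subset that]] by (rule Cder_has_derivative[OF f that])
  ultimately show ?thesis unfolding C1_closure_def using CderD(1)[OF f] by blast
qed

lemma C1_closure_imp_Cder:
  assumes "C1_closure U f"
  obtains f' where "Cder id U f f'"
proof -
  obtain F where F: "continuous_on (closure U) f" "continuous_on (closure U) F"
    "\<And>z. z \<in> U \<Longrightarrow> (f has_derivative blinfun_apply (F z)) (at z)"
    using assms unfolding C1_closure_def by auto
  have "Cder id U f (\<lambda>z. blinfun_apply (F z))"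
    unfolding Cder_def
  proof (intro conjI ballI allI F(1))
    show "linear (blinfun_apply (F z))" for z
      by (rule bounded_linear.linear[OF blinfun.bounded_linear_right])
    show "continuous_on (closure U) (\<lambda>z. F z h)" for h by (intro continuous_intros F(2))
    show "((\<lambda>h. f (z + id h)) has_derivative blinfun_apply (F z)) (at 0)" if "z \<in> U" for z
      using has_derivative_shift[OF F(3)[OF that]] by simp
  qed
  then show ?thesis by (rule that)
qed

lemma Cder_spatial:
  fixes f :: "real \<times> 'a::euclidean_space \<Rightarrow> 'b::real_normed_vector"
  assumes f: "Cder id U f f'"
  shows "Cder (Pair 0) U f (\<lambda>z h. f' z (0, h))"
  unfolding Cder_def
proof (intro conjI ballI allI CderD(1)[OF f] CderD(3)[OF f])
  show "linear (\<lambda>h. f' z (0, h))" if "z \<in> closure U" for z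
    using linear_add[OF CderD(2)[OF f that], of "(0, _)" "(0, _)"] linear_cmul[OF CderD(2)[OF f that], of _ "(0, _)"]
    by (intro linearI) auto
  show "((\<lambda>h. f (z + (0, h))) has_derivative (\<lambda>h. f' z (0, h))) (at 0)" if "z \<in> U" for z
  proof -
    have "((\<lambda>h. (0, h)) has_derivative (\<lambda>h. (0, h))) (at (0::'a))" by (auto intro!: derivative_eq_intros)
    moreover have "((\<lambda>h. f (z + h)) has_derivative f' z) (at ((\<lambda>h. (0, h)) (0::'a)))"
      using CderD(4)[OF f that] by (simp add: zero_prod_def)
    ultimately show ?thesis by (rule has_derivative_compose)
  qed
qed

section \<open>Differential operators computed from total derivatives\<close>

lemma grad_inner:
  fixes f :: "real^'d::finite \<Rightarrow> real"
  assumes "(f has_derivative D) (at x)"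
  shows "grad f x \<bullet> h = D h"
proof -
  have D: "frechet_derivative f (at x) = D" using frechet_derivative_at[OF assms] by simp
  have lin: "linear D" using assms has_derivative_linear by blast
  have "h = (\<Sum>i\<in>UNIV. h $ i *\<^sub>R axis i 1)"
    using basis_expansion[of h] by (simp add: scalar_mult_eq_scaleR)
  then have "D h = D (\<Sum>i\<in>UNIV. h $ i *\<^sub>R axis i 1)" by simp
  also have "\<dots> = (\<Sum>i\<in>UNIV. h $ i * D (axis i 1))"
    by (simp add: linear_sum[OF lin] linear_cmul[OF lin])
  finally show ?thesis by (simp add: grad_def D inner_vec_def mult.commute)
qed

lemma Grad_mult:
  fixes u :: "real^'d::finite \<Rightarrow> real^'d"
  assumes "(u has_derivative D) (at x)"
  shows "Grad u x *v h = D h"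
proof -
  have "(u has_derivative (\<lambda>h. jacobian u (at x) *v h)) (at x)"
    using assms jacobian_works by (auto simp: differentiable_def)
  from has_derivative_unique[OF this assms] show ?thesis unfolding Grad_def by metis
qed

lemma Grad_row:
  fixes u :: "real^'d::finite \<Rightarrow> real^'d"
  assumes "(u has_derivative D) (at x)"
  shows "Grad u x $ i = grad (\<lambda>y. u y $ i) x"
proof -
  have "((\<lambda>y. u y $ i) has_derivative (\<lambda>h. D h $ i)) (at x)"
    by (rule bounded_linear.has_derivative[OF bounded_linear_vec_nth assms])
  from grad_inner[OF this] Grad_mult[OF assms]
  have "Grad u x $ i \<bullet> h = grad (\<lambda>y. u y $ i) x \<bullet> h" for h by (simp flip: matrix_vector_mul_component)
  then show ?thesis using vector_eq_rdot by blast
qed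

lemma dvg_eq:
  fixes u :: "real^'d::finite \<Rightarrow> real^'d"
  assumes "(u has_derivative D) (at x)"
  shows "dvg u x = (\<Sum>i\<in>UNIV. D (axis i 1) $ i)"
proof -
  have "Grad u x $ i $ i = D (axis i 1) $ i" for i
    unfolding Grad_mult[OF assms, symmetric] matrix_vector_mul_component by (simp add: inner_axis)
  then show ?thesis by (simp add: dvg_def trace_def)
qed

lemma dvg_scaleR:
  fixes w :: "real^'d::finite \<Rightarrow> real^'d"
  assumes c: "(c has_derivative c') (at x)" and w: "(w has_derivative w') (at x)"
  shows "dvg (\<lambda>y. c y *\<^sub>R w y) x = grad c x \<bullet> w x + c x * dvg w x"
proof -
  have "grad c x \<bullet> w x = (\<Sum>i\<in>UNIV. c' (axis i 1) * w x $ i)"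
    by (simp add: inner_vec_def grad_def frechet_derivative_at[OF c, symmetric])
  then show ?thesis
    unfolding dvg_eq[OF has_derivative_scaleR[OF c w]] dvg_eq[OF w]
    by (simp add: sum.distrib sum_distrib_left add.commute)
qed

lemma dvg_diff:
  fixes u w :: "real^'d::finite \<Rightarrow> real^'d"
  assumes "(u has_derivative u') (at x)" "(w has_derivative w') (at x)"
  shows "dvg (\<lambda>y. u y - w y) x = dvg u x - dvg w x"
  unfolding dvg_eq[OF has_derivative_diff[OF assms]] dvg_eq[OF assms(1)] dvg_eq[OF assms(2)]
  by (simp add: sum_subtractf)

lemma dvg_sum:
  fixes u :: "'i \<Rightarrow> real^'d::finite \<Rightarrow> real^'d"
  assumes "\<And>i. i \<in> I \<Longrightarrow> (u i has_derivative u' i) (at x)"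
  shows "dvg (\<lambda>y. \<Sum>i\<in>I. u i y) x = (\<Sum>i\<in>I. dvg (u i) x)"
proof -
  have "dvg (\<lambda>y. \<Sum>i\<in>I. u i y) x = (\<Sum>j\<in>UNIV. (\<Sum>i\<in>I. u' i (axis j 1)) $ j)"
    by (rule dvg_eq[OF has_derivative_sum[OF assms]])
  also have "\<dots> = (\<Sum>i\<in>I. \<Sum>j\<in>UNIV. u' i (axis j 1) $ j)"
    unfolding sum_component by (rule sum.swap)
  also have "\<dots> = (\<Sum>i\<in>I. dvg (u i) x)"
    by (rule sum.cong[OF refl]) (simp add: dvg_eq[OF assms])
  finally show ?thesis .
qed

lemma dt_eq:
  assumes "((\<lambda>(t, x). f t x) has_derivative D) (at (t, x))"
  shows "dt f t x = D (1, 0)"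
proof -
  have "((\<lambda>\<tau>. (\<tau>, x)) has_derivative (\<lambda>a. (a, 0))) (at t)" by (auto intro!: derivative_eq_intros)
  from has_derivative_compose[OF this assms]
  have "((\<lambda>\<tau>. f \<tau> x) has_derivative (\<lambda>a. D (a, 0))) (at t)" by simp
  moreover have "(\<lambda>a. D (a, 0)) = (\<lambda>a. a *\<^sub>R D (1, 0))"
  proof
    fix a show "D (a, 0) = a *\<^sub>R D (1, 0)"
      using linear_cmul[OF has_derivative_linear[OF assms], of a "(1, 0)"] by simp
  qed
  ultimately have "((\<lambda>\<tau>. f \<tau> x) has_vector_derivative D (1, 0)) (at t)"
    unfolding has_vector_derivative_def by (rule subst[rotated])
  then show ?thesis
    unfolding dt_def by (rule vector_derivative_at)
qed

lemma spatial_has_derivative: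
  assumes "((\<lambda>(t, x). f t x) has_derivative D) (at (t, x))"
  shows "(f t has_derivative (\<lambda>h. D (0, h))) (at x)"
proof -
  have "((\<lambda>y. (t, y)) has_derivative (\<lambda>h. (0, h))) (at x)" by (auto intro!: derivative_eq_intros)
  from has_derivative_compose[OF this assms] show ?thesis by simp
qed

lemma dev_add: "dev (A + B) = dev A + dev (B :: real^'d::finite^'d)"
  by (simp add: dev_def symm_def transpose_add trace_add algebra_simps add_divide_distrib)

lemma dev_scaleR: "dev (c *\<^sub>R A) = c *\<^sub>R dev (A :: real^'d::finite^'d)"
  by (simp add: dev_def symm_def transpose_scaleR trace_scaleR algebra_simps)

lemma bounded_linear_dev: "bounded_linear (dev :: real^'d::finite^'d \<Rightarrow> _)"
  by (simp add: linear_conv_bounded_linear[symmetric] linearI dev_add dev_scaleR)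

lemma bounded_linear_trace: "bounded_linear (trace :: real^'d::finite^'d \<Rightarrow> real)"
  by (simp add: linear_conv_bounded_linear[symmetric] linearI trace_add trace_scaleR)

lemma dvg_cong_open:
  fixes f g :: "real^'d::finite \<Rightarrow> real^'d"
  assumes "(f has_derivative D) (at x)" "open S" "x \<in> S" "\<And>y. y \<in> S \<Longrightarrow> f y = g y"
  shows "(g has_derivative D) (at x)" "dvg g x = dvg f x"
proof -
  show g: "(g has_derivative D) (at x)" by (rule has_derivative_transform_within_open[OF assms(1-3)]) (use assms in auto)
  show "dvg g x = dvg f x" unfolding dvg_eq[OF g] dvg_eq[OF assms(1)] ..
qed

section \<open>The strong solution up to the boundary of the cylinder\<close>

locale strong_setup = thermodynamics p e s for p e s +
  fixes T :: real and \<Omega> :: "(real^'d::finite) set" and \<theta>B :: "real \<Rightarrow> real^'d \<Rightarrow> real"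
    and \<kappa> \<mu> lam :: "real \<Rightarrow> real \<Rightarrow> real"
    and \<rho>0 \<theta>0 :: "real^'d \<Rightarrow> real" and u0 :: "real^'d \<Rightarrow> real^'d"
    and \<rho>' \<theta>' :: "real \<Rightarrow> real^'d \<Rightarrow> real" and u' :: "real \<Rightarrow> real^'d \<Rightarrow> real^'d"
  assumes T: "T > 0" and dom: "bounded_domain \<Omega>"
    and tk: "transport_coefficient \<kappa>" and tm: "transport_coefficient \<mu>" and tl: "transport_coefficient lam"
    and strong: "strong_solution T \<Omega> \<theta>B p e \<kappa> \<mu> lam \<rho>0 u0 \<theta>0 \<rho>' u' \<theta>'"
begin

abbreviation Q :: "(real \<times> (real^'d)) set" where "Q \<equiv> QT T \<Omega>"

lemma open_dom: "open \<Omega>" and bounded_dom: "bounded \<Omega>"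
  using dom by (auto simp: bounded_domain_def)

lemma open_Q: "open Q"
  by (intro open_Times open_dom) auto

lemma closure_Q: "closure Q = {0..T} \<times> closure \<Omega>"
  by (simp only: closure_Times closure_greaterThanLessThan[OF T])

lemma Q_closure: "z \<in> Q \<Longrightarrow> z \<in> closure Q"
  by (rule subsetD[OF closure_subset])

lemma compact_closure_Q: "compact (closure Q)"
  unfolding closure_Q using bounded_dom by (intro compact_Times compact_Icc) (simp add: compact_closure)

lemma continuous_bounded:
  fixes f :: "real \<times> (real^'d) \<Rightarrow> 'b::real_normed_vector"
  assumes "continuous_on (closure Q) f"
  obtains B where "B \<ge> 0" "\<And>z. z \<in> closure Q \<Longrightarrow> norm (f z) \<le> B"
proof -
  have "bounded (f ` closure Q)"
    using compact_imp_bounded[OF compact_continuous_image[OF assms compact_closure_Q]] .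
  then obtain B where "B > 0" "\<forall>y\<in>f ` closure Q. norm y \<le> B" by (auto simp: bounded_pos)
  then show ?thesis by (intro that[of B]) auto
qed

definition "R = (\<lambda>(t, x). \<rho>' t x)"
definition "U = (\<lambda>(t, x). u' t x)"
definition "H = (\<lambda>(t, x). \<theta>' t x)"

lemma RUH_simps [simp]: "R (t, x) = \<rho>' t x" "U (t, x) = u' t x" "H (t, x) = \<theta>' t x"
  by (simp_all add: R_def U_def H_def)

text \<open>The derivatives inside \<open>Q\<close>, continued to the compact closure. The operators
  \<open>dt\<close>, \<open>grad\<close> and \<open>Grad\<close> give usable values only inside,
  whereas bounds on the coefficients come from compactness of the closure.\<close>

definition "DR = (SOME D. Cder id Q R D)"
definition "DU = (SOME D. Cder id Q U D)"
definition "DH = (SOME D. Cder id Q H D)"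

lemma DR: "Cder id Q R DR" and DU: "Cder id Q U DU" and DH: "Cder id Q H DH"
proof -
  have "C1_closure Q R" "C1_closure Q U" "C1_closure Q H"
    using strong unfolding strong_solution_def R_def U_def H_def by auto
  then show "Cder id Q R DR" "Cder id Q U DU" "Cder id Q H DH"
    unfolding DR_def DU_def DH_def by (metis C1_closure_imp_Cder someI)+
qed

lemma positive: "z \<in> closure Q \<Longrightarrow> R z > 0 \<and> H z > 0"
  using strong unfolding strong_solution_def closure_Q by (auto simp: R_def H_def)

lemma joint_derivs:
  assumes "(t, x) \<in> Q"
  shows "((\<lambda>(t, x). \<rho>' t x) has_derivative DR (t, x)) (at (t, x))"
    "((\<lambda>(t, x). u' t x) has_derivative DU (t, x)) (at (t, x))"
    "((\<lambda>(t, x). \<theta>' t x) has_derivative DH (t, x)) (at (t, x))"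
  using Cder_has_derivative[OF DR assms] Cder_has_derivative[OF DU assms] Cder_has_derivative[OF DH assms]
  by (simp_all add: R_def U_def H_def)

lemma spatial_derivs:
  assumes "(t, x) \<in> Q"
  shows "(\<rho>' t has_derivative (\<lambda>h. grad (\<rho>' t) x \<bullet> h)) (at x)"
    "(u' t has_derivative (\<lambda>h. Grad (u' t) x *v h)) (at x)"
    "(\<theta>' t has_derivative (\<lambda>h. grad (\<theta>' t) x \<bullet> h)) (at x)"
  using spatial_has_derivative[OF joint_derivs(1)[OF assms]] spatial_has_derivative[OF joint_derivs(2)[OF assms]]
    spatial_has_derivative[OF joint_derivs(3)[OF assms]]
  by (simp_all add: grad_inner Grad_mult)

lemma D_decomp:
  assumes "(t, x) \<in> Q"
  shows "DR (t, x) (a, h) = dt \<rho>' t x * a + grad (\<rho>' t) x \<bullet> h"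
    "DU (t, x) (a, h) = a *\<^sub>R dt u' t x + Grad (u' t) x *v h"
    "DH (t, x) (a, h) = dt \<theta>' t x * a + grad (\<theta>' t) x \<bullet> h"
proof -
  have *: "D (a, h) = a *\<^sub>R D (1, 0) + D (0, h)" if "linear D" for D :: "real \<times> (real^'d) \<Rightarrow> 'b::real_vector"
    using linear_add[OF that, of "a *\<^sub>R (1, 0)" "(0, h)"] linear_cmul[OF that, of a "(1, 0)"] by simp
  note j = joint_derivs[OF assms]
  show "DR (t, x) (a, h) = dt \<rho>' t x * a + grad (\<rho>' t) x \<bullet> h"
    using *[OF has_derivative_linear[OF j(1)]] dt_eq[OF j(1)] grad_inner[OF spatial_has_derivative[OF j(1)]]
    by (simp add: mult.commute)
  show "DU (t, x) (a, h) = a *\<^sub>R dt u' t x + Grad (u' t) x *v h"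
    using *[OF has_derivative_linear[OF j(2)]] dt_eq[OF j(2)] Grad_mult[OF spatial_has_derivative[OF j(2)]] by simp
  show "DH (t, x) (a, h) = dt \<theta>' t x * a + grad (\<theta>' t) x \<bullet> h"
    using *[OF has_derivative_linear[OF j(3)]] dt_eq[OF j(3)] grad_inner[OF spatial_has_derivative[OF j(3)]]
    by (simp add: mult.commute)
qed

lemma quad_fields_derivs:
  assumes f: "quad_deriv f fr fh" and z: "(t, x) \<in> Q"
  shows "((\<lambda>(t, x). f (\<rho>' t x) (\<theta>' t x)) has_derivative (\<lambda>h. fr (\<rho>' t x) (\<theta>' t x) * DR (t, x) h + fh (\<rho>' t x) (\<theta>' t x) * DH (t, x) h)) (at (t, x))"
    and "dt (\<lambda>t x. f (\<rho>' t x) (\<theta>' t x)) t x = fr (\<rho>' t x) (\<theta>' t x) * dt \<rho>' t x + fh (\<rho>' t x) (\<theta>' t x) * dt \<theta>' t x"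
    and "((\<lambda>y. f (\<rho>' t y) (\<theta>' t y)) has_derivative (\<lambda>h. (fr (\<rho>' t x) (\<theta>' t x) *\<^sub>R grad (\<rho>' t) x + fh (\<rho>' t x) (\<theta>' t x) *\<^sub>R grad (\<theta>' t) x) \<bullet> h)) (at x)"
    and "grad (\<lambda>y. f (\<rho>' t y) (\<theta>' t y)) x = fr (\<rho>' t x) (\<theta>' t x) *\<^sub>R grad (\<rho>' t) x + fh (\<rho>' t x) (\<theta>' t x) *\<^sub>R grad (\<theta>' t) x"
proof -
  have "Cder id Q (\<lambda>z. f (R z) (H z)) (\<lambda>z h. fr (R z) (H z) * DR z h + fh (R z) (H z) * DH z h)"
    by (rule Cder_quadrant[OF f DR DH positive]) auto
  from Cder_has_derivative[OF this z]
  show j: "((\<lambda>(t, x). f (\<rho>' t x) (\<theta>' t x)) has_derivative (\<lambda>h. fr (\<rho>' t x) (\<theta>' t x) * DR (t, x) h + fh (\<rho>' t x) (\<theta>' t x) * DH (t, x) h)) (at (t, x))"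
    by (simp add: R_def H_def case_prod_unfold)
  show "dt (\<lambda>t x. f (\<rho>' t x) (\<theta>' t x)) t x = fr (\<rho>' t x) (\<theta>' t x) * dt \<rho>' t x + fh (\<rho>' t x) (\<theta>' t x) * dt \<theta>' t x"
    using dt_eq[OF j] by (simp add: D_decomp[OF z])
  show g: "((\<lambda>y. f (\<rho>' t y) (\<theta>' t y)) has_derivative (\<lambda>h. (fr (\<rho>' t x) (\<theta>' t x) *\<^sub>R grad (\<rho>' t) x + fh (\<rho>' t x) (\<theta>' t x) *\<^sub>R grad (\<theta>' t) x) \<bullet> h)) (at x)"
    using spatial_has_derivative[OF j] by (simp add: D_decomp[OF z] inner_simps)
  have "grad (\<lambda>y. f (\<rho>' t y) (\<theta>' t y)) x \<bullet> h = (fr (\<rho>' t x) (\<theta>' t x) *\<^sub>R grad (\<rho>' t) x + fh (\<rho>' t x) (\<theta>' t x) *\<^sub>R grad (\<theta>' t) x) \<bullet> h" for h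
    by (rule grad_inner[OF g])
  then show "grad (\<lambda>y. f (\<rho>' t y) (\<theta>' t y)) x = fr (\<rho>' t x) (\<theta>' t x) *\<^sub>R grad (\<rho>' t) x + fh (\<rho>' t x) (\<theta>' t x) *\<^sub>R grad (\<theta>' t) x"
    using vector_eq_rdot by blast
qed

text \<open>Taken from the continued derivatives, these gradients are continuous up to the boundary;
  inside \<open>Q\<close> they are the gradients of velocity and temperature.\<close>

definition "Gu z = (\<chi> i j. DU z (0, axis j 1) $ i)"
definition "gH z = (\<chi> i. DH z (0, axis i 1))"

lemma Gu_eq: "(t, x) \<in> Q \<Longrightarrow> Gu (t, x) = Grad (u' t) x"
  by (simp add: Gu_def D_decomp vec_eq_iff matrix_vector_mul_component inner_axis)

lemma gH_eq: "(t, x) \<in> Q \<Longrightarrow> gH (t, x) = grad (\<theta>' t) x"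
  by (simp add: gH_def D_decomp vec_eq_iff inner_axis)

lemma continuous_Gu: "continuous_on (closure Q) Gu" and continuous_gH: "continuous_on (closure Q) gH"
  unfolding Gu_def gH_def by (intro continuous_intros CderD(3)[OF DU] CderD(3)[OF DH])+

text \<open>Spatial differentiability is given for the gradient inside \<open>Q\<close>, continuity
  up to the boundary for its continuation \<open>G\<close>; the two are joined here.\<close>

lemma Cder_of_C1x:
  fixes g :: "real \<Rightarrow> real^'d \<Rightarrow> 'b::real_normed_vector"
  assumes "continuous_on (closure Q) G" "\<And>t x. (t, x) \<in> Q \<Longrightarrow> G (t, x) = g t x" "C1x_QT T \<Omega> g"
  shows "\<exists>G'. Cder (Pair 0) Q G G'"
proof -
  obtain g' :: "real \<times> (real^'d) \<Rightarrow> (real^'d) \<Rightarrow>\<^sub>L 'b" where g': "continuous_on (closure Q) g'"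
    "\<And>t x. (t, x) \<in> Q \<Longrightarrow> (g t has_derivative blinfun_apply (g' (t, x))) (at x)"
    using assms(3) unfolding C1x_QT_def by auto
  have "Cder (Pair 0) Q G (\<lambda>z. blinfun_apply (g' z))"
    unfolding Cder_def
  proof (intro conjI ballI allI assms(1))
    show "linear (blinfun_apply (g' z))" for z
      by (rule bounded_linear.linear[OF blinfun.bounded_linear_right])
    show "continuous_on (closure Q) (\<lambda>z. g' z h)" for h by (intro continuous_intros g')
    fix z assume z: "z \<in> Q"
    obtain t x where tx: "z = (t, x)" by fastforce
    have "((\<lambda>y. G (t, y)) has_derivative blinfun_apply (g' (t, x))) (at x)"
      by (rule has_derivative_transform_within_open[OF g'(2) open_dom]) (use z tx assms(2) in auto)
    from has_derivative_shift[OF this]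
    show "((\<lambda>h. G (z + (0, h))) has_derivative blinfun_apply (g' z)) (at 0)" by (simp add: tx)
  qed
  then show ?thesis by blast
qed

definition "DGu = (SOME G'. Cder (Pair 0) Q Gu G')"
definition "DgH = (SOME G'. Cder (Pair 0) Q gH G')"

lemma DGu: "Cder (Pair 0) Q Gu DGu" and DgH: "Cder (Pair 0) Q gH DgH"
proof -
  have "C1x_QT T \<Omega> (\<lambda>t. Grad (u' t))" "C1x_QT T \<Omega> (\<lambda>t. grad (\<theta>' t))"
    using strong unfolding strong_solution_def by auto
  then have "\<exists>G'. Cder (Pair 0) Q Gu G'" "\<exists>G'. Cder (Pair 0) Q gH G'"
    using Cder_of_C1x[OF continuous_Gu] Cder_of_C1x[OF continuous_gH] Gu_eq gH_eq by metis+
  then show "Cder (Pair 0) Q Gu DGu" "Cder (Pair 0) Q gH DgH"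
    unfolding DGu_def DgH_def by (metis someI)+
qed

lemma Cder_coefficient:
  assumes "Ck_quadrant (Suc 0) f"
  shows "\<exists>f'. Cder (Pair 0) Q (\<lambda>z. f (R z) (H z)) f'"
  using Cder_quadrant[OF quad_deriv_Ck[OF assms] Cder_spatial[OF DR] Cder_spatial[OF DH] positive]
  by (auto simp: zero_prod_def)

lemma tC1: "Ck_quadrant (Suc 0) \<kappa>" "Ck_quadrant (Suc 0) \<mu>" "Ck_quadrant (Suc 0) lam"
  using tk tm tl by (auto simp: transport_coefficient_def)

definition "S z = stress \<mu> lam (R z) (H z) (Gu z)"
definition "qH z = \<kappa> (R z) (H z) *\<^sub>R gH z"

definition "DS = (SOME S'. Cder (Pair 0) Q S S')"
definition "DqH = (SOME q'. Cder (Pair 0) Q qH q')"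

lemma DS: "Cder (Pair 0) Q S DS" and DqH: "Cder (Pair 0) Q qH DqH"
proof -
  obtain m' l' k' where m: "Cder (Pair 0) Q (\<lambda>z. \<mu> (R z) (H z)) m'" and l: "Cder (Pair 0) Q (\<lambda>z. lam (R z) (H z)) l'"
    and k: "Cder (Pair 0) Q (\<lambda>z. \<kappa> (R z) (H z)) k'"
    using Cder_coefficient[OF tC1(1)] Cder_coefficient[OF tC1(2)] Cder_coefficient[OF tC1(3)] by auto
  have z: "Pair 0 0 = (0 :: real \<times> (real^'d))" by (simp add: zero_prod_def)
  have L: "bounded_linear (\<lambda>A :: real^'d^'d. trace A *\<^sub>R (mat 1 :: real^'d^'d))"
    by (rule bounded_linear_scaleR_const[OF bounded_linear_trace])
  have "S = (\<lambda>z. \<mu> (R z) (H z) *\<^sub>R dev (Gu z) + lam (R z) (H z) *\<^sub>R (trace (Gu z) *\<^sub>R mat 1))"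
    by (simp add: fun_eq_iff S_def stress_def)
  then have "\<exists>S'. Cder (Pair 0) Q S S'"
    using Cder_add[OF Cder_bilinear[OF m Cder_linear[OF DGu bounded_linear_dev] bounded_bilinear_scaleR z]
        Cder_bilinear[OF l Cder_linear[OF DGu L] bounded_bilinear_scaleR z]] by auto
  then show "Cder (Pair 0) Q S DS" unfolding DS_def by (metis someI)
  have "qH = (\<lambda>z. \<kappa> (R z) (H z) *\<^sub>R gH z)" by (simp add: fun_eq_iff qH_def)
  then have "\<exists>q'. Cder (Pair 0) Q qH q'"
    using Cder_bilinear[OF k DgH bounded_bilinear_scaleR z] by auto
  then show "Cder (Pair 0) Q qH DqH" unfolding DqH_def by (metis someI)
qed

lemma S_symm: "transpose (S z) = S z"
  by (simp add: S_def stress_symm)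

lemma spatial_at:
  assumes "Cder (Pair 0) Q f f'" "(t, x) \<in> Q"
  shows "((\<lambda>y. f (t, y)) has_derivative f' (t, x)) (at x)"
  by (rule has_derivative_unshift) (use CderD(4)[OF assms] in simp)

text \<open>Divergences of the stress, row by row, and of \<open>qH\<close>, expressed by continued
  derivatives. They are the values later given to the parameters \<open>dS\<close> and
  \<open>dK\<close> of \<open>rel_rate\<close>.\<close>

definition "dS z = (\<chi> i. \<Sum>j\<in>UNIV. DS z (axis j 1) $ i $ j)"
definition "dK z = (\<Sum>j\<in>UNIV. DqH z (axis j 1) $ j)"

lemma Dvg_eq:
  fixes A :: "real^'d \<Rightarrow> real^'d^'d"
  assumes "(A has_derivative A') (at x)"
  shows "Dvg A x = (\<chi> i. \<Sum>j\<in>UNIV. A' (axis j 1) $ i $ j)"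
proof -
  have "((\<lambda>y. A y $ i) has_derivative (\<lambda>h. A' h $ i)) (at x)" for i
    by (rule bounded_linear.has_derivative[OF bounded_linear_vec_nth assms])
  from dvg_eq[OF this] show ?thesis by (simp add: Dvg_def)
qed

lemma dK_eq: "(t, x) \<in> Q \<Longrightarrow> dvg (\<lambda>y. qH (t, y)) x = dK (t, x)"
  using dvg_eq[OF spatial_at[OF DqH]] by (simp add: dK_def)

lemma pde_continuity:
  assumes z: "(t, x) \<in> Q"
  shows "dt \<rho>' t x + u' t x \<bullet> grad (\<rho>' t) x + \<rho>' t x * trace (Grad (u' t) x) = 0"
    and "dt \<rho>' t x + dvg (\<lambda>y. \<rho>' t y *\<^sub>R u' t y) x = 0"
proof -
  show c: "dt \<rho>' t x + dvg (\<lambda>y. \<rho>' t y *\<^sub>R u' t y) x = 0"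
    using strong z unfolding strong_solution_def by auto
  then show "dt \<rho>' t x + u' t x \<bullet> grad (\<rho>' t) x + \<rho>' t x * trace (Grad (u' t) x) = 0"
    using dvg_scaleR[OF spatial_derivs(1)[OF z] spatial_derivs(2)[OF z]] by (simp add: dvg_def inner_commute)
qed

lemma momentum_flux_derivative:
  assumes z: "(t, x) \<in> Q"
  shows "((\<lambda>y. \<rho>' t y *\<^sub>R u' t y) has_derivative
    (\<lambda>h. \<rho>' t x *\<^sub>R (Grad (u' t) x *v h) + (grad (\<rho>' t) x \<bullet> h) *\<^sub>R u' t x)) (at x)"
  by (rule has_derivative_scaleR[OF spatial_derivs(1)[OF z] spatial_derivs(2)[OF z]])

text \<open>The product rule splits off the velocity times the continuity equation and leaves the
  density times the material derivative of the velocity. The energy equation is reduced in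
  \<open>pde_energy\<close> in the same manner, with \<open>e\<close> in the place of the
  velocity.\<close>

lemma pde_momentum:
  assumes z: "(t, x) \<in> Q"
  shows "\<rho>' t x *\<^sub>R (dt u' t x + Grad (u' t) x *v u' t x)
    + (d_rho p (\<rho>' t x) (\<theta>' t x) *\<^sub>R grad (\<rho>' t) x + d_theta p (\<rho>' t x) (\<theta>' t x) *\<^sub>R grad (\<theta>' t) x) = dS (t, x)"
proof -
  note j = joint_derivs[OF z]
  have m: "dt (\<lambda>\<tau> y. \<rho>' \<tau> y *\<^sub>R u' \<tau> y) t x
      + Dvg (\<lambda>y. \<rho>' t y *\<^sub>R outer (u' t y) (u' t y)) x
      + grad (\<lambda>y. p (\<rho>' t y) (\<theta>' t y)) x
      = Dvg (\<lambda>y. stress \<mu> lam (\<rho>' t y) (\<theta>' t y) (Grad (u' t) y)) x"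
    using strong z unfolding strong_solution_def by auto
  have "((\<lambda>(t, x). \<rho>' t x *\<^sub>R u' t x) has_derivative (\<lambda>h. \<rho>' t x *\<^sub>R DU (t, x) h + DR (t, x) h *\<^sub>R u' t x)) (at (t, x))"
    using has_derivative_scaleR[OF j(1) j(2)] by (simp add: case_prod_unfold)
  from dt_eq[OF this] have 1: "dt (\<lambda>\<tau> y. \<rho>' \<tau> y *\<^sub>R u' \<tau> y) t x = \<rho>' t x *\<^sub>R dt u' t x + dt \<rho>' t x *\<^sub>R u' t x"
    by (simp add: D_decomp[OF z])
  have 2: "Dvg (\<lambda>y. \<rho>' t y *\<^sub>R outer (u' t y) (u' t y)) x
      = dvg (\<lambda>y. \<rho>' t y *\<^sub>R u' t y) x *\<^sub>R u' t x + \<rho>' t x *\<^sub>R (Grad (u' t) x *v u' t x)"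
  proof -
    have "dvg (\<lambda>y. (\<rho>' t y *\<^sub>R outer (u' t y) (u' t y)) $ i) x
        = dvg (\<lambda>y. \<rho>' t y *\<^sub>R u' t y) x * u' t x $ i + \<rho>' t x * (Grad (u' t) x *v u' t x) $ i" for i
    proof -
      have ui: "((\<lambda>y. u' t y $ i) has_derivative (\<lambda>h. (Grad (u' t) x *v h) $ i)) (at x)"
        by (rule bounded_linear.has_derivative[OF bounded_linear_vec_nth spatial_derivs(2)[OF z]])
      have "(\<lambda>y. (\<rho>' t y *\<^sub>R outer (u' t y) (u' t y)) $ i) = (\<lambda>y. u' t y $ i *\<^sub>R (\<rho>' t y *\<^sub>R u' t y))"
        by (simp add: fun_eq_iff outer_def vec_eq_iff mult_ac)
      then show ?thesis
        using dvg_scaleR[OF ui momentum_flux_derivative[OF z]] grad_inner[OF ui] by (simp add: mult.commute)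
    qed
    then show ?thesis by (simp add: Dvg_def vec_eq_iff)
  qed
  have 3: "Dvg (\<lambda>y. stress \<mu> lam (\<rho>' t y) (\<theta>' t y) (Grad (u' t) y)) x = dS (t, x)"
  proof -
    have "((\<lambda>y. stress \<mu> lam (\<rho>' t y) (\<theta>' t y) (Grad (u' t) y)) has_derivative DS (t, x)) (at x)"
      by (rule has_derivative_transform_within_open[OF spatial_at[OF DS z] open_dom])
        (use z in \<open>auto simp: S_def Gu_eq\<close>)
    from Dvg_eq[OF this] show ?thesis by (simp add: dS_def)
  qed
  have c: "dvg (\<lambda>y. \<rho>' t y *\<^sub>R u' t y) x = - dt \<rho>' t x" using pde_continuity(2)[OF z] by linarith
  show ?thesis
    using m unfolding 1 2 3 c quad_fields_derivs(4)[OF quad_deriv_Ck[OF p1(2)] z]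
    by (simp add: algebra_simps)
qed

lemma pde_energy:
  assumes z: "(t, x) \<in> Q"
  shows "\<rho>' t x * (d_rho e (\<rho>' t x) (\<theta>' t x) * (dt \<rho>' t x + u' t x \<bullet> grad (\<rho>' t) x)
      + d_theta e (\<rho>' t x) (\<theta>' t x) * (dt \<theta>' t x + u' t x \<bullet> grad (\<theta>' t) x))
    = dK (t, x) + stress \<mu> lam (\<rho>' t x) (\<theta>' t x) (Grad (u' t) x) \<bullet> symm (Grad (u' t) x)
      - p (\<rho>' t x) (\<theta>' t x) * trace (Grad (u' t) x)"
proof -
  have en: "dt (\<lambda>\<tau> y. \<rho>' \<tau> y * e (\<rho>' \<tau> y) (\<theta>' \<tau> y)) t x
         + dvg (\<lambda>y. (\<rho>' t y * e (\<rho>' t y) (\<theta>' t y)) *\<^sub>R u' t y) x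
         - dvg (\<lambda>y. \<kappa> (\<rho>' t y) (\<theta>' t y) *\<^sub>R grad (\<theta>' t) y) x
         = stress \<mu> lam (\<rho>' t x) (\<theta>' t x) (Grad (u' t) x) \<bullet> symm (Grad (u' t) x)
           - p (\<rho>' t x) (\<theta>' t x) * dvg (u' t) x"
    using strong z unfolding strong_solution_def by auto
  note q = quad_fields_derivs[OF quad_deriv_Ck[OF e1(2)] z]
  have "((\<lambda>(t, x). \<rho>' t x * e (\<rho>' t x) (\<theta>' t x)) has_derivative
      (\<lambda>h. \<rho>' t x * (d_rho e (\<rho>' t x) (\<theta>' t x) * DR (t, x) h + d_theta e (\<rho>' t x) (\<theta>' t x) * DH (t, x) h)
        + DR (t, x) h * e (\<rho>' t x) (\<theta>' t x))) (at (t, x))"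
    using has_derivative_mult[OF joint_derivs(1)[OF z] q(1)] by (simp add: case_prod_unfold)
  from dt_eq[OF this] have 1: "dt (\<lambda>\<tau> y. \<rho>' \<tau> y * e (\<rho>' \<tau> y) (\<theta>' \<tau> y)) t x
      = \<rho>' t x * (d_rho e (\<rho>' t x) (\<theta>' t x) * dt \<rho>' t x + d_theta e (\<rho>' t x) (\<theta>' t x) * dt \<theta>' t x) + dt \<rho>' t x * e (\<rho>' t x) (\<theta>' t x)"
    by (simp add: D_decomp[OF z])
  have "(\<lambda>y. (\<rho>' t y * e (\<rho>' t y) (\<theta>' t y)) *\<^sub>R u' t y) = (\<lambda>y. e (\<rho>' t y) (\<theta>' t y) *\<^sub>R (\<rho>' t y *\<^sub>R u' t y))"
    by (simp add: fun_eq_iff mult.commute)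
  then have 2: "dvg (\<lambda>y. (\<rho>' t y * e (\<rho>' t y) (\<theta>' t y)) *\<^sub>R u' t y) x
      = (d_rho e (\<rho>' t x) (\<theta>' t x) *\<^sub>R grad (\<rho>' t) x + d_theta e (\<rho>' t x) (\<theta>' t x) *\<^sub>R grad (\<theta>' t) x) \<bullet> (\<rho>' t x *\<^sub>R u' t x)
        + e (\<rho>' t x) (\<theta>' t x) * dvg (\<lambda>y. \<rho>' t y *\<^sub>R u' t y) x"
    using dvg_scaleR[OF q(3) momentum_flux_derivative[OF z]] q(4) by simp
  have 3: "dvg (\<lambda>y. \<kappa> (\<rho>' t y) (\<theta>' t y) *\<^sub>R grad (\<theta>' t) y) x = dK (t, x)"
  proof -
    have "dvg (\<lambda>y. \<kappa> (\<rho>' t y) (\<theta>' t y) *\<^sub>R grad (\<theta>' t) y) x = dvg (\<lambda>y. qH (t, y)) x"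
      by (rule dvg_cong_open(2)[OF spatial_at[OF DqH z] open_dom]) (use z in \<open>auto simp: qH_def gH_eq\<close>)
    then show ?thesis using dK_eq[OF z] by simp
  qed
  have c: "dvg (\<lambda>y. \<rho>' t y *\<^sub>R u' t y) x = - dt \<rho>' t x" using pde_continuity(2)[OF z] by linarith
  show ?thesis
    using en unfolding 1 2 3 c
    by (simp add: dvg_def inner_simps inner_commute[of "u' t x"] algebra_simps)
qed

definition "P z = p (R z) (H z)"

text \<open>Mechanical flux of pressure and viscosity; the sum is the stress applied to the
  velocity. Its divergence provides the purely strong counterparts of terms of the rate that are
  linear in \<open>u\<close>, \<open>A\<close> and the pressure, and the boundary condition on the
  velocity makes the integral of this divergence zero.\<close>

definition "F z = P z *\<^sub>R U z - (\<Sum>j\<in>UNIV. U z $ j *\<^sub>R (S z $ j))"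

lemma Cder_F: "\<exists>F'. Cder (Pair 0) Q F F'"
proof -
  have z: "Pair 0 0 = (0 :: real \<times> (real^'d))" by (simp add: zero_prod_def)
  obtain P' where P: "Cder (Pair 0) Q (\<lambda>z. p (R z) (H z)) P'"
    using Cder_coefficient[OF p1(2)] by auto
  have "\<exists>f'. Cder (Pair 0) Q (\<lambda>z. U z $ j *\<^sub>R (S z $ j)) f'" for j
    using Cder_bilinear[OF Cder_linear[OF Cder_spatial[OF DU] bounded_linear_vec_nth[of j]]
        Cder_linear[OF DS bounded_linear_vec_nth[of j]] bounded_bilinear_scaleR z] by auto
  then have f': "Cder (Pair 0) Q (\<lambda>z. U z $ j *\<^sub>R (S z $ j)) (SOME f'. Cder (Pair 0) Q (\<lambda>z. U z $ j *\<^sub>R (S z $ j)) f')" for j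
    by (rule someI_ex)
  have eq: "F = (\<lambda>z. p (R z) (H z) *\<^sub>R U z - (\<Sum>j\<in>UNIV. U z $ j *\<^sub>R (S z $ j)))"
    by (simp add: fun_eq_iff F_def P_def)
  show ?thesis
    unfolding eq
    by (rule exI, rule Cder_diff[OF Cder_bilinear[OF P Cder_spatial[OF DU] bounded_bilinear_scaleR z] Cder_sum[OF f']])
qed

lemma dvg_F:
  assumes z: "(t, x) \<in> Q"
  shows "dvg (\<lambda>y. F (t, y)) x = u' t x \<bullet> (d_rho p (\<rho>' t x) (\<theta>' t x) *\<^sub>R grad (\<rho>' t) x + d_theta p (\<rho>' t x) (\<theta>' t x) *\<^sub>R grad (\<theta>' t) x)
    + p (\<rho>' t x) (\<theta>' t x) * trace (Grad (u' t) x) - (u' t x \<bullet> dS (t, x) + Grad (u' t) x \<bullet> S (t, x))"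
proof -
  note q = quad_fields_derivs[OF quad_deriv_Ck[OF p1(2)] z]
  have uj: "((\<lambda>y. u' t y $ j) has_derivative (\<lambda>h. (Grad (u' t) x *v h) $ j)) (at x)" for j
    by (rule bounded_linear.has_derivative[OF bounded_linear_vec_nth spatial_derivs(2)[OF z]])
  have Sj: "((\<lambda>y. S (t, y) $ j) has_derivative (\<lambda>h. DS (t, x) h $ j)) (at x)" for j
    by (rule bounded_linear.has_derivative[OF bounded_linear_vec_nth spatial_at[OF DS z]])
  have dSj: "dvg (\<lambda>y. S (t, y) $ j) x = dS (t, x) $ j" for j
    unfolding dvg_eq[OF Sj] by (simp add: dS_def)
  have gj: "grad (\<lambda>y. u' t y $ j) x = Grad (u' t) x $ j" for j
    using Grad_row[OF spatial_derivs(2)[OF z]] by simp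
  have 1: "dvg (\<lambda>y. p (\<rho>' t y) (\<theta>' t y) *\<^sub>R u' t y) x
     = (d_rho p (\<rho>' t x) (\<theta>' t x) *\<^sub>R grad (\<rho>' t) x + d_theta p (\<rho>' t x) (\<theta>' t x) *\<^sub>R grad (\<theta>' t) x) \<bullet> u' t x
       + p (\<rho>' t x) (\<theta>' t x) * trace (Grad (u' t) x)"
    using dvg_scaleR[OF q(3) spatial_derivs(2)[OF z]] q(4) by (simp add: dvg_def)
  have 2: "dvg (\<lambda>y. u' t y $ j *\<^sub>R S (t, y) $ j) x = Grad (u' t) x $ j \<bullet> S (t, x) $ j + u' t x $ j * dS (t, x) $ j" for j
    using dvg_scaleR[OF uj Sj] gj dSj by simp
  have s: "((\<lambda>y. \<Sum>j\<in>UNIV. u' t y $ j *\<^sub>R S (t, y) $ j) has_derivative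
      (\<lambda>h. \<Sum>j\<in>UNIV. u' t x $ j *\<^sub>R (DS (t, x) h $ j) + (Grad (u' t) x *v h) $ j *\<^sub>R (S (t, x) $ j))) (at x)"
    by (rule has_derivative_sum[OF has_derivative_scaleR[OF uj Sj]])
  have "dvg (\<lambda>y. \<Sum>j\<in>UNIV. u' t y $ j *\<^sub>R S (t, y) $ j) x = (\<Sum>j\<in>UNIV. dvg (\<lambda>y. u' t y $ j *\<^sub>R S (t, y) $ j) x)"
    by (rule dvg_sum[OF has_derivative_scaleR[OF uj Sj]])
  also have "\<dots> = Grad (u' t) x \<bullet> S (t, x) + u' t x \<bullet> dS (t, x)"
    unfolding 2 by (simp add: sum.distrib inner_vec_def)
  finally have 3: "dvg (\<lambda>y. \<Sum>j\<in>UNIV. u' t y $ j *\<^sub>R S (t, y) $ j) x = Grad (u' t) x \<bullet> S (t, x) + u' t x \<bullet> dS (t, x)" .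
  have "dvg (\<lambda>y. F (t, y)) x = dvg (\<lambda>y. p (\<rho>' t y) (\<theta>' t y) *\<^sub>R u' t y) x - dvg (\<lambda>y. \<Sum>j\<in>UNIV. u' t y $ j *\<^sub>R S (t, y) $ j) x"
    unfolding F_def P_def RUH_simps
    by (rule dvg_diff[OF has_derivative_scaleR[OF q(3) spatial_derivs(2)[OF z]] s])
  then show ?thesis unfolding 1 3 by (simp add: inner_commute)
qed

section \<open>Integration over the space-time cylinder\<close>

lemma measurable_Q:
  fixes f :: "real \<times> (real^'d) \<Rightarrow> 'b::euclidean_space"
  assumes "continuous_on (closure Q) f"
  shows "f \<in> borel_measurable (lebesgue_on Q)"
  using open_Q by (intro continuous_imp_measurable_on_sets_lebesgue continuous_on_subset[OF assms closure_subset]) auto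

lemma integrable_Q:
  fixes f :: "real \<times> (real^'d) \<Rightarrow> 'b::euclidean_space"
  assumes "continuous_on (closure Q) f"
  shows "integrable (lebesgue_on Q) f"
proof -
  obtain B where B: "\<And>z. z \<in> closure Q \<Longrightarrow> norm (f z) \<le> B" using continuous_bounded[OF assms] by metis
  have "Q \<in> lmeasurable"
    using open_Q T bounded_dom by (intro lmeasurable_open bounded_Times) auto
  then interpret finite_measure "lebesgue_on Q" by (rule finite_measure_lebesgue_on)
  show ?thesis
    by (rule integrable_const_bound[of _ B]) (use B Q_closure measurable_Q[OF assms] in \<open>auto intro!: AE_I2\<close>)
qed

lemma sets_Q: "\<tau> \<in> {0<..<T} \<Longrightarrow> QT \<tau> \<Omega> \<subseteq> Q \<and> QT \<tau> \<Omega> \<in> sets lebesgue \<and> Q \<in> sets lebesgue"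
  using prod_sets_lebesgue[OF open_greaterThanLessThan open_dom] by auto

text \<open>At each time the components of \<open>F\<close> vanish on the boundary of \<Omega>. Each
  diagonal partial derivative then has integral zero by itself, without an outer normal, and
  Fubini's theorem assembles the slices.\<close>

lemma integral_dvg_F:
  assumes \<tau>: "\<tau> \<in> {0<..<T}"
  shows "integrable (lebesgue_on Q) (\<lambda>(t, x). dvg (\<lambda>y. F (t, y)) x)"
    and "(LINT (t, x)|lebesgue_on (QT \<tau> \<Omega>). dvg (\<lambda>y. F (t, y)) x) = 0"
proof -
  obtain F' where F: "Cder (Pair 0) Q F F'" using Cder_F by auto
  define g where "g z = (\<Sum>i\<in>UNIV. F' z (axis i 1) $ i)" for z
  have gc: "continuous_on (closure Q) g"
    unfolding g_def by (intro continuous_intros CderD(3)[OF F])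
  have g: "dvg (\<lambda>y. F (t, y)) x = g (t, x)" if "(t, x) \<in> Q" for t x
    using dvg_eq[OF spatial_at[OF F that]] by (simp add: g_def)
  have gi: "integrable (lebesgue_on Q) g" by (rule integrable_Q[OF gc])
  then show "integrable (lebesgue_on Q) (\<lambda>(t, x). dvg (\<lambda>y. F (t, y)) x)"
    by (rule Bochner_Integration.integrable_cong[THEN iffD1, rotated 2]) (use g in auto)
  have gi': "integrable (lebesgue_on (QT \<tau> \<Omega>)) g"
    using integrable_lebesgue_on_mono[OF gi] sets_Q[OF \<tau>] by auto
  have z0: "(LINT x|lebesgue_on \<Omega>. g (t, x)) = 0" if t: "t \<in> {0<..<\<tau>}" for t
  proof -
    have tT: "t \<in> {0<..<T}" using t \<tau> by auto
    have hb: "has_bochner_integral (lebesgue_on \<Omega>) (\<lambda>x. F' (t, x) (axis i 1) $ i) 0" for i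
    proof -
      define D where "D x = Blinfun (\<lambda>h. F' (t, x) h $ i)" for x
      have D: "blinfun_apply (D x) = (\<lambda>h. F' (t, x) h $ i)" if "x \<in> closure \<Omega>" for x
      proof -
        have "(t, x) \<in> closure Q" using that tT by (simp add: closure_Q)
        then have "linear (\<lambda>h. F' (t, x) h $ i)"
          using linear_compose[OF CderD(2)[OF F] bounded_linear.linear[OF bounded_linear_vec_nth]] by (simp add: o_def)
        then show ?thesis unfolding D_def
          by (intro bounded_linear_Blinfun_apply) (simp add: linear_conv_bounded_linear)
      qed
      have slice: "continuous_on (closure \<Omega>) (\<lambda>x. f (t, x))" if "continuous_on (closure Q) f" for f :: "_ \<Rightarrow> 'x::topological_space"
        by (rule continuous_on_compose2[OF that]) (use tT in \<open>auto simp: closure_Q intro!: continuous_intros\<close>)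
      have Dc: "continuous_on (closure \<Omega>) D"
      proof (rule continuous_on_blinfun_componentwise)
        fix h :: "real^'d"
        have "continuous_on (closure \<Omega>) (\<lambda>x. F' (t, x) h $ i)"
          by (intro continuous_intros slice CderD(3)[OF F])
        then show "continuous_on (closure \<Omega>) (\<lambda>x. D x h)" by (rule continuous_on_eq) (simp add: D)
      qed
      have "bounded (D ` closure \<Omega>)"
        using bounded_dom by (intro compact_imp_bounded compact_continuous_image Dc) (simp add: compact_closure)
      then obtain L where L: "\<And>x. x \<in> closure \<Omega> \<Longrightarrow> norm (D x) \<le> L" by (auto simp: bounded_iff)
      have "integrable (lebesgue_on \<Omega>) (\<lambda>x. D x (axis i 1))" "(LINT x|lebesgue_on \<Omega>. D x (axis i 1)) = 0"
      proof -
        have a: "continuous_on (closure \<Omega>) (\<lambda>x. F (t, x) $ i)" by (intro continuous_intros slice CderD(1)[OF F])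
        have b: "F (t, x) $ i = 0" if "x \<in> frontier \<Omega>" for x
        proof -
          have "u' t x = 0" using strong that tT unfolding strong_solution_def by auto
          then show ?thesis by (simp add: F_def)
        qed
        have c: "((\<lambda>x. F (t, x) $ i) has_derivative D x) (at x)" if "x \<in> \<Omega>" for x
          using bounded_linear.has_derivative[OF bounded_linear_vec_nth spatial_at[OF F]] that tT D closure_subset[of \<Omega>] by auto
        have d: "continuous_on \<Omega> D" by (rule continuous_on_subset[OF Dc closure_subset])
        have f: "norm (D x) \<le> L" if "x \<in> \<Omega>" for x using that L closure_subset by blast
        show "integrable (lebesgue_on \<Omega>) (\<lambda>x. D x (axis i 1))" "(LINT x|lebesgue_on \<Omega>. D x (axis i 1)) = 0"
          using integral_deriv_zero_boundary[OF open_dom bounded_dom a b c d f] by auto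
      qed
      then have "has_bochner_integral (lebesgue_on \<Omega>) (\<lambda>x. D x (axis i 1)) 0"
        by (simp add: has_bochner_integral_iff)
      then show ?thesis
        by (rule has_bochner_integral_cong[THEN iffD1, rotated 3]) (simp_all add: D[OF subsetD[OF closure_subset]])
    qed
    have "has_bochner_integral (lebesgue_on \<Omega>) (\<lambda>x. \<Sum>i\<in>UNIV. F' (t, x) (axis i 1) $ i) (\<Sum>i\<in>(UNIV :: 'd set). 0)"
      by (rule has_bochner_integral_sum[OF hb])
    then show ?thesis by (simp add: g_def has_bochner_integral_iff)
  qed
  have "(LINT (t, x)|lebesgue_on (QT \<tau> \<Omega>). dvg (\<lambda>y. F (t, y)) x) = integral\<^sup>L (lebesgue_on (QT \<tau> \<Omega>)) g"
    by (rule Bochner_Integration.integral_cong) (use g \<tau> in auto)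
  also have "\<dots> = (LINT t|lebesgue_on {0<..<\<tau>}. LINT x|lebesgue_on \<Omega>. g (t, x))"
    by (rule Fubini_lebesgue_on(3)[symmetric]) (use open_dom gi' in auto)
  also have "\<dots> = (LINT t|lebesgue_on {0<..<\<tau>}. 0)"
    by (rule Bochner_Integration.integral_cong) (use z0 in auto)
  finally show "(LINT (t, x)|lebesgue_on (QT \<tau> \<Omega>). dvg (\<lambda>y. F (t, y)) x) = 0" by simp
qed

end

section \<open>Test functions built from the strong solution\<close>

lemma Bernstein_deriv:
  obtains b' where "\<And>x. (Bernstein n k has_real_derivative b' x) (at x)" "continuous_on UNIV b'"
proof (rule that)
  show "(Bernstein n k has_real_derivative
      real (n choose k) * (real k * x ^ (k - 1) * (1 - x) ^ (n - k) - x ^ k * (real (n - k) * (1 - x) ^ (n - k - 1)))) (at x)" for x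
    unfolding Bernstein_def
    by (auto intro!: derivative_eq_intros simp: algebra_simps)
qed (intro continuous_intros)

context strong_setup
begin

lemma zero_Pair: "Pair 0 0 = (0 :: real \<times> (real^'d))"
  by (simp add: zero_prod_def)

lemma slice_closure:
  assumes "continuous_on (closure Q) f" "t \<in> {0..T}"
  shows "continuous_on (closure Q) (\<lambda>z. f (t, snd z))"
  by (rule continuous_on_compose2[OF assms(1)])
    (use assms(2) in \<open>auto simp: closure_Q intro!: continuous_intros\<close>)

lemma integrable_coeff:
  fixes b f c :: "real \<times> (real^'d) \<Rightarrow> 'b::euclidean_space"
  assumes b: "integrable (lebesgue_on Q) b" and c: "continuous_on (closure Q) c" and f: "\<And>z. z \<in> Q \<Longrightarrow> f z = c z"
  shows "integrable (lebesgue_on Q) (\<lambda>z. b z \<bullet> f z)"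
proof -
  obtain B where B: "\<And>z. z \<in> closure Q \<Longrightarrow> norm (c z) \<le> B" using continuous_bounded[OF c] by metis
  have "integrable (lebesgue_on Q) (\<lambda>z. b z \<bullet> c z)"
    by (rule integrable_inner_bounded[OF b measurable_Q[OF c], of B]) (simp add: B[OF Q_closure])
  then show ?thesis
    by (rule Bochner_Integration.integrable_cong[THEN iffD1, rotated 2]) (simp_all add: f)
qed

lemma integrable_continuous_eq:
  fixes f c :: "real \<times> (real^'d) \<Rightarrow> 'b::euclidean_space"
  assumes c: "continuous_on (closure Q) c" and f: "\<And>z. z \<in> Q \<Longrightarrow> f z = c z"
  shows "integrable (lebesgue_on Q) f"
  using integrable_Q[OF c]
  by (rule Bochner_Integration.integrable_cong[THEN iffD1, rotated 2]) (simp_all add: f)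

text \<open>Kinetic energy density minus chemical potential: the test function for the continuity equation.\<close>

definition "\<psi> t x = (norm (u' t x))\<^sup>2 / 2 - (e (\<rho>' t x) (\<theta>' t x) - \<theta>' t x * s (\<rho>' t x) (\<theta>' t x) + p (\<rho>' t x) (\<theta>' t x) / \<rho>' t x)"

lemma Cder_\<psi>: "Cder id Q (\<lambda>(t, x). \<psi> t x) (\<lambda>z h. U z \<bullet> DU z h
   - (d_rho p (R z) (H z) / R z * DR z h + (d_theta p (R z) (H z) / R z - s (R z) (H z)) * DH z h))"
proof -
  have a: "Cder id Q (\<lambda>z. (1/2) * (U z \<bullet> U z)) (\<lambda>z h. (1/2) * (U z \<bullet> DU z h + DU z h \<bullet> U z))"
    by (rule Cder_linear[OF Cder_bilinear[OF DU DU bounded_bilinear_inner] bounded_linear_mult_right]) simp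
  have b: "Cder id Q (\<lambda>z. e (R z) (H z) - H z * s (R z) (H z) + p (R z) (H z) / R z)
      (\<lambda>z h. d_rho p (R z) (H z) / R z * DR z h + (d_theta p (R z) (H z) / R z - s (R z) (H z)) * DH z h)"
    by (rule Cder_quadrant[OF quad_deriv_chemical_potential DR DH positive]) auto
  have eq1: "(\<lambda>z. (1/2) * (U z \<bullet> U z) - (e (R z) (H z) - H z * s (R z) (H z) + p (R z) (H z) / R z)) = (\<lambda>(t, x). \<psi> t x)"
    by (auto simp: fun_eq_iff \<psi>_def power2_norm_eq_inner R_def U_def H_def)
  have eq2: "(\<lambda>z h. (1/2) * (U z \<bullet> DU z h + DU z h \<bullet> U z)) = (\<lambda>z h. U z \<bullet> DU z h)"
    by (simp add: fun_eq_iff inner_commute)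
  show ?thesis by (rule Cder_diff[OF a[unfolded eq2] b, unfolded eq1])
qed

lemma \<psi>_derivs:
  assumes z: "(t, x) \<in> Q"
  defines "Pt \<equiv> d_rho p (\<rho>' t x) (\<theta>' t x) * dt \<rho>' t x + d_theta p (\<rho>' t x) (\<theta>' t x) * dt \<theta>' t x"
    and "Px \<equiv> d_rho p (\<rho>' t x) (\<theta>' t x) *\<^sub>R grad (\<rho>' t) x + d_theta p (\<rho>' t x) (\<theta>' t x) *\<^sub>R grad (\<theta>' t) x"
  shows "dt \<psi> t x = u' t x \<bullet> dt u' t x - (Pt / \<rho>' t x - s (\<rho>' t x) (\<theta>' t x) * dt \<theta>' t x)"
    and "grad (\<psi> t) x = transpose (Grad (u' t) x) *v u' t x - ((1 / \<rho>' t x) *\<^sub>R Px - s (\<rho>' t x) (\<theta>' t x) *\<^sub>R grad (\<theta>' t) x)"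
proof -
  note d = Cder_has_derivative[OF Cder_\<psi> z]
  show "dt \<psi> t x = u' t x \<bullet> dt u' t x - (Pt / \<rho>' t x - s (\<rho>' t x) (\<theta>' t x) * dt \<theta>' t x)"
    using dt_eq[OF d] by (simp add: D_decomp[OF z] Pt_def algebra_simps add_divide_distrib)
  have "grad (\<psi> t) x \<bullet> h = (transpose (Grad (u' t) x) *v u' t x - ((1 / \<rho>' t x) *\<^sub>R Px - s (\<rho>' t x) (\<theta>' t x) *\<^sub>R grad (\<theta>' t) x)) \<bullet> h" for h
  proof -
    have tr: "(transpose (Grad (u' t) x) *v u' t x) \<bullet> h = u' t x \<bullet> (Grad (u' t) x *v h)"
      unfolding transpose_matrix_vector by (rule dot_lmul_matrix)
    show ?thesis
      unfolding inner_diff_left tr using grad_inner[OF spatial_has_derivative[OF d], of h]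
      by (simp add: D_decomp[OF z] Px_def inner_simps algebra_simps add_divide_distrib)
  qed
  then show "grad (\<psi> t) x = transpose (Grad (u' t) x) *v u' t x - ((1 / \<rho>' t x) *\<^sub>R Px - s (\<rho>' t x) (\<theta>' t x) *\<^sub>R grad (\<theta>' t) x)"
    using vector_eq_rdot by blast
qed

lemma Cder_P: "Cder id Q P (\<lambda>z h. d_rho p (R z) (H z) * DR z h + d_theta p (R z) (H z) * DH z h)"
  unfolding P_def[abs_def]
  by (rule Cder_quadrant[OF quad_deriv_Ck[OF p1(2)] DR DH positive]) auto

definition "Pt t x = d_rho p (\<rho>' t x) (\<theta>' t x) * dt \<rho>' t x + d_theta p (\<rho>' t x) (\<theta>' t x) * dt \<theta>' t x"

lemma slice_dom:
  fixes f :: "real \<times> (real^'d) \<Rightarrow> 'b::euclidean_space"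
  assumes f: "continuous_on (closure Q) f" and t: "t \<in> {0..T}"
  shows "(\<lambda>x. f (t, x)) \<in> borel_measurable (lebesgue_on \<Omega>)"
    and "\<exists>B. \<forall>x\<in>\<Omega>. norm (f (t, x)) \<le> B"
    and "integrable (lebesgue_on \<Omega>) (\<lambda>x. f (t, x))"
proof -
  obtain B where B: "\<And>z. z \<in> closure Q \<Longrightarrow> norm (f z) \<le> B" using continuous_bounded[OF f] by metis
  have in_cl: "(t, x) \<in> closure Q" if "x \<in> \<Omega>" for x
    using t subsetD[OF closure_subset that] by (simp add: closure_Q)
  have c: "continuous_on \<Omega> (\<lambda>x. f (t, x))"
    by (rule continuous_on_compose2[OF f]) (use in_cl in \<open>auto intro!: continuous_intros\<close>)
  show m: "(\<lambda>x. f (t, x)) \<in> borel_measurable (lebesgue_on \<Omega>)"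
    using open_dom by (intro continuous_imp_measurable_on_sets_lebesgue c) auto
  have b: "norm (f (t, x)) \<le> B" if "x \<in> \<Omega>" for x
    by (rule B[OF in_cl[OF that]])
  then show "\<exists>B. \<forall>x\<in>\<Omega>. norm (f (t, x)) \<le> B" by blast
  have "\<Omega> \<in> lmeasurable" using open_dom bounded_dom by (intro lmeasurable_open)
  then interpret finite_measure "lebesgue_on \<Omega>" by (rule finite_measure_lebesgue_on)
  show "integrable (lebesgue_on \<Omega>) (\<lambda>x. f (t, x))"
    by (rule integrable_const_bound[of _ B]) (use b m in \<open>auto intro!: AE_I2\<close>)
qed

lemmas integrable_P = slice_dom(3)[OF CderD(1)[OF Cder_P]]

text \<open>The fundamental theorem of calculus in time at each fixed point of \<Omega>, in the
  version for functions continuous on the closed interval and differentiable inside; Fubini's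
  theorem with space as the outer variable gives the rest.\<close>

lemma integral_Pt:
  assumes \<tau>: "\<tau> \<in> {0<..<T}"
  shows "integrable (lebesgue_on Q) (\<lambda>(t, x). Pt t x)"
    and "(LINT (t, x)|lebesgue_on (QT \<tau> \<Omega>). Pt t x) = (LINT x|lebesgue_on \<Omega>. P (\<tau>, x)) - (LINT x|lebesgue_on \<Omega>. P (0, x))"
proof -
  define g where "g z = d_rho p (R z) (H z) * DR z (1, 0) + d_theta p (R z) (H z) * DH z (1, 0)" for z
  have gc: "continuous_on (closure Q) g" unfolding g_def by (rule CderD(3)[OF Cder_P])
  have g: "Pt t x = g (t, x)" if "(t, x) \<in> Q" for t x
    using D_decomp[OF that] by (simp add: Pt_def g_def)
  show "integrable (lebesgue_on Q) (\<lambda>(t, x). Pt t x)"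
    by (rule integrable_continuous_eq[OF gc]) (use g in auto)
  have gi: "integrable (lebesgue_on (QT \<tau> \<Omega>)) g"
    using integrable_lebesgue_on_mono[OF integrable_Q[OF gc]] sets_Q[OF \<tau>] by blast
  have inner: "(LINT t|lebesgue_on {0<..<\<tau>}. g (t, x)) = P (\<tau>, x) - P (0, x)" if x: "x \<in> \<Omega>" for x
  proof -
    have cs: "continuous_on {0..\<tau>} (\<lambda>t. f (t, x))" if "continuous_on (closure Q) f" for f :: "_ \<Rightarrow> real"
      by (rule continuous_on_compose2[OF that])
        (use x \<tau> closure_subset[of \<Omega>] in \<open>auto simp: closure_Q intro!: continuous_intros\<close>)
    have "integrable (lebesgue_on {0..\<tau>}) (\<lambda>t. g (t, x))"
      by (intro absolutely_integrable_imp_integrable absolutely_integrable_continuous_real cs gc) auto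
    then have i: "integrable (lebesgue_on {0<..<\<tau>}) (\<lambda>t. g (t, x))"
      by (rule integrable_lebesgue_on_mono) auto
    have "((\<lambda>t. g (t, x)) has_integral (LINT t|lebesgue_on {0<..<\<tau>}. g (t, x))) {0..\<tau>}"
      using has_integral_integral_lebesgue_on[OF i] by (simp add: has_integral_Icc_iff_Ioo)
    moreover have "((\<lambda>t. g (t, x)) has_integral (P (\<tau>, x) - P (0, x))) {0..\<tau>}"
    proof (rule fundamental_theorem_of_calculus_interior)
      show "continuous_on {0..\<tau>} (\<lambda>t. P (t, x))" by (rule cs[OF CderD(1)[OF Cder_P]])
      fix t assume t: "t \<in> {0<..<\<tau>}"
      then have z: "(t, x) \<in> Q" using x \<tau> by auto
      have "((\<lambda>\<tau>. (\<tau>, x)) has_derivative (\<lambda>a. (a, 0))) (at t)" by (auto intro!: derivative_eq_intros)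
      from has_derivative_compose[OF this Cder_has_derivative[OF Cder_P z]]
      have "((\<lambda>t. P (t, x)) has_derivative (\<lambda>a. d_rho p (R (t, x)) (H (t, x)) * DR (t, x) (a, 0) + d_theta p (R (t, x)) (H (t, x)) * DH (t, x) (a, 0))) (at t)" .
      then show "((\<lambda>t. P (t, x)) has_vector_derivative g (t, x)) (at t)"
        unfolding has_vector_derivative_def g_def
        by (rule has_derivative_eq_rhs) (simp add: D_decomp[OF z] fun_eq_iff algebra_simps)
    qed (use \<tau> in auto)
    ultimately show ?thesis by (rule has_integral_unique)
  qed
  have "(LINT (t, x)|lebesgue_on (QT \<tau> \<Omega>). Pt t x) = integral\<^sup>L (lebesgue_on (QT \<tau> \<Omega>)) g"
    by (rule Bochner_Integration.integral_cong) (use g \<tau> in auto)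
  also have "\<dots> = (LINT x|lebesgue_on \<Omega>. LINT t|lebesgue_on {0<..<\<tau>}. g (t, x))"
    by (rule Fubini_lebesgue_on(4)[symmetric]) (use open_dom gi in auto)
  also have "\<dots> = (LINT x|lebesgue_on \<Omega>. P (\<tau>, x) - P (0, x))"
    by (rule Bochner_Integration.integral_cong) (use inner in auto)
  also have "\<dots> = (LINT x|lebesgue_on \<Omega>. P (\<tau>, x)) - (LINT x|lebesgue_on \<Omega>. P (0, x))"
    using integrable_P \<tau> by (intro Bochner_Integration.integral_diff) auto
  finally show "(LINT (t, x)|lebesgue_on (QT \<tau> \<Omega>). Pt t x) = (LINT x|lebesgue_on \<Omega>. P (\<tau>, x)) - (LINT x|lebesgue_on \<Omega>. P (0, x))" .
qed

lemma Cder_time: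
  assumes g: "\<And>x. (g has_real_derivative g' x) (at x)" and g': "continuous_on UNIV g'"
  shows "Cder id Q (\<lambda>z. g (fst z)) (\<lambda>z h. g' (fst z) * fst h)"
  unfolding Cder_def
proof (intro conjI ballI allI)
  have "continuous_on UNIV g" using g by (meson DERIV_isCont continuous_at_imp_continuous_on)
  then show "continuous_on (closure Q) (\<lambda>z. g (fst z))"
    by (rule continuous_on_compose2) (auto intro!: continuous_intros)
  have "continuous_on (closure Q) (\<lambda>z. g' (fst z))"
    by (rule continuous_on_compose2[OF g']) (auto intro!: continuous_intros)
  then show "continuous_on (closure Q) (\<lambda>z. g' (fst z) * fst h)" for h :: "real \<times> (real^'d)"
    by (intro continuous_on_mult_right)
  show "linear (\<lambda>h :: real \<times> (real^'d). g' (fst z) * fst h)" for z :: "real \<times> (real^'d)"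
    by (intro linearI) (simp_all add: algebra_simps)
  fix z :: "real \<times> (real^'d)"
  have "((\<lambda>h. fst (z + h)) has_derivative fst) (at 0)"
    by (auto intro!: derivative_eq_intros)
  moreover have "(g has_derivative (*) (g' (fst z))) (at (fst (z + 0)))"
    using g[of "fst z"] by (simp add: has_field_derivative_def)
  ultimately show "((\<lambda>h. g (fst (z + id h))) has_derivative (\<lambda>h. g' (fst z) * fst h)) (at 0)"
    unfolding id_def by (rule has_derivative_compose)
qed

lemma Cder_frozen_time:
  assumes G: "Cder (Pair 0) Q G G'" and t: "t \<in> {0<..<T}"
  shows "Cder id Q (\<lambda>z. G (t, snd z)) (\<lambda>z h. G' (t, snd z) (snd h))"
  unfolding Cder_def
proof (intro conjI ballI allI)
  have t': "t \<in> {0..T}" using t by auto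
  show "continuous_on (closure Q) (\<lambda>z. G (t, snd z))" by (rule slice_closure[OF CderD(1)[OF G] t'])
  show "continuous_on (closure Q) (\<lambda>z. G' (t, snd z) (snd h))" for h :: "real \<times> (real^'d)"
    by (rule slice_closure[OF CderD(3)[OF G] t'])
  show "linear (\<lambda>h :: real \<times> (real^'d). G' (t, snd z) (snd h))" if "z \<in> closure Q" for z
  proof -
    have "(t, snd z) \<in> closure Q" using that t' by (auto simp: closure_Q)
    then show ?thesis
      using linear_compose[OF linear_snd CderD(2)[OF G]] by (simp add: o_def)
  qed
  fix z assume "z \<in> Q"
  then have z: "(t, snd z) \<in> Q" using t by auto
  have "((\<lambda>h. snd (z + h)) has_derivative snd) (at 0)"
    by (auto intro!: derivative_eq_intros)
  moreover have "((\<lambda>y. G (t, y)) has_derivative G' (t, snd z)) (at (snd (z + 0)))"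
    using spatial_at[OF G z] by simp
  ultimately show "((\<lambda>h. G (t, snd (z + id h))) has_derivative (\<lambda>h. G' (t, snd z) (snd h))) (at 0)"
    unfolding id_def by (rule has_derivative_compose)
qed

text \<open>Each summand is a polynomial in time times a frozen field, hence jointly C1 even if
  \<open>G\<close> has no time derivative. The indices 0 and \<open>n\<close> are left out because
  their nodes are the end points of the time interval.\<close>

lemma Bernstein_test_field:
  fixes G :: "real \<times> (real^'d) \<Rightarrow> 'b::real_normed_vector" and c :: "nat \<Rightarrow> real"
  assumes G: "Cder (Pair 0) Q G G'"
  defines "\<Phi> n t x \<equiv> \<Sum>k\<in>{1..<n}. (Bernstein n k (t / T) * c k) *\<^sub>R G (k / n * T, x)"
  shows "C1_QT T \<Omega> (\<Phi> n)"
    and "(t, x) \<in> Q \<Longrightarrow> (\<Phi> n t has_derivative (\<lambda>h. \<Sum>k\<in>{1..<n}. (Bernstein n k (t / T) * c k) *\<^sub>R G' (k / n * T, x) h)) (at x)"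
proof -
  have node: "real k / real n * T \<in> {0<..<T}" if "k \<in> {1..<n}" for k n
    using that T by (auto simp: field_simps)
  have ex: "\<exists>f'. Cder id Q (\<lambda>z. (Bernstein n k (fst z / T) * c k) *\<^sub>R G (k / n * T, snd z)) f'" if k: "k \<in> {1..<n}" for k
  proof -
    obtain b' where b': "\<And>x. (Bernstein n k has_real_derivative b' x) (at x)" "continuous_on UNIV b'"
      using Bernstein_deriv by blast
    have "((\<lambda>t. Bernstein n k (t / T) * c k) has_real_derivative b' (t / T) * (1 / T) * c k) (at t)" for t
      by (intro DERIV_cmult_right DERIV_chain2[where g = "\<lambda>t. t / T", OF b'(1)] DERIV_cdivide DERIV_ident)
    moreover have "continuous_on UNIV (\<lambda>t. b' (t / T) * (1 / T) * c k)"
      using T by (intro continuous_intros continuous_on_compose2[OF b'(2)]) auto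
    ultimately have ct: "Cder id Q (\<lambda>z. Bernstein n k (fst z / T) * c k) (\<lambda>z h. b' (fst z / T) * (1 / T) * c k * fst h)"
      by (rule Cder_time)
    show ?thesis
      by (rule exI, rule Cder_bilinear[OF ct Cder_frozen_time[OF G node[OF k]] bounded_bilinear_scaleR id_apply])
  qed
  have f': "Cder id Q (\<lambda>z. (Bernstein n k (fst z / T) * c k) *\<^sub>R G (k / n * T, snd z))
      (SOME f'. Cder id Q (\<lambda>z. (Bernstein n k (fst z / T) * c k) *\<^sub>R G (k / n * T, snd z)) f')" if "k \<in> {1..<n}" for k
    by (rule someI_ex[OF ex[OF that]])
  have "C1_closure Q (\<lambda>z. \<Sum>k\<in>{1..<n}. (Bernstein n k (fst z / T) * c k) *\<^sub>R G (k / n * T, snd z))"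
    by (rule Cder_imp_C1_closure, rule Cder_sum, rule f')
  moreover have "(\<lambda>(t, x). \<Phi> n t x) = (\<lambda>z. \<Sum>k\<in>{1..<n}. (Bernstein n k (fst z / T) * c k) *\<^sub>R G (k / n * T, snd z))"
    by (simp add: \<Phi>_def fun_eq_iff)
  ultimately show "C1_QT T \<Omega> (\<Phi> n)" by simp
  show "(\<Phi> n t has_derivative (\<lambda>h. \<Sum>k\<in>{1..<n}. (Bernstein n k (t / T) * c k) *\<^sub>R G' (k / n * T, x) h)) (at x)" if "(t, x) \<in> Q"
    unfolding \<Phi>_def
  proof (intro has_derivative_sum has_derivative_scaleR_right spatial_at[OF G])
    fix k assume "k \<in> {1..<n}"
    from node[OF this] show "(real k / real n * T, x) \<in> Q" using that by auto
  qed
qed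

text \<open>Up to sign the entropy flux by heat conduction. It is the field with which the
  temperature compatibility is tested, and its divergence \<open>d\<eta>\<close> is the coefficient
  of \<open>\<theta> - h\<close> among the completing terms of the rate.\<close>

definition "\<eta> z = (1 / H z) *\<^sub>R qH z"
definition "D\<eta> = (SOME \<eta>'. Cder (Pair 0) Q \<eta> \<eta>')"
definition "d\<eta> z = (\<Sum>j\<in>UNIV. D\<eta> z (axis j 1) $ j)"

lemma D\<eta>: "Cder (Pair 0) Q \<eta> D\<eta>"
proof -
  have "Cder (Pair 0) Q (\<lambda>z. 1 / H z) (\<lambda>z h. 0 * DR z (0, h) + - 1 / (H z)\<^sup>2 * DH z (0, h))"
    by (rule Cder_quadrant[OF quad_deriv_inverse_theta Cder_spatial[OF DR] Cder_spatial[OF DH] positive zero_Pair])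
  from Cder_bilinear[OF this DqH bounded_bilinear_scaleR zero_Pair]
  have "\<exists>\<eta>'. Cder (Pair 0) Q \<eta> \<eta>'" unfolding \<eta>_def[abs_def] by blast
  then show ?thesis unfolding D\<eta>_def by (rule someI_ex)
qed

lemma \<eta>_eq: "(t, x) \<in> Q \<Longrightarrow> \<eta> (t, x) = (\<kappa> (\<rho>' t x) (\<theta>' t x) / \<theta>' t x) *\<^sub>R grad (\<theta>' t) x"
  by (simp add: \<eta>_def qH_def gH_eq)

lemma d\<eta>_eq:
  assumes z: "(t, x) \<in> Q"
  shows "d\<eta> (t, x) = dK (t, x) / \<theta>' t x - \<kappa> (\<rho>' t x) (\<theta>' t x) * (norm (grad (\<theta>' t) x))\<^sup>2 / (\<theta>' t x)\<^sup>2"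
proof -
  note q = quad_fields_derivs[OF quad_deriv_inverse_theta z]
  have "d\<eta> (t, x) = dvg (\<lambda>y. \<eta> (t, y)) x"
    using dvg_eq[OF spatial_at[OF D\<eta> z]] by (simp add: d\<eta>_def)
  also have "(\<lambda>y. \<eta> (t, y)) = (\<lambda>y. (1 / \<theta>' t y) *\<^sub>R qH (t, y))" by (simp add: \<eta>_def)
  also have "dvg \<dots> x = grad (\<lambda>y. 1 / \<theta>' t y) x \<bullet> qH (t, x) + 1 / \<theta>' t x * dvg (\<lambda>y. qH (t, y)) x"
    by (rule dvg_scaleR[OF q(3) spatial_at[OF DqH z]])
  finally show ?thesis
    unfolding q(4) dK_eq[OF z] by (simp add: qH_def gH_eq[OF z] power2_norm_eq_inner mult.commute)
qed

lemma state_bounds: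
  obtains a b B where "a > 0" "a \<le> b" "B \<ge> 0"
    "\<And>t x. (t, x) \<in> Q \<Longrightarrow> \<rho>' t x \<in> {a..b} \<and> \<theta>' t x \<in> {a..b} \<and> norm (u' t x) \<le> B \<and> \<bar>dt \<theta>' t x\<bar> \<le> B \<and>
      norm (grad (\<theta>' t) x) \<le> B \<and> norm (Grad (u' t) x) \<le> B \<and> norm (dS (t, x)) \<le> B"
proof -
  have pc: "continuous_on (closure Q) (\<lambda>z. 1 / R z)" "continuous_on (closure Q) (\<lambda>z. 1 / H z)"
    using positive CderD(1)[OF DR] CderD(1)[OF DH] by (auto intro!: continuous_intros simp: less_le)
  have dSc: "continuous_on (closure Q) dS"
    unfolding dS_def by (intro continuous_intros CderD(3)[OF DS])
  obtain B1 where B1: "B1 \<ge> 0" "\<And>z. z \<in> closure Q \<Longrightarrow> norm (1 / R z) \<le> B1" using continuous_bounded[OF pc(1)] by metis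
  obtain B2 where B2: "B2 \<ge> 0" "\<And>z. z \<in> closure Q \<Longrightarrow> norm (1 / H z) \<le> B2" using continuous_bounded[OF pc(2)] by metis
  obtain B3 where B3: "B3 \<ge> 0" "\<And>z. z \<in> closure Q \<Longrightarrow> norm (R z) \<le> B3" using continuous_bounded[OF CderD(1)[OF DR]] by metis
  obtain B4 where B4: "B4 \<ge> 0" "\<And>z. z \<in> closure Q \<Longrightarrow> norm (H z) \<le> B4" using continuous_bounded[OF CderD(1)[OF DH]] by metis
  obtain B5 where B5: "B5 \<ge> 0" "\<And>z. z \<in> closure Q \<Longrightarrow> norm (U z) \<le> B5" using continuous_bounded[OF CderD(1)[OF DU]] by metis
  obtain B6 where B6: "B6 \<ge> 0" "\<And>z. z \<in> closure Q \<Longrightarrow> norm (DH z (1, 0)) \<le> B6" using continuous_bounded[OF CderD(3)[OF DH]] by metis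
  obtain B7 where B7: "B7 \<ge> 0" "\<And>z. z \<in> closure Q \<Longrightarrow> norm (gH z) \<le> B7" using continuous_bounded[OF continuous_gH] by metis
  obtain B8 where B8: "B8 \<ge> 0" "\<And>z. z \<in> closure Q \<Longrightarrow> norm (Gu z) \<le> B8" using continuous_bounded[OF continuous_Gu] by metis
  obtain B9 where B9: "B9 \<ge> 0" "\<And>z. z \<in> closure Q \<Longrightarrow> norm (dS z) \<le> B9" using continuous_bounded[OF dSc] by metis
  \<comment> \<open>Lower bounds for density and temperature come from upper bounds for their
    reciprocals. The additional 1 gives \<open>1 / m \<le> 1 \<le> b\<close>, so the interval is
    nonempty.\<close>
  define m where "m = 1 + B1 + B2"
  define b where "b = max 1 (max B3 B4)"
  define B where "B = B5 + B6 + B7 + B8 + B9"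
  have m: "m \<ge> 1" "B1 \<le> m" "B2 \<le> m" using B1 B2 by (auto simp: m_def)
  show ?thesis
  proof (rule that[of "1 / m" b B])
    show "1 / m > 0" "B \<ge> 0" using m B5 B6 B7 B8 B9 by (auto simp: B_def)
    have "1 / m \<le> 1" using m by (simp add: field_simps)
    then show "1 / m \<le> b" by (simp add: b_def)
    fix t x assume z: "(t, x) \<in> Q"
    note zc = Q_closure[OF z]
    have lb: "1 / m \<le> y" if "y > 0" "norm (1 / y) \<le> m" for y :: real
    proof -
      have "1 / y \<le> m" using that by simp
      then have "1 \<le> m * y" using that by (simp add: field_simps)
      then show ?thesis using m by (simp add: field_simps)
    qed
    have "1 / m \<le> \<rho>' t x" using positive[OF zc] B1(2)[OF zc] m by (intro lb) auto
    moreover have "1 / m \<le> \<theta>' t x" using positive[OF zc] B2(2)[OF zc] m by (intro lb) auto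
    moreover have "\<rho>' t x \<le> b" "\<theta>' t x \<le> b" using B3(2)[OF zc] B4(2)[OF zc] by (auto simp: b_def)
    moreover have "norm (u' t x) \<le> B" using B5(2)[OF zc] B6 B7 B8 B9 by (simp add: B_def)
    moreover have "\<bar>dt \<theta>' t x\<bar> \<le> B" using B6(2)[OF zc] B5 B7 B8 B9 by (simp add: B_def D_decomp[OF z])
    moreover have "norm (grad (\<theta>' t) x) \<le> B" using B7(2)[OF zc] B5 B6 B8 B9 by (simp add: B_def gH_eq[OF z])
    moreover have "norm (Grad (u' t) x) \<le> B" using B8(2)[OF zc] B5 B6 B7 B9 by (simp add: B_def Gu_eq[OF z])
    moreover have "norm (dS (t, x)) \<le> B" using B9(2)[OF zc] B5 B6 B7 B8 by (simp add: B_def)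
    ultimately show "\<rho>' t x \<in> {1 / m..b} \<and> \<theta>' t x \<in> {1 / m..b} \<and> norm (u' t x) \<le> B \<and> \<bar>dt \<theta>' t x\<bar> \<le> B \<and>
      norm (grad (\<theta>' t) x) \<le> B \<and> norm (Grad (u' t) x) \<le> B \<and> norm (dS (t, x)) \<le> B" by simp
  qed
qed

end

section \<open>Almost-everywhere arguments and localized compatibility conditions\<close>

lemma AE_in_domain: "AE x in lebesgue_on X. x \<in> X"
  by (rule AE_I2) simp

text \<open>Completeness of Lebesgue measure passes measurability from \<open>g\<close> to
  \<open>f\<close>. It is meant for an \<open>f\<close> with brackets of differences, which agree
  with differences of brackets only almost everywhere.\<close>

lemma integral_cong_AE_lebesgue_on:
  fixes f g :: "'a::euclidean_space \<Rightarrow> real"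
  assumes "S \<in> sets lebesgue" "g \<in> borel_measurable (lebesgue_on S)" "AE z in lebesgue_on S. f z = g z"
  shows "integral\<^sup>L (lebesgue_on S) f = integral\<^sup>L (lebesgue_on S) g"
proof -
  let ?i = "\<lambda>h z. indicator S z *\<^sub>R h z"
  have g: "?i g \<in> borel_measurable lebesgue"
    using assms(1,2) by (simp add: borel_measurable_restrict_space_iff)
  have ae: "AE z in lebesgue. ?i g z = ?i f z"
    using assms(3) by (auto simp: AE_restrict_space_iff assms(1) indicator_def elim!: eventually_mono)
  have f: "?i f \<in> borel_measurable lebesgue" by (rule borel_measurable_AE[OF g ae])
  show ?thesis
    unfolding integral_lebesgue_on_eq[OF assms(1)] by (rule integral_cong_AE[OF g f ae, symmetric])
qed

text \<open>The constitutive functions are arbitrary off the positive quadrant and give no Borel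
  measurability on the whole phase space. It is read off from integrability with respect to
  \<open>M\<close>.\<close>

lemma return_bracket:
  fixes f :: "'a::t2_space \<Rightarrow> 'b::{banach, second_countable_topology}"
  assumes "M = return borel z" "integrable M f"
  shows "\<langle>M; f\<rangle> = f z"
proof -
  have "f \<in> borel_measurable borel"
    using borel_measurable_integrable[OF assms(2)] by (simp add: assms(1) cong: measurable_cong_sets)
  then show ?thesis unfolding assms(1) by (intro integral_return) auto
qed

context strong_setup
begin

text \<open>The common shape of both compatibility conditions: \<open>b1\<close> and
  \<open>b2\<close> are brackets, \<open>c2\<close> is a field and \<open>c1\<close> its divergence,
  and \<open>zero\<close> is the condition tested with the Bernstein fields. In the localization
  only \<open>c1\<close> and \<open>c2\<close> are frozen in time, not the brackets.\<close>

lemma pairing_localization: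
  fixes b1 c1 :: "real \<times> (real^'d) \<Rightarrow> 'b::euclidean_space" and b2 c2 :: "real \<times> (real^'d) \<Rightarrow> 'c::euclidean_space"
  assumes b1: "integrable (lebesgue_on Q) b1" and b2: "integrable (lebesgue_on Q) b2"
    and c1: "continuous_on (closure Q) c1" and c2: "continuous_on (closure Q) c2"
    and zero: "\<And>n (c :: nat \<Rightarrow> real).
      (LINT z|lebesgue_on Q. b1 z \<bullet> (\<Sum>k\<in>{1..<n}. (Bernstein n k (fst z / T) * c k) *\<^sub>R c1 (k / n * T, snd z))) +
      (LINT z|lebesgue_on Q. b2 z \<bullet> (\<Sum>k\<in>{1..<n}. (Bernstein n k (fst z / T) * c k) *\<^sub>R c2 (k / n * T, snd z))) = 0"
    and \<tau>: "\<tau> \<in> {0<..<T}"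
  shows "integrable (lebesgue_on Q) (\<lambda>z. b1 z \<bullet> c1 z + b2 z \<bullet> c2 z)"
    and "(LINT z|lebesgue_on (QT \<tau> \<Omega>). b1 z \<bullet> c1 z + b2 z \<bullet> c2 z) = 0"
proof -
  obtain B1 where B1: "B1 \<ge> 0" "\<And>z. z \<in> closure Q \<Longrightarrow> norm (c1 z) \<le> B1" using continuous_bounded[OF c1] by metis
  obtain B2 where B2: "B2 \<ge> 0" "\<And>z. z \<in> closure Q \<Longrightarrow> norm (c2 z) \<le> B2" using continuous_bounded[OF c2] by metis
  show "integrable (lebesgue_on Q) (\<lambda>z. b1 z \<bullet> c1 z + b2 z \<bullet> c2 z)"
    by (intro Bochner_Integration.integrable_add integrable_coeff[OF b1 c1] integrable_coeff[OF b2 c2] refl)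
  define HH where "HH s z = b1 z \<bullet> c1 (s, snd z) + b2 z \<bullet> c2 (s, snd z)" for s z
  have inc: "(t, snd z) \<in> closure Q" if "z \<in> Q" "t \<in> {0..T}" for t z
    using that Q_closure[OF that(1)] by (auto simp: closure_Q)
  have "(LINT z|lebesgue_on (QT \<tau> \<Omega>). HH (fst z) z) = 0"
  proof (rule time_localization(2)[OF T open_dom])
    show "integrable (lebesgue_on Q) (\<lambda>z. B1 * norm (b1 z) + B2 * norm (b2 z))"
      using b1 b2 by auto
    show "HH s \<in> borel_measurable (lebesgue_on Q)" if s: "s \<in> {0<..<T}" for s
    proof -
      have "(\<lambda>z. c1 (s, snd z)) \<in> borel_measurable (lebesgue_on Q)" "(\<lambda>z. c2 (s, snd z)) \<in> borel_measurable (lebesgue_on Q)"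
        using s by (auto intro!: measurable_Q slice_closure c1 c2)
      then show ?thesis unfolding HH_def using b1 b2 by (auto intro!: borel_measurable_add borel_measurable_inner)
    qed
    show "\<bar>HH s z\<bar> \<le> B1 * norm (b1 z) + B2 * norm (b2 z)" if z: "z \<in> Q" "s \<in> {0<..<T}" for s z
    proof -
      have zc: "(s, snd z) \<in> closure Q" using inc z by auto
      have "\<bar>b1 z \<bullet> c1 (s, snd z)\<bar> \<le> norm (b1 z) * B1"
        using Cauchy_Schwarz_ineq2 mult_left_mono[OF B1(2)[OF zc] norm_ge_zero] order_trans by blast
      moreover have "\<bar>b2 z \<bullet> c2 (s, snd z)\<bar> \<le> norm (b2 z) * B2"
        using Cauchy_Schwarz_ineq2 mult_left_mono[OF B2(2)[OF zc] norm_ge_zero] order_trans by blast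
      ultimately show ?thesis unfolding HH_def by (simp add: mult.commute abs_le_iff)
    qed
    show "continuous_on {0..T} (\<lambda>s. HH s z)" if z: "z \<in> Q" for z
    proof -
      have "continuous_on {0..T} (\<lambda>s. c1 (s, snd z))" "continuous_on {0..T} (\<lambda>s. c2 (s, snd z))"
        by (rule continuous_on_compose2[OF c1], (auto intro!: continuous_intros inc[OF z])[2])
          (rule continuous_on_compose2[OF c2], (auto intro!: continuous_intros inc[OF z])[2])
      then show ?thesis unfolding HH_def by (intro continuous_intros)
    qed
    fix n and c :: "nat \<Rightarrow> real"
    let ?w = "\<lambda>k z. Bernstein n k (fst z / T) * c k"
    have node: "real k / real n * T \<in> {0..T}" if "k \<in> {1..<n}" for k
      using that T by (auto simp: field_simps)
    have cw: "continuous_on (closure Q) (\<lambda>z. \<Sum>k\<in>{1..<n}. ?w k z *\<^sub>R f (k / n * T, snd z))"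
      if "continuous_on (closure Q) f" for f :: "real \<times> (real^'d) \<Rightarrow> 'x::euclidean_space"
      unfolding Bernstein_def using T by (intro continuous_intros slice_closure that node) auto
    have "(LINT z|lebesgue_on Q. (\<Sum>k\<in>{1..<n}. Bernstein n k (fst z / T) * c k * HH (k / n * T) z))
      = (LINT z|lebesgue_on Q. b1 z \<bullet> (\<Sum>k\<in>{1..<n}. ?w k z *\<^sub>R c1 (k / n * T, snd z)) + b2 z \<bullet> (\<Sum>k\<in>{1..<n}. ?w k z *\<^sub>R c2 (k / n * T, snd z)))"
      by (rule Bochner_Integration.integral_cong) (simp_all add: HH_def inner_sum_right sum.distrib distrib_left)
    also have "\<dots> = (LINT z|lebesgue_on Q. b1 z \<bullet> (\<Sum>k\<in>{1..<n}. ?w k z *\<^sub>R c1 (k / n * T, snd z)))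
        + (LINT z|lebesgue_on Q. b2 z \<bullet> (\<Sum>k\<in>{1..<n}. ?w k z *\<^sub>R c2 (k / n * T, snd z)))"
      by (intro Bochner_Integration.integral_add integrable_coeff[OF b1 cw[OF c1]] integrable_coeff[OF b2 cw[OF c2]] refl)
    finally show "(LINT z|lebesgue_on Q. (\<Sum>k\<in>{1..<n}. Bernstein n k (fst z / T) * c k * HH (k / n * T) z)) = 0"
      using zero by simp
  qed (use \<tau> in auto)
  then show "(LINT z|lebesgue_on (QT \<tau> \<Omega>). b1 z \<bullet> c1 z + b2 z \<bullet> c2 z) = 0" by (simp add: HH_def)
qed

lemma continuous_dS: "continuous_on (closure Q) dS"
  unfolding dS_def by (intro continuous_intros CderD(3)[OF DS])

lemma continuous_d\<eta>: "continuous_on (closure Q) d\<eta>"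
  unfolding d\<eta>_def by (intro continuous_intros CderD(3)[OF D\<eta>])

lemma C1_velocity_slice:
  assumes t: "t \<in> {0<..<T}"
  shows "C1_closure \<Omega> (u' t)"
proof (rule Cder_imp_C1_closure[of _ _ "\<lambda>x h. DU (t, x) (0, h)"], unfold Cder_def, intro conjI ballI allI)
  have in_cl: "(t, x) \<in> closure Q" if "x \<in> closure \<Omega>" for x
    using t that by (simp add: closure_Q)
  have c: "continuous_on (closure \<Omega>) (\<lambda>x. f (t, x))" if "continuous_on (closure Q) f" for f :: "_ \<Rightarrow> real^'d"
    by (rule continuous_on_compose2[OF that]) (use in_cl in \<open>auto intro!: continuous_intros\<close>)
  show "continuous_on (closure \<Omega>) (u' t)" using c[OF CderD(1)[OF DU]] by simp
  show "continuous_on (closure \<Omega>) (\<lambda>x. DU (t, x) (0, h))" for h by (rule c[OF CderD(3)[OF DU]])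
  show "linear (\<lambda>h. DU (t, x) (0, h))" if "x \<in> closure \<Omega>" for x
    by (rule CderD(2)[OF Cder_spatial[OF DU] in_cl[OF that]])
  show "((\<lambda>h. u' t (x + id h)) has_derivative (\<lambda>h. DU (t, x) (0, h))) (at 0)" if "x \<in> \<Omega>" for x
    using has_derivative_shift[OF spatial_has_derivative[OF joint_derivs(2)]] that t by simp
qed

lemma C1_norm_bounded:
  obtains M where "M \<ge> 0" "\<And>t. t \<in> {0<..<T} \<Longrightarrow> C1_norm \<Omega> (u' t) \<le> M"
proof -
  obtain B1 where B1: "B1 \<ge> 0" "\<And>z. z \<in> closure Q \<Longrightarrow> norm (U z) \<le> B1" using continuous_bounded[OF CderD(1)[OF DU]] by metis
  obtain B2 where B2: "B2 \<ge> 0" "\<And>z. z \<in> closure Q \<Longrightarrow> norm (Gu z) \<le> B2" using continuous_bounded[OF continuous_Gu] by metis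
  have ne: "\<Omega> \<noteq> {}" using dom by (simp add: bounded_domain_def)
  show ?thesis
  proof (rule that[of "B1 + B2"])
    fix t assume t: "t \<in> {0<..<T}"
    show "C1_norm \<Omega> (u' t) \<le> B1 + B2"
      unfolding C1_norm_def
    proof (intro add_mono cSUP_least ne)
      fix x assume "x \<in> \<Omega>"
      then have z: "(t, x) \<in> Q" using t by auto
      show "norm (u' t x) \<le> B1" using B1(2)[OF Q_closure[OF z]] by simp
      show "norm (Grad (u' t) x) \<le> B2" using B2(2)[OF Q_closure[OF z]] by (simp add: Gu_eq[OF z])
    qed
  qed (use B1 B2 in auto)
qed

lemma C1_fields: "C1_QT T \<Omega> \<rho>'" "C1_QT T \<Omega> u'" "C1_QT T \<Omega> \<theta>'" "C1_QT T \<Omega> \<psi>"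
  using strong Cder_imp_C1_closure[OF Cder_\<psi>] unfolding strong_solution_def by auto

lemma admissible_\<theta>': "admissible T \<Omega> \<theta>B \<theta>'"
  using strong unfolding strong_solution_def admissible_def by auto

end

section \<open>The relative energy inequality\<close>

locale weak_strong = strong_setup p e s T \<Omega> \<theta>B \<kappa> \<mu> lam \<rho>0 \<theta>0 u0 \<rho>' \<theta>' u'
  for p e s :: "real \<Rightarrow> real \<Rightarrow> real" and T :: real and \<Omega> :: "(real^'d::finite) set"
    and \<theta>B :: "real \<Rightarrow> real^'d \<Rightarrow> real" and \<kappa> \<mu> lam :: "real \<Rightarrow> real \<Rightarrow> real"
    and \<rho>0 \<theta>0 :: "real^'d \<Rightarrow> real" and u0 :: "real^'d \<Rightarrow> real^'d"
    and \<rho>' \<theta>' :: "real \<Rightarrow> real^'d \<Rightarrow> real" and u' :: "real \<Rightarrow> real^'d \<Rightarrow> real^'d" +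
  fixes V0 :: "real^'d \<Rightarrow> 'd phase0 measure" and V :: "real \<Rightarrow> real^'d \<Rightarrow> 'd phase measure"
    and D :: "(real \<Rightarrow> real^'d \<Rightarrow> real) \<Rightarrow> real \<Rightarrow> real"
  assumes mv: "measure_valued_solution T \<Omega> \<theta>B p e s \<kappa> \<mu> lam V0 V D"
    and init: "AE x in lebesgue_on \<Omega>. V0 x = return borel (\<rho>0 x, u0 x, \<theta>0 x)"
begin

text \<open>Integrands on the phase space. As abbreviations they are syntactically those in the
  definition of a measure-valued solution.\<close>

abbreviation Kr :: "'d phase \<Rightarrow> real" where "Kr \<equiv> (\<lambda>(\<rho>, u, \<theta>, A, g). \<rho>)"
abbreviation Km :: "'d phase \<Rightarrow> real^'d" where "Km \<equiv> (\<lambda>(\<rho>, u, \<theta>, A, g). \<rho> *\<^sub>R u)"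
abbreviation Kf :: "'d phase \<Rightarrow> real^'d^'d" where "Kf \<equiv> (\<lambda>(\<rho>, u, \<theta>, A, g). \<rho> *\<^sub>R outer u u)"
abbreviation Kp :: "'d phase \<Rightarrow> real" where "Kp \<equiv> (\<lambda>(\<rho>, u, \<theta>, A, g). p \<rho> \<theta>)"
abbreviation Kst :: "'d phase \<Rightarrow> real^'d^'d" where "Kst \<equiv> (\<lambda>(\<rho>, u, \<theta>, A, g). stress \<mu> lam \<rho> \<theta> A)"
abbreviation Kep :: "'d phase \<Rightarrow> real" where "Kep \<equiv> (\<lambda>(\<rho>, u, \<theta>, A, g). entropy_production \<kappa> \<mu> lam \<rho> \<theta> A g)"
abbreviation Kes :: "'d phase \<Rightarrow> real" where "Kes \<equiv> (\<lambda>(\<rho>, u, \<theta>, A, g). \<rho> * s \<rho> \<theta>)"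
abbreviation Kesu :: "'d phase \<Rightarrow> real^'d" where "Kesu \<equiv> (\<lambda>(\<rho>, u, \<theta>, A, g). (\<rho> * s \<rho> \<theta>) *\<^sub>R u)"
abbreviation Kk :: "'d phase \<Rightarrow> real^'d" where "Kk \<equiv> (\<lambda>(\<rho>, u, \<theta>, A, g). (\<kappa> \<rho> \<theta> / \<theta>) *\<^sub>R g)"
abbreviation Ku :: "'d phase \<Rightarrow> real^'d" where "Ku \<equiv> (\<lambda>(\<rho>, u, \<theta>, A, g). u)"
abbreviation KA :: "'d phase \<Rightarrow> real^'d^'d" where "KA \<equiv> (\<lambda>(\<rho>, u, \<theta>, A, g). A)"
abbreviation Kth :: "'d phase \<Rightarrow> real" where "Kth \<equiv> (\<lambda>(\<rho>, u, \<theta>, A, g). \<theta>)"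
abbreviation Kg :: "'d phase \<Rightarrow> real^'d" where "Kg \<equiv> (\<lambda>(\<rho>, u, \<theta>, A, g). g)"
abbreviation Kb :: "real \<Rightarrow> 'd phase \<Rightarrow> real" where "Kb h \<equiv> (\<lambda>(\<rho>, u, \<theta>, A, g). ballistic e s h \<rho> u \<theta>)"

definition "W z = V (fst z) (snd z)"

section \<open>Integrability and vanishing of the terms of the balance\<close>

lemma bracket_integrableD:
  assumes "integrable_QT T \<Omega> V (\<lambda>t x. K t x)"
  shows "AE z in lebesgue_on Q. integrable (W z) (K (fst z) (snd z))"
    and "integrable (lebesgue_on Q) (\<lambda>z. \<langle>W z; K (fst z) (snd z)\<rangle>)"
  using assms unfolding bracket_integrable_def W_def by (simp_all add: case_prod_unfold)

lemma mv_integrable: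
  shows "integrable_QT T \<Omega> V (\<lambda>t x. Kr)" "integrable_QT T \<Omega> V (\<lambda>t x. Km)" "integrable_QT T \<Omega> V (\<lambda>t x. Kf)"
    "integrable_QT T \<Omega> V (\<lambda>t x. Kp)" "integrable_QT T \<Omega> V (\<lambda>t x. Kst)" "integrable_QT T \<Omega> V (\<lambda>t x. Kep)"
    "integrable_QT T \<Omega> V (\<lambda>t x. Kes)" "integrable_QT T \<Omega> V (\<lambda>t x. Kesu)" "integrable_QT T \<Omega> V (\<lambda>t x. Kk)"
    "integrable_QT T \<Omega> V (\<lambda>t x. Ku)" "integrable_QT T \<Omega> V (\<lambda>t x. KA)" "integrable_QT T \<Omega> V (\<lambda>t x. Kth)"
    "integrable_QT T \<Omega> V (\<lambda>t x. Kg)" "integrable_QT T \<Omega> V (\<lambda>t x. Kb (\<theta>' t x))"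
proof -
  obtain r where m: "mv_momentum_eq T \<Omega> p \<mu> lam V0 V r"
    using mv unfolding measure_valued_solution_def by blast
  have b: "mv_ballistic_energy_ineq T \<Omega> \<theta>B e s \<kappa> \<mu> lam V0 V D" and c: "mv_continuity_eq T \<Omega> V0 V"
    and v: "mv_velocity_compat T \<Omega> V" and t: "mv_temperature_compat T \<Omega> \<theta>B V"
    using mv unfolding measure_valued_solution_def by blast+
  show "integrable_QT T \<Omega> V (\<lambda>t x. Kr)" "integrable_QT T \<Omega> V (\<lambda>t x. Km)"
    using c unfolding mv_continuity_eq_def by blast+
  show "integrable_QT T \<Omega> V (\<lambda>t x. Kf)" "integrable_QT T \<Omega> V (\<lambda>t x. Kp)" "integrable_QT T \<Omega> V (\<lambda>t x. Kst)"
    using m unfolding mv_momentum_eq_def by blast+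
  show "integrable_QT T \<Omega> V (\<lambda>t x. Ku)" "integrable_QT T \<Omega> V (\<lambda>t x. KA)"
    using v unfolding mv_velocity_compat_def by blast+
  show "integrable_QT T \<Omega> V (\<lambda>t x. Kth)" "integrable_QT T \<Omega> V (\<lambda>t x. Kg)"
    using t unfolding mv_temperature_compat_def by blast+
  show "integrable_QT T \<Omega> V (\<lambda>t x. Kep)" "integrable_QT T \<Omega> V (\<lambda>t x. Kes)" "integrable_QT T \<Omega> V (\<lambda>t x. Kesu)"
    "integrable_QT T \<Omega> V (\<lambda>t x. Kk)" "integrable_QT T \<Omega> V (\<lambda>t x. Kb (\<theta>' t x))"
    using b[unfolded mv_ballistic_energy_ineq_def, rule_format, OF admissible_\<theta>'] by blast+
qed

lemmas bi = mv_integrable[THEN bracket_integrableD(2)]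

lemma term_integrable:
  fixes K :: "'d phase \<Rightarrow> 'b::euclidean_space"
  assumes "integrable (lebesgue_on Q) (\<lambda>z. \<langle>W z; K\<rangle>)" "continuous_on (closure Q) c" "\<And>t x. (t, x) \<in> Q \<Longrightarrow> f t x = c (t, x)"
  shows "integrable (lebesgue_on Q) (\<lambda>(t, x). \<langle>V t x; K\<rangle> \<bullet> f t x)"
proof -
  have "integrable (lebesgue_on Q) (\<lambda>z. \<langle>W z; K\<rangle> \<bullet> f (fst z) (snd z))"
    by (rule integrable_coeff[OF assms(1,2)]) (use assms(3) in auto)
  then show ?thesis by (simp add: W_def case_prod_unfold)
qed

lemma term_integrable_real:
  fixes K :: "'d phase \<Rightarrow> real"
  assumes "integrable (lebesgue_on Q) (\<lambda>z. \<langle>W z; K\<rangle>)" "continuous_on (closure Q) c" "\<And>t x. (t, x) \<in> Q \<Longrightarrow> f t x = c (t, x)"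
  shows "integrable (lebesgue_on Q) (\<lambda>(t, x). \<langle>V t x; K\<rangle> * f t x)"
  using term_integrable[OF assms] by simp

text \<open>\<open>t0\<close> to \<open>t4\<close> belong to the ballistic energy inequality with
  temperature \<theta>', \<open>a1\<close>, \<open>t5\<close> and \<open>t6\<close> to the momentum
  equation tested with \<open>u'\<close>, \<open>a2\<close> and \<open>t7\<close> to the continuity
  equation tested with \<psi>.\<close>

definition "t0 = (\<lambda>(t, x). \<langle>V t x; Kb (\<theta>' t x)\<rangle>)"
definition "t1 = (\<lambda>(t, x). \<langle>V t x; Kep\<rangle> * \<theta>' t x)"
definition "t2 = (\<lambda>(t, x). \<langle>V t x; Kes\<rangle> * dt \<theta>' t x)"
definition "t3 = (\<lambda>(t, x). \<langle>V t x; Kesu\<rangle> \<bullet> grad (\<theta>' t) x)"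
definition "t4 = (\<lambda>(t, x). \<langle>V t x; Kk\<rangle> \<bullet> grad (\<theta>' t) x)"
definition "t5 = (\<lambda>(t, x). \<langle>V t x; Km\<rangle> \<bullet> dt u' t x + \<langle>V t x; Kf\<rangle> \<bullet> Grad (u' t) x + \<langle>V t x; Kp\<rangle> * dvg (u' t) x)"
definition "t6 = (\<lambda>(t, x). \<langle>V t x; Kst\<rangle> \<bullet> Grad (u' t) x)"
definition "t7 = (\<lambda>(t, x). \<langle>V t x; Kr\<rangle> * dt \<psi> t x + \<langle>V t x; Km\<rangle> \<bullet> grad (\<psi> t) x)"
definition "t8 = (\<lambda>(t, x). Pt t x)"
definition "t9 = (\<lambda>z. \<langle>W z; Ku\<rangle> \<bullet> dS z + \<langle>W z; KA\<rangle> \<bullet> S z)"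
definition "t10 = (\<lambda>(t, x). dvg (\<lambda>y. F (t, y)) x)"
definition "t11 = (\<lambda>z. (\<langle>W z; Kth\<rangle> - H z) \<bullet> d\<eta> z + (\<langle>W z; Kg\<rangle> - gH z) \<bullet> \<eta> z)"
definition "a1 = (\<lambda>(t, x). \<langle>V t x; Km\<rangle> \<bullet> u' t x)"
definition "a2 = (\<lambda>(t, x). \<langle>V t x; Kr\<rangle> * \<psi> t x)"

text \<open>\<open>fE\<close> is the bracket of the relative energy and \<open>fI\<close> that of its rate. The terms \<open>t8\<close> to
  \<open>t11\<close> are added to complete the rate to a quadratic remainder: \<open>t8\<close> balances the pressure \<open>P\<close> in
  \<open>fE\<close>, and the integrals of the other three vanish, by the boundary conditions for \<open>t10\<close> and by the
  compatibility conditions for \<open>t9\<close> and \<open>t11\<close>.\<close>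

definition "fE z = t0 z - a1 z + a2 z + P z"
definition "fI z = - t1 z - t2 z - t3 z + t4 z - t5 z + t6 z + t7 z + t8 z + t9 z + t10 z + t11 z"

text \<open>The coefficients of the balance are derivatives, controlled only inside
  \<open>Q\<close>. A continuous function on the compact closure that agrees with them there
  supplies the measurability and boundedness that integrability requires.\<close>

lemma ex_coeff:
  shows "\<exists>c. continuous_on (closure Q) c \<and> (\<forall>t x. (t, x) \<in> Q \<longrightarrow> dt \<psi> t x = c (t, x))"
    and "\<exists>c. continuous_on (closure Q) c \<and> (\<forall>t x. (t, x) \<in> Q \<longrightarrow> grad (\<psi> t) x = c (t, x))"
    and "\<exists>c. continuous_on (closure Q) c \<and> (\<forall>t x. (t, x) \<in> Q \<longrightarrow> dt u' t x = c (t, x))"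
    and "\<exists>c. continuous_on (closure Q) c \<and> (\<forall>t x. (t, x) \<in> Q \<longrightarrow> dt \<theta>' t x = c (t, x))"
    and "\<exists>c. continuous_on (closure Q) c \<and> (\<forall>t x. (t, x) \<in> Q \<longrightarrow> dvg (u' t) x = c (t, x))"
proof -
  obtain D\<psi> where D\<psi>: "Cder id Q (\<lambda>(t, x). \<psi> t x) D\<psi>" using Cder_\<psi> by blast
  show "\<exists>c. continuous_on (closure Q) c \<and> (\<forall>t x. (t, x) \<in> Q \<longrightarrow> dt \<psi> t x = c (t, x))"
    using dt_eq[OF Cder_has_derivative[OF D\<psi>]] CderD(3)[OF D\<psi>]
    by (intro exI[of _ "\<lambda>z. D\<psi> z (1, 0)"]) auto
  show "\<exists>c. continuous_on (closure Q) c \<and> (\<forall>t x. (t, x) \<in> Q \<longrightarrow> grad (\<psi> t) x = c (t, x))"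
  proof (intro exI[of _ "\<lambda>z. \<chi> i. D\<psi> z (0, axis i 1)"] conjI allI impI)
    show "continuous_on (closure Q) (\<lambda>z. \<chi> i. D\<psi> z (0, axis i 1))"
      by (intro continuous_intros CderD(3)[OF D\<psi>])
    fix t x assume z: "(t, x) \<in> Q"
    have "grad (\<psi> t) x $ i = D\<psi> (t, x) (0, axis i 1)" for i
      using grad_inner[OF spatial_has_derivative[OF Cder_has_derivative[OF D\<psi> z]], of "axis i 1"]
      by (simp add: inner_axis)
    then show "grad (\<psi> t) x = (\<chi> i. D\<psi> (t, x) (0, axis i 1))" by (simp add: vec_eq_iff)
  qed
  show "\<exists>c. continuous_on (closure Q) c \<and> (\<forall>t x. (t, x) \<in> Q \<longrightarrow> dt u' t x = c (t, x))"
    using CderD(3)[OF DU] by (intro exI[of _ "\<lambda>z. DU z (1, 0)"]) (auto simp: D_decomp)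
  show "\<exists>c. continuous_on (closure Q) c \<and> (\<forall>t x. (t, x) \<in> Q \<longrightarrow> dt \<theta>' t x = c (t, x))"
    using CderD(3)[OF DH] by (intro exI[of _ "\<lambda>z. DH z (1, 0)"]) (auto simp: D_decomp)
  have "continuous_on (closure Q) (\<lambda>z. trace (Gu z))"
    using bounded_linear.continuous_on[OF bounded_linear_trace continuous_Gu] .
  then show "\<exists>c. continuous_on (closure Q) c \<and> (\<forall>t x. (t, x) \<in> Q \<longrightarrow> dvg (u' t) x = c (t, x))"
    by (intro exI[of _ "\<lambda>z. trace (Gu z)"]) (auto simp: dvg_def Gu_eq)
qed

lemma terms_integrable:
  shows "integrable (lebesgue_on Q) t0" "integrable (lebesgue_on Q) t1" "integrable (lebesgue_on Q) t2"
    "integrable (lebesgue_on Q) t3" "integrable (lebesgue_on Q) t4" "integrable (lebesgue_on Q) t5"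
    "integrable (lebesgue_on Q) t6" "integrable (lebesgue_on Q) t7" "integrable (lebesgue_on Q) t8"
    "integrable (lebesgue_on Q) t10" "integrable (lebesgue_on Q) a1" "integrable (lebesgue_on Q) a2"
    "integrable (lebesgue_on Q) P"
proof -
  obtain c1 where c1: "continuous_on (closure Q) c1" "\<And>t x. (t, x) \<in> Q \<Longrightarrow> dt \<psi> t x = c1 (t, x)"
    using ex_coeff(1) by blast
  obtain c2 where c2: "continuous_on (closure Q) c2" "\<And>t x. (t, x) \<in> Q \<Longrightarrow> grad (\<psi> t) x = c2 (t, x)"
    using ex_coeff(2) by blast
  obtain c3 where c3: "continuous_on (closure Q) c3" "\<And>t x. (t, x) \<in> Q \<Longrightarrow> dt u' t x = c3 (t, x)"
    using ex_coeff(3) by blast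
  obtain c4 where c4: "continuous_on (closure Q) c4" "\<And>t x. (t, x) \<in> Q \<Longrightarrow> dt \<theta>' t x = c4 (t, x)"
    using ex_coeff(4) by blast
  obtain c5 where c5: "continuous_on (closure Q) c5" "\<And>t x. (t, x) \<in> Q \<Longrightarrow> dvg (u' t) x = c5 (t, x)"
    using ex_coeff(5) by blast
  note c = c1 c2 c3 c4 c5
  have \<tau>: "T / 2 \<in> {0<..<T}" using T by auto
  show "integrable (lebesgue_on Q) t0"
    using bi(14) unfolding t0_def W_def by (simp add: case_prod_unfold)
  show "integrable (lebesgue_on Q) t1"
    unfolding t1_def by (rule term_integrable_real[OF bi(6) CderD(1)[OF DH]]) simp
  show "integrable (lebesgue_on Q) t2"
    unfolding t2_def by (rule term_integrable_real[OF bi(7) c(7) c(8)])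
  show "integrable (lebesgue_on Q) t3"
    unfolding t3_def by (rule term_integrable[OF bi(8) continuous_gH]) (simp add: gH_eq)
  show "integrable (lebesgue_on Q) t4"
    unfolding t4_def by (rule term_integrable[OF bi(9) continuous_gH]) (simp add: gH_eq)
  have "integrable (lebesgue_on Q) (\<lambda>(t, x). \<langle>V t x; Km\<rangle> \<bullet> dt u' t x)"
    by (rule term_integrable[OF bi(2) c(5) c(6)])
  moreover have "integrable (lebesgue_on Q) (\<lambda>(t, x). \<langle>V t x; Kf\<rangle> \<bullet> Grad (u' t) x)"
    by (rule term_integrable[OF bi(3) continuous_Gu]) (simp add: Gu_eq)
  moreover have "integrable (lebesgue_on Q) (\<lambda>(t, x). \<langle>V t x; Kp\<rangle> * dvg (u' t) x)"
    by (rule term_integrable_real[OF bi(4) c(9) c(10)])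
  ultimately show "integrable (lebesgue_on Q) t5"
    unfolding t5_def case_prod_unfold by (intro Bochner_Integration.integrable_add)
  show "integrable (lebesgue_on Q) t6"
    unfolding t6_def by (rule term_integrable[OF bi(5) continuous_Gu]) (simp add: Gu_eq)
  have "integrable (lebesgue_on Q) (\<lambda>(t, x). \<langle>V t x; Kr\<rangle> * dt \<psi> t x)"
    by (rule term_integrable_real[OF bi(1) c(1) c(2)])
  moreover have "integrable (lebesgue_on Q) (\<lambda>(t, x). \<langle>V t x; Km\<rangle> \<bullet> grad (\<psi> t) x)"
    by (rule term_integrable[OF bi(2) c(3) c(4)])
  ultimately show "integrable (lebesgue_on Q) t7"
    unfolding t7_def case_prod_unfold by (intro Bochner_Integration.integrable_add)
  show "integrable (lebesgue_on Q) t8" unfolding t8_def by (rule integral_Pt(1)[OF \<tau>])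
  show "integrable (lebesgue_on Q) t10" unfolding t10_def by (rule integral_dvg_F(1)[OF \<tau>])
  show "integrable (lebesgue_on Q) a1"
    unfolding a1_def by (rule term_integrable[OF bi(2) CderD(1)[OF DU]]) simp
  show "integrable (lebesgue_on Q) a2"
    unfolding a2_def by (rule term_integrable_real[OF bi(1) CderD(1)[OF Cder_\<psi>]]) simp
  show "integrable (lebesgue_on Q) P" by (rule integrable_Q[OF CderD(1)[OF Cder_P]])
qed

text \<open>\<open>S\<close> is symmetric, hence so are its Bernstein combinations, as the velocity
  compatibility demands of a test field. Their divergences are the same combinations of
  \<open>dS\<close>.\<close>

lemma t9:
  assumes \<tau>: "\<tau> \<in> {0<..<T}"
  shows "integrable (lebesgue_on Q) t9" "integral\<^sup>L (lebesgue_on (QT \<tau> \<Omega>)) t9 = 0"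
proof -
  have v: "mv_velocity_compat T \<Omega> V" using mv unfolding measure_valued_solution_def by blast
  have zero: "(LINT z|lebesgue_on Q. \<langle>W z; Ku\<rangle> \<bullet> (\<Sum>k\<in>{1..<n}. (Bernstein n k (fst z / T) * c k) *\<^sub>R dS (k / n * T, snd z))) +
      (LINT z|lebesgue_on Q. \<langle>W z; KA\<rangle> \<bullet> (\<Sum>k\<in>{1..<n}. (Bernstein n k (fst z / T) * c k) *\<^sub>R S (k / n * T, snd z))) = 0"
    for n and c :: "nat \<Rightarrow> real"
  proof -
    let ?\<Phi> = "\<lambda>t x. \<Sum>k\<in>{1..<n}. (Bernstein n k (t / T) * c k) *\<^sub>R S (k / n * T, x)"
    have sym: "transpose (?\<Phi> t x) = ?\<Phi> t x" for t x
    proof -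
      have "linear (transpose :: real^'d^'d \<Rightarrow> _)" by (intro linearI) (simp_all add: transpose_add transpose_scaleR)
      then show ?thesis by (simp add: linear_sum transpose_scaleR S_symm)
    qed
    have "- (LINT (t, x)|lebesgue_on Q. \<langle>V t x; Ku\<rangle> \<bullet> Dvg (?\<Phi> t) x) = (LINT (t, x)|lebesgue_on Q. \<langle>V t x; KA\<rangle> \<bullet> ?\<Phi> t x)"
      by (rule v[unfolded mv_velocity_compat_def, THEN conjunct2, THEN conjunct2, rule_format])
        (intro conjI Bernstein_test_field(1)[OF DS] ballI sym)
    moreover have "(LINT (t, x)|lebesgue_on Q. \<langle>V t x; Ku\<rangle> \<bullet> Dvg (?\<Phi> t) x)
        = (LINT z|lebesgue_on Q. \<langle>W z; Ku\<rangle> \<bullet> (\<Sum>k\<in>{1..<n}. (Bernstein n k (fst z / T) * c k) *\<^sub>R dS (k / n * T, snd z)))"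
    proof (rule Bochner_Integration.integral_cong[OF refl])
      fix z assume "z \<in> space (lebesgue_on Q)"
      then have z: "(fst z, snd z) \<in> Q" by simp
      have "Dvg (?\<Phi> (fst z)) (snd z) = (\<Sum>k\<in>{1..<n}. (Bernstein n k (fst z / T) * c k) *\<^sub>R dS (k / n * T, snd z))"
        unfolding Dvg_eq[OF Bernstein_test_field(2)[OF DS z]] dS_def
        by (simp add: vec_eq_iff sum_component sum_distrib_left, intro allI, rule sum.swap)
      then show "(case z of (t, x) \<Rightarrow> \<langle>V t x; Ku\<rangle> \<bullet> Dvg (?\<Phi> t) x) = \<langle>W z; Ku\<rangle> \<bullet> (\<Sum>k\<in>{1..<n}. (Bernstein n k (fst z / T) * c k) *\<^sub>R dS (k / n * T, snd z))"
        by (simp add: case_prod_unfold W_def)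
    qed
    moreover have "(LINT (t, x)|lebesgue_on Q. \<langle>V t x; KA\<rangle> \<bullet> ?\<Phi> t x)
        = (LINT z|lebesgue_on Q. \<langle>W z; KA\<rangle> \<bullet> (\<Sum>k\<in>{1..<n}. (Bernstein n k (fst z / T) * c k) *\<^sub>R S (k / n * T, snd z)))"
      by (simp add: case_prod_unfold W_def)
    ultimately show ?thesis by linarith
  qed
  show "integrable (lebesgue_on Q) t9" "integral\<^sup>L (lebesgue_on (QT \<tau> \<Omega>)) t9 = 0"
    unfolding t9_def
    by (rule pairing_localization[OF bi(10) bi(11) continuous_dS CderD(1)[OF DS] zero \<tau>])+
qed

lemma W_young: "AE z in lebesgue_on Q. sets (W z) = sets borel \<and> prob_space (W z) \<and> emeasure (W z) phase_space = 1"
  using mv unfolding measure_valued_solution_def young_measure_def W_def by (simp add: case_prod_unfold)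

text \<open>The temperature compatibility with \<theta>' itself as the extension of the boundary
  data, tested with Bernstein combinations of \<eta>, so that both factors are deviations from the
  strong state.\<close>

lemma t11:
  assumes \<tau>: "\<tau> \<in> {0<..<T}"
  shows "integrable (lebesgue_on Q) t11" "integral\<^sup>L (lebesgue_on (QT \<tau> \<Omega>)) t11 = 0"
proof -
  have v: "mv_temperature_compat T \<Omega> \<theta>B V" using mv unfolding measure_valued_solution_def by blast
  have Qs: "Q \<in> sets lebesgue" using sets_Q[OF \<tau>] by blast
  have b1: "integrable (lebesgue_on Q) (\<lambda>z. \<langle>W z; Kth\<rangle> - H z)"
    by (intro Bochner_Integration.integrable_diff bi(12) integrable_Q CderD(1)[OF DH])
  have b2: "integrable (lebesgue_on Q) (\<lambda>z. \<langle>W z; Kg\<rangle> - gH z)"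
    by (intro Bochner_Integration.integrable_diff bi(13) integrable_Q continuous_gH)
  have in_Q: "AE z in lebesgue_on Q. z \<in> Q" by (rule AE_I2) simp
  \<comment> \<open>The strong value leaves the bracket because \<open>W z\<close> is a probability
    measure and the temperature is integrable, both known for almost every \<open>z\<close>
    only.\<close>
  have e1: "AE z in lebesgue_on Q. \<langle>V (fst z) (snd z); \<lambda>(\<rho>, u, \<theta>, A, g). \<theta> - \<theta>' (fst z) (snd z)\<rangle> = \<langle>W z; Kth\<rangle> - H z"
    using W_young bracket_integrableD(1)[OF mv_integrable(12)]
  proof eventually_elim
    case (elim z)
    interpret prob_space "W z" using elim by blast
    have "(\<lambda>(\<rho>, u, \<theta>, A, g). \<theta> - \<theta>' (fst z) (snd z)) = (\<lambda>w. Kth w - H z)"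
      by (auto simp: fun_eq_iff H_def case_prod_unfold)
    then show ?case using elim by (simp add: W_def[symmetric] prob_space)
  qed
  have e2: "AE z in lebesgue_on Q. \<langle>V (fst z) (snd z); \<lambda>(\<rho>, u, \<theta>, A, g). g - grad (\<theta>' (fst z)) (snd z)\<rangle> = \<langle>W z; Kg\<rangle> - gH z"
    using W_young bracket_integrableD(1)[OF mv_integrable(13)] in_Q
  proof eventually_elim
    case (elim z)
    interpret prob_space "W z" using elim by blast
    have "gH z = grad (\<theta>' (fst z)) (snd z)" using gH_eq[of "fst z" "snd z"] elim by simp
    then have "(\<lambda>(\<rho>, u, \<theta>, A, g). g - grad (\<theta>' (fst z)) (snd z)) = (\<lambda>w. Kg w - gH z)"
      by (auto simp: fun_eq_iff)
    then show ?case using elim by (simp add: W_def[symmetric] prob_space)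
  qed
  have zero: "(LINT z|lebesgue_on Q. (\<langle>W z; Kth\<rangle> - H z) \<bullet> (\<Sum>k\<in>{1..<n}. (Bernstein n k (fst z / T) * c k) *\<^sub>R d\<eta> (k / n * T, snd z))) +
      (LINT z|lebesgue_on Q. (\<langle>W z; Kg\<rangle> - gH z) \<bullet> (\<Sum>k\<in>{1..<n}. (Bernstein n k (fst z / T) * c k) *\<^sub>R \<eta> (k / n * T, snd z))) = 0"
    for n and c :: "nat \<Rightarrow> real"
  proof -
    let ?\<Phi> = "\<lambda>t x. \<Sum>k\<in>{1..<n}. (Bernstein n k (t / T) * c k) *\<^sub>R \<eta> (k / n * T, x)"
    have node: "real k / real n * T \<in> {0..T}" if "k \<in> {1..<n}" for k
      using that T by (auto simp: field_simps)
    have cw: "continuous_on (closure Q) (\<lambda>z. \<Sum>k\<in>{1..<n}. (Bernstein n k (fst z / T) * c k) *\<^sub>R f (k / n * T, snd z))"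
      if "continuous_on (closure Q) f" for f :: "real \<times> (real^'d) \<Rightarrow> 'x::euclidean_space"
      unfolding Bernstein_def using T by (intro continuous_intros slice_closure that node) auto
    have "- (LINT (t, x)|lebesgue_on Q. \<langle>V t x; \<lambda>(\<rho>, u, \<theta>, A, g). \<theta> - \<theta>' t x\<rangle> * dvg (?\<Phi> t) x)
       = (LINT (t, x)|lebesgue_on Q. \<langle>V t x; \<lambda>(\<rho>, u, \<theta>, A, g). g - grad (\<theta>' t) x\<rangle> \<bullet> ?\<Phi> t x)"
      by (rule v[unfolded mv_temperature_compat_def, THEN conjunct2, THEN conjunct2, rule_format])
        (use Bernstein_test_field(1)[OF D\<eta>, of n c] C1_fields(3) strong in \<open>auto simp: strong_solution_def\<close>)
    moreover have "(LINT (t, x)|lebesgue_on Q. \<langle>V t x; \<lambda>(\<rho>, u, \<theta>, A, g). \<theta> - \<theta>' t x\<rangle> * dvg (?\<Phi> t) x)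
        = (LINT z|lebesgue_on Q. (\<langle>W z; Kth\<rangle> - H z) \<bullet> (\<Sum>k\<in>{1..<n}. (Bernstein n k (fst z / T) * c k) *\<^sub>R d\<eta> (k / n * T, snd z)))"
    proof (rule integral_cong_AE_lebesgue_on[OF Qs])
      show "(\<lambda>z. (\<langle>W z; Kth\<rangle> - H z) \<bullet> (\<Sum>k\<in>{1..<n}. (Bernstein n k (fst z / T) * c k) *\<^sub>R d\<eta> (k / n * T, snd z))) \<in> borel_measurable (lebesgue_on Q)"
        by (rule borel_measurable_integrable[OF integrable_coeff[OF b1 cw[OF continuous_d\<eta>] refl]])
      show "AE z in lebesgue_on Q. (case z of (t, x) \<Rightarrow> \<langle>V t x; \<lambda>(\<rho>, u, \<theta>, A, g). \<theta> - \<theta>' t x\<rangle> * dvg (?\<Phi> t) x)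
          = (\<langle>W z; Kth\<rangle> - H z) \<bullet> (\<Sum>k\<in>{1..<n}. (Bernstein n k (fst z / T) * c k) *\<^sub>R d\<eta> (k / n * T, snd z))"
        using e1 in_Q
      proof eventually_elim
        case (elim z)
        then have z: "(fst z, snd z) \<in> Q" by simp
        have "dvg (?\<Phi> (fst z)) (snd z) = (\<Sum>k\<in>{1..<n}. (Bernstein n k (fst z / T) * c k) *\<^sub>R d\<eta> (k / n * T, snd z))"
          unfolding dvg_eq[OF Bernstein_test_field(2)[OF D\<eta> z]] d\<eta>_def
          by (simp add: sum_component sum_distrib_left, rule sum.swap)
        then show ?case using elim(1) by (simp add: case_prod_unfold)
      qed
    qed
    moreover have "(LINT (t, x)|lebesgue_on Q. \<langle>V t x; \<lambda>(\<rho>, u, \<theta>, A, g). g - grad (\<theta>' t) x\<rangle> \<bullet> ?\<Phi> t x)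
        = (LINT z|lebesgue_on Q. (\<langle>W z; Kg\<rangle> - gH z) \<bullet> (\<Sum>k\<in>{1..<n}. (Bernstein n k (fst z / T) * c k) *\<^sub>R \<eta> (k / n * T, snd z)))"
    proof (rule integral_cong_AE_lebesgue_on[OF Qs])
      show "(\<lambda>z. (\<langle>W z; Kg\<rangle> - gH z) \<bullet> (\<Sum>k\<in>{1..<n}. (Bernstein n k (fst z / T) * c k) *\<^sub>R \<eta> (k / n * T, snd z))) \<in> borel_measurable (lebesgue_on Q)"
        by (rule borel_measurable_integrable[OF integrable_coeff[OF b2 cw[OF CderD(1)[OF D\<eta>]] refl]])
      show "AE z in lebesgue_on Q. (case z of (t, x) \<Rightarrow> \<langle>V t x; \<lambda>(\<rho>, u, \<theta>, A, g). g - grad (\<theta>' t) x\<rangle> \<bullet> ?\<Phi> t x)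
          = (\<langle>W z; Kg\<rangle> - gH z) \<bullet> (\<Sum>k\<in>{1..<n}. (Bernstein n k (fst z / T) * c k) *\<^sub>R \<eta> (k / n * T, snd z))"
        using e2 by eventually_elim (simp add: case_prod_unfold)
    qed
    ultimately show ?thesis by linarith
  qed
  show "integrable (lebesgue_on Q) t11" "integral\<^sup>L (lebesgue_on (QT \<tau> \<Omega>)) t11 = 0"
    unfolding t11_def
    by (rule pairing_localization[OF b1 b2 continuous_d\<eta> CderD(1)[OF D\<eta>] zero \<tau>])+
qed

lemma fE_integrable: "integrable (lebesgue_on Q) fE"
  unfolding fE_def[abs_def]
  by (intro Bochner_Integration.integrable_add Bochner_Integration.integrable_diff terms_integrable)

lemma fI_integrable: "integrable (lebesgue_on Q) fI"
  unfolding fI_def[abs_def] using t9(1)[of "T / 2"] t11(1)[of "T / 2"] T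
  by (intro Bochner_Integration.integrable_add Bochner_Integration.integrable_diff Bochner_Integration.integrable_minus terms_integrable) auto

text \<open>At time 0 the measure is the Dirac mass at the strong state, whose relative energy with
  respect to itself is zero. The four terms are the initial contributions of the balance laws, and
  their integrands cancel pointwise.\<close>

lemma initial_balance:
  "(LINT x|lebesgue_on \<Omega>. \<langle>V0 x; \<lambda>(\<rho>, u, \<theta>). ballistic e s (\<theta>' 0 x) \<rho> u \<theta>\<rangle>)
   - (LINT x|lebesgue_on \<Omega>. \<langle>V0 x; \<lambda>(\<rho>, u, \<theta>). \<rho> *\<^sub>R u\<rangle> \<bullet> u' 0 x)
   + (LINT x|lebesgue_on \<Omega>. \<langle>V0 x; \<lambda>(\<rho>, u, \<theta>). \<rho>\<rangle> * \<psi> 0 x) + (LINT x|lebesgue_on \<Omega>. P (0, x)) = 0"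
proof -
  obtain r where m: "mv_momentum_eq T \<Omega> p \<mu> lam V0 V r"
    using mv unfolding measure_valued_solution_def by blast
  have b: "mv_ballistic_energy_ineq T \<Omega> \<theta>B e s \<kappa> \<mu> lam V0 V D" and c: "mv_continuity_eq T \<Omega> V0 V"
    using mv unfolding measure_valued_solution_def by blast+
  have ib: "bracket_integrable \<Omega> V0 (\<lambda>x (\<rho>, u, \<theta>). ballistic e s (\<theta>' 0 x) \<rho> u \<theta>)"
    using b[unfolded mv_ballistic_energy_ineq_def, rule_format, OF admissible_\<theta>'] by blast
  have im: "bracket_integrable \<Omega> V0 (\<lambda>x (\<rho>, u, \<theta>). \<rho> *\<^sub>R u)"
    using m unfolding mv_momentum_eq_def by blast
  have ir: "bracket_integrable \<Omega> V0 (\<lambda>x (\<rho>, u, \<theta>). \<rho>)"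
    using c unfolding mv_continuity_eq_def by blast
  have T0: "0 \<in> {0..T}" using T by simp
  note su = slice_dom[OF CderD(1)[OF DU] T0, unfolded RUH_simps]
  note sp = slice_dom[OF CderD(1)[OF Cder_\<psi>] T0, unfolded prod.case]
  obtain B1 where B1: "\<And>x. x \<in> \<Omega> \<Longrightarrow> norm (u' 0 x) \<le> B1" using su(2) by blast
  obtain B2 where B2: "\<And>x. x \<in> \<Omega> \<Longrightarrow> norm (\<psi> 0 x) \<le> B2" using sp(2) by blast
  have i1: "integrable (lebesgue_on \<Omega>) (\<lambda>x. \<langle>V0 x; \<lambda>(\<rho>, u, \<theta>). ballistic e s (\<theta>' 0 x) \<rho> u \<theta>\<rangle>)"
    using ib unfolding bracket_integrable_def by simp
  have i2: "integrable (lebesgue_on \<Omega>) (\<lambda>x. \<langle>V0 x; \<lambda>(\<rho>, u, \<theta>). \<rho> *\<^sub>R u\<rangle> \<bullet> u' 0 x)"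
    by (rule integrable_inner_bounded[OF _ su(1)]) (use im B1 in \<open>auto simp: bracket_integrable_def\<close>)
  have i3: "integrable (lebesgue_on \<Omega>) (\<lambda>x. \<langle>V0 x; \<lambda>(\<rho>, u, \<theta>). \<rho>\<rangle> * \<psi> 0 x)"
    using integrable_inner_bounded[OF conjunct2[OF ir[unfolded bracket_integrable_def]] sp(1), of B2] B2 by simp
  have i4: "integrable (lebesgue_on \<Omega>) (\<lambda>x. P (0, x))" by (rule integrable_P[OF T0])
  have "AE x in lebesgue_on \<Omega>. x \<in> \<Omega>" by (rule AE_I2) simp
  then have "AE x in lebesgue_on \<Omega>. \<langle>V0 x; \<lambda>(\<rho>, u, \<theta>). ballistic e s (\<theta>' 0 x) \<rho> u \<theta>\<rangle>
      - \<langle>V0 x; \<lambda>(\<rho>, u, \<theta>). \<rho> *\<^sub>R u\<rangle> \<bullet> u' 0 x + \<langle>V0 x; \<lambda>(\<rho>, u, \<theta>). \<rho>\<rangle> * \<psi> 0 x + P (0, x) = 0"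
    using init conjunct1[OF ib[unfolded bracket_integrable_def]] conjunct1[OF im[unfolded bracket_integrable_def]]
      conjunct1[OF ir[unfolded bracket_integrable_def]]
  proof eventually_elim
    case (elim x)
    have eqs: "\<rho>0 x = \<rho>' 0 x" "u0 x = u' 0 x" "\<theta>0 x = \<theta>' 0 x"
      using strong elim(1) unfolding strong_solution_def by auto
    have pos: "\<rho>' 0 x > 0"
      using positive[of "(0, x)"] T subsetD[OF closure_subset elim(1)] by (simp add: closure_Q)
    show ?case
      unfolding return_bracket[OF elim(2,3)] return_bracket[OF elim(2,4)] return_bracket[OF elim(2,5)]
      using pos by (simp add: eqs ballistic_def \<psi>_def P_def power2_norm_eq_inner field_simps)
  qed
  then have "(LINT x|lebesgue_on \<Omega>. \<langle>V0 x; \<lambda>(\<rho>, u, \<theta>). ballistic e s (\<theta>' 0 x) \<rho> u \<theta>\<rangle>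
      - \<langle>V0 x; \<lambda>(\<rho>, u, \<theta>). \<rho> *\<^sub>R u\<rangle> \<bullet> u' 0 x + \<langle>V0 x; \<lambda>(\<rho>, u, \<theta>). \<rho>\<rangle> * \<psi> 0 x + P (0, x)) = 0"
    by (rule integral_eq_zero_AE)
  then show ?thesis using i1 i2 i3 i4 by simp
qed

text \<open>The ballistic energy inequality, minus the tested momentum equation, plus the tested
  continuity equation, plus the integrated pressure; the integrals that vanish are inserted on the
  right. The momentum defect is bounded by an integrable weight times the dissipation defect, which
  also stands on the left, so Gronwall's inequality can treat it together with the energy.\<close>

lemma energy_inequality:
  obtains k where "integrable (lebesgue_on {0<..<T}) k" "\<And>t. k t \<ge> 0"
    "integrable (lebesgue_on {0<..<T}) (\<lambda>t. k t * D \<theta>' t)"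
    "AE \<tau> in lebesgue_on {0<..<T}. (LINT x|lebesgue_on \<Omega>. fE (\<tau>, x)) + D \<theta>' \<tau>
      \<le> integral\<^sup>L (lebesgue_on (QT \<tau> \<Omega>)) fI + (LINT t|lebesgue_on {0<..<\<tau>}. k t * D \<theta>' t)"
proof -
  obtain r where m: "mv_momentum_eq T \<Omega> p \<mu> lam V0 V r" and dc: "mv_defect_compat T \<Omega> \<theta>B D r"
    using mv unfolding measure_valued_solution_def by blast
  have b: "mv_ballistic_energy_ineq T \<Omega> \<theta>B e s \<kappa> \<mu> lam V0 V D" and c: "mv_continuity_eq T \<Omega> V0 V"
    using mv unfolding measure_valued_solution_def by blast+
  have Dm: "D \<theta>' \<in> borel_measurable (lebesgue_on {0<..<T})"
    and "\<exists>C. AE \<tau> in lebesgue_on {0<..<T}. 0 \<le> D \<theta>' \<tau> \<and> D \<theta>' \<tau> \<le> C"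
    using mv admissible_\<theta>' unfolding measure_valued_solution_def by blast+
  then obtain C where C: "AE \<tau> in lebesgue_on {0<..<T}. 0 \<le> D \<theta>' \<tau> \<and> D \<theta>' \<tau> \<le> C" by blast
  obtain \<xi> where \<xi>: "integrable (lebesgue_on {0<..<T}) \<xi>"
    "AE \<tau> in lebesgue_on {0<..<T}. \<forall>\<phi>. C1_closure \<Omega> \<phi> \<and> (\<forall>x\<in>frontier \<Omega>. \<phi> x = 0) \<longrightarrow>
           \<bar>pairing (closure \<Omega>) (r \<tau>) (Grad_cl \<Omega> \<phi>)\<bar> \<le> \<xi> \<tau> * D \<theta>' \<tau> * C1_norm \<Omega> \<phi>"
    using dc[unfolded mv_defect_compat_def, rule_format, OF admissible_\<theta>'] by blast
  obtain M where M: "M \<ge> 0" "\<And>t. t \<in> {0<..<T} \<Longrightarrow> C1_norm \<Omega> (u' t) \<le> M" using C1_norm_bounded by blast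
  \<comment> \<open>\<open>M\<close> bounds the C1 norm of the strong velocity uniformly in time.
    The modulus is taken because no sign is prescribed for \<xi>.\<close>
  define k where "k t = M * \<bar>\<xi> t\<bar>" for t
  have k: "integrable (lebesgue_on {0<..<T}) k" unfolding k_def using \<xi>(1) by simp
  have k0: "k t \<ge> 0" for t using M(1) by (simp add: k_def)
  have kD: "integrable (lebesgue_on {0<..<T}) (\<lambda>t. k t * D \<theta>' t)"
  proof (rule Bochner_Integration.integrable_bound)
    show "integrable (lebesgue_on {0<..<T}) (\<lambda>t. k t * C)" using k by simp
    show "(\<lambda>t. k t * D \<theta>' t) \<in> borel_measurable (lebesgue_on {0<..<T})" using k Dm by auto
    show "AE t in lebesgue_on {0<..<T}. norm (k t * D \<theta>' t) \<le> norm (k t * C)"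
      using C by eventually_elim (simp add: abs_mult k0 mult_left_mono)
  qed
  have vz: "u' t x = 0" if "t \<in> {0..T}" "x \<in> frontier \<Omega>" for t x
    using strong that unfolding strong_solution_def by auto
  have pb: "AE t in lebesgue_on {0<..<T}. \<bar>pairing (closure \<Omega>) (r t) (Grad_cl \<Omega> (u' t))\<bar> \<le> k t * D \<theta>' t"
    using \<xi>(2) C AE_in_domain[of "{0<..<T}"]
  proof eventually_elim
    case (elim t)
    have "\<bar>pairing (closure \<Omega>) (r t) (Grad_cl \<Omega> (u' t))\<bar> \<le> \<xi> t * D \<theta>' t * C1_norm \<Omega> (u' t)"
      using elim(1)[rule_format, of "u' t"] C1_velocity_slice[OF elim(3)] vz elim(3) by auto
    also have "\<dots> \<le> \<bar>\<xi> t\<bar> * D \<theta>' t * C1_norm \<Omega> (u' t)"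
    proof -
      have "0 \<le> C1_norm \<Omega> (u' t)"
      proof -
        \<comment> \<open>A real supremum is meaningful only over a nonempty set that is bounded
          above, so even the sign of the C1 norm rests on the bounds for the strong
          solution.\<close>
        have bdd: "bdd_above ((\<lambda>x. norm (f (t, x))) ` \<Omega>)" if "continuous_on (closure Q) f" for f :: "_ \<Rightarrow> 'x::euclidean_space"
          using slice_dom(2)[OF that, of t] elim(3) by (force simp: bdd_above_def)
        obtain x where x: "x \<in> \<Omega>" using dom by (auto simp: bounded_domain_def)
        have "0 \<le> (SUP x\<in>\<Omega>. norm (u' t x))"
          using bdd[OF CderD(1)[OF DU]] x by (intro cSUP_upper2[OF _ x]) auto
        moreover have "0 \<le> (SUP x\<in>\<Omega>. norm (Grad (u' t) x))"
        proof -
          have "(\<lambda>x. norm (Grad (u' t) x)) ` \<Omega> = (\<lambda>x. norm (Gu (t, x))) ` \<Omega>"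
            using elim(3) by (intro image_cong) (auto simp: Gu_eq)
          then have "bdd_above ((\<lambda>x. norm (Grad (u' t) x)) ` \<Omega>)" using bdd[OF continuous_Gu] by simp
          then show ?thesis using x by (intro cSUP_upper2[OF _ x]) auto
        qed
        ultimately show ?thesis by (simp add: C1_norm_def)
      qed
      then show ?thesis using elim(2) by (intro mult_right_mono) auto
    qed
    also have "\<dots> \<le> \<bar>\<xi> t\<bar> * D \<theta>' t * M" using M(2)[OF elim(3)] elim(2) by (intro mult_left_mono) auto
    finally show ?case by (simp add: k_def mult_ac)
  qed
  have bal: "AE \<tau> in lebesgue_on {0<..<T}.
         (LINT x|lebesgue_on \<Omega>. t0 (\<tau>, x)) + integral\<^sup>L (lebesgue_on (QT \<tau> \<Omega>)) t1 + D \<theta>' \<tau>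
         \<le> (LINT x|lebesgue_on \<Omega>. \<langle>V0 x; \<lambda>(\<rho>, u, \<theta>). ballistic e s (\<theta>' 0 x) \<rho> u \<theta>\<rangle>)
           - integral\<^sup>L (lebesgue_on (QT \<tau> \<Omega>)) t2 - integral\<^sup>L (lebesgue_on (QT \<tau> \<Omega>)) t3
           + integral\<^sup>L (lebesgue_on (QT \<tau> \<Omega>)) t4"
    using b[unfolded mv_ballistic_energy_ineq_def, rule_format, OF admissible_\<theta>']
    unfolding t0_def t1_def t2_def t3_def t4_def prod.case by blast
  have con: "AE \<tau> in lebesgue_on {0<..<T}.
       (LINT x|lebesgue_on \<Omega>. a2 (\<tau>, x)) - (LINT x|lebesgue_on \<Omega>. \<langle>V0 x; \<lambda>(\<rho>, u, \<theta>). \<rho>\<rangle> * \<psi> 0 x)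
       = integral\<^sup>L (lebesgue_on (QT \<tau> \<Omega>)) t7"
  proof -
    have "AE \<tau> in lebesgue_on {0<..<T}. \<forall>\<psi>. C1_QT T \<Omega> \<psi> \<longrightarrow>
       (LINT x|lebesgue_on \<Omega>. \<langle>V \<tau> x; \<lambda>(\<rho>, u, \<theta>, A, g). \<rho>\<rangle> * \<psi> \<tau> x)
       - (LINT x|lebesgue_on \<Omega>. \<langle>V0 x; \<lambda>(\<rho>, u, \<theta>). \<rho>\<rangle> * \<psi> 0 x)
       = (LINT (t, x)|lebesgue_on (QT \<tau> \<Omega>).
            \<langle>V t x; \<lambda>(\<rho>, u, \<theta>, A, g). \<rho>\<rangle> * dt \<psi> t x
            + \<langle>V t x; \<lambda>(\<rho>, u, \<theta>, A, g). \<rho> *\<^sub>R u\<rangle> \<bullet> grad (\<psi> t) x)"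
      using c unfolding mv_continuity_eq_def by blast
    then show ?thesis
      unfolding a2_def t7_def prod.case by (rule eventually_mono) (use C1_fields(4) in blast)
  qed
  have mom: "AE \<tau> in lebesgue_on {0<..<T}.
       (LINT x|lebesgue_on \<Omega>. a1 (\<tau>, x)) - (LINT x|lebesgue_on \<Omega>. \<langle>V0 x; \<lambda>(\<rho>, u, \<theta>). \<rho> *\<^sub>R u\<rangle> \<bullet> u' 0 x)
       = integral\<^sup>L (lebesgue_on (QT \<tau> \<Omega>)) t5 - integral\<^sup>L (lebesgue_on (QT \<tau> \<Omega>)) t6
         + (LINT t|lebesgue_on {0<..<\<tau>}. pairing (closure \<Omega>) (r t) (Grad_cl \<Omega> (u' t)))"
  proof -
    have "AE \<tau> in lebesgue_on {0<..<T}. \<forall>\<phi>. C1_QT T \<Omega> \<phi> \<and> (\<forall>t\<in>{0..T}. \<forall>x\<in>frontier \<Omega>. \<phi> t x = 0) \<longrightarrow>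
       (LINT x|lebesgue_on \<Omega>. \<langle>V \<tau> x; \<lambda>(\<rho>, u, \<theta>, A, g). \<rho> *\<^sub>R u\<rangle> \<bullet> \<phi> \<tau> x)
       - (LINT x|lebesgue_on \<Omega>. \<langle>V0 x; \<lambda>(\<rho>, u, \<theta>). \<rho> *\<^sub>R u\<rangle> \<bullet> \<phi> 0 x)
       = (LINT (t, x)|lebesgue_on (QT \<tau> \<Omega>).
            \<langle>V t x; \<lambda>(\<rho>, u, \<theta>, A, g). \<rho> *\<^sub>R u\<rangle> \<bullet> dt \<phi> t x
            + \<langle>V t x; \<lambda>(\<rho>, u, \<theta>, A, g). \<rho> *\<^sub>R outer u u\<rangle> \<bullet> Grad (\<phi> t) x
            + \<langle>V t x; \<lambda>(\<rho>, u, \<theta>, A, g). p \<rho> \<theta>\<rangle> * dvg (\<phi> t) x)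
         - (LINT (t, x)|lebesgue_on (QT \<tau> \<Omega>).
              \<langle>V t x; \<lambda>(\<rho>, u, \<theta>, A, g). stress \<mu> lam \<rho> \<theta> A\<rangle> \<bullet> Grad (\<phi> t) x)
         + (LINT t|lebesgue_on {0<..<\<tau>}. pairing (closure \<Omega>) (r t) (Grad_cl \<Omega> (\<phi> t)))"
      using m unfolding mv_momentum_eq_def by blast
    then show ?thesis
      unfolding a1_def t5_def t6_def prod.case
      by (rule eventually_mono) (use C1_fields(2) vz in blast)
  qed
  have slices: "AE \<tau> in lebesgue_on {0<..<T}. integrable (lebesgue_on \<Omega>) (\<lambda>x. f (\<tau>, x))"
    if "integrable (lebesgue_on Q) f" for f :: "_ \<Rightarrow> real"
    by (rule Fubini_lebesgue_on(1)[OF open_greaterThanLessThan open_dom that])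
  have "AE \<tau> in lebesgue_on {0<..<T}. (LINT x|lebesgue_on \<Omega>. fE (\<tau>, x)) + D \<theta>' \<tau>
      \<le> integral\<^sup>L (lebesgue_on (QT \<tau> \<Omega>)) fI + (LINT t|lebesgue_on {0<..<\<tau>}. k t * D \<theta>' t)"
    using bal con mom slices[OF terms_integrable(1)] slices[OF terms_integrable(11)] slices[OF terms_integrable(12)]
      AE_in_domain[of "{0<..<T}"]
  proof eventually_elim
    case (elim \<tau>)
    note \<tau> = elim(7)
    have Q\<tau>: "integrable (lebesgue_on (QT \<tau> \<Omega>)) f" if "integrable (lebesgue_on Q) f" for f :: "_ \<Rightarrow> real"
      using integrable_lebesgue_on_mono[OF that] sets_Q[OF \<tau>] by blast
    note ti = terms_integrable[THEN Q\<tau>] t9(1)[OF \<tau>, THEN Q\<tau>] t11(1)[OF \<tau>, THEN Q\<tau>]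
    have iP: "integrable (lebesgue_on \<Omega>) (\<lambda>x. P (\<tau>, x))" using integrable_P[of \<tau>] \<tau> by auto
    have 1: "(LINT x|lebesgue_on \<Omega>. fE (\<tau>, x)) = (LINT x|lebesgue_on \<Omega>. t0 (\<tau>, x)) - (LINT x|lebesgue_on \<Omega>. a1 (\<tau>, x))
        + (LINT x|lebesgue_on \<Omega>. a2 (\<tau>, x)) + (LINT x|lebesgue_on \<Omega>. P (\<tau>, x))"
      unfolding fE_def using elim(4-6) iP by simp
    have 2: "integral\<^sup>L (lebesgue_on (QT \<tau> \<Omega>)) fI = - integral\<^sup>L (lebesgue_on (QT \<tau> \<Omega>)) t1
        - integral\<^sup>L (lebesgue_on (QT \<tau> \<Omega>)) t2 - integral\<^sup>L (lebesgue_on (QT \<tau> \<Omega>)) t3 + integral\<^sup>L (lebesgue_on (QT \<tau> \<Omega>)) t4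
        - integral\<^sup>L (lebesgue_on (QT \<tau> \<Omega>)) t5 + integral\<^sup>L (lebesgue_on (QT \<tau> \<Omega>)) t6 + integral\<^sup>L (lebesgue_on (QT \<tau> \<Omega>)) t7
        + integral\<^sup>L (lebesgue_on (QT \<tau> \<Omega>)) t8 + integral\<^sup>L (lebesgue_on (QT \<tau> \<Omega>)) t9 + integral\<^sup>L (lebesgue_on (QT \<tau> \<Omega>)) t10
        + integral\<^sup>L (lebesgue_on (QT \<tau> \<Omega>)) t11"
      unfolding fI_def[abs_def] using ti by simp
    have 3: "integral\<^sup>L (lebesgue_on (QT \<tau> \<Omega>)) t8 = (LINT x|lebesgue_on \<Omega>. P (\<tau>, x)) - (LINT x|lebesgue_on \<Omega>. P (0, x))"
      unfolding t8_def by (rule integral_Pt(2)[OF \<tau>])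
    have 4: "integral\<^sup>L (lebesgue_on (QT \<tau> \<Omega>)) t10 = 0"
      unfolding t10_def by (rule integral_dvg_F(2)[OF \<tau>])
    \<comment> \<open>The field paired with the defect varies in time, so integrability of the
      pairing is not at hand; the bound holds without it.\<close>
    have 5: "\<bar>LINT t|lebesgue_on {0<..<\<tau>}. pairing (closure \<Omega>) (r t) (Grad_cl \<Omega> (u' t))\<bar> \<le> (LINT t|lebesgue_on {0<..<\<tau>}. k t * D \<theta>' t)"
      using \<tau> by (intro integral_norm_bound_le integrable_lebesgue_on_mono[OF kD] AE_lebesgue_on_mono_set[OF pb]) auto
    \<comment> \<open>The combination of the balances as plain real numbers. The momentum equation
      is subtracted, so its defect enters with a minus sign and only \<open>- pr \<le> K'\<close> is
      used.\<close>
    have arith: "E' + d \<le> I' + K'"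
      if "A + x1 + d \<le> B0 - x2 - x3 + x4" "A2 - B2 = x7" "A1 - B1 = x5 - x6 + pr" "E' = A - A1 + A2 + PP"
        "I' = - x1 - x2 - x3 + x4 - x5 + x6 + x7 + x8 + x9 + x10 + x11" "x8 = PP - P0" "x10 = 0" "- pr \<le> K'" "x9 = 0" "x11 = 0"
        "B0 - B1 + B2 + P0 = 0"
      for E' d I' K' A A1 A2 B0 B1 B2 PP P0 pr x1 x2 x3 x4 x5 x6 x7 x8 x9 x10 x11 :: real
      using that by linarith
    show ?case
      by (rule arith[OF elim(1-3) 1 2 3 4 abs_le_D2[OF 5] t9(2)[OF \<tau>] t11(2)[OF \<tau>] initial_balance])
  qed
  then show ?thesis using k k0 kD by (intro that[of k]) auto
qed

section \<open>Relative energy and rate as brackets\<close>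

abbreviation "rr t x \<equiv> rel_rate p s \<kappa> \<mu> lam (\<rho>' t x) (\<theta>' t x) (u' t x) (dt \<rho>' t x) (dt \<theta>' t x) (dt u' t x)
  (grad (\<rho>' t) x) (grad (\<theta>' t) x) (Grad (u' t) x) (dS (t, x)) (dK (t, x))"

abbreviation "re t x \<equiv> rel_energy p e s (\<rho>' t x) (u' t x) (\<theta>' t x)"

lemma has_bochner_integral_prob_const:
  "prob_space M \<Longrightarrow> has_bochner_integral M (\<lambda>_. c) (c :: 'c::{banach, second_countable_topology})"
  by (simp add: has_bochner_integral_iff prob_space.prob_space finite_measure.integrable_const prob_space.finite_measure)

lemma rel_energy_bracket:
  "AE z in lebesgue_on Q. has_bochner_integral (W z) (re (fst z) (snd z)) (fE z)"
  using W_young bracket_integrableD(1)[OF mv_integrable(1)] bracket_integrableD(1)[OF mv_integrable(2)]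
    bracket_integrableD(1)[OF mv_integrable(14)]
proof eventually_elim
  case (elim z)
  obtain t x where z: "z = (t, x)" by fastforce
  have K: "has_bochner_integral (W z) Kr \<langle>W z; Kr\<rangle>" "has_bochner_integral (W z) Km \<langle>W z; Km\<rangle>"
    "has_bochner_integral (W z) (Kb (\<theta>' t x)) \<langle>W z; Kb (\<theta>' t x)\<rangle>"
    using elim(2-4) by (simp_all add: has_bochner_integral_iff z)
  have "has_bochner_integral (W z) (\<lambda>w. Kb (\<theta>' t x) w - Km w \<bullet> u' t x + Kr w * \<psi> t x + P (t, x))
     (\<langle>W z; Kb (\<theta>' t x)\<rangle> - \<langle>W z; Km\<rangle> \<bullet> u' t x + \<langle>W z; Kr\<rangle> * \<psi> t x + P (t, x))"
    by (intro has_bochner_integral_add has_bochner_integral_diff has_bochner_integral_inner_left has_bochner_integral_mult_left K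
        has_bochner_integral_prob_const) (use elim(1) in blast)
  moreover have "(\<lambda>w. Kb (\<theta>' t x) w - Km w \<bullet> u' t x + Kr w * \<psi> t x + P (t, x)) = re t x"
    by (auto simp: fun_eq_iff rel_energy_def \<psi>_def P_def)
  moreover have "\<langle>W z; Kb (\<theta>' t x)\<rangle> - \<langle>W z; Km\<rangle> \<bullet> u' t x + \<langle>W z; Kr\<rangle> * \<psi> t x + P (t, x) = fE z"
    by (simp add: fE_def t0_def a1_def a2_def W_def z)
  ultimately show ?case by (simp add: z)
qed

text \<open>At fixed \<open>z\<close> the rate is a linear combination of integrands with known
  brackets, plus constants, which a probability measure reproduces. The formulas for the derivatives
  of \<psi>, \<open>F\<close> and \<eta> turn the terms of \<open>fI\<close> into the parameters of
  \<open>rel_rate\<close>.\<close>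

lemma rel_rate_bracket:
  "AE z in lebesgue_on Q. has_bochner_integral (W z) (rr (fst z) (snd z)) (fI z)"
  using W_young mv_integrable[THEN bracket_integrableD(1)] AE_in_domain[of Q]
proof eventually_elim
  case (elim z)
  obtain t x where z: "z = (t, x)" by fastforce
  have zQ: "(t, x) \<in> Q" using elim z by simp
  have K: "has_bochner_integral (W z) Kr \<langle>W z; Kr\<rangle>" "has_bochner_integral (W z) Km \<langle>W z; Km\<rangle>"
    "has_bochner_integral (W z) Kf \<langle>W z; Kf\<rangle>" "has_bochner_integral (W z) Kp \<langle>W z; Kp\<rangle>"
    "has_bochner_integral (W z) Kst \<langle>W z; Kst\<rangle>" "has_bochner_integral (W z) Kep \<langle>W z; Kep\<rangle>"
    "has_bochner_integral (W z) Kes \<langle>W z; Kes\<rangle>" "has_bochner_integral (W z) Kesu \<langle>W z; Kesu\<rangle>"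
    "has_bochner_integral (W z) Kk \<langle>W z; Kk\<rangle>" "has_bochner_integral (W z) Ku \<langle>W z; Ku\<rangle>"
    "has_bochner_integral (W z) KA \<langle>W z; KA\<rangle>" "has_bochner_integral (W z) Kth \<langle>W z; Kth\<rangle>"
    "has_bochner_integral (W z) Kg \<langle>W z; Kg\<rangle>"
    using elim(2-14) by (simp_all add: has_bochner_integral_iff)
  have C: "has_bochner_integral (W z) (\<lambda>_. c) c" "has_bochner_integral (W z) (\<lambda>_. v) v" for c :: real and v :: "real^'d"
    using has_bochner_integral_prob_const elim(1) by blast+
  define G where "G w = - (Kep w * \<theta>' t x) - Kes w * dt \<theta>' t x - Kesu w \<bullet> grad (\<theta>' t) x + Kk w \<bullet> grad (\<theta>' t) x
      - (Km w \<bullet> dt u' t x + Kf w \<bullet> Grad (u' t) x + Kp w * dvg (u' t) x) + Kst w \<bullet> Grad (u' t) x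
      + (Kr w * dt \<psi> t x + Km w \<bullet> grad (\<psi> t) x) + Pt t x + (Ku w \<bullet> dS (t, x) + KA w \<bullet> S (t, x))
      + dvg (\<lambda>y. F (t, y)) x + ((Kth w - H (t, x)) \<bullet> d\<eta> (t, x) + (Kg w - gH (t, x)) \<bullet> \<eta> (t, x))" for w
  have "has_bochner_integral (W z) G (fI z)"
    unfolding G_def[abs_def] fI_def t1_def t2_def t3_def t4_def t5_def t6_def t7_def t8_def t9_def t10_def t11_def z prod.case
    using K C unfolding z W_def fst_conv snd_conv
    by (intro has_bochner_integral_add has_bochner_integral_diff has_bochner_integral_minus has_bochner_integral_inner_left
        has_bochner_integral_mult_left)
  moreover have "G = rr t x"
  proof
    fix w :: "'d phase"
    obtain \<rho> u \<theta> A g where w: "w = (\<rho>, u, \<theta>, A, g)" by (metis prod.exhaust)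
    show "G w = rr t x w"
      unfolding w G_def rel_rate_def Let_def prod.case \<psi>_derivs[OF zQ] dvg_F[OF zQ] d\<eta>_eq[OF zQ] \<eta>_eq[OF zQ] gH_eq[OF zQ] Pt_def
      by (simp only: dvg_def S_def Gu_eq[OF zQ] RUH_simps inner_real_def prod.case)
  qed
  ultimately show ?case unfolding z fst_conv snd_conv by (rule back_subst)
qed

end

section \<open>Vanishing of the relative energy and identification of the Young measure\<close>

lemma emeasure_eq_1_imp_AE:
  assumes "prob_space M" "emeasure M X = 1"
  shows "AE w in M. w \<in> X"
  using prob_space.AE_prob_1[OF assms(1)] assms(2) by (simp add: measure_def)

lemma has_bochner_integral_nonneg_zero:
  fixes f :: "'a \<Rightarrow> real"
  assumes "has_bochner_integral M f 0" "AE w in M. f w \<ge> 0"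
  shows "AE w in M. f w = 0"
  using assms integral_nonneg_eq_0_iff_AE[of M f] by (auto simp: has_bochner_integral_iff)

context weak_strong
begin

lemma relative_energy_estimate:
  assumes pos: "\<rho>_lo > 0" "\<theta>_lo > 0"
    and supp: "AE (t, x) in lebesgue_on Q.
      emeasure (V t x) {(\<rho>, u, \<theta>, A, g). \<rho>_lo < \<rho> \<and> \<rho> < \<rho>_hi \<and> \<theta>_lo < \<theta> \<and> \<theta> < \<theta>_hi} = 1"
  obtains c0 c C where "c0 > 0" "c > 0" "C \<ge> 0"
    "AE z in lebesgue_on Q. AE w in W z.
      (case w of (\<rho>, u, \<theta>, A, g) \<Rightarrow>
        c0 * ((\<rho> - R z)\<^sup>2 + (\<theta> - H z)\<^sup>2 + (norm (u - U z))\<^sup>2) \<le> re (fst z) (snd z) w \<and>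
        c * ((norm (A - symm (Gu z)))\<^sup>2 + (norm (g - gH z))\<^sup>2) \<le> C * re (fst z) (snd z) w - rr (fst z) (snd z) w)"
proof -
  obtain a' b' B where st: "a' > 0" "a' \<le> b'" "B \<ge> 0"
    "\<And>t x. (t, x) \<in> Q \<Longrightarrow> \<rho>' t x \<in> {a'..b'} \<and> \<theta>' t x \<in> {a'..b'} \<and> norm (u' t x) \<le> B \<and> \<bar>dt \<theta>' t x\<bar> \<le> B \<and>
      norm (grad (\<theta>' t) x) \<le> B \<and> norm (Grad (u' t) x) \<le> B \<and> norm (dS (t, x)) \<le> B"
    by (rule state_bounds) (rule that)
  \<comment> \<open>One square holds the densities and temperatures of the strong solution and those
    charged by the Young measure, so the uniform constants apply to every pair of states.\<close>
  define a where "a = min a' (min \<rho>_lo \<theta>_lo)"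
  define b where "b = max b' (max \<rho>_hi \<theta>_hi)"
  have ab: "a > 0" "a \<le> b" using st pos by (auto simp: a_def b_def)
  obtain c0 where c0: "c0 > 0" "\<And>\<rho> \<theta> r h u (v :: real^'d) A g. {\<rho>, \<theta>, r, h} \<subseteq> {a..b} \<Longrightarrow>
    c0 * ((\<rho> - r)\<^sup>2 + (\<theta> - h)\<^sup>2 + (norm (u - v))\<^sup>2) \<le> rel_energy p e s r v h (\<rho>, u, \<theta>, A, g)"
    by (rule rel_energy_coercive[OF ab(1)]) (rule that)
  obtain c C where cC: "c > 0" "C \<ge> 0"
    "\<And>r h (v :: real^'d) rt ht vt gr q Gv dS dK \<rho> u \<theta> A g.
      {\<rho>, \<theta>, r, h} \<subseteq> {a..b} \<Longrightarrow> transpose A = A \<Longrightarrow>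
      norm v \<le> B \<Longrightarrow> \<bar>ht\<bar> \<le> B \<Longrightarrow> norm q \<le> B \<Longrightarrow> norm Gv \<le> B \<Longrightarrow> norm dS \<le> B \<Longrightarrow>
      rt + v \<bullet> gr + r * trace Gv = 0 \<Longrightarrow>
      r *\<^sub>R (vt + Gv *v v) + (d_rho p r h *\<^sub>R gr + d_theta p r h *\<^sub>R q) = dS \<Longrightarrow>
      r * (d_rho e r h * (rt + v \<bullet> gr) + d_theta e r h * (ht + v \<bullet> q))
        = dK + stress \<mu> lam r h Gv \<bullet> symm Gv - p r h * trace Gv \<Longrightarrow>
      rel_rate p s \<kappa> \<mu> lam r h v rt ht vt gr q Gv dS dK (\<rho>, u, \<theta>, A, g)
        \<le> C * ((\<rho> - r)\<^sup>2 + (\<theta> - h)\<^sup>2 + (norm (u - v))\<^sup>2) - c * ((norm (A - symm Gv))\<^sup>2 + (norm (g - q))\<^sup>2)"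
    by (rule rel_rate_bound[OF tk tm tl ab st(3)]) (rule that)
  have "AE z in lebesgue_on Q. AE w in W z.
      (case w of (\<rho>, u, \<theta>, A, g) \<Rightarrow>
        c0 * ((\<rho> - R z)\<^sup>2 + (\<theta> - H z)\<^sup>2 + (norm (u - U z))\<^sup>2) \<le> re (fst z) (snd z) w \<and>
        c * ((norm (A - symm (Gu z)))\<^sup>2 + (norm (g - gH z))\<^sup>2) \<le> C / c0 * re (fst z) (snd z) w - rr (fst z) (snd z) w)"
    using W_young supp AE_in_domain[of Q]
  proof eventually_elim
    case (elim z)
    obtain t x where z: "z = (t, x)" by fastforce
    have zQ: "(t, x) \<in> Q" using elim z by simp
    have "AE w in W z. w \<in> phase_space"
      using emeasure_eq_1_imp_AE elim(1) by blast
    moreover have "AE w in W z. w \<in> {(\<rho>, u, \<theta>, A, g). \<rho>_lo < \<rho> \<and> \<rho> < \<rho>_hi \<and> \<theta>_lo < \<theta> \<and> \<theta> < \<theta>_hi}"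
      using elim(1,2) by (intro emeasure_eq_1_imp_AE) (simp_all add: z W_def)
    ultimately show ?case
    proof eventually_elim
      case (elim w)
      obtain \<rho> u \<theta> A g where w: "w = (\<rho>, u, \<theta>, A, g)" by (metis prod.exhaust)
      note sb = st(4)[OF zQ]
      have rng: "{\<rho>, \<theta>, \<rho>' t x, \<theta>' t x} \<subseteq> {a..b}" using elim(2) sb by (auto simp: w a_def b_def)
      have sym: "transpose A = A" using elim(1) by (simp add: w phase_space_def)
      let ?X = "(\<rho> - \<rho>' t x)\<^sup>2 + (\<theta> - \<theta>' t x)\<^sup>2 + (norm (u - u' t x))\<^sup>2"
      have 1: "c0 * ?X \<le> re t x w" unfolding w by (rule c0(2)[OF rng])
      have "rr t x w \<le> C * ?X - c * ((norm (A - symm (Grad (u' t) x)))\<^sup>2 + (norm (g - grad (\<theta>' t) x))\<^sup>2)"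
        unfolding w by (rule cC(3)[OF rng sym _ _ _ _ _ pde_continuity(1)[OF zQ] pde_momentum[OF zQ] pde_energy[OF zQ]])
          (use sb in auto)
      \<comment> \<open>Coercivity exchanges the squared deviations for the relative energy itself,
        whence the constant \<open>C / c0\<close>.\<close>
      moreover have "C * ?X \<le> C / c0 * re t x w"
      proof -
        have "C * ?X = C / c0 * (c0 * ?X)" using c0(1) by simp
        also have "\<dots> \<le> C / c0 * re t x w" using cC(2) c0(1) by (intro mult_left_mono 1) auto
        finally show ?thesis .
      qed
      ultimately have 2: "c * ((norm (A - symm (Grad (u' t) x)))\<^sup>2 + (norm (g - grad (\<theta>' t) x))\<^sup>2) \<le> C / c0 * re t x w - rr t x w"
        by linarith
      show ?case unfolding w z prod.case fst_conv snd_conv RUH_simps Gu_eq[OF zQ] gH_eq[OF zQ]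
        by (rule conjI[OF 1[unfolded w] 2[unfolded w]])
    qed
  qed
  then show ?thesis by (rule that[OF c0(1) cC(1) divide_nonneg_pos[OF cC(2) c0(1)]])
qed

text \<open>Put \<open>g = C * E + k * D \<theta>'\<close>. Since \<open>C * fE - fI\<close> is
  nonnegative, the energy inequality bounds \<open>E + D \<theta>'\<close> by the integral of
  \<open>g\<close>; as all quantities are nonnegative, \<open>g\<close> is at most
  \<open>C + k\<close> times that integral, and Gronwall's inequality applies. The unbounded weight
  \<open>k\<close> is the reason for the version with an integrable factor.\<close>

lemma energy_and_rate_vanish:
  assumes E: "AE z in lebesgue_on Q. fE z \<ge> 0" and I: "AE z in lebesgue_on Q. C * fE z - fI z \<ge> 0" and C: "C \<ge> 0"
  shows "AE z in lebesgue_on Q. fE z = 0" and "AE z in lebesgue_on Q. C * fE z - fI z = 0"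
proof -
  obtain k where k: "integrable (lebesgue_on {0<..<T}) k" "\<And>t. k t \<ge> 0"
    "integrable (lebesgue_on {0<..<T}) (\<lambda>t. k t * D \<theta>' t)"
    and ineq: "AE \<tau> in lebesgue_on {0<..<T}. (LINT x|lebesgue_on \<Omega>. fE (\<tau>, x)) + D \<theta>' \<tau>
      \<le> integral\<^sup>L (lebesgue_on (QT \<tau> \<Omega>)) fI + (LINT t|lebesgue_on {0<..<\<tau>}. k t * D \<theta>' t)"
    by (rule energy_inequality) (rule that)
  have "\<exists>K. AE \<tau> in lebesgue_on {0<..<T}. 0 \<le> D \<theta>' \<tau> \<and> D \<theta>' \<tau> \<le> K"
    using mv admissible_\<theta>' unfolding measure_valued_solution_def by blast
  then have D0: "AE \<tau> in lebesgue_on {0<..<T}. 0 \<le> D \<theta>' \<tau>" by (auto elim: eventually_mono)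
  define E where "E t = (LINT x|lebesgue_on \<Omega>. fE (t, x))" for t
  note Fub = Fubini_lebesgue_on[OF open_greaterThanLessThan open_dom]
  have Ei: "integrable (lebesgue_on {0<..<T}) E" unfolding E_def by (rule Fub(2)[OF fE_integrable])
  have E0: "AE t in lebesgue_on {0<..<T}. E t \<ge> 0"
  proof -
    have "AE t in lebesgue_on {0<..<T}. AE x in lebesgue_on \<Omega>. fE (t, x) \<ge> 0"
      using AE_lebesgue_on_Times[OF open_greaterThanLessThan open_dom E] .
    then show ?thesis unfolding E_def by eventually_elim (rule integral_nonneg_AE)
  qed
  have sub: "integrable (lebesgue_on (QT \<tau> \<Omega>)) f" if "integrable (lebesgue_on Q) f" "\<tau> \<in> {0<..<T}" for f :: "_ \<Rightarrow> real" and \<tau>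
    using integrable_lebesgue_on_mono[OF that(1)] sets_Q[OF that(2)] by blast
  have subt: "integrable (lebesgue_on {0<..<\<tau>}) f" if "integrable (lebesgue_on {0<..<T}) f" "\<tau> \<in> {0<..<T}" for f :: "_ \<Rightarrow> real" and \<tau>
    by (rule integrable_lebesgue_on_mono[OF that(1)]) (use that(2) in auto)
  have gap: "0 \<le> integral\<^sup>L (lebesgue_on (QT \<tau> \<Omega>)) (\<lambda>z. C * fE z - fI z)"
    and slab: "integral\<^sup>L (lebesgue_on (QT \<tau> \<Omega>)) (\<lambda>z. C * fE z - fI z)
      = C * (LINT t|lebesgue_on {0<..<\<tau>}. E t) - integral\<^sup>L (lebesgue_on (QT \<tau> \<Omega>)) fI" if \<tau>: "\<tau> \<in> {0<..<T}" for \<tau>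
  proof -
    show "0 \<le> integral\<^sup>L (lebesgue_on (QT \<tau> \<Omega>)) (\<lambda>z. C * fE z - fI z)"
      by (rule integral_nonneg_AE, rule AE_lebesgue_on_mono_set[OF I]) (use sets_Q[OF \<tau>] in auto)
    show "integral\<^sup>L (lebesgue_on (QT \<tau> \<Omega>)) (\<lambda>z. C * fE z - fI z)
      = C * (LINT t|lebesgue_on {0<..<\<tau>}. E t) - integral\<^sup>L (lebesgue_on (QT \<tau> \<Omega>)) fI"
      unfolding E_def Fub(3)[OF sub[OF fE_integrable \<tau>]] using sub[OF fE_integrable \<tau>] sub[OF fI_integrable \<tau>] by simp
  qed
  define g where "g t = C * E t + k t * D \<theta>' t" for t
  have gi: "integrable (lebesgue_on {0<..<T}) g" unfolding g_def using Ei k(3) by auto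
  have g0: "AE t in lebesgue_on {0<..<T}. g t \<ge> 0"
    using E0 D0 by eventually_elim (simp add: g_def C k(2))
  have bound: "AE \<tau> in lebesgue_on {0<..<T}. E \<tau> + D \<theta>' \<tau> \<le> (LINT t|lebesgue_on {0<..<\<tau>}. g t)"
    using ineq AE_in_domain[of "{0<..<T}"]
  proof eventually_elim
    case (elim \<tau>)
    have "(LINT t|lebesgue_on {0<..<\<tau>}. g t) = C * (LINT t|lebesgue_on {0<..<\<tau>}. E t) + (LINT t|lebesgue_on {0<..<\<tau>}. k t * D \<theta>' t)"
      unfolding g_def using subt[OF Ei elim(2)] subt[OF k(3) elim(2)] by simp
    then show ?case using elim(1) gap[OF elim(2)] slab[OF elim(2)] unfolding E_def by linarith
  qed
  have gz: "AE t in lebesgue_on {0<..<T}. g t = 0"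
  proof (rule Gronwall_L1[OF T gi _ g0])
    show "integrable (lebesgue_on {0<..<T}) (\<lambda>t. C + k t)" 
    proof (rule Bochner_Integration.integrable_add[OF _ k(1)])
      show "integrable (lebesgue_on {0<..<T}) (\<lambda>t. C)"
        by (rule finite_measure.integrable_const) (rule finite_measure_lebesgue_on, simp)
    qed
    show "AE t in lebesgue_on {0<..<T}. 0 \<le> C + k t" using C k(2) by (simp add: add_nonneg_nonneg)
    show "AE \<tau> in lebesgue_on {0<..<T}. g \<tau> \<le> (C + k \<tau>) * (LINT t|lebesgue_on {0<..<\<tau>}. g t)"
      using bound E0 D0
    proof eventually_elim
      case (elim \<tau>)
      have "g \<tau> \<le> (C + k \<tau>) * (E \<tau> + D \<theta>' \<tau>)"
        using elim C k(2)[of \<tau>] by (simp add: g_def algebra_simps)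
      also have "\<dots> \<le> (C + k \<tau>) * (LINT t|lebesgue_on {0<..<\<tau>}. g t)"
        using elim(1) C k(2)[of \<tau>] by (intro mult_left_mono) auto
      finally show ?case .
    qed
  qed
  have gint: "(LINT t|lebesgue_on {0<..<\<tau>}. g t) = 0" if "\<tau> \<in> {0<..<T}" for \<tau>
    by (rule integral_eq_zero_AE, rule AE_lebesgue_on_mono_set[OF gz]) (use that in auto)
  have EDz: "AE \<tau> in lebesgue_on {0<..<T}. E \<tau> = 0 \<and> D \<theta>' \<tau> = 0"
    using bound E0 D0 AE_in_domain[of "{0<..<T}"]
    by eventually_elim (use gint in force)
  have "integral\<^sup>L (lebesgue_on Q) fE = (LINT t|lebesgue_on {0<..<T}. E t)"
    unfolding E_def by (rule Fub(3)[OF fE_integrable, symmetric])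
  also have "\<dots> = 0" by (rule integral_eq_zero_AE) (use EDz in \<open>auto elim: eventually_mono\<close>)
  finally show "AE z in lebesgue_on Q. fE z = 0"
    using integral_nonneg_eq_0_iff_AE[OF fE_integrable E] by simp
  have iCI: "integrable (lebesgue_on Q) (\<lambda>z. C * fE z - fI z)" using fE_integrable fI_integrable by auto
  \<comment> \<open>With energy and defect zero, the energy inequality makes the integral of
    \<open>fI\<close> over the slab nonnegative, whereas the sign of \<open>C * fE - fI\<close>
    makes it nonpositive.\<close>
  have slabz: "AE \<tau> in lebesgue_on {0<..<T}. AE z in lebesgue_on (QT \<tau> \<Omega>). C * fE z - fI z = 0"
    using ineq EDz AE_in_domain[of "{0<..<T}"]
  proof eventually_elim
    case (elim \<tau>)
    have "(LINT t|lebesgue_on {0<..<\<tau>}. E t) = 0" "(LINT t|lebesgue_on {0<..<\<tau>}. k t * D \<theta>' t) = 0"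
      by (rule integral_eq_zero_AE, rule AE_lebesgue_on_mono_set[where S = "{0<..<T}"], use EDz elim(3) in \<open>auto elim: eventually_mono\<close>)+
    then have "integral\<^sup>L (lebesgue_on (QT \<tau> \<Omega>)) (\<lambda>z. C * fE z - fI z) = 0"
      using elim(1,2) gap[OF elim(3)] slab[OF elim(3)] by (simp add: E_def)
    moreover have "AE z in lebesgue_on (QT \<tau> \<Omega>). C * fE z - fI z \<ge> 0"
      by (rule AE_lebesgue_on_mono_set[OF I]) (use sets_Q[OF elim(3)] in auto)
    ultimately show ?case using integral_nonneg_eq_0_iff_AE[OF sub[OF iCI elim(3)]] by blast
  qed
  \<comment> \<open>The previous statement concerns slabs up to almost every time before
    \<open>T\<close>, not the whole cylinder. Every interval \<open>(T * (1 - 1/(n+1)), T)\<close>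
    contains a good time, as it has positive length, and the corresponding countably many slabs
    exhaust \<open>Q\<close>.\<close>
  let ?good = "\<lambda>n t. T * (1 - 1 / real (Suc n)) < t \<and> t \<in> {0<..<T} \<and> (AE z in lebesgue_on (QT t \<Omega>). C * fE z - fI z = 0)"
  have ex: "\<exists>t. ?good n t" for n
  proof (rule ccontr)
    assume no: "\<not> ?thesis"
    let ?J = "{T * (1 - 1 / real (Suc n))<..<T}"
    have l: "T * (1 - 1 / real (Suc n)) \<ge> 0" "T * (1 - 1 / real (Suc n)) < T" using T by (auto simp: field_simps)
    have "AE \<tau> in lborel. \<tau> \<in> {0<..<T} \<longrightarrow> (AE z in lebesgue_on (QT \<tau> \<Omega>). C * fE z - fI z = 0)"
      using slabz by (simp add: AE_lebesgue_on_iff)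
    then have "AE \<tau> in lborel. \<tau> \<notin> ?J"
    proof eventually_elim
      case (elim t)
      show ?case
      proof
        assume J: "t \<in> ?J"
        then have "t \<in> {0<..<T}" using le_less_trans[OF l(1)] by simp
        then have "?good n t" using elim J by simp
        then show False using no by blast
      qed
    qed
    then have "?J \<in> null_sets lborel" by (simp add: AE_iff_null_sets)
    then have "emeasure lborel ?J = 0" by blast
    then show False using l T by (simp add: emeasure_lborel_Ioo)
  qed
  define \<tau> where "\<tau> n = (SOME t. ?good n t)" for n
  have \<tau>: "?good n (\<tau> n)" for n unfolding \<tau>_def by (rule someI_ex[OF ex])
  have "AE z in lborel. z \<in> QT (\<tau> n) \<Omega> \<longrightarrow> C * fE z - fI z = 0" for n
    using \<tau>[of n] sets_Q[of "\<tau> n"] by (simp add: AE_lebesgue_on_iff)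
  then have "AE z in lborel. \<forall>n. z \<in> QT (\<tau> n) \<Omega> \<longrightarrow> C * fE z - fI z = 0"
    unfolding AE_all_countable by (rule allI)
  moreover have "\<exists>n. z \<in> QT (\<tau> n) \<Omega>" if "z \<in> Q" for z
  proof -
    have "fst z < T" using that by auto
    then obtain n where "1 / real (Suc n) < (T - fst z) / T" using T nat_approx_posE[of "(T - fst z) / T"] by auto
    then have "T * (1 / real (Suc n)) < T - fst z" using T by (simp add: pos_less_divide_eq mult.commute)
    then have "fst z < \<tau> n" using \<tau>[of n] by (simp add: right_diff_distrib)
    then show ?thesis using that by (intro exI[of _ n]) auto
  qed
  ultimately have "AE z in lborel. z \<in> Q \<longrightarrow> C * fE z - fI z = 0"
    by (auto elim: eventually_mono)
  then show "AE z in lebesgue_on Q. C * fE z - fI z = 0"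
    using sets_Q[of "T / 2"] T by (simp add: AE_lebesgue_on_iff)
qed

text \<open>A nonnegative integrand with bracket zero vanishes almost everywhere for the Young
  measure. Zero relative energy fixes \<rho>, \<open>u\<close> and \<theta>; then the rate is zero
  as well, and the coercive form fixes the two gradient variables. A probability measure
  concentrated at one point is the Dirac mass there.\<close>

theorem young_measure_eq_return:
  assumes pos: "\<rho>_lo > 0" "\<theta>_lo > 0"
    and supp: "AE (t, x) in lebesgue_on Q.
      emeasure (V t x) {(\<rho>, u, \<theta>, A, g). \<rho>_lo < \<rho> \<and> \<rho> < \<rho>_hi \<and> \<theta>_lo < \<theta> \<and> \<theta> < \<theta>_hi} = 1"
  shows "AE (t, x) in lebesgue_on Q.
    V t x = return borel (\<rho>' t x, u' t x, \<theta>' t x, symm (Grad (u' t) x), grad (\<theta>' t) x)"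
proof -
  obtain c0 c C where c: "c0 > 0" "c > 0" "C \<ge> 0"
    and est: "AE z in lebesgue_on Q. AE w in W z.
      (case w of (\<rho>, u, \<theta>, A, g) \<Rightarrow>
        c0 * ((\<rho> - R z)\<^sup>2 + (\<theta> - H z)\<^sup>2 + (norm (u - U z))\<^sup>2) \<le> re (fst z) (snd z) w \<and>
        c * ((norm (A - symm (Gu z)))\<^sup>2 + (norm (g - gH z))\<^sup>2) \<le> C * re (fst z) (snd z) w - rr (fst z) (snd z) w)"
    by (rule relative_energy_estimate[OF assms]) (rule that)
  have nonneg: "AE z in lebesgue_on Q. AE w in W z. 0 \<le> re (fst z) (snd z) w \<and> 0 \<le> C * re (fst z) (snd z) w - rr (fst z) (snd z) w"
    using est
  proof eventually_elim
    case (elim z)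
    then show ?case
    proof eventually_elim
      case (elim w)
      obtain \<rho> u \<theta> A g where w: "w = (\<rho>, u, \<theta>, A, g)" by (metis prod.exhaust)
      have "0 \<le> c0 * ((\<rho> - R z)\<^sup>2 + (\<theta> - H z)\<^sup>2 + (norm (u - U z))\<^sup>2)" using c by simp
      moreover have "0 \<le> c * ((norm (A - symm (Gu z)))\<^sup>2 + (norm (g - gH z))\<^sup>2)" using c by simp
      ultimately show ?case using elim unfolding w prod.case by linarith
    qed
  qed
  have br: "AE z in lebesgue_on Q. has_bochner_integral (W z) (re (fst z) (snd z)) (fE z) \<and>
      has_bochner_integral (W z) (\<lambda>w. C * re (fst z) (snd z) w - rr (fst z) (snd z) w) (C * fE z - fI z)"
    using rel_energy_bracket rel_rate_bracket
  proof eventually_elim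
    case (elim z)
    then show ?case by (intro conjI has_bochner_integral_diff has_bochner_integral_mult_right) auto
  qed
  have "AE z in lebesgue_on Q. fE z \<ge> 0 \<and> C * fE z - fI z \<ge> 0"
    using nonneg br
  proof eventually_elim
    case (elim z)
    have "AE w in W z. 0 \<le> re (fst z) (snd z) w" "AE w in W z. 0 \<le> C * re (fst z) (snd z) w - rr (fst z) (snd z) w"
      using elim(1) by (auto elim: eventually_mono)
    then show ?case
      using elim(2) integral_nonneg_AE[where M = "W z" and f = "re (fst z) (snd z)"]
        integral_nonneg_AE[where M = "W z" and f = "\<lambda>w. C * re (fst z) (snd z) w - rr (fst z) (snd z) w"]
      by (simp only: has_bochner_integral_iff)
  qed
  then have "AE z in lebesgue_on Q. fE z \<ge> 0" "AE z in lebesgue_on Q. C * fE z - fI z \<ge> 0"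
    by (auto elim: eventually_mono)
  note van = energy_and_rate_vanish[OF this c(3)]
  have "AE z in lebesgue_on Q.
    W z = return borel (\<rho>' (fst z) (snd z), u' (fst z) (snd z), \<theta>' (fst z) (snd z), symm (Grad (u' (fst z)) (snd z)), grad (\<theta>' (fst z)) (snd z))"
    using van nonneg est br W_young AE_in_domain[of Q]
  proof eventually_elim
    case (elim z)
    obtain t x where z: "z = (t, x)" by fastforce
    have zQ: "(t, x) \<in> Q" using elim z by simp
    have "AE w in W z. re t x w = 0"
    proof (rule has_bochner_integral_nonneg_zero)
      show "has_bochner_integral (W z) (re t x) 0" using elim(1,5) by (simp add: z)
      show "AE w in W z. 0 \<le> re t x w" using elim(3) by (auto simp: z elim: eventually_mono)
    qed
    moreover have "AE w in W z. C * re t x w - rr t x w = 0"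
    proof (rule has_bochner_integral_nonneg_zero)
      show "has_bochner_integral (W z) (\<lambda>w. C * re t x w - rr t x w) 0" using elim(5) unfolding elim(2) by (simp add: z)
      show "AE w in W z. 0 \<le> C * re t x w - rr t x w" using elim(3) by (auto simp: z elim: eventually_mono)
    qed
    ultimately have eq: "AE w in W z. w = (\<rho>' t x, u' t x, \<theta>' t x, symm (Grad (u' t) x), grad (\<theta>' t) x)"
      using elim(4)
    proof eventually_elim
      case (elim w)
      obtain \<rho> u \<theta> A g where w: "w = (\<rho>, u, \<theta>, A, g)" by (metis prod.exhaust)
      have rr0: "rr t x w = 0" using elim(1,2) by simp
      have "c0 * ((\<rho> - \<rho>' t x)\<^sup>2 + (\<theta> - \<theta>' t x)\<^sup>2 + (norm (u - u' t x))\<^sup>2) \<le> 0"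
        "c * ((norm (A - symm (Grad (u' t) x)))\<^sup>2 + (norm (g - grad (\<theta>' t) x))\<^sup>2) \<le> 0"
        using elim(3) unfolding z w prod.case fst_conv snd_conv elim(1)[unfolded w] rr0[unfolded w] RUH_simps Gu_eq[OF zQ] gH_eq[OF zQ]
          mult_zero_right diff_self
        by blast+
      then have s: "(\<rho> - \<rho>' t x)\<^sup>2 + (\<theta> - \<theta>' t x)\<^sup>2 + (norm (u - u' t x))\<^sup>2 \<le> 0"
        "(norm (A - symm (Grad (u' t) x)))\<^sup>2 + (norm (g - grad (\<theta>' t) x))\<^sup>2 \<le> 0"
        using c by (simp_all add: mult_le_0_iff)
      have "(\<rho> - \<rho>' t x)\<^sup>2 = 0" "(\<theta> - \<theta>' t x)\<^sup>2 = 0" "(norm (u - u' t x))\<^sup>2 = 0"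
        "(norm (A - symm (Grad (u' t) x)))\<^sup>2 = 0" "(norm (g - grad (\<theta>' t) x))\<^sup>2 = 0"
        using s zero_le_power2[of "\<rho> - \<rho>' t x"] zero_le_power2[of "\<theta> - \<theta>' t x"] zero_le_power2[of "norm (u - u' t x)"]
          zero_le_power2[of "norm (A - symm (Grad (u' t) x))"] zero_le_power2[of "norm (g - grad (\<theta>' t) x)"]
        by linarith+
      then show ?case by (simp add: w)
    qed
    have "prob_space (W z)" "sets (W z) = sets borel" using elim(6) by blast+
    from prob_space_AE_eq_imp_return[OF this eq] show ?case unfolding z fst_conv snd_conv .
  qed
  then show ?thesis by (simp add: W_def case_prod_unfold)
qed

end

theorem theorem4p1:
  fixes T :: real
    and \<Omega> :: "(real^'d::finite) set"
    and \<theta>B :: "real \<Rightarrow> real^'d \<Rightarrow> real"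
    and p e s \<kappa> \<mu> lam :: "real \<Rightarrow> real \<Rightarrow> real"
    and \<rho>0 \<theta>0 :: "real^'d \<Rightarrow> real" and u0 :: "real^'d \<Rightarrow> real^'d"
    and \<rho>' \<theta>' :: "real \<Rightarrow> real^'d \<Rightarrow> real" and u' :: "real \<Rightarrow> real^'d \<Rightarrow> real^'d"
    and V0 :: "real^'d \<Rightarrow> 'd phase0 measure"
    and V :: "real \<Rightarrow> real^'d \<Rightarrow> 'd phase measure"
    and D :: "(real \<Rightarrow> real^'d \<Rightarrow> real) \<Rightarrow> real \<Rightarrow> real"
    and \<rho>_lo \<rho>_hi \<theta>_lo \<theta>_hi :: real
  assumes "CARD('d) \<in> {2, 3}" and "T > 0" and "bounded_domain \<Omega>"
    and "boundary_temperature T \<Omega> \<theta>B"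
    and "Ck_quadrant 2 p" and "Ck_quadrant 2 e" and "Ck_quadrant 2 s"
    and "gibbs p e s" and "thermodynamically_stable p e"
    and "transport_coefficient \<kappa>" and "transport_coefficient \<mu>" and "transport_coefficient lam"
    and "\<And>x. x \<in> \<Omega> \<Longrightarrow> \<rho>0 x > 0" and "\<And>x. x \<in> \<Omega> \<Longrightarrow> \<theta>0 x > 0"
    and "strong_solution T \<Omega> \<theta>B p e \<kappa> \<mu> lam \<rho>0 u0 \<theta>0 \<rho>' u' \<theta>'"
    and "measure_valued_solution T \<Omega> \<theta>B p e s \<kappa> \<mu> lam V0 V D"
    and "AE x in lebesgue_on \<Omega>. V0 x = return borel (\<rho>0 x, u0 x, \<theta>0 x)"
    and "\<rho>_lo > 0" and "\<rho>_hi > 0" and "\<theta>_lo > 0" and "\<theta>_hi > 0"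
    and "AE (t, x) in lebesgue_on (QT T \<Omega>).
      emeasure (V t x) {(\<rho>, u, \<theta>, A, g). \<rho>_lo < \<rho> \<and> \<rho> < \<rho>_hi \<and> \<theta>_lo < \<theta> \<and> \<theta> < \<theta>_hi} = 1"
  shows "AE (t, x) in lebesgue_on (QT T \<Omega>).
    V t x = return borel (\<rho>' t x, u' t x, \<theta>' t x, symm (Grad (u' t) x), grad (\<theta>' t) x)"
proof -
  interpret weak_strong p e s T \<Omega> \<theta>B \<kappa> \<mu> lam \<rho>0 \<theta>0 u0 \<rho>' \<theta>' u' V0 V D
    by unfold_locales (use assms in auto)
  show ?thesis by (rule young_measure_eq_return) fact+
qed

end
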